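(* Suppose there exist $R_1\in(0,\infty]$, constants $a_1,a_2,a_3>0$ and $\alpha_2\ge\alpha_1>0$ such that $$a_1\Big(\frac Rr\Big)^{1+\alpha_1}\le\frac{\nu(r)}{\nu(R)}\le a_2\Big(\frac Rr\Big)^{1+\alpha_2}\quad\text{for all }0<r\le R<R_1,\qquad \sup_{r\ge R_1}\nu(r)\le a_3$$ (the last condition being vacuous if $R_1=\infty$). Then for every $T>0$ there exist constants $c_1,c_2,c_3,c_5>1$ and $c_4>0$ such that the following hold for all $t\in(0,T]$. (1) For all $x\in(0,tb(t)]$, $$\frac{c_1^{-1}}{\sqrt{t(-\phi''(\sigma))}}\exp(-tH(\sigma))\le p(t,x)\le\frac{c_1}{\sqrt{t(-\phi''(\sigma))}}\exp(-tH(\sigma)),$$ where $\sigma=(\phi')^{-1}(x/t)$. In particular, for all $x\in(0,tb(t)]$, $$c_2^{-1}H^{-1}(1/t)\exp(-2tH(\sigma))\le p(t,x)\le c_2H^{-1}(1/t)\exp\big(-\tfrac t2H(\sigma)\big).$$ (2) For all $y\in[0,R_1/2)$, $$c_3^{-1}H^{-1}(1/t)\min\Big\{1,\frac{t\nu(y)}{H^{-1}(1/t)}+\exp\Big(-\frac{c_4y}{\theta(t,y/(8e^2))}\Big)\Big\}\le p(t,tb(t)+y)\le c_3H^{-1}(1/t)\min\Big\{1,\frac{t\nu(y)}{H^{-1}(1/t)}+\exp\Big(-\frac{y}{8\theta(t,y/(8e^2))}\Big)\Big\}.\quad( * )$$ In particular, for all $y\in(D(t),R_1/2)$, $$c_5^{-1}t\nu(y)\le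 p(t,tb(t)+y)\le c_5t\nu(y).\quad( ** )$$ Moreover, if in addition there are constants $a_4,a_5>0$ such that $a_4\sup_{u\ge r}\nu(u)\le\nu(r)$ and $a_5\nu(r)\le\nu(2r)$ for all $r\ge R_1/2$, then $( * )$ holds for all $y\in[0,\infty)$ and $( ** )$ holds for all $y\in(D(t),\infty)$.
   Context: $S=(S_t)_{t\ge0}$ is a subordinator (non-decreasing Lévy process on $\mathbb R$ with $S_0=0$) without drift. Its Laplace exponent $\phi$ is given by $\mathbb E e^{-\lambda S_t}=e^{-t\phi(\lambda)}$ and $\phi(\lambda)=\int_0^\infty(1-e^{-\lambda s})\nu(s)\,ds$, where the Lévy measure has a density $\nu:(0,\infty)\to[0,\infty)$ with $\int_0^\infty\min\{1,s\}\nu(s)ds<\infty$. (Inequalities on quotients of $\nu$ presuppose $\nu>0$ on the stated range.) Standing assumption: there is $T_0\in[0,\infty)$ with $\liminf_{x\to0}x\nu(x)=1/T_0$, where $1/0=\infty$. (The hypotheses of the claim imply this with $T_0=0$.) For $t>T_0$, $S_t$ has a transition density $p(t,\cdot)$, continuous and bounded on $(0,\infty)$. Notation: $H(\lambda)=\phi(\lambda)-\lambda\phi'(\lambda)$, a strictly increasing bijection of $(0,\infty)$ with inverse $H^{-1}$; $b(t)=\phi'(H^{-1}(1/t))$; $w(r)=\int_r^\infty\nu(s)ds$; $w^{-1}(u)=\inf\{r>0:w(r)\le u\}$ for $u>0$; $\phi'(0)=\lim_{\lambda\downarrow0}\phi'(\lambda)\in(0,\infty]$; $\sigma=\sigma(t,x)=(\phi')^{-1}(x/t)$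 for $t>0$, $0<x<t\phi'(0)$. Convention: $\nu(0)=\infty$. One has $w^{-1}(2e/t)\le H^{-1}(1/t)^{-1}$ for all $t>0$, where $H^{-1}(1/t)^{-1}=1/H^{-1}(1/t)$. Define $$D(t)=t\max_{s\in[w^{-1}(2e/t),\,H^{-1}(1/t)^{-1}]}sH(s^{-1}),$$ and $\theta:(0,\infty)\times[0,\infty)\to(0,\infty)$ by $\theta(t,y)=H^{-1}(1/t)^{-1}$ if $y\in[0,H^{-1}(1/t)^{-1})$; $\theta(t,y)=\min\{s\in[w^{-1}(2e/t),H^{-1}(1/t)^{-1}]:tsH(s^{-1})=y\}$ if $y\in[H^{-1}(1/t)^{-1},D(t)]$; $\theta(t,y)=w^{-1}(2e/t)$ if $y\in(D(t),\infty)$. *)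

theory Defs
  imports "HOL-Probability.Probability"
begin

text \<open>
  Only the values of a Levy density on \<open>(0,\<infinity>)\<close> matter, and all functions below are
  meant on \<open>(0,\<infinity>)\<close>.
\<close>

definition laplace_exponent :: "(real \<Rightarrow> real) \<Rightarrow> real \<Rightarrow> real" where
  "laplace_exponent \<nu> l = (LINT s:{0<..}|lborel. (1 - exp (- l * s)) * \<nu> s)"

locale subordinator = prob_space M for M :: "'a measure" +
  fixes S :: "real \<Rightarrow> 'a \<Rightarrow> real"
  assumes measurable_S: "\<And>t. 0 \<le> t \<Longrightarrow> S t \<in> borel_measurable M"
    and zero_start: "AE \<omega> in M. S 0 \<omega> = 0"
    and nondecreasing_paths: "AE \<omega> in M. mono_on {0..} (\<lambda>t. S t \<omega>)"
    and right_continuous_paths: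
      "AE \<omega> in M. \<forall>t\<ge>0. continuous (at_right t) (\<lambda>u. S u \<omega>)"
    and stationary_increments:
      "\<And>s t. 0 \<le> s \<Longrightarrow> 0 \<le> t \<Longrightarrow>
        distr M borel (\<lambda>\<omega>. S (s + t) \<omega> - S s \<omega>) = distr M borel (S t)"
    and independent_increments:
      "\<And>(\<tau> :: nat \<Rightarrow> real) n. 0 \<le> \<tau> 0 \<Longrightarrow> incseq \<tau> \<Longrightarrow>
        indep_vars (\<lambda>_. borel) (\<lambda>i \<omega>. S (\<tau> (Suc i)) \<omega> - S (\<tau> i) \<omega>) {..<n}"

text \<open>The absence of drift is expressed by the form of the Laplace exponent.\<close>

locale driftless_subordinator = subordinator M S
  for M :: "'a measure" and S :: "real \<Rightarrow> 'a \<Rightarrow> real" +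
  fixes \<nu> :: "real \<Rightarrow> real"
  assumes levy_density_nonneg: "\<And>s. 0 < s \<Longrightarrow> 0 \<le> \<nu> s"
    and levy_density_measurable: "set_borel_measurable lborel {0<..} \<nu>"
    and levy_density_integrable: "set_integrable lborel {0<..} (\<lambda>s. min 1 s * \<nu> s)"
    and laplace_transform: "\<And>t l. 0 \<le> t \<Longrightarrow> 0 \<le> l \<Longrightarrow>
        expectation (\<lambda>\<omega>. exp (- l * S t \<omega>)) = exp (- t * laplace_exponent \<nu> l)"

text \<open>
  \<open>p t\<close> is a density of \<open>S t\<close> that is continuous and bounded on \<open>(0,\<infinity>)\<close>, which
  determines it there; its values outside \<open>(0,\<infinity>)\<close> are ignored.
\<close>

definition transition_density_at ::
    "'a measure \<Rightarrow> (real \<Rightarrow> 'a \<Rightarrow> real) \<Rightarrow> (real \<Rightarrow> real \<Rightarrow> real) \<Rightarrow> real \<Rightarrow> bool" where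
  "transition_density_at M S p t \<longleftrightarrow>
     (\<forall>x>0. 0 \<le> p t x) \<and> continuous_on {0<..} (p t) \<and> bounded (p t ` {0<..}) \<and>
     distributed M lborel (S t) (\<lambda>x. ennreal (indicator {0<..} x * p t x))"

definition H_fun :: "(real \<Rightarrow> real) \<Rightarrow> real \<Rightarrow> real" where
  "H_fun \<nu> l = laplace_exponent \<nu> l - l * deriv (laplace_exponent \<nu>) l"

definition H_inv :: "(real \<Rightarrow> real) \<Rightarrow> real \<Rightarrow> real" where
  "H_inv \<nu> = inv_into {0<..} (H_fun \<nu>)"

definition b_fun :: "(real \<Rightarrow> real) \<Rightarrow> real \<Rightarrow> real" where
  "b_fun \<nu> t = deriv (laplace_exponent \<nu>) (H_inv \<nu> (1 / t))"

definition levy_tail :: "(real \<Rightarrow> real) \<Rightarrow> real \<Rightarrow> real" where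
  "levy_tail \<nu> r = (LINT s:{r<..}|lborel. \<nu> s)"

definition levy_tail_inv :: "(real \<Rightarrow> real) \<Rightarrow> real \<Rightarrow> real" where
  "levy_tail_inv \<nu> u = Inf {r. 0 < r \<and> levy_tail \<nu> r \<le> u}"

definition sigma_fun :: "(real \<Rightarrow> real) \<Rightarrow> real \<Rightarrow> real \<Rightarrow> real" where
  "sigma_fun \<nu> t x = inv_into {0<..} (deriv (laplace_exponent \<nu>)) (x / t)"

definition scale_interval :: "(real \<Rightarrow> real) \<Rightarrow> real \<Rightarrow> real set" where
  "scale_interval \<nu> t = {levy_tail_inv \<nu> (2 * exp 1 / t) .. 1 / H_inv \<nu> (1 / t)}"

text \<open>
  \<open>GREATEST\<close> and \<open>LEAST\<close> are the maximum and minimum over sets of reals, which may be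
  infinite.
\<close>

definition D_fun :: "(real \<Rightarrow> real) \<Rightarrow> real \<Rightarrow> real" where
  "D_fun \<nu> t = t * (GREATEST m. m \<in> (\<lambda>s. s * H_fun \<nu> (1 / s)) ` scale_interval \<nu> t)"

definition theta_fun :: "(real \<Rightarrow> real) \<Rightarrow> real \<Rightarrow> real \<Rightarrow> real" where
  "theta_fun \<nu> t y =
     (if y < 1 / H_inv \<nu> (1 / t) then 1 / H_inv \<nu> (1 / t)
      else if y \<le> D_fun \<nu> t
        then (LEAST s. s \<in> scale_interval \<nu> t \<and> t * s * H_fun \<nu> (1 / s) = y)
      else levy_tail_inv \<nu> (2 * exp 1 / t))"

text \<open>The convention \<open>\<nu>(0) = \<infinity>\<close>:\<close>

definition levy_density_ext :: "(real \<Rightarrow> real) \<Rightarrow> real \<Rightarrow> ereal" where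
  "levy_density_ext \<nu> y = (if y = 0 then \<infinity> else ereal (\<nu> y))"

definition right_profile :: "(real \<Rightarrow> real) \<Rightarrow> real \<Rightarrow> real \<Rightarrow> real \<Rightarrow> ereal" where
  "right_profile \<nu> k t y =
     ereal (H_inv \<nu> (1 / t)) *
       min 1 (ereal t * levy_density_ext \<nu> y / ereal (H_inv \<nu> (1 / t)) +
              ereal (exp (- (k * y / theta_fun \<nu> t (y / (8 * (exp 1)\<^sup>2))))))"

end

theory Submission
 imports Defs
begin

text \<open>
  All densities are treated through the laws with Laplace transform \<open>exp (- t * \<phi> l)\<close>. These are closed under
  convolution and exponential tilting, and splitting off a finite part \<open>q\<close> of mass \<open>m\<close> from the Levy density
  compares a law \<open>\<mu>\<close> with the law \<open>\<mu>'\<close> of the remaining jumps: \<open>\<mu>\<close> is at least \<open>exp (- m) * \<mu>'\<close> and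
  \<open>exp (- m) * (q * \<mu>')\<close>, and at most \<open>\<mu>' + q * \<mu>\<close>.

  Weak scaling bounds the characteristic function of the tilted law by \<open>C / (1 + v\<^sup>2 * \<xi>\<^sup>2)\<close> with
  \<open>v\<^sup>2 = - t * \<phi>'' l\<close>, so the tilted density is at most \<open>C / v\<close>; once \<open>t * H l\<close> is large the tilted law is close
  to a normal law, which gives the matching lower bound. This is part (1), and for bounded \<open>t * H l\<close> the lower bound
  \<open>c * H_inv (1 / t)\<close> is carried on to a neighbourhood of \<open>t * b t\<close>, by a normal approximation where jumps of
  the size \<open>1 / H_inv (1 / t)\<close> are rare and by adding such jumps where they are not.

  Far to the right of \<open>t * b t\<close> one jump of size about \<open>y\<close> yields \<open>t * \<nu> y\<close>, and about \<open>t * H (1 / \<theta>)\<close>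
  independent steps of size \<open>\<theta>\<close> yield \<open>exp (- c * y / \<theta>)\<close>. For the upper bound the jumps above
  \<open>y / 2, y / 4, ...\<close> are removed down to the level \<open>\<theta>\<close>: each level costs a multiple of \<open>t * \<nu> y\<close> with geometric
  decay, and Chernoff's inequality controls the law without jumps above \<open>\<theta>\<close>. Minimality of \<open>\<theta>\<close> bounds
  \<open>t * \<theta> * \<nu> \<theta>\<close> from below, and then the exponential is absorbed by \<open>t * \<nu> y\<close> beyond \<open>D t\<close>.

  In the paper's notation \<open>HH\<close> is \<open>H\<close>, \<open>ww\<close> is \<open>w\<close>, \<open>mom j\<close> is the \<open>j\<close>-th derivative of \<open>\<phi>\<close> up to sign,
  \<open>rho t\<close> is \<open>1 / H_inv (1 / t)\<close>, \<open>s0 t\<close> is \<open>w_inv (2 * e / t)\<close>, \<open>cc t\<close> is \<open>t * b t\<close>, \<open>vv t l\<close> is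
  \<open>sqrt (- t * \<phi>'' l)\<close>, \<open>DD\<close> is \<open>D\<close> and \<open>th\<close> is \<open>\<theta>\<close>;
  \<open>xM M t\<close> is the point with saddle parameter \<open>H_inv (M / t)\<close>.
\<close>

section \<open>Laws with a given Levy density\<close>

text \<open>The density \<open>p t\<close> is given only as a continuous version of the law, so
  identities between densities are avoided: every pointwise bound comes from a bound for the mass of
  all short intervals around a point, proportional to their length, which continuity turns into a
  bound at the point. The ranges y < R_1/2 and y >= 0 are treated by one argument. It works on a
  downward closed set \<open>Y\<close> of admissible y, with a base scale \<open>R0\<close> in
  \<open>Y\<close> up to which lower scaling holds, and a ceiling \<open>L\<close> for all scales
  \<open>rho t\<close> with t <= T. Between \<open>R0\<close> and \<open>L\<close> no lower scaling
  is available; there the functionals are compared with their values at \<open>R0\<close>, at the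
  price of powers of L/R0, and this is how T enters the constants. Part (1) and the lower half of
  part (2) meet at a threshold \<open>M\<close> for t H(sigma): above it the normal approximation of
  the tilted law is good, below it only finitely many scales of size \<open>rho t\<close> remain,
  and the lower bound is carried across them with constants that do not depend on t.\<close>

text \<open>Extension by zero to the left of 0 lets every integral run over the whole line without
  indicators.\<close>

definition levy :: "(real \<Rightarrow> real) \<Rightarrow> bool" where
 "levy N \<longleftrightarrow> N \<in> borel_measurable borel \<and> (\<forall>s. 0 \<le> N s) \<and> (\<forall>s\<le>0. N s = 0) \<and>
   integrable lborel (\<lambda>s. min 1 s * N s)"

text \<open>The complex argument serves two transforms at once: real z gives the Laplace exponent, z
  = -i xi the characteristic exponent.\<close>

definition levyexp :: "(real \<Rightarrow> real) \<Rightarrow> complex \<Rightarrow> complex" where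
 "levyexp N z = (\<integral>s. N s *\<^sub>R (1 - exp (- z * of_real s)) \<partial>lborel)"

definition lap :: "real measure \<Rightarrow> complex \<Rightarrow> complex" where
 "lap \<mu> z = (\<integral>x. exp (- z * of_real x) \<partial>\<mu>)"

definition nonneg_dist :: "real measure \<Rightarrow> bool" where
 "nonneg_dist \<mu> \<longleftrightarrow> real_distribution \<mu> \<and> (AE x in \<mu>. 0 \<le> x)"

text \<open>The transform is required on the whole closed right half-plane, although its values at
  the integers determine the law; in this form the characteristic function can be read off
  directly.\<close>

definition id_law :: "(real \<Rightarrow> real) \<Rightarrow> real measure \<Rightarrow> bool" where
 "id_law N \<mu> \<longleftrightarrow> nonneg_dist \<mu> \<and> (\<forall>z. 0 \<le> Re z \<longrightarrow> lap \<mu> z = exp (- levyexp N z))"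

lemma levyD:
 assumes "levy N"
 shows levy_measurable: "N \<in> borel_measurable borel" and levy_nonneg: "0 \<le> N s"
  and levy_zero: "s \<le> 0 \<Longrightarrow> N s = 0" and levy_min_integrable: "integrable lborel (\<lambda>s. min 1 s * N s)" using assms by (auto simp: levy_def)

lemma levy_integrable:
 fixes f :: "real \<Rightarrow> 'b::{banach, second_countable_topology}"
 assumes "levy N" and [measurable]: "f \<in> borel_measurable borel"
  and b: "\<And>s. 0 < s \<Longrightarrow> norm (f s) \<le> C * min 1 s"
 shows "integrable lborel (\<lambda>s. N s *\<^sub>R f s)"
proof (rule Bochner_Integration.integrable_bound)
 show "integrable lborel (\<lambda>s. C * (min 1 s * N s))" using levy_min_integrable[OF assms(1)] by simp
 show "(\<lambda>s. N s *\<^sub>R f s) \<in> borel_measurable lborel" using levy_measurable[OF assms(1)] by measurable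
 show "AE s in lborel. norm (N s *\<^sub>R f s) \<le> norm (C * (min 1 s * N s))"
 proof (rule AE_I2)
  fix s :: real
  show "norm (N s *\<^sub>R f s) \<le> norm (C * (min 1 s * N s))"
  proof (cases "0 < s")
   case True
   have "N s * norm (f s) \<le> N s * (C * min 1 s)" using b[OF True] levy_nonneg[OF assms(1)] by (intro mult_left_mono) auto
   also have "\<dots> \<le> \<bar>C * (min 1 s * N s)\<bar>" by (simp add: algebra_simps)
   finally show ?thesis using levy_nonneg[OF assms(1), of s] by simp
  qed (use levy_zero[OF assms(1)] in auto)
 qed
qed

lemma levy_integrable_real:
 assumes "levy N" "f \<in> borel_measurable borel" "\<And>s. 0 < s \<Longrightarrow> \<bar>f s\<bar> \<le> C * min 1 s"
 shows "integrable lborel (\<lambda>s. N s * f s)" using levy_integrable[of N f C] assms by simp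

lemma levy_integral_mono:
 assumes "levy N" "integrable lborel (\<lambda>s. N s * f s)" "integrable lborel (\<lambda>s. N s * g s)"
  and "\<And>s. 0 < s \<Longrightarrow> f s \<le> g s"
 shows "(\<integral>s. N s * f s \<partial>lborel) \<le> (\<integral>s. N s * g s \<partial>lborel)"
proof (rule integral_mono[OF assms(2,3)])
 fix s show "N s * f s \<le> N s * g s" using assms(4)[of s] levy_nonneg[OF assms(1), of s] levy_zero[OF assms(1), of s]
  by (cases "0 < s") (auto intro: mult_left_mono)
qed

lemma levy_scale: "levy N \<Longrightarrow> 0 \<le> c \<Longrightarrow> levy (\<lambda>s. c * N s)"
 unfolding levy_def by (auto simp: mult.left_commute)

lemma levy_le:
 assumes "levy N" "q \<in> borel_measurable borel" "\<And>s. 0 \<le> q s" "\<And>s. q s \<le> N s"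
 shows "levy q" unfolding levy_def
proof (intro conjI allI impI)
 show "q s = 0" if "s \<le> 0" for s using assms(3)[of s] assms(4)[of s] levy_zero[OF assms(1) that] by simp
 show "integrable lborel (\<lambda>s. min 1 s * q s)"
 proof (rule Bochner_Integration.integrable_bound[OF levy_min_integrable[OF assms(1)]])
  show "AE s in lborel. norm (min 1 s * q s) \<le> norm (min 1 s * N s)"
  proof (rule AE_I2)
   fix s
   have "\<bar>q s\<bar> \<le> \<bar>N s\<bar>" using assms(3,4)[of s] by linarith
   then show "norm (min 1 s * q s) \<le> norm (min 1 s * N s)" by (simp add: abs_mult mult_left_mono)
  qed
 qed (use assms(2) in measurable)
qed (use assms in auto)

lemma levy_diff:
 assumes "levy N" "q \<in> borel_measurable borel" "\<And>s. 0 \<le> q s" "\<And>s. q s \<le> N s"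
 shows "levy (\<lambda>s. N s - q s)" using levy_measurable[OF assms(1)] assms by (intro levy_le[OF assms(1)]) auto

text \<open>Mean value inequality on the convex half-plane where the derivative of exp has modulus
  at most 1.\<close>

lemma norm_exp_diff_le:
 fixes w z :: complex
 assumes "Re w \<le> 0" "Re z \<le> 0"
 shows "norm (exp w - exp z) \<le> norm (w - z)"
proof -
 have "norm (exp w - exp z) \<le> 1 * norm (w - z)"
 proof (rule field_differentiable_bound[of "{u. Re u \<le> 0}" exp exp])
  show "convex {u. Re u \<le> 0}" by (rule convex_halfspace_Re_le)
 qed (use assms in \<open>auto intro!: derivative_eq_intros\<close>)
 then show ?thesis by simp
qed

lemma norm_one_minus_exp_le:
 fixes z :: complex
 assumes "0 \<le> Re z" "0 \<le> s"
 shows "norm (1 - exp (- z * of_real s)) \<le> (2 + norm z) * min 1 s"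
proof -
 have a: "norm (exp 0 - exp (- z * of_real s)) \<le> norm (0 - (- z * of_real s))" using assms by (intro norm_exp_diff_le) auto
 have "norm (1 - exp (- z * of_real s)) \<le> norm (1::complex) + norm (exp (- z * of_real s))" by (rule norm_triangle_ineq4)
 also have "\<dots> \<le> 2" using assms by simp
 finally have b: "norm (1 - exp (- z * of_real s)) \<le> 2" .
 show ?thesis
 proof (cases "1 \<le> s")
  case True
  have "2 \<le> (2 + norm z) * min 1 s" using True by simp
  with b show ?thesis by linarith
 next
  case False
  have "norm (1 - exp (- z * of_real s)) \<le> norm z * s" using a assms by (simp add: norm_mult)
  also have "\<dots> \<le> (2 + norm z) * s" using assms by (intro mult_right_mono) auto
  finally show ?thesis using False by simp
 qed
qed

lemma levyexp_integrable:
 assumes "levy N" "0 \<le> Re z"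
 shows "integrable lborel (\<lambda>s. N s *\<^sub>R (1 - exp (- z * of_real s)))"
 using assms by (intro levy_integrable[where C="2 + norm z"] norm_one_minus_exp_le) auto

lemma levyexp_add:
 assumes "levy N" "levy N'" "0 \<le> Re z"
 shows "levyexp (\<lambda>s. N s + N' s) z = levyexp N z + levyexp N' z"
 unfolding levyexp_def using levyexp_integrable[OF assms(1,3)] levyexp_integrable[OF assms(2,3)]
 by (simp add: scaleR_left_distrib)

lemma levyexp_scale: "levyexp (\<lambda>s. c * N s) z = of_real c * levyexp N z"
proof -
 have "levyexp (\<lambda>s. c * N s) z = (\<integral>s. c *\<^sub>R (N s *\<^sub>R (1 - exp (- z * of_real s))) \<partial>lborel)" unfolding levyexp_def by simp
 also have "\<dots> = c *\<^sub>R levyexp N z" unfolding levyexp_def by (rule integral_scaleR_right)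
 finally show ?thesis by (simp add: scaleR_conv_of_real)
qed

lemma lap_of_nat_real:
 assumes "nonneg_dist \<mu>"
 shows "lap \<mu> (of_real l) = of_real (\<integral>x. exp (- l * x) \<partial>\<mu>)" unfolding lap_def integral_complex_of_real[symmetric]
 by (intro Bochner_Integration.integral_cong) (auto simp: exp_of_real[symmetric])

text \<open>Since \<open>exp (- X)\<close> is bounded, its characteristic function is the power series in its moments.\<close>

lemma char_bounded_moments:
 assumes "real_distribution \<nu>" and b: "AE y in \<nu>. \<bar>y\<bar> \<le> 1"
 shows "(\<lambda>n. (\<i> * of_real \<xi>) ^ n / fact n * of_real (\<integral>y. y ^ n \<partial>\<nu>)) sums char \<nu> \<xi>"
proof -
 interpret real_distribution \<nu> by fact
 let ?f = "\<lambda>n y. \<Sum>k<n. (\<i> * of_real (\<xi> * y)) ^ k / fact k"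
 have i1: "integrable \<nu> (\<lambda>y. y ^ n)" for n
  using b by (intro integrable_const_bound[where B=1]) (auto elim!: eventually_mono simp: power_abs power_le_one)
 have i: "integrable \<nu> (\<lambda>y. complex_of_real (y ^ n))" for n using integrable_of_real[OF i1, where 'a=complex] by simp
 have "(\<lambda>n. \<integral>y. ?f n y \<partial>\<nu>) \<longlonglongrightarrow> (\<integral>y. iexp (\<xi> * y) \<partial>\<nu>)"
 proof (rule integral_dominated_convergence[where w="\<lambda>_. exp \<bar>\<xi>\<bar>"])
  show "AE y in \<nu>. (\<lambda>n. ?f n y) \<longlonglongrightarrow> iexp (\<xi> * y)"
  proof (rule AE_I2)
   fix y
   have "(\<lambda>k. (\<i> * of_real (\<xi> * y)) ^ k /\<^sub>R fact k) sums exp (\<i> * of_real (\<xi> * y))" by (rule exp_converges)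
   then show "(\<lambda>n. ?f n y) \<longlonglongrightarrow> iexp (\<xi> * y)" by (simp add: sums_def scaleR_conv_of_real divide_inverse mult.commute)
  qed
  show "AE y in \<nu>. norm (?f n y) \<le> exp \<bar>\<xi>\<bar>" for n using b
  proof eventually_elim
   case (elim y)
   have "norm (?f n y) \<le> (\<Sum>k<n. norm ((\<i> * of_real (\<xi> * y)) ^ k / fact k))" by (rule norm_sum)
   also have "\<dots> \<le> (\<Sum>k<n. \<bar>\<xi>\<bar> ^ k /\<^sub>R fact k)"
   proof (rule sum_mono)
    fix k
    have "\<bar>\<xi> * y\<bar> ^ k \<le> \<bar>\<xi>\<bar> ^ k" using elim by (intro power_mono) (auto simp: abs_mult mult_left_le)
    then have "\<bar>\<xi> * y\<bar> ^ k / fact k \<le> \<bar>\<xi>\<bar> ^ k / fact k" by (rule divide_right_mono) simp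
    moreover have "norm ((\<i> * of_real (\<xi> * y)) ^ k / fact k) = \<bar>\<xi> * y\<bar> ^ k / fact k"
     by (simp only: norm_divide norm_power norm_mult norm_fact norm_of_real norm_ii mult_1)
    moreover have "\<bar>\<xi>\<bar> ^ k /\<^sub>R fact k = \<bar>\<xi>\<bar> ^ k / fact k" by (simp add: divide_inverse)
    ultimately show "norm ((\<i> * of_real (\<xi> * y)) ^ k / fact k) \<le> \<bar>\<xi>\<bar> ^ k /\<^sub>R fact k" by simp
   qed
   also have "\<dots> \<le> exp \<bar>\<xi>\<bar>" unfolding exp_def by (intro sum_le_suminf summable_exp_generic) auto
   finally show ?case .
  qed
 qed auto
 moreover have "(\<integral>y. ?f n y \<partial>\<nu>) = (\<Sum>k<n. (\<i> * of_real \<xi>) ^ k / fact k * of_real (\<integral>y. y ^ k \<partial>\<nu>))" for n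
 proof -
  have e: "?f n y = (\<Sum>k<n. (\<i> * of_real \<xi>) ^ k / fact k * of_real (y ^ k))" for y by (intro sum.cong) (auto simp: power_mult_distrib)
  have "(\<integral>y. ?f n y \<partial>\<nu>) = (\<Sum>k<n. \<integral>y. (\<i> * of_real \<xi>) ^ k / fact k * of_real (y ^ k) \<partial>\<nu>)"
   unfolding e by (intro Bochner_Integration.integral_sum integrable_mult_right i)
  also have "\<dots> = (\<Sum>k<n. (\<i> * of_real \<xi>) ^ k / fact k * of_real (\<integral>y. y ^ k \<partial>\<nu>))"
   by (intro sum.cong refl) (simp only: integral_mult_right_zero integral_complex_of_real)
  finally show ?thesis .
 qed
 ultimately show ?thesis by (simp add: sums_def char_def)
qed

text \<open>The image of the law under exp (-x) lives on the unit interval, and its moments are the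
  Laplace transform at the integers. They determine its characteristic function, hence the image,
  and -ln recovers the law.\<close>

lemma laplace_unique:
 assumes \<mu>: "nonneg_dist \<mu>" and \<mu>': "nonneg_dist \<mu>'"
  and eq: "\<And>n::nat. (\<integral>x. exp (- real n * x) \<partial>\<mu>) = (\<integral>x. exp (- real n * x) \<partial>\<mu>')"
 shows "\<mu> = \<mu>'"
proof -
 \<comment> \<open>The absolute value makes the map bounded by 1 on the whole line; it changes
   nothing almost everywhere.\<close>
 let ?Y = "\<lambda>\<mu>. distr \<mu> borel (\<lambda>x::real. exp (- \<bar>x\<bar>))"
 have rd: "real_distribution (?Y \<mu>)" if "nonneg_dist \<mu>" for \<mu>
 proof -
  interpret real_distribution \<mu> using that by (simp add: nonneg_dist_def)
  show ?thesis by (auto simp: real_distribution_def real_distribution_axioms_def intro!: prob_space_distr)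
 qed
 have mom: "(\<integral>y. y ^ n \<partial>?Y \<mu>) = (\<integral>x. exp (- real n * x) \<partial>\<mu>)" if "nonneg_dist \<mu>" for \<mu> n
 proof -
  interpret real_distribution \<mu> using that by (simp add: nonneg_dist_def)
  have "(\<integral>y. y ^ n \<partial>?Y \<mu>) = (\<integral>x. exp (- \<bar>x\<bar>) ^ n \<partial>\<mu>)" by (rule integral_distr) auto
  also have "\<dots> = (\<integral>x. exp (- real n * x) \<partial>\<mu>)"
   proof (rule integral_cong_AE)
    have "AE x in \<mu>. 0 \<le> x" using that by (simp add: nonneg_dist_def)
    then show "AE x in \<mu>. exp (- \<bar>x\<bar>) ^ n = exp (- real n * x)" by eventually_elim (simp add: exp_of_nat_mult[symmetric])
   qed auto
  finally show ?thesis .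
 qed
 have bd: "AE y in ?Y \<mu>. \<bar>y\<bar> \<le> 1" if "nonneg_dist \<mu>" for \<mu>
 proof -
  interpret real_distribution \<mu> using that by (simp add: nonneg_dist_def)
  show ?thesis by (subst AE_distr_iff) auto
 qed
 have "char (?Y \<mu>) = char (?Y \<mu>')"
 proof
  fix \<xi>
  show "char (?Y \<mu>) \<xi> = char (?Y \<mu>') \<xi>"
   using char_bounded_moments[OF rd[OF \<mu>] bd[OF \<mu>], of \<xi>] char_bounded_moments[OF rd[OF \<mu>'] bd[OF \<mu>'], of \<xi>]
   unfolding mom[OF \<mu>] mom[OF \<mu>'] eq by (rule sums_unique2)
 qed
 then have Yeq: "?Y \<mu> = ?Y \<mu>'" by (intro Levy_uniqueness rd \<mu> \<mu>')
 have inv_Y: "distr (?Y \<mu>) borel (\<lambda>y. - ln y) = \<mu>" if "nonneg_dist \<mu>" for \<mu>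
 proof -
  interpret real_distribution \<mu> using that by (simp add: nonneg_dist_def)
  have "distr (?Y \<mu>) borel (\<lambda>y. - ln y) = distr \<mu> borel (\<lambda>x. \<bar>x\<bar>)" by (subst distr_distr) (auto simp: comp_def)
  also have "\<dots> = distr \<mu> borel (\<lambda>x. x)" using that by (intro distr_cong_AE) (auto simp: nonneg_dist_def elim!: eventually_mono)
  also have "\<dots> = \<mu>" by (rule distr_id2) simp
  finally show ?thesis .
 qed
 show ?thesis by (subst inv_Y[OF \<mu>, symmetric], subst inv_Y[OF \<mu>', symmetric], rule arg_cong[OF Yeq])
qed

lemma id_law_unique:
 assumes "id_law N \<mu>" "id_law N' \<mu>'" "\<And>z. 0 \<le> Re z \<Longrightarrow> levyexp N z = levyexp N' z"
 shows "\<mu> = \<mu>'"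
proof (rule laplace_unique)
 show 1: "nonneg_dist \<mu>" and 2: "nonneg_dist \<mu>'" using assms by (auto simp: id_law_def)
 fix n :: nat
 have "lap \<mu> (of_real (real n)) = lap \<mu>' (of_real (real n))" using assms by (auto simp: id_law_def)
 then show "(\<integral>x. exp (- real n * x) \<partial>\<mu>) = (\<integral>x. exp (- real n * x) \<partial>\<mu>')"
  unfolding lap_of_nat_real[OF 1] lap_of_nat_real[OF 2] by (simp only: of_real_eq_iff)
qed

section \<open>Convolution and exponential tilting of laws\<close>

text \<open>The disjunct \<open>Re z < 0\<close> stands for a hypothesis on z: the two conclusions
  share their assumptions, and the first one does not mention z.\<close>

lemma nonneg_dist_conv:
 assumes "nonneg_dist \<mu>" "nonneg_dist \<mu>'"
 shows "nonneg_dist (\<mu> \<star> \<mu>')" "lap (\<mu> \<star> \<mu>') z = lap \<mu> z * lap \<mu>' z \<or> Re z < 0"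
proof -
 interpret M: real_distribution \<mu> using assms by (simp add: nonneg_dist_def)
 interpret N: real_distribution \<mu>' using assms by (simp add: nonneg_dist_def)
 interpret P: pair_prob_space \<mu> \<mu>' ..
 have "prob_space (\<mu> \<star> \<mu>')" unfolding convolution_def by (rule P.prob_space_distr) auto
 then have rd: "real_distribution (\<mu> \<star> \<mu>')" by (simp add: real_distribution_def real_distribution_axioms_def)
 have a1: "AE x in \<mu>. 0 \<le> x" and a2: "AE x in \<mu>'. 0 \<le> x" using assms by (auto simp: nonneg_dist_def)
 have ae: "AE w in \<mu> \<Otimes>\<^sub>M \<mu>'. 0 \<le> fst w \<and> 0 \<le> snd w"
  proof (rule P.AE_pair_measure)
   show "{w \<in> space (\<mu> \<Otimes>\<^sub>M \<mu>'). 0 \<le> fst w \<and> 0 \<le> snd w} \<in> sets (\<mu> \<Otimes>\<^sub>M \<mu>')" by measurable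
  qed (use a1 a2 in \<open>auto elim!: eventually_mono\<close>)
 have "AE x in \<mu> \<star> \<mu>'. 0 \<le> x" unfolding convolution_def
 proof (subst AE_distr_iff)
  show "AE w in \<mu> \<Otimes>\<^sub>M \<mu>'. 0 \<le> (case w of (x, y) \<Rightarrow> x + y)" using ae by eventually_elim (auto simp: case_prod_beta')
 qed auto
 with rd show "nonneg_dist (\<mu> \<star> \<mu>')" by (simp add: nonneg_dist_def)
 show "lap (\<mu> \<star> \<mu>') z = lap \<mu> z * lap \<mu>' z \<or> Re z < 0"
 proof (cases "Re z < 0")
  case False
  have int: "integrable (\<mu> \<Otimes>\<^sub>M \<mu>') (\<lambda>w. exp (- z * of_real (fst w + snd w)))"
  proof (rule P.integrable_const_bound[where B=1])
   show "AE w in \<mu> \<Otimes>\<^sub>M \<mu>'. norm (exp (- z * of_real (fst w + snd w))) \<le> 1"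
    using ae by eventually_elim (use False in \<open>auto intro!: mult_nonneg_nonneg\<close>)
  qed measurable
  have "lap (\<mu> \<star> \<mu>') z = (\<integral>w. exp (- z * of_real (fst w + snd w)) \<partial>(\<mu> \<Otimes>\<^sub>M \<mu>'))"
   unfolding lap_def convolution_def by (subst integral_distr) (auto simp: case_prod_beta')
  also have "\<dots> = (\<integral>x. \<integral>y. exp (- z * of_real (x + y)) \<partial>\<mu>' \<partial>\<mu>)" using P.integral_fst'[OF int] by simp
  also have "\<dots> = (\<integral>x. exp (- z * of_real x) * lap \<mu>' z \<partial>\<mu>)" unfolding lap_def by (intro Bochner_Integration.integral_cong refl)
     (simp add: exp_add[symmetric] ring_distribs flip: integral_mult_right_zero)
  also have "\<dots> = lap \<mu> z * lap \<mu>' z" unfolding lap_def by simp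
  finally show ?thesis by simp
 qed simp
qed

lemma id_law_conv:
 assumes "levy N" "levy N'" "id_law N \<mu>" "id_law N' \<mu>'"
 shows "id_law (\<lambda>s. N s + N' s) (\<mu> \<star> \<mu>')"
proof -
 have n: "nonneg_dist \<mu>" "nonneg_dist \<mu>'" using assms by (auto simp: id_law_def)
 show ?thesis unfolding id_law_def
 proof (intro conjI allI impI)
  fix z :: complex assume z: "0 \<le> Re z"
  have "lap (\<mu> \<star> \<mu>') z = lap \<mu> z * lap \<mu>' z" using nonneg_dist_conv(2)[OF n, of z] z by auto
  also have "\<dots> = exp (- levyexp (\<lambda>s. N s + N' s) z)"
   using assms(3,4) z by (simp add: id_law_def levyexp_add[OF assms(1,2) z] exp_add[symmetric])
  finally show "lap (\<mu> \<star> \<mu>') z = exp (- levyexp (\<lambda>s. N s + N' s) z)" .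
 qed (rule nonneg_dist_conv(1)[OF n])
qed

text \<open>Tilting shifts the argument of the transform by l, and the difference of the exponents
  at z + l and at l is the exponent at z of the tilted density.\<close>

lemma id_law_tilt:
 assumes N: "levy N" and \<mu>: "id_law N \<mu>" and l: "0 \<le> l"
 shows "id_law (\<lambda>s. exp (- l * s) * N s)
   (density \<mu> (\<lambda>x. ennreal (exp (- l * x) * exp (Re (levyexp N (of_real l))))))"
  and "levy (\<lambda>s. exp (- l * s) * N s)"
proof -
 have nd: "nonneg_dist \<mu>" using \<mu> by (simp add: id_law_def)
 interpret real_distribution \<mu> using nd by (simp add: nonneg_dist_def)
 show lv: "levy (\<lambda>s. exp (- l * s) * N s)"
 proof (rule levy_le[OF N])
  fix s
  have "exp (- l * s) * N s \<le> 1 * N s" if "0 < s" using that l levy_nonneg[OF N] by (intro mult_right_mono) auto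
  then show "exp (- l * s) * N s \<le> N s" using levy_zero[OF N, of s] by (cases "0 < s") auto
 qed (use levy_measurable[OF N] levy_nonneg[OF N] in auto)
 let ?E = "Re (levyexp N (of_real l))"
 let ?d = "\<lambda>x. exp (- l * x) * exp ?E"
 have lap_l: "lap \<mu> (of_real l) = exp (- levyexp N (of_real l))" using \<mu> l by (simp add: id_law_def)
 have real: "levyexp N (of_real l) = of_real ?E"
 proof -
  have "levyexp N (of_real l) = (\<integral>s. complex_of_real (N s * (1 - exp (- l * s))) \<partial>lborel)" unfolding levyexp_def
   by (intro Bochner_Integration.integral_cong) (auto simp: scaleR_conv_of_real simp flip: exp_of_real)
  also have "\<dots> = of_real (\<integral>s. N s * (1 - exp (- l * s)) \<partial>lborel)" by (rule integral_complex_of_real)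
  finally show ?thesis by simp
 qed
 have Ee: "(\<integral>x. exp (- l * x) \<partial>\<mu>) = exp (- ?E)"
  proof -
  have "complex_of_real (\<integral>x. exp (- l * x) \<partial>\<mu>) = exp (- of_real ?E)"
   using lap_l arg_cong[where f="\<lambda>u. exp (- u)", OF real] unfolding lap_of_nat_real[OF nd] by (rule trans)
  also have "\<dots> = of_real (exp (- ?E))" by (simp flip: exp_of_real)
  finally show ?thesis by (simp only: of_real_eq_iff)
 qed
 let ?D = "density \<mu> (\<lambda>x. ennreal (?d x))"
 have i0: "integrable \<mu> (\<lambda>x. exp (- l * x))"
  using nd l by (intro integrable_const_bound[where B=1]) (auto simp: nonneg_dist_def elim!: eventually_mono)
 have "emeasure ?D (space ?D) = (\<integral>\<^sup>+x. ennreal (?d x) \<partial>\<mu>)" by (simp add: emeasure_density)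
 also have "\<dots> = ennreal (\<integral>x. ?d x \<partial>\<mu>)" using i0 by (intro nn_integral_eq_integral) auto
 also have "(\<integral>x. ?d x \<partial>\<mu>) = (\<integral>x. exp (- l * x) \<partial>\<mu>) * exp ?E" by (rule integral_mult_left_zero)
 also have "ennreal \<dots> = 1" unfolding Ee by (simp flip: exp_add)
 finally have "prob_space ?D" by (rule prob_spaceI)
 then have "real_distribution ?D" by (simp add: real_distribution_def real_distribution_axioms_def)
 moreover have "AE x in ?D. 0 \<le> x" using nd by (subst AE_density) (auto simp: nonneg_dist_def elim!: eventually_mono)
 ultimately have ndD: "nonneg_dist ?D" unfolding nonneg_dist_def by blast
 show "id_law (\<lambda>s. exp (- l * s) * N s) ?D" unfolding id_law_def
 proof (intro conjI allI impI ndD)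
  fix z :: complex assume z: "0 \<le> Re z"
  have zl: "0 \<le> Re (z + of_real l)" using z l by simp
  have "lap ?D z = (\<integral>x. ?d x *\<^sub>R exp (- z * of_real x) \<partial>\<mu>)" unfolding lap_def by (rule integral_density) auto
  also have "\<dots> = (\<integral>x. exp (of_real ?E) * exp (- (z + of_real l) * of_real x) \<partial>\<mu>)" by (intro Bochner_Integration.integral_cong refl)
     (simp add: scaleR_conv_of_real exp_of_real[symmetric] exp_add[symmetric] algebra_simps)
  also have "\<dots> = exp (of_real ?E) * lap \<mu> (z + of_real l)" unfolding lap_def by simp
  also have "\<dots> = exp (levyexp N (of_real l) - levyexp N (z + of_real l))"
   using \<mu> zl by (subst real) (simp add: id_law_def exp_add[symmetric])
  also have "levyexp N (of_real l) - levyexp N (z + of_real l) = - levyexp (\<lambda>s. exp (- l * s) * N s) z"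
  proof -
   have "levyexp N (z + of_real l) - levyexp N (of_real l) = (\<integral>s. N s *\<^sub>R (1 - exp (- (z + of_real l) * of_real s))
     - N s *\<^sub>R (1 - exp (- of_real l * of_real s)) \<partial>lborel)"
    unfolding levyexp_def using levyexp_integrable[OF N zl] levyexp_integrable[OF N, of "of_real l"] l
    by (subst Bochner_Integration.integral_diff) auto
   also have "\<dots> = levyexp (\<lambda>s. exp (- l * s) * N s) z" unfolding levyexp_def by (intro Bochner_Integration.integral_cong refl)
      (simp add: scaleR_conv_of_real exp_of_real[symmetric] exp_add[symmetric] algebra_simps)
   finally show ?thesis by (metis minus_diff_eq)
  qed
  finally show "lap ?D z = exp (- levyexp (\<lambda>s. exp (- l * s) * N s) z)" .
 qed
qed

section \<open>Compound Poisson laws\<close>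

lemma nn_integral_conv_nonneg_dist:
 assumes "nonneg_dist \<mu>" "nonneg_dist \<mu>'" "g \<in> borel_measurable borel"
 shows "(\<integral>\<^sup>+x. g x \<partial>(\<mu> \<star> \<mu>')) = (\<integral>\<^sup>+x. \<integral>\<^sup>+y. g (x + y) \<partial>\<mu>' \<partial>\<mu>)"
proof -
 interpret M: real_distribution \<mu> using assms by (simp add: nonneg_dist_def)
 interpret N: real_distribution \<mu>' using assms by (simp add: nonneg_dist_def)
 show ?thesis by (rule nn_integral_convolution) (use assms in \<open>auto intro: M.finite_measure_axioms N.finite_measure_axioms\<close>)
qed

primrec conv_pow :: "real measure \<Rightarrow> nat \<Rightarrow> real measure" where
 "conv_pow \<mu> 0 = return borel 0"
| "conv_pow \<mu> (Suc n) = (\<mu> \<star> conv_pow \<mu> n)"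

lemma nonneg_dist_return: "nonneg_dist (return borel 0)"
 by (auto simp: nonneg_dist_def real_distribution_def real_distribution_axioms_def prob_space_return AE_return)

lemma conv_pow_props:
 assumes "nonneg_dist \<mu>"
 shows "nonneg_dist (conv_pow \<mu> n)" and "0 \<le> Re z \<Longrightarrow> lap (conv_pow \<mu> n) z = lap \<mu> z ^ n"
proof (induction n)
 case 0
 show "nonneg_dist (conv_pow \<mu> 0)" by (simp add: nonneg_dist_return)
 show "lap (conv_pow \<mu> 0) z = lap \<mu> z ^ 0" by (simp add: lap_def integral_return)
next
 case (Suc n)
 show "nonneg_dist (conv_pow \<mu> (Suc n))" using nonneg_dist_conv(1)[OF assms Suc(1)] by simp
 show "lap (conv_pow \<mu> (Suc n)) z = lap \<mu> z ^ Suc n" if "0 \<le> Re z" using nonneg_dist_conv(2)[OF assms Suc(1), of z] Suc(2) that by auto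
qed

text \<open>The compound Poisson law: the sum of a Poisson number, with mean m, of independent jumps
  with law \<open>\<mu>\<close>.\<close>

definition cpoisson :: "real \<Rightarrow> real measure \<Rightarrow> real measure" where
 "cpoisson m \<mu> = measure_pmf (poisson_pmf m) \<bind> conv_pow \<mu>"

lemma conv_pow_measurable:
 assumes "nonneg_dist \<mu>"
 shows "conv_pow \<mu> \<in> measurable (measure_pmf p) (subprob_algebra borel)"
proof -
 have "conv_pow \<mu> n \<in> space (subprob_algebra borel)" for n
 proof -
  interpret real_distribution "conv_pow \<mu> n" using conv_pow_props(1)[OF assms] by (simp add: nonneg_dist_def)
  show ?thesis by (simp add: space_subprob_algebra subprob_space_axioms)
 qed
 then show ?thesis by (simp add: measurable_def)
qed

lemma nn_integral_cpoisson:
 assumes "nonneg_dist \<mu>" "g \<in> borel_measurable borel" "0 < m"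
 shows "(\<integral>\<^sup>+x. g x \<partial>cpoisson m \<mu>) = (\<Sum>n. ennreal (m ^ n / fact n * exp (- m)) * (\<integral>\<^sup>+x. g x \<partial>conv_pow \<mu> n))"
proof -
 have "(\<integral>\<^sup>+x. g x \<partial>cpoisson m \<mu>) = (\<integral>\<^sup>+n. \<integral>\<^sup>+x. g x \<partial>conv_pow \<mu> n \<partial>measure_pmf (poisson_pmf m))"
  unfolding cpoisson_def by (rule nn_integral_bind[OF assms(2) conv_pow_measurable[OF assms(1)]])
 also have "\<dots> = (\<integral>\<^sup>+n. ennreal (m ^ n / fact n * exp (- m)) * (\<integral>\<^sup>+x. g x \<partial>conv_pow \<mu> n) \<partial>count_space UNIV)"
  by (simp only: nn_integral_measure_pmf pmf_poisson[OF assms(3)])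
 finally show ?thesis by (simp add: nn_integral_count_space_nat)
qed

lemma integral_cpoisson:
 fixes g :: "real \<Rightarrow> complex"
 assumes "nonneg_dist \<mu>" and [measurable]: "g \<in> borel_measurable borel" and "0 < m"
  and b: "\<And>x. norm (g x) \<le> 1"
 shows "(\<lambda>n. of_real (m ^ n / fact n * exp (- m)) * (\<integral>x. g x \<partial>conv_pow \<mu> n)) sums (\<integral>x. g x \<partial>cpoisson m \<mu>)"
proof -
 let ?p = "measure_pmf (poisson_pmf m)"
 have rd: "real_distribution (conv_pow \<mu> n)" for n using conv_pow_props(1)[OF assms(1)] by (simp add: nonneg_dist_def)
 have s: "sets (conv_pow \<mu> n) = sets borel" for n using rd[of n] by (simp add: real_distribution_def real_distribution_axioms_def)
 have ig: "integrable (conv_pow \<mu> n) g" for n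
 proof -
  interpret real_distribution "conv_pow \<mu> n" by (rule rd)
  show ?thesis by (rule integrable_const_bound[where B=1]) (use b in auto)
 qed
 \<comment> \<open>The mixture formula is established for real integrands and applied to the real
   and the imaginary part of \<open>g\<close>.\<close>
 have re: "(\<integral>x. f x \<partial>cpoisson m \<mu>) = (\<integral>n. (\<integral>x. f x \<partial>conv_pow \<mu> n) \<partial>?p)"
  and ic: "integrable (cpoisson m \<mu>) f"
  if [measurable]: "f \<in> borel_measurable borel" and "\<And>x. \<bar>f x\<bar> \<le> 1" for f :: "real \<Rightarrow> real"
 proof -
  have AEb: "AE n in ?p. emeasure (conv_pow \<mu> n) (space (conv_pow \<mu> n)) \<le> ennreal 1"
  proof (rule AE_I2)
   fix n
   interpret real_distribution "conv_pow \<mu> n" by (rule rd)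
   show "emeasure (conv_pow \<mu> n) (space (conv_pow \<mu> n)) \<le> ennreal 1" using emeasure_space_1 by simp
  qed
  show "(\<integral>x. f x \<partial>cpoisson m \<mu>) = (\<integral>n. (\<integral>x. f x \<partial>conv_pow \<mu> n) \<partial>?p)" unfolding cpoisson_def
   by (rule integral_bind[where B=1 and B'=1 and K=borel, OF that(1) _ conv_pow_measurable[OF assms(1)] _ AEb])
     (use that in \<open>auto intro: measure_pmf.finite_measure_axioms\<close>)
  show "integrable (cpoisson m \<mu>) f" unfolding cpoisson_def
   by (rule integrable_bind[where B=1 and B'=1 and K=borel, OF that(1) _ conv_pow_measurable[OF assms(1)] _ AEb])
     (use that in \<open>auto intro: measure_pmf.finite_measure_axioms\<close>)
 qed
 have bRe: "\<bar>Re (g x)\<bar> \<le> 1" and bIm: "\<bar>Im (g x)\<bar> \<le> 1" for x using b[of x] abs_Re_le_cmod[of "g x"] abs_Im_le_cmod[of "g x"] by linarith+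
 have icg: "integrable (cpoisson m \<mu>) g"
 proof -
  have "integrable (cpoisson m \<mu>) (\<lambda>x. complex_of_real (Re (g x)) + \<i> * complex_of_real (Im (g x)))"
   using bRe bIm by (intro Bochner_Integration.integrable_add integrable_mult_right integrable_of_real ic) measurable
  then show ?thesis by (simp flip: complex_eq)
 qed
 define c where "c n = (\<integral>x. g x \<partial>conv_pow \<mu> n)" for n
 have cb: "norm (c n) \<le> 1" for n
 proof -
  interpret real_distribution "conv_pow \<mu> n" by (rule rd)
  have "norm (c n) \<le> (\<integral>x. norm (g x) \<partial>conv_pow \<mu> n)" unfolding c_def by (rule integral_norm_bound)
  also have "\<dots> \<le> (\<integral>x. 1 \<partial>conv_pow \<mu> n)" using ig[of n] b by (intro integral_mono) auto
  finally show ?thesis using prob_space by simp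
 qed
 have icp: "integrable ?p c" by (rule measure_pmf.integrable_const_bound[where B=1]) (use cb in auto)
 have "(\<integral>x. g x \<partial>cpoisson m \<mu>) = (\<integral>n. c n \<partial>?p)"
 proof (rule complex_eqI)
  have "Re (\<integral>x. g x \<partial>cpoisson m \<mu>) = (\<integral>x. Re (g x) \<partial>cpoisson m \<mu>)" using icg by simp
  also have "\<dots> = (\<integral>n. Re (c n) \<partial>?p)" using re[of "\<lambda>x. Re (g x)"] bRe ig by (simp add: c_def)
  finally show "Re (\<integral>x. g x \<partial>cpoisson m \<mu>) = Re (\<integral>n. c n \<partial>?p)" using icp by simp
  have "Im (\<integral>x. g x \<partial>cpoisson m \<mu>) = (\<integral>x. Im (g x) \<partial>cpoisson m \<mu>)" using icg by simp
  also have "\<dots> = (\<integral>n. Im (c n) \<partial>?p)" using re[of "\<lambda>x. Im (g x)"] bIm ig by (simp add: c_def)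
  finally show "Im (\<integral>x. g x \<partial>cpoisson m \<mu>) = Im (\<integral>n. c n \<partial>?p)" using icp by simp
 qed
 moreover have "(\<lambda>n. (m ^ n / fact n * exp (- m)) *\<^sub>R c n) sums (\<integral>n. c n \<partial>?p)"
 proof -
  have p: "?p = density (count_space UNIV) (\<lambda>n. ennreal (m ^ n / fact n * exp (- m)))"
   by (simp only: measure_pmf_eq_density pmf_poisson[OF assms(3)])
  have i: "integrable (count_space UNIV) (\<lambda>n. (m ^ n / fact n * exp (- m)) *\<^sub>R c n)"
   using icp unfolding p by (subst (asm) integrable_density) (use assms(3) in auto)
  have "(\<integral>n. c n \<partial>?p) = (\<integral>n. (m ^ n / fact n * exp (- m)) *\<^sub>R c n \<partial>count_space UNIV)"
   unfolding p by (rule integral_density) (use assms(3) in auto)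
  then show ?thesis using sums_integral_count_space_nat[OF i] by simp
 qed
 ultimately show ?thesis by (simp add: c_def scaleR_conv_of_real)
qed

lemma nonneg_dist_cpoisson:
 assumes "nonneg_dist \<mu>" "0 < m"
 shows "nonneg_dist (cpoisson m \<mu>)"
proof -
 have rd: "real_distribution (conv_pow \<mu> n)" for n using conv_pow_props(1)[OF assms(1)] by (simp add: nonneg_dist_def)
 have st: "sets (cpoisson m \<mu>) = sets borel"
 proof -
  have "sets (conv_pow \<mu> n) = sets borel" for n using rd[of n] by (simp add: real_distribution_def real_distribution_axioms_def)
  then show ?thesis unfolding cpoisson_def by (subst sets_bind[where N=borel]) auto
 qed
 have e: "emeasure (cpoisson m \<mu>) A = (\<Sum>n. ennreal (m ^ n / fact n * exp (- m)) * emeasure (conv_pow \<mu> n) A)"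
  if "A \<in> sets borel" for A
 proof -
  have "sets (conv_pow \<mu> n) = sets borel" for n using rd[of n] by (simp add: real_distribution_def real_distribution_axioms_def)
  then show ?thesis using nn_integral_cpoisson[OF assms(1) borel_measurable_indicator assms(2), OF that] that st by simp
 qed
 have "emeasure (cpoisson m \<mu>) (space (cpoisson m \<mu>)) = 1"
 proof -
  have u: "emeasure (conv_pow \<mu> n) UNIV = 1" for n
  proof -
   interpret real_distribution "conv_pow \<mu> n" by (rule rd)
   show ?thesis using emeasure_space_1 by simp
  qed
  have "(\<lambda>n. m ^ n /\<^sub>R fact n) sums exp m" by (rule exp_converges)
  then have "(\<lambda>n. m ^ n / fact n * exp (- m)) sums (exp m * exp (- m))" by (intro sums_mult2) (simp add: divide_inverse mult.commute)
  then have "(\<Sum>n. ennreal (m ^ n / fact n * exp (- m))) = ennreal (exp m * exp (- m))" using assms(2) by (intro suminf_ennreal_eq) auto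
  also have "\<dots> = 1" by (simp flip: exp_add)
  finally show ?thesis using e[of UNIV] sets_eq_imp_space_eq[OF st] by (simp add: u)
 qed
 then have "prob_space (cpoisson m \<mu>)" by (rule prob_spaceI)
 moreover have "AE x in cpoisson m \<mu>. 0 \<le> x"
 proof -
  have z: "emeasure (conv_pow \<mu> n) {..<0} = 0" for n
  proof -
   interpret real_distribution "conv_pow \<mu> n" by (rule rd)
   have "AE x in conv_pow \<mu> n. x \<notin> {..<0}" using conv_pow_props(1)[OF assms(1), of n] by (simp add: nonneg_dist_def not_less)
   then show ?thesis by (subst (asm) AE_iff_measurable[OF _ refl]) (auto simp: Collect_conv_if lessThan_def)
  qed
  have "emeasure (cpoisson m \<mu>) {..<0} = 0" by (simp add: e z)
  then show ?thesis using st by (intro AE_I[where N="{..<0}"]) auto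
 qed
 ultimately show ?thesis using st
  by (simp add: nonneg_dist_def real_distribution_def real_distribution_axioms_def)
qed

lemma lap_cpoisson:
 assumes "nonneg_dist \<mu>" "0 < m" "0 \<le> Re z"
 shows "lap (cpoisson m \<mu>) z = exp (- (of_real m * (1 - lap \<mu> z)))"
proof -
 \<comment> \<open>With the absolute value the integrand is bounded by 1 everywhere and unchanged
   almost everywhere.\<close>
 let ?g = "\<lambda>x. exp (- z * of_real \<bar>x\<bar>)"
 have abs: "lap \<nu> z = (\<integral>x. ?g x \<partial>\<nu>)" if "nonneg_dist \<nu>" for \<nu>
 proof -
  interpret real_distribution \<nu> using that by (simp add: nonneg_dist_def)
  have "AE x in \<nu>. 0 \<le> x" using that by (simp add: nonneg_dist_def)
  then have "AE x in \<nu>. exp (- z * of_real x) = ?g x" by eventually_elim simp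
  then show ?thesis unfolding lap_def by (intro integral_cong_AE) auto
 qed
 have "(\<lambda>n. of_real (m ^ n / fact n * exp (- m)) * lap \<mu> z ^ n) sums lap (cpoisson m \<mu>) z"
 proof -
  have "norm (?g x) \<le> 1" for x using assms(3) by simp
  then have "(\<lambda>n. of_real (m ^ n / fact n * exp (- m)) * (\<integral>x. ?g x \<partial>conv_pow \<mu> n)) sums (\<integral>x. ?g x \<partial>cpoisson m \<mu>)"
   by (intro integral_cpoisson[OF assms(1) _ assms(2)]) measurable
  then show ?thesis
   by (simp only: abs[symmetric] conv_pow_props[OF assms(1)] assms(3) nonneg_dist_cpoisson[OF assms(1,2)])
 qed
 moreover have "(\<lambda>n. of_real (m ^ n / fact n * exp (- m)) * lap \<mu> z ^ n) sums (exp (of_real m * lap \<mu> z) * of_real (exp (- m)))"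
 proof -
  have "(\<lambda>n. (of_real m * lap \<mu> z) ^ n /\<^sub>R fact n) sums exp (of_real m * lap \<mu> z)" by (rule exp_converges)
  from sums_mult2[OF this, of "of_real (exp (- m))"] show ?thesis
   by (rule sums_cong[THEN iffD1, rotated]) (simp add: power_mult_distrib scaleR_conv_of_real field_simps)
 qed
 ultimately have "lap (cpoisson m \<mu>) z = exp (of_real m * lap \<mu> z) * of_real (exp (- m))" by (rule sums_unique2)
 then show ?thesis by (simp add: exp_of_real[symmetric] exp_add[symmetric] algebra_simps)
qed

text \<open>The lower bounds keep only the event of no jump or of exactly one jump. For the upper
  bound one jump is split off: the Poisson weight of n + 1 is at most m times the weight of n, so
  the remaining jumps again form the full compound Poisson law.\<close>

lemma cpoisson_bounds:
 assumes "nonneg_dist \<mu>" "0 < m" and [measurable]: "g \<in> borel_measurable borel"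
 shows "ennreal (exp (- m)) * g 0 \<le> (\<integral>\<^sup>+x. g x \<partial>cpoisson m \<mu>)"
  and "ennreal (m * exp (- m)) * (\<integral>\<^sup>+x. g x \<partial>\<mu>) \<le> (\<integral>\<^sup>+x. g x \<partial>cpoisson m \<mu>)"
  and "(\<integral>\<^sup>+x. g x \<partial>cpoisson m \<mu>) \<le> g 0 + ennreal m * (\<integral>\<^sup>+s. \<integral>\<^sup>+x. g (s + x) \<partial>cpoisson m \<mu> \<partial>\<mu>)"
proof -
 interpret real_distribution \<mu> using assms by (simp add: nonneg_dist_def)
 let ?p = "\<lambda>n. ennreal (m ^ n / fact n * exp (- m))"
 let ?a = "\<lambda>n. \<integral>\<^sup>+x. g x \<partial>conv_pow \<mu> n"
 have S: "(\<integral>\<^sup>+x. g x \<partial>cpoisson m \<mu>) = (\<Sum>n. ?p n * ?a n)" by (rule nn_integral_cpoisson[OF assms(1,3,2)])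
 have a0: "?a 0 = g 0" by (simp add: nn_integral_return)
 have nc: "nonneg_dist (conv_pow \<mu> n)" for n by (rule conv_pow_props(1)[OF assms(1)])
 have mz[measurable]: "(\<lambda>s. \<integral>\<^sup>+x. g (s + x) \<partial>conv_pow \<mu> n) \<in> borel_measurable borel" for n
 proof -
  interpret N: real_distribution "conv_pow \<mu> n" using nc by (simp add: nonneg_dist_def)
  show ?thesis by measurable
 qed
 have aS: "?a (Suc n) = (\<integral>\<^sup>+s. \<integral>\<^sup>+x. g (s + x) \<partial>conv_pow \<mu> n \<partial>\<mu>)" for n using nn_integral_conv_nonneg_dist[OF assms(1) nc assms(3)] by simp
 have a1: "?a 1 = (\<integral>\<^sup>+x. g x \<partial>\<mu>)" using aS[of 0] by (simp add: nn_integral_return)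
 have "(\<Sum>n\<in>{0}. ?p n * ?a n) \<le> (\<Sum>n. ?p n * ?a n)" by (rule sum_le_suminf) auto
 then show "ennreal (exp (- m)) * g 0 \<le> (\<integral>\<^sup>+x. g x \<partial>cpoisson m \<mu>)" using S a0 by simp
 have "(\<Sum>n\<in>{1}. ?p n * ?a n) \<le> (\<Sum>n. ?p n * ?a n)" by (rule sum_le_suminf) auto
 then show "ennreal (m * exp (- m)) * (\<integral>\<^sup>+x. g x \<partial>\<mu>) \<le> (\<integral>\<^sup>+x. g x \<partial>cpoisson m \<mu>)" using S a1 by simp
 have "(\<Sum>n. ?p n * ?a n) = ?p 0 * ?a 0 + (\<Sum>n. ?p (Suc n) * ?a (Suc n))"
  using suminf_offset[of "\<lambda>n. ?p n * ?a n" 1] by (simp add: add.commute)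
 also have "\<dots> \<le> g 0 + (\<Sum>n. ennreal m * (?p n * ?a (Suc n)))"
 proof (rule add_mono)
  have "exp (- m) \<le> 1" using assms(2) by simp
  then have "ennreal (exp (- m)) \<le> 1" by (metis ennreal_1 ennreal_leI)
  then have "ennreal (exp (- m)) * g 0 \<le> 1 * g 0" by (rule mult_right_mono) simp
  then show "?p 0 * ?a 0 \<le> g 0" using a0 by simp
  show "(\<Sum>n. ?p (Suc n) * ?a (Suc n)) \<le> (\<Sum>n. ennreal m * (?p n * ?a (Suc n)))"
  proof (rule suminf_le)
   fix n
   have "m ^ Suc n / fact (Suc n) * exp (- m) \<le> m * (m ^ n / fact n * exp (- m))"
   proof -
    have "m ^ Suc n / fact (Suc n) \<le> m ^ Suc n / fact n" using assms(2) by (intro divide_left_mono) (auto simp: mult_le_cancel_right1)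
    then have "m ^ Suc n / fact (Suc n) * exp (- m) \<le> m ^ Suc n / fact n * exp (- m)" by (rule mult_right_mono) simp
    then show ?thesis by (simp only: power_Suc times_divide_eq_right mult.assoc times_divide_eq_left)
   qed
   then have "?p (Suc n) \<le> ennreal m * ?p n" using assms(2) by (simp add: ennreal_mult'[symmetric] ennreal_leI)
   then show "?p (Suc n) * ?a (Suc n) \<le> ennreal m * (?p n * ?a (Suc n))" by (metis mult.assoc mult_right_mono zero_le)
  qed auto
 qed
 also have "(\<Sum>n. ennreal m * (?p n * ?a (Suc n))) = ennreal m * (\<Sum>n. ?p n * ?a (Suc n))" by (rule ennreal_suminf_cmult)
 also have "(\<Sum>n. ?p n * ?a (Suc n)) = (\<Sum>n. \<integral>\<^sup>+s. ?p n * (\<integral>\<^sup>+x. g (s + x) \<partial>conv_pow \<mu> n) \<partial>\<mu>)"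
  unfolding aS by (intro suminf_cong nn_integral_cmult[symmetric]) measurable
 also have "\<dots> = (\<integral>\<^sup>+s. (\<Sum>n. ?p n * (\<integral>\<^sup>+x. g (s + x) \<partial>conv_pow \<mu> n)) \<partial>\<mu>)" by (rule nn_integral_suminf[symmetric]) measurable
 also have "\<dots> = (\<integral>\<^sup>+s. \<integral>\<^sup>+x. g (s + x) \<partial>cpoisson m \<mu> \<partial>\<mu>)" by (intro nn_integral_cong nn_integral_cpoisson[symmetric] assms(1,2)) measurable
 finally show "(\<integral>\<^sup>+x. g x \<partial>cpoisson m \<mu>) \<le> g 0 + ennreal m * (\<integral>\<^sup>+s. \<integral>\<^sup>+x. g (s + x) \<partial>cpoisson m \<mu> \<partial>\<mu>)" using S by simp
qed

section \<open>Existence of the laws and splitting off jumps\<close>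

definition lexp :: "(real \<Rightarrow> real) \<Rightarrow> real \<Rightarrow> real" where
 "lexp N l = (\<integral>s. N s * (1 - exp (- l * s)) \<partial>lborel)"

lemma levyexp_of_real: "levyexp N (of_real l) = of_real (lexp N l)"
proof -
 have "levyexp N (of_real l) = (\<integral>s. complex_of_real (N s * (1 - exp (- l * s))) \<partial>lborel)" unfolding levyexp_def
  by (intro Bochner_Integration.integral_cong) (auto simp: scaleR_conv_of_real simp flip: exp_of_real)
 also have "\<dots> = of_real (\<integral>s. N s * (1 - exp (- l * s)) \<partial>lborel)" by (rule integral_complex_of_real)
 finally show ?thesis by (simp add: lexp_def)
qed

lemma lexp_integrable:
 assumes "levy N" "0 \<le> l"
 shows "integrable lborel (\<lambda>s. N s * (1 - exp (- l * s)))"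
proof (rule levy_integrable_real[OF assms(1)])
 fix s :: real assume "0 < s"
 have e: "1 - exp (- complex_of_real l * of_real s) = of_real (1 - exp (- l * s))" by (simp flip: exp_of_real)
 show "\<bar>1 - exp (- l * s)\<bar> \<le> (2 + l) * min 1 s"
  using norm_one_minus_exp_le[of "of_real l" s] assms(2) \<open>0 < s\<close> unfolding e norm_of_real by simp
qed auto

lemma lap_id_law_real:
 assumes "id_law N \<mu>" "0 \<le> l"
 shows "(\<integral>x. exp (- l * x) \<partial>\<mu>) = exp (- lexp N l)"
proof -
 have "complex_of_real (\<integral>x. exp (- l * x) \<partial>\<mu>) = exp (- levyexp N (of_real l))"
  using assms lap_of_nat_real[of \<mu> l] by (auto simp: id_law_def)
 also have "\<dots> = of_real (exp (- lexp N l))" by (simp add: levyexp_of_real exp_of_real[symmetric])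
 finally show ?thesis by (simp only: of_real_eq_iff)
qed

text \<open>Restates the compound Poisson estimates with the jump density \<open>q\<close> in place
  of a normalised jump law, the form needed for splitting Levy densities.\<close>

lemma compound_poisson_exists:
 assumes q: "levy q" and qi: "integrable lborel q"
 defines "m \<equiv> integral\<^sup>L lborel q"
 obtains \<mu> where "id_law q \<mu>"
  "\<And>g. g \<in> borel_measurable borel \<Longrightarrow> ennreal (exp (- m)) * g 0 \<le> (\<integral>\<^sup>+x. g x \<partial>\<mu>)"
  "\<And>g. g \<in> borel_measurable borel \<Longrightarrow> ennreal (exp (- m)) * (\<integral>\<^sup>+s. ennreal (q s) * g s \<partial>lborel) \<le> (\<integral>\<^sup>+x. g x \<partial>\<mu>)"
  "\<And>g. g \<in> borel_measurable borel \<Longrightarrow>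
    (\<integral>\<^sup>+x. g x \<partial>\<mu>) \<le> g 0 + (\<integral>\<^sup>+s. ennreal (q s) * (\<integral>\<^sup>+x. g (s + x) \<partial>\<mu>) \<partial>lborel)"
proof -
 have qn: "0 \<le> q s" for s by (rule levy_nonneg[OF q])
 have [measurable]: "q \<in> borel_measurable borel" by (rule levy_measurable[OF q])
 have m0: "0 \<le> m" unfolding m_def by (intro integral_nonneg_AE) (simp add: qn)
 show ?thesis
 proof (cases "m = 0")
  \<comment> \<open>A density of mass zero has no normalised jump law; the law is then the point
    mass at 0.\<close>
  case True
  have AE0: "AE s in lborel. q s = 0" using integral_nonneg_eq_0_iff_AE[OF qi] qn True unfolding m_def by simp
  have z: "(\<integral>\<^sup>+s. ennreal (q s) * h s \<partial>lborel) = 0" for h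
  proof -
   have "(\<integral>\<^sup>+s. ennreal (q s) * h s \<partial>lborel) = (\<integral>\<^sup>+s. 0 \<partial>(lborel::real measure))"
    by (rule nn_integral_cong_AE) (use AE0 in \<open>eventually_elim, simp\<close>)
   then show ?thesis by simp
  qed
  show ?thesis
  proof
   have "levyexp q w = 0" for w unfolding levyexp_def by (rule integral_eq_zero_AE) (use AE0 in \<open>eventually_elim, simp\<close>)
   then show "id_law q (return borel 0)" by (simp add: id_law_def nonneg_dist_return lap_def integral_return)
  qed (simp_all add: True z nn_integral_return)
 next
  case False
  with m0 have m: "0 < m" by simp
  let ?\<mu> = "density lborel (\<lambda>s. ennreal (q s / m))"
  have "emeasure ?\<mu> (space ?\<mu>) = ennreal (\<integral>s. q s / m \<partial>lborel)" using qi m qn by (simp add: emeasure_density nn_integral_eq_integral)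
  also have "(\<integral>s. q s / m \<partial>lborel) = 1" using m unfolding m_def by simp
  finally have "prob_space ?\<mu>" by (intro prob_spaceI) simp
  then have "real_distribution ?\<mu>" by (simp add: real_distribution_def real_distribution_axioms_def)
  moreover have "AE s in ?\<mu>. 0 \<le> s"
  proof (subst AE_density)
   show "AE x in lborel. 0 < ennreal (q x / m) \<longrightarrow> 0 \<le> x"
   proof (rule AE_I2, rule impI, rule ccontr)
    fix x assume "0 < ennreal (q x / m)" "\<not> 0 \<le> x"
    then show False using levy_zero[OF q, of x] by simp
   qed
  qed measurable
  ultimately have nd: "nonneg_dist ?\<mu>" unfolding nonneg_dist_def by blast
  have nn: "(\<integral>\<^sup>+s. h s \<partial>?\<mu>) = (\<integral>\<^sup>+s. ennreal (q s / m) * h s \<partial>lborel)" if "h \<in> borel_measurable borel" for h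
   using that by (subst nn_integral_density) auto
  have mm: "ennreal m * (\<integral>\<^sup>+s. h s \<partial>?\<mu>) = (\<integral>\<^sup>+s. ennreal (q s) * h s \<partial>lborel)"
   if [measurable]: "h \<in> borel_measurable borel" for h
  proof -
   have "ennreal m * ennreal (q s / m) = ennreal (q s)" for s using m qn[of s] by (simp flip: ennreal_mult')
   then show ?thesis unfolding nn[OF that]
    by (subst nn_integral_cmult[symmetric]) (auto simp flip: mult.assoc)
  qed
  show ?thesis
  proof
   show "id_law q (cpoisson m ?\<mu>)" unfolding id_law_def
   proof (intro conjI allI impI)
    show "nonneg_dist (cpoisson m ?\<mu>)" by (rule nonneg_dist_cpoisson[OF nd m])
    fix z :: complex assume z: "0 \<le> Re z"
    have qe: "integrable lborel (\<lambda>s. q s *\<^sub>R exp (- z * of_real s))"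
    proof (rule Bochner_Integration.integrable_bound[OF qi])
     show "AE s in lborel. norm (q s *\<^sub>R exp (- z * of_real s)) \<le> norm (q s)"
     proof (rule AE_I2)
      fix s show "norm (q s *\<^sub>R exp (- z * of_real s)) \<le> norm (q s)"
       using z qn[of s] levy_zero[OF q, of s] by (cases "0 < s") (auto intro!: mult_left_le mult_nonneg_nonneg)
     qed
    qed measurable
    have "lap ?\<mu> z = (\<integral>s. (q s / m) *\<^sub>R exp (- z * of_real s) \<partial>lborel)" unfolding lap_def using m qn by (intro integral_density) auto
    also have "\<dots> = (\<integral>s. (1 / m) *\<^sub>R (q s *\<^sub>R exp (- z * of_real s)) \<partial>lborel)" by simp
    also have "\<dots> = (1 / m) *\<^sub>R (\<integral>s. q s *\<^sub>R exp (- z * of_real s) \<partial>lborel)" by (rule integral_scaleR_right)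
    finally have l: "of_real m * lap ?\<mu> z = (\<integral>s. q s *\<^sub>R exp (- z * of_real s) \<partial>lborel)" using m by (simp add: scaleR_conv_of_real)
    have "levyexp q z = (\<integral>s. q s *\<^sub>R 1 - q s *\<^sub>R exp (- z * of_real s) \<partial>lborel)" unfolding levyexp_def by (simp only: scaleR_diff_right)
    also have "\<dots> = (\<integral>s. q s *\<^sub>R (1::complex) \<partial>lborel) - of_real m * lap ?\<mu> z"
     unfolding l by (rule Bochner_Integration.integral_diff[OF _ qe]) (rule integrable_scaleR_left[OF _], simp add: qi)
    also have "(\<integral>s. q s *\<^sub>R (1::complex) \<partial>lborel) = of_real m" unfolding m_def by (simp add: scaleR_conv_of_real)
    finally have "levyexp q z = of_real m * (1 - lap ?\<mu> z)" by (simp add: algebra_simps)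
    then show "lap (cpoisson m ?\<mu>) z = exp (- levyexp q z)" using lap_cpoisson[OF nd m z] by simp
   qed
  next
   fix g :: "real \<Rightarrow> ennreal" assume [measurable]: "g \<in> borel_measurable borel"
   interpret C: real_distribution "cpoisson m ?\<mu>" using nonneg_dist_cpoisson[OF nd m] by (simp add: nonneg_dist_def)
   show "ennreal (exp (- m)) * g 0 \<le> (\<integral>\<^sup>+x. g x \<partial>cpoisson m ?\<mu>)" by (rule cpoisson_bounds[OF nd m]) measurable
   have "ennreal (exp (- m)) * (\<integral>\<^sup>+s. ennreal (q s) * g s \<partial>lborel) = ennreal (m * exp (- m)) * (\<integral>\<^sup>+x. g x \<partial>?\<mu>)"
    using m by (subst mm[symmetric]) (auto simp: ennreal_mult ac_simps)
   also have "\<dots> \<le> (\<integral>\<^sup>+x. g x \<partial>cpoisson m ?\<mu>)" by (rule cpoisson_bounds[OF nd m]) measurable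
   finally show "ennreal (exp (- m)) * (\<integral>\<^sup>+s. ennreal (q s) * g s \<partial>lborel) \<le> (\<integral>\<^sup>+x. g x \<partial>cpoisson m ?\<mu>)" .
   have "(\<integral>\<^sup>+x. g x \<partial>cpoisson m ?\<mu>) \<le> g 0 + ennreal m * (\<integral>\<^sup>+s. \<integral>\<^sup>+x. g (s + x) \<partial>cpoisson m ?\<mu> \<partial>?\<mu>)"
    by (rule cpoisson_bounds[OF nd m]) measurable
   also have "ennreal m * (\<integral>\<^sup>+s. \<integral>\<^sup>+x. g (s + x) \<partial>cpoisson m ?\<mu> \<partial>?\<mu>)
     = (\<integral>\<^sup>+s. ennreal (q s) * (\<integral>\<^sup>+x. g (s + x) \<partial>cpoisson m ?\<mu>) \<partial>lborel)"
    by (rule mm) measurable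
   finally show "(\<integral>\<^sup>+x. g x \<partial>cpoisson m ?\<mu>)
     \<le> g 0 + (\<integral>\<^sup>+s. ennreal (q s) * (\<integral>\<^sup>+x. g (s + x) \<partial>cpoisson m ?\<mu>) \<partial>lborel)" .
  qed
 qed
qed

lemma levy_truncate_below:
 assumes "levy N" "0 < e"
 shows "levy (\<lambda>s. if e < s then N s else 0)" "integrable lborel (\<lambda>s. if e < s then N s else 0)"
proof -
 have [measurable]: "N \<in> borel_measurable borel" by (rule levy_measurable[OF assms(1)])
 show "levy (\<lambda>s. if e < s then N s else 0)" by (rule levy_le[OF assms(1)]) (use levy_nonneg[OF assms(1)] in auto)
 have "integrable lborel (\<lambda>s. N s * (if e < s then 1 else 0))"
 proof (rule levy_integrable_real[OF assms(1), where C="1 / e + 1"])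
  fix s :: real assume "0 < s"
  have "1 \<le> (1 / e + 1) * min 1 s" if "e < s"
  proof (cases "s \<le> 1")
   case True
   have "1 \<le> (1 / e) * s" using that assms(2) by (simp add: field_simps)
   also have "\<dots> \<le> (1 / e + 1) * s" using \<open>0 < s\<close> by (intro mult_right_mono) auto
   finally show ?thesis using True by simp
  qed (use assms(2) in auto)
  then show "\<bar>if e < s then 1 else 0\<bar> \<le> (1 / e + 1) * min 1 s" using assms(2) \<open>0 < s\<close> by auto
 qed measurable
 then show "integrable lborel (\<lambda>s. if e < s then N s else 0)" by (rule Bochner_Integration.integrable_cong[THEN iffD1, rotated -1]) auto
qed

lemma levy_dominated_convergence:
 fixes f :: "nat \<Rightarrow> real \<Rightarrow> real"
 assumes N: "levy N" and [measurable]: "\<And>n. f n \<in> borel_measurable borel"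
  and b: "\<And>n s. 0 < s \<Longrightarrow> \<bar>f n s\<bar> \<le> min 1 s" and lim: "\<And>s. 0 < s \<Longrightarrow> (\<lambda>n. f n s) \<longlonglongrightarrow> 0"
 shows "(\<lambda>n. \<integral>s. N s * f n s \<partial>lborel) \<longlonglongrightarrow> 0"
proof -
 have [measurable]: "N \<in> borel_measurable borel" by (rule levy_measurable[OF N])
 have "(\<lambda>n. \<integral>s. N s * f n s \<partial>lborel) \<longlonglongrightarrow> (\<integral>s. 0 \<partial>(lborel::real measure))"
 proof (rule integral_dominated_convergence[where w="\<lambda>s. min 1 s * N s"])
  show "AE s in lborel. (\<lambda>n. N s * f n s) \<longlonglongrightarrow> 0"
  proof (rule AE_I2)
   fix s show "(\<lambda>n. N s * f n s) \<longlonglongrightarrow> 0" using tendsto_mult[OF tendsto_const lim, of s "N s"] levy_zero[OF N, of s] by (cases "0 < s") auto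
  qed
  show "AE s in lborel. norm (N s * f n s) \<le> min 1 s * N s" for n
  proof (rule AE_I2)
   fix s show "norm (N s * f n s) \<le> min 1 s * N s"
    using mult_right_mono[OF b levy_nonneg[OF N], of s n] levy_nonneg[OF N, of s] levy_zero[OF N, of s]
    by (cases "0 < s") (auto simp: abs_mult mult.commute)
  qed
 qed (use levy_min_integrable[OF N] in auto)
 then show ?thesis by simp
qed

lemma lexp_tendsto_0:
 assumes "levy N"
 shows "(\<lambda>n. lexp N (1 / real (Suc n))) \<longlonglongrightarrow> 0" unfolding lexp_def
proof (rule levy_dominated_convergence[OF assms])
 fix n and s :: real assume s: "0 < s"
 have "(1 / real (Suc n)) * s \<le> s" using s by (simp add: divide_le_eq)
 then show "\<bar>1 - exp (- (1 / real (Suc n)) * s)\<bar> \<le> min 1 s" using s exp_ge_add_one_self[of "- (1 / real (Suc n)) * s"] by simp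
 have "(\<lambda>n. 1 - exp (- inverse (real (Suc n)) * s)) \<longlonglongrightarrow> 1 - exp (- 0 * s)" by (intro tendsto_intros LIMSEQ_inverse_real_of_nat)
 then show "(\<lambda>n. 1 - exp (- (1 / real (Suc n)) * s)) \<longlonglongrightarrow> 0" by (simp add: divide_inverse)
qed simp

text \<open>Markov's inequality for 1 - exp (-l x), which is at least 1 - 1/e >= 1/2 beyond 1/l. The
  bound is monotone in the Levy density, hence uniform over truncations, and gives
  tightness.\<close>

lemma id_law_tail:
 assumes "levy N" "id_law N \<mu>" "0 < l"
 shows "measure \<mu> {1 / l..} \<le> 2 * lexp N l"
proof -
 have nd: "nonneg_dist \<mu>" using assms by (simp add: id_law_def)
 interpret real_distribution \<mu> using nd by (simp add: nonneg_dist_def)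
 have i: "integrable \<mu> (\<lambda>x. exp (- l * x))"
  using nd assms(3) by (intro integrable_const_bound[where B=1]) (auto simp: nonneg_dist_def elim!: eventually_mono)
 have e1: "1 - exp (- 1) \<ge> (1 / 2 :: real)" using exp_ge_add_one_self[of "1::real"] by (simp add: exp_minus field_simps)
 have "measure \<mu> {1 / l..} = (\<integral>x. indicator {1 / l..} x \<partial>\<mu>)" by simp
 also have "\<dots> \<le> (\<integral>x. 2 * (1 - exp (- l * x)) \<partial>\<mu>)"
 proof (rule integral_mono_AE)
  have "AE x in \<mu>. 0 \<le> x" using nd by (simp add: nonneg_dist_def)
  then show "AE x in \<mu>. indicator {1 / l..} x \<le> 2 * (1 - exp (- l * x))"
  proof eventually_elim
   case (elim x)
   show ?case
   proof (cases "1 / l \<le> x")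
    case True
    then have "1 \<le> l * x" using assms(3) by (simp add: field_simps)
    then have "exp (- l * x) \<le> exp (- 1)" by simp
    then have "1 - exp (- 1) \<le> 1 - exp (- l * x)" by (rule diff_left_mono)
    with e1 have "1 / 2 \<le> 1 - exp (- l * x)" by (rule order_trans)
    then have "1 \<le> 2 * (1 - exp (- l * x))" by (simp add: field_simps)
    then show ?thesis using True by (simp add: indicator_def)
   qed (use elim assms(3) in auto)
  qed
  show "integrable \<mu> (indicator {1 / l..} :: real \<Rightarrow> real)" by (rule integrable_const_bound[where B=1]) (auto simp: indicator_def)
 qed (use i in auto)
 also have "\<dots> = 2 * (1 - exp (- lexp N l))" using i prob_space lap_id_law_real[OF assms(2), of l] assms(3) by simp
 also have "\<dots> \<le> 2 * lexp N l" using exp_ge_add_one_self[of "- lexp N l"] by simp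
 finally show ?thesis .
qed

lemma levyexp_truncate_tendsto:
 assumes "levy N" "0 \<le> Re z"
 shows "(\<lambda>n. levyexp (\<lambda>s. if 1 / real (Suc n) < s then N s else 0) z) \<longlonglongrightarrow> levyexp N z" unfolding levyexp_def
proof (rule integral_dominated_convergence[where w="\<lambda>s. norm (N s *\<^sub>R (1 - exp (- z * of_real s)))"])
 have [measurable]: "N \<in> borel_measurable borel" by (rule levy_measurable[OF assms(1)])
 show "(\<lambda>s. N s *\<^sub>R (1 - exp (- z * of_real s))) \<in> borel_measurable lborel"
  "(\<lambda>s. (if 1 / real (Suc n) < s then N s else 0) *\<^sub>R (1 - exp (- z * of_real s))) \<in> borel_measurable lborel" for n by measurable
 show "integrable lborel (\<lambda>s. norm (N s *\<^sub>R (1 - exp (- z * of_real s))))" by (rule integrable_norm[OF levyexp_integrable[OF assms]])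
 show "AE s in lborel. norm ((if 1 / real (Suc n) < s then N s else 0) *\<^sub>R (1 - exp (- z * of_real s)))
   \<le> norm (N s *\<^sub>R (1 - exp (- z * of_real s)))" for n
  by (rule AE_I2) auto
 show "AE s in lborel. (\<lambda>n. (if 1 / real (Suc n) < s then N s else 0) *\<^sub>R (1 - exp (- z * of_real s)))
   \<longlonglongrightarrow> N s *\<^sub>R (1 - exp (- z * of_real s))"
 proof (rule AE_I2)
  fix s
  show "(\<lambda>n. (if 1 / real (Suc n) < s then N s else 0) *\<^sub>R (1 - exp (- z * of_real s)))
   \<longlonglongrightarrow> N s *\<^sub>R (1 - exp (- z * of_real s))"
  proof (cases "0 < s")
   case True
   have "(\<lambda>n. inverse (real (Suc n))) \<longlonglongrightarrow> 0" by (rule LIMSEQ_inverse_real_of_nat)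
   then have "\<forall>\<^sub>F n in sequentially. inverse (real (Suc n)) < s" using True by (rule order_tendstoD)
   then have "\<forall>\<^sub>F n in sequentially. (if 1 / real (Suc n) < s then N s else 0) *\<^sub>R (1 - exp (- z * of_real s))
     = N s *\<^sub>R (1 - exp (- z * of_real s))"
    by eventually_elim (simp add: divide_inverse)
   then show ?thesis by (rule tendsto_eventually)
  next
   case False
   then have "N s = 0" using levy_zero[OF assms(1)] by simp
   then show ?thesis by (simp cong: if_cong)
  qed
 qed
qed

text \<open>Without its jumps below 1/(n+1) the density is finite and compound Poisson laws do the
  job. These laws are tight, a subsequence converges weakly, and the transforms, which integrate
  bounded continuous functions, converge to the right exponent.\<close>

lemma id_law_exists:
 assumes N: "levy N"
 obtains \<mu> where "id_law N \<mu>"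
proof -
 let ?N = "\<lambda>n s. if 1 / real (Suc n) < s then N s else 0"
 have "\<exists>\<mu>. id_law (?N n) \<mu>" for n
  using compound_poisson_exists[OF levy_truncate_below[OF N, of "1 / real (Suc n)"]] by (metis of_nat_0_less_iff zero_less_Suc zero_less_divide_1_iff)
 then obtain \<mu> where \<mu>: "\<And>n. id_law (?N n) (\<mu> n)" by metis
 have lv: "levy (?N n)" for n using levy_truncate_below(1)[OF N, of "1 / real (Suc n)"] by simp
 have rd: "real_distribution (\<mu> n)" for n using \<mu> by (simp add: id_law_def nonneg_dist_def)
 have pos: "AE x in \<mu> n. 0 \<le> x" for n using \<mu> by (simp add: id_law_def nonneg_dist_def)
 have "tight \<mu>" unfolding tight_def
 proof (intro conjI allI impI rd)
  fix \<epsilon> :: real assume \<epsilon>: "0 < \<epsilon>"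
  have "(\<lambda>k. 2 * lexp N (1 / real (Suc k))) \<longlonglongrightarrow> 2 * 0" by (intro tendsto_intros lexp_tendsto_0[OF N])
  then have "\<forall>\<^sub>F k in sequentially. 2 * lexp N (1 / real (Suc k)) < \<epsilon>" using \<epsilon> by (intro order_tendstoD(2)[of _ 0]) auto
  then obtain k where k: "2 * lexp N (1 / real (Suc k)) < \<epsilon>" by (auto simp: eventually_sequentially)
  show "\<exists>a b. a < b \<and> (\<forall>n. 1 - \<epsilon> < measure (\<mu> n) {a<..b})"
  proof (rule exI[of _ "- 1"], rule exI[of _ "real (Suc k)"], intro conjI allI)
   fix n
   interpret real_distribution "\<mu> n" by (rule rd)
   have "measure (\<mu> n) {1 / (1 / real (Suc k))..} \<le> 2 * lexp (?N n) (1 / real (Suc k))" by (rule id_law_tail[OF lv \<mu>]) simp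
   also have "lexp (?N n) (1 / real (Suc k)) \<le> lexp N (1 / real (Suc k))" unfolding lexp_def
   proof (rule integral_mono)
    fix s show "?N n s * (1 - exp (- (1 / real (Suc k)) * s)) \<le> N s * (1 - exp (- (1 / real (Suc k)) * s))"
     using levy_nonneg[OF N, of s] levy_zero[OF N, of s] by (cases "0 < s") (auto intro!: mult_nonneg_nonneg)
   next
    show "integrable lborel (\<lambda>s. ?N n s * (1 - exp (- (1 / real (Suc k)) * s)))" by (rule lexp_integrable[OF lv]) simp
    show "integrable lborel (\<lambda>s. N s * (1 - exp (- (1 / real (Suc k)) * s)))" by (rule lexp_integrable[OF N]) simp
   qed
   also have "2 * lexp N (1 / real (Suc k)) < \<epsilon>" by (rule k)
   finally have "measure (\<mu> n) {real (Suc k)..} < \<epsilon>" by simp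
   moreover have "measure (\<mu> n) {real (Suc k)<..} \<le> measure (\<mu> n) {real (Suc k)..}" by (rule finite_measure_mono) auto
   moreover have "measure (\<mu> n) {- 1<..real (Suc k)} + measure (\<mu> n) {real (Suc k)<..} = 1"
   proof -
    have "measure (\<mu> n) {- 1<..real (Suc k)} + measure (\<mu> n) {real (Suc k)<..} = measure (\<mu> n) {- 1<..}"
     by (subst finite_measure_Union[symmetric]) (auto intro!: arg_cong[where f="measure (\<mu> n)"])
    also have "\<dots> = 1" by (rule prob_eq_1[THEN iffD2]) (use pos[of n] in \<open>auto elim!: eventually_mono\<close>)
    finally show ?thesis .
   qed
   ultimately show "1 - \<epsilon> < measure (\<mu> n) {- 1<..real (Suc k)}" by linarith
  qed simp
 qed
 from tight_imp_convergent_subsubsequence[OF this strict_mono_id]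
 obtain r M where r: "strict_mono r" and M: "real_distribution M" and w: "weak_conv_m (\<lambda>n. \<mu> (r n)) M" by (auto simp: comp_def)
 interpret M: real_distribution M by fact
 have conv: "(\<lambda>n. \<integral>x. f x \<partial>\<mu> (r n)) \<longlonglongrightarrow> (\<integral>x. f x \<partial>M)"
  if "\<And>x. isCont f x" "\<And>x. norm (f x) \<le> 1" for f :: "real \<Rightarrow> complex" by (rule weak_conv_imp_integral_bdd_continuous_conv[OF rd M w that])
 have convr: "(\<lambda>n. \<integral>x. f x \<partial>\<mu> (r n)) \<longlonglongrightarrow> (\<integral>x. f x \<partial>M)"
  if "\<And>x. isCont f x" "\<And>x. norm (f x) \<le> 1" for f :: "real \<Rightarrow> real" by (rule weak_conv_imp_integral_bdd_continuous_conv[OF rd M w that])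
 have posM: "AE x in M. 0 \<le> x"
 proof -
  \<comment> \<open>A bounded continuous test function that vanishes exactly on the nonnegative
    half-line.\<close>
  let ?f = "\<lambda>x::real. min 1 (max 0 (- x))"
  have "(\<lambda>n. \<integral>x. ?f x \<partial>\<mu> (r n)) \<longlonglongrightarrow> (\<integral>x. ?f x \<partial>M)" by (rule convr) (auto intro!: continuous_intros)
  moreover have "(\<integral>x. ?f x \<partial>\<mu> (r n)) = 0" for n by (rule integral_eq_zero_AE) (use pos[of "r n"] in \<open>auto elim!: eventually_mono\<close>)
  ultimately have z: "(\<integral>x. ?f x \<partial>M) = 0" by (simp add: LIMSEQ_const_iff)
  have i: "integrable M ?f" by (rule M.integrable_const_bound[where B=1]) auto
  have "AE x in M. ?f x = 0" using integral_nonneg_eq_0_iff_AE[OF i] z by simp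
  then show ?thesis by eventually_elim (auto simp: min_def max_def split: if_splits)
 qed
 have nd: "nonneg_dist M" using M posM by (simp add: nonneg_dist_def)
 show ?thesis
 proof
  show "id_law N M" unfolding id_law_def
  proof (intro conjI allI impI nd)
   fix z :: complex assume z: "0 \<le> Re z"
   let ?g = "\<lambda>x. exp (- z * of_real \<bar>x\<bar>)"
   have abs: "lap \<nu> z = (\<integral>x. ?g x \<partial>\<nu>)" if "nonneg_dist \<nu>" for \<nu>
   proof -
    interpret real_distribution \<nu> using that by (simp add: nonneg_dist_def)
    have "AE x in \<nu>. 0 \<le> x" using that by (simp add: nonneg_dist_def)
    then have "AE x in \<nu>. exp (- z * of_real x) = ?g x" by eventually_elim simp
    then show ?thesis unfolding lap_def by (intro integral_cong_AE) auto
   qed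
   have "(\<lambda>n. \<integral>x. ?g x \<partial>\<mu> (r n)) \<longlonglongrightarrow> (\<integral>x. ?g x \<partial>M)" by (rule conv) (use z in \<open>auto intro!: continuous_intros\<close>)
   then have "(\<lambda>n. lap (\<mu> (r n)) z) \<longlonglongrightarrow> lap M z" using abs[OF nd] abs[of "\<mu> (r n)" for n] \<mu> by (simp add: id_law_def)
   moreover have "(\<lambda>n. lap (\<mu> (r n)) z) \<longlonglongrightarrow> exp (- levyexp N z)"
   proof -
    have "(\<lambda>n. exp (- levyexp (?N n) z)) \<longlonglongrightarrow> exp (- levyexp N z)" by (intro tendsto_intros levyexp_truncate_tendsto[OF N z])
    from LIMSEQ_subseq_LIMSEQ[OF this r] show ?thesis
     using \<mu> z by (simp add: comp_def id_law_def)
   qed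
   ultimately show "lap M z = exp (- levyexp N z)" by (rule LIMSEQ_unique)
  qed
 qed
qed

text \<open>By uniqueness \<open>\<mu>\<close> is the convolution of \<open>\<mu>'\<close> with a
  compound Poisson law with jump density \<open>q\<close>. The compound Poisson estimates are
  applied to the average of the shifts of \<open>g\<close> under \<open>\<mu>'\<close>; in the upper
  bound the full law \<open>\<mu>\<close> remains after one jump has been split off.\<close>

lemma id_law_split:
 assumes N: "levy N" and [measurable]: "q \<in> borel_measurable borel" and q0: "\<And>s. 0 \<le> q s" and qN: "\<And>s. q s \<le> N s"
  and qi: "integrable lborel q"
  and \<mu>: "id_law N \<mu>" and \<mu>': "id_law (\<lambda>s. N s - q s) \<mu>'" and [measurable]: "g \<in> borel_measurable borel"
 defines "m \<equiv> integral\<^sup>L lborel q"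
 shows "ennreal (exp (- m)) * (\<integral>\<^sup>+x. g x \<partial>\<mu>') \<le> (\<integral>\<^sup>+x. g x \<partial>\<mu>)"
  and "ennreal (exp (- m)) * (\<integral>\<^sup>+s. ennreal (q s) * (\<integral>\<^sup>+x. g (s + x) \<partial>\<mu>') \<partial>lborel) \<le> (\<integral>\<^sup>+x. g x \<partial>\<mu>)"
  and "(\<integral>\<^sup>+x. g x \<partial>\<mu>) \<le> (\<integral>\<^sup>+x. g x \<partial>\<mu>') + (\<integral>\<^sup>+s. ennreal (q s) * (\<integral>\<^sup>+x. g (s + x) \<partial>\<mu>) \<partial>lborel)"
proof -
 have lq: "levy q" by (rule levy_le[OF N]) (use q0 qN in auto)
 have lNq: "levy (\<lambda>s. N s - q s)" by (rule levy_diff[OF N]) (use q0 qN in auto)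
 obtain \<kappa> where \<kappa>: "id_law q \<kappa>"
  and k1: "\<And>g. g \<in> borel_measurable borel \<Longrightarrow> ennreal (exp (- m)) * g 0 \<le> (\<integral>\<^sup>+x. g x \<partial>\<kappa>)"
  and k2: "\<And>g. g \<in> borel_measurable borel \<Longrightarrow> ennreal (exp (- m)) * (\<integral>\<^sup>+s. ennreal (q s) * g s \<partial>lborel) \<le> (\<integral>\<^sup>+x. g x \<partial>\<kappa>)"
  and k3: "\<And>g. g \<in> borel_measurable borel \<Longrightarrow>
    (\<integral>\<^sup>+x. g x \<partial>\<kappa>) \<le> g 0 + (\<integral>\<^sup>+s. ennreal (q s) * (\<integral>\<^sup>+x. g (s + x) \<partial>\<kappa>) \<partial>lborel)"
  by (rule compound_poisson_exists[OF lq qi, folded m_def], rule that)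
 have nk: "nonneg_dist \<kappa>" and nm: "nonneg_dist \<mu>'" using \<kappa> \<mu>' by (auto simp: id_law_def)
 interpret K: real_distribution \<kappa> using nk by (simp add: nonneg_dist_def)
 interpret M: real_distribution \<mu>' using nm by (simp add: nonneg_dist_def)
 have "id_law (\<lambda>s. q s + (N s - q s)) (\<kappa> \<star> \<mu>')" by (rule id_law_conv[OF lq lNq \<kappa> \<mu>'])
 then have eq: "\<mu> = (\<kappa> \<star> \<mu>')" using id_law_unique[OF \<mu>] by simp
 have int: "(\<integral>\<^sup>+x. h x \<partial>\<mu>) = (\<integral>\<^sup>+w. (\<integral>\<^sup>+y. h (w + y) \<partial>\<mu>') \<partial>\<kappa>)" if "h \<in> borel_measurable borel" for h
  unfolding eq by (rule nn_integral_conv_nonneg_dist[OF nk nm that])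
 let ?G = "\<lambda>w. \<integral>\<^sup>+y. g (w + y) \<partial>\<mu>'"
 have G: "?G \<in> borel_measurable borel" by measurable
 show "ennreal (exp (- m)) * (\<integral>\<^sup>+x. g x \<partial>\<mu>') \<le> (\<integral>\<^sup>+x. g x \<partial>\<mu>)" using k1[OF G] by (simp add: int)
 show "ennreal (exp (- m)) * (\<integral>\<^sup>+s. ennreal (q s) * (\<integral>\<^sup>+x. g (s + x) \<partial>\<mu>') \<partial>lborel) \<le> (\<integral>\<^sup>+x. g x \<partial>\<mu>)" using k2[OF G] by (simp add: int)
 have "(\<integral>\<^sup>+x. g (s + x) \<partial>\<mu>) = (\<integral>\<^sup>+x. ?G (s + x) \<partial>\<kappa>)" for s by (subst int) (auto simp: add.assoc)
 then show "(\<integral>\<^sup>+x. g x \<partial>\<mu>) \<le> (\<integral>\<^sup>+x. g x \<partial>\<mu>') + (\<integral>\<^sup>+s. ennreal (q s) * (\<integral>\<^sup>+x. g (s + x) \<partial>\<mu>) \<partial>lborel)" using k3[OF G] by (simp add: int)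
qed

text \<open>Exponential Markov inequality, with the exponential moment computed by tilting backwards from the
  law with Levy density \<open>exp (l * s) * N s\<close>.\<close>

lemma id_law_chernoff:
 assumes N: "levy N" and r: "\<And>s. r < s \<Longrightarrow> N s = 0" and l: "0 \<le> l" and \<mu>: "id_law N \<mu>"
 shows "emeasure \<mu> {z..} \<le> ennreal (exp (- l * z + (\<integral>s. N s * (exp (l * s) - 1) \<partial>lborel)))"
proof -
 have [measurable]: "N \<in> borel_measurable borel" by (rule levy_measurable[OF N])
 let ?N' = "\<lambda>s. exp (l * s) * N s"
 \<comment> \<open>Jumps do not exceed r, so the backward tilt is dominated by exp (l r) N.\<close>
 have N': "levy ?N'"
 proof (rule levy_le[OF levy_scale[OF N, of "exp (l * r)"]])
  fix s show "exp (l * s) * N s \<le> exp (l * r) * N s"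
   using r[of s] l levy_nonneg[OF N, of s] by (cases "s \<le> r") (auto intro!: mult_right_mono mult_left_mono)
 qed (use levy_nonneg[OF N] in auto)
 obtain \<mu>' where \<mu>': "id_law ?N' \<mu>'" using id_law_exists[OF N'] by auto
 interpret M: real_distribution \<mu>' using \<mu>' by (simp add: id_law_def nonneg_dist_def)
 have "id_law N (density \<mu>' (\<lambda>x. ennreal (exp (- l * x) * exp (Re (levyexp ?N' (of_real l))))))"
 proof -
  have "(\<lambda>s. exp (- l * s) * ?N' s) = N"
  proof
   fix s show "exp (- l * s) * ?N' s = N s" by (simp add: exp_minus)
  qed
  then show ?thesis using id_law_tilt(1)[OF N' \<mu>' l] by (simp only:)
 qed
 then have eq: "\<mu> = density \<mu>' (\<lambda>x. ennreal (exp (- l * x) * exp (Re (levyexp ?N' (of_real l)))))" using id_law_unique[OF \<mu>] by simp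
 have E: "Re (levyexp ?N' (of_real l)) = (\<integral>s. N s * (exp (l * s) - 1) \<partial>lborel)" (is "_ = ?E")
  unfolding levyexp_of_real Re_complex_of_real lexp_def
  by (intro Bochner_Integration.integral_cong refl) (simp add: algebra_simps flip: exp_add)
 have "emeasure \<mu> {z..} = (\<integral>\<^sup>+x. ennreal (exp (- l * x) * exp ?E) * indicator {z..} x \<partial>\<mu>')" unfolding eq E by (rule emeasure_density) auto
 also have "\<dots> \<le> (\<integral>\<^sup>+x. ennreal (exp (- l * z + ?E)) \<partial>\<mu>')"
 proof (rule nn_integral_mono)
  fix x
  show "ennreal (exp (- l * x) * exp ?E) * indicator {z..} x \<le> ennreal (exp (- l * z + ?E))"
   using l by (auto simp: exp_add[symmetric] ennreal_leI mult_left_mono split: split_indicator)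
 qed
 also have "\<dots> = ennreal (exp (- l * z + ?E))" using M.emeasure_space_1 by simp
 finally show ?thesis .
qed

section \<open>Local estimates from characteristic functions\<close>

text \<open>The kernel of Levy's inversion formula is bounded by b - a, so an integrable
  \<open>h\<close> gives a bound that does not depend on the cut-off of the inversion
  integral.\<close>

lemma inversion_kernel_integrable:
 fixes h :: "real \<Rightarrow> complex"
 assumes "a \<le> b" and h: "integrable lborel h"
 shows "integrable lborel (\<lambda>t. (iexp (- (t * a)) - iexp (- (t * b))) / (\<i> * of_real t) * h t)" (is "integrable _ ?g")
  and "norm (CLBINT t=c..d. (iexp (- (t * a)) - iexp (- (t * b))) / (\<i> * of_real t) * h t) \<le> (b - a) * (\<integral>t. norm (h t) \<partial>lborel)"
proof -
 have bd: "norm (?g t) \<le> (b - a) * norm (h t)" for t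
 proof (cases "t = 0")
  case False
  have "cmod ((iexp (t * (- a)) - iexp (t * (- b))) / (\<i> * t)) \<le> - a - (- b)" by (rule Levy_Inversion_aux2) (use assms False in auto)
  then have "cmod ((iexp (- (t * a)) - iexp (- (t * b))) / (\<i> * t)) \<le> b - a" by simp
  then show ?thesis unfolding norm_mult by (intro mult_right_mono) auto
 qed (use assms in auto)
 have [measurable]: "h \<in> borel_measurable borel" using borel_measurable_integrable[OF h] by simp
 have hn: "integrable lborel (\<lambda>t. (b - a) * norm (h t))" using h by simp
 show i: "integrable lborel ?g"
 proof (rule Bochner_Integration.integrable_bound[OF hn])
  show "AE t in lborel. norm (?g t) \<le> norm ((b - a) * norm (h t))" using bd by (intro AE_I2) (metis abs_ge_self order_trans real_norm_def)
 qed measurable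
 have S: "norm (CLINT t:A|lborel. ?g t) \<le> (b - a) * (\<integral>t. norm (h t) \<partial>lborel)" if [measurable]: "A \<in> sets borel" for A
 proof -
  have "norm (CLINT t:A|lborel. ?g t) \<le> (\<integral>t. norm (indicator A t *\<^sub>R ?g t) \<partial>lborel)"
   unfolding set_lebesgue_integral_def by (rule integral_norm_bound)
  also have "\<dots> \<le> (\<integral>t. (b - a) * norm (h t) \<partial>lborel)"
  proof (rule integral_mono[OF _ hn])
   have "A \<in> sets lborel" using that by simp
   from integrable_mult_indicator[OF this i]
   show "integrable lborel (\<lambda>t. norm (indicator A t *\<^sub>R ?g t))" by (rule integrable_norm)
   show "norm (indicator A t *\<^sub>R ?g t) \<le> (b - a) * norm (h t)" for t using bd[of t] assms(1) by (auto simp: indicator_def)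
  qed
  also have "\<dots> = (b - a) * (\<integral>t. norm (h t) \<partial>lborel)" by (rule integral_mult_right_zero)
  finally show ?thesis .
 qed
 show "norm (CLBINT t=c..d. ?g t) \<le> (b - a) * (\<integral>t. norm (h t) \<partial>lborel)" using S[of "einterval c d"] S[of "einterval d c"]
  by (auto simp: interval_lebesgue_integral_def)
qed

lemma measure_interval_le_char:
 assumes "real_distribution \<mu>" "integrable lborel (char \<mu>)" "a \<le> b" "measure \<mu> {a} = 0" "measure \<mu> {b} = 0"
 shows "measure \<mu> {a<..b} \<le> (b - a) / (2 * pi) * (\<integral>t. norm (char \<mu> t) \<partial>lborel)"
proof -
 interpret real_distribution \<mu> by fact
 have "norm (complex_of_real (measure \<mu> {a<..b})) \<le> (b - a) / (2 * pi) * (\<integral>t. norm (char \<mu> t) \<partial>lborel)"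
 proof (rule LIMSEQ_le_const2[OF tendsto_norm[OF Levy_Inversion[OF assms(3-5)]]], rule exI[of _ 0], intro allI impI)
  fix T :: nat
  show "norm (complex_of_real (1 / (2 * pi)) * (CLBINT t=ereal (real_of_int (- int T))..ereal (real T). (iexp (-(t * a)) - iexp (-(t * b))) / (\<i> * complex_of_real t) * char \<mu> t))
    \<le> (b - a) / (2 * pi) * (\<integral>t. norm (char \<mu> t) \<partial>lborel)"
   using inversion_kernel_integrable(2)[OF assms(3,2)] by (simp add: norm_mult norm_divide field_simps)
 qed
 then show ?thesis by simp
qed

lemma measure_interval_diff_char:
 assumes "real_distribution \<mu>" "integrable lborel (char \<mu>)" "real_distribution \<nu>" "integrable lborel (char \<nu>)"
  and "a \<le> b" "measure \<mu> {a} = 0" "measure \<mu> {b} = 0" "measure \<nu> {a} = 0" "measure \<nu> {b} = 0"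
 shows "\<bar>measure \<mu> {a<..b} - measure \<nu> {a<..b}\<bar> \<le> (b - a) / (2 * pi) * (\<integral>t. norm (char \<mu> t - char \<nu> t) \<partial>lborel)"
proof -
 interpret M: real_distribution \<mu> by fact
 interpret N: real_distribution \<nu> by fact
 have d: "integrable lborel (\<lambda>t. char \<mu> t - char \<nu> t)" using assms by simp
 have "norm (complex_of_real (measure \<mu> {a<..b}) - complex_of_real (measure \<nu> {a<..b}))
   \<le> (b - a) / (2 * pi) * (\<integral>t. norm (char \<mu> t - char \<nu> t) \<partial>lborel)"
 proof (rule LIMSEQ_le_const2[OF tendsto_norm[OF tendsto_diff[OF M.Levy_Inversion[OF assms(5-7)] N.Levy_Inversion[OF assms(5,8,9)]]]],
   rule exI[of _ 0], intro allI impI)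
  fix T :: nat
  let ?F = "\<lambda>t. (iexp (-(t * a)) - iexp (-(t * b))) / (\<i> * of_real t)"
  let ?I = "\<lambda>h. CLBINT t=ereal (real_of_int (- int T))..ereal (real T). ?F t * h t"
  have ii: "interval_lebesgue_integrable lborel c d (\<lambda>t. ?F t * h t)" if "integrable lborel h" for c d h
   using inversion_kernel_integrable(1)[OF assms(5) that]
   by (auto simp: interval_lebesgue_integrable_def set_integrable_def intro!: integrable_mult_indicator)
  have "?I (char \<mu>) - ?I (char \<nu>) = ?I (\<lambda>t. char \<mu> t - char \<nu> t)"
   unfolding right_diff_distrib by (rule interval_lebesgue_integral_diff(2)[symmetric]) (intro ii assms)+
  then have "norm (complex_of_real (1 / (2 * pi)) * ?I (char \<mu>) - complex_of_real (1 / (2 * pi)) * ?I (char \<nu>))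
   = 1 / (2 * pi) * norm (?I (\<lambda>t. char \<mu> t - char \<nu> t))"
   by (simp only: norm_mult norm_of_real right_diff_distrib[symmetric]) simp
  also have "\<dots> \<le> 1 / (2 * pi) * ((b - a) * (\<integral>t. norm (char \<mu> t - char \<nu> t) \<partial>lborel))"
   by (intro mult_left_mono inversion_kernel_integrable(2)[OF assms(5) d]) auto
  finally show "norm (complex_of_real (1 / (2 * pi)) * ?I (char \<mu>) - complex_of_real (1 / (2 * pi)) * ?I (char \<nu>))
    \<le> (b - a) / (2 * pi) * (\<integral>t. norm (char \<mu> t - char \<nu> t) \<partial>lborel)" by simp
 qed
 then show ?thesis by (simp flip: of_real_diff)
qed

lemma integrable_inverse_1_square: "integrable lborel (\<lambda>x::real. 1 / (1 + x\<^sup>2))"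
 using integrable_inverse_1_plus_square by (simp add: set_integrable_def divide_inverse)

lemma integral_inverse_1_square: "(\<integral>x. 1 / (1 + x\<^sup>2) \<partial>lborel) = pi"
 using LBINT_inverse_1_plus_square
 by (simp add: interval_lebesgue_integral_def set_lebesgue_integral_def divide_inverse)

lemma cauchy_integral_scaled:
 assumes "0 < v"
 shows "integrable lborel (\<lambda>x. C / (1 + v\<^sup>2 * x\<^sup>2))" "(\<integral>x. C / (1 + v\<^sup>2 * x\<^sup>2) \<partial>lborel) = C * pi / v"
proof -
 have i0: "integrable lborel (\<lambda>x::real. C * (1 / (1 + x\<^sup>2)))" by (intro integrable_mult_right integrable_inverse_1_square)
 have "integrable lborel (\<lambda>x. (\<lambda>x. C * (1 / (1 + x\<^sup>2))) (0 + v * x))" by (rule lborel_integrable_real_affine[OF i0]) (use assms in auto)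
 then show "integrable lborel (\<lambda>x. C / (1 + v\<^sup>2 * x\<^sup>2))" by (simp add: power_mult_distrib)
 have "(\<integral>x. C * (1 / (1 + x\<^sup>2)) \<partial>lborel) = \<bar>v\<bar> *\<^sub>R (\<integral>x. C * (1 / (1 + (0 + v * x)\<^sup>2)) \<partial>lborel)"
  by (rule lborel_integral_real_affine) (use assms in simp)
 then have "C * pi = v * (\<integral>x. C / (1 + v\<^sup>2 * x\<^sup>2) \<partial>lborel)"
 proof -
  have l: "(\<integral>x. C * (1 / (1 + x\<^sup>2)) \<partial>lborel) = C * pi" by (simp only: integral_mult_right_zero integral_inverse_1_square)
  assume "(\<integral>x. C * (1 / (1 + x\<^sup>2)) \<partial>lborel) = \<bar>v\<bar> *\<^sub>R (\<integral>x. C * (1 / (1 + (0 + v * x)\<^sup>2)) \<partial>lborel)"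
  then show ?thesis unfolding l using assms by (simp add: power_mult_distrib)
 qed
 then show "(\<integral>x. C / (1 + v\<^sup>2 * x\<^sup>2) \<partial>lborel) = C * pi / v" using assms by (simp add: field_simps)
qed

text \<open>The Cauchy profile of width 1/v integrates to C pi / v; divided by 2 pi this is a bound
  C / (2 v) for the mass per unit length.\<close>

lemma char_bound_upper:
 assumes "real_distribution \<mu>" and na: "\<And>x. measure \<mu> {x} = 0" and v: "0 < v"
  and b: "\<And>\<xi>. norm (char \<mu> \<xi>) \<le> C / (1 + v\<^sup>2 * \<xi>\<^sup>2)" and ab: "a \<le> b"
 shows "measure \<mu> {a<..b} \<le> C / (2 * v) * (b - a)" "integrable lborel (char \<mu>)"
proof -
 interpret real_distribution \<mu> by fact
 show i: "integrable lborel (char \<mu>)"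
 proof (rule Bochner_Integration.integrable_bound[OF cauchy_integral_scaled(1)[OF v, of C]])
  show "AE x in lborel. norm (char \<mu> x) \<le> norm (C / (1 + v\<^sup>2 * x\<^sup>2))"
   using b by (intro AE_I2) (metis abs_ge_self order_trans real_norm_def)
 qed simp
 have "(\<integral>t. norm (char \<mu> t) \<partial>lborel) \<le> (\<integral>x. C / (1 + v\<^sup>2 * x\<^sup>2) \<partial>lborel)"
  using i by (intro integral_mono cauchy_integral_scaled(1)[OF v] b) auto
 also have "\<dots> = C * pi / v" by (rule cauchy_integral_scaled(2)[OF v])
 finally have *: "(\<integral>t. norm (char \<mu> t) \<partial>lborel) \<le> C * pi / v" .
 have "measure \<mu> {a<..b} \<le> (b - a) / (2 * pi) * (\<integral>t. norm (char \<mu> t) \<partial>lborel)" by (rule measure_interval_le_char) (use assms i in auto)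
 also have "\<dots> \<le> (b - a) / (2 * pi) * (C * pi / v)" using ab * by (intro mult_left_mono) auto
 also have "\<dots> = C / (2 * v) * (b - a)" by simp
 finally show "measure \<mu> {a<..b} \<le> C / (2 * v) * (b - a)" .
qed

lemma char_id_law:
 assumes "levy N" "id_law N \<mu>"
 shows "char \<mu> \<xi> = exp (- levyexp N (- \<i> * of_real \<xi>))"
proof -
 have "char \<mu> \<xi> = lap \<mu> (- \<i> * of_real \<xi>)" unfolding char_def lap_def by (simp add: mult.assoc)
 then show ?thesis using assms by (simp add: id_law_def)
qed

lemma Re_levyexp_imaginary:
 assumes "levy N"
 shows "Re (levyexp N (- \<i> * of_real \<xi>)) = (\<integral>s. N s * (1 - cos (\<xi> * s)) \<partial>lborel)"
  and "integrable lborel (\<lambda>s. N s * (1 - cos (\<xi> * s)))"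
proof -
 have i: "integrable lborel (\<lambda>s. N s *\<^sub>R (1 - exp (- (- \<i> * of_real \<xi>) * of_real s)))" by (rule levyexp_integrable[OF assms]) simp
 have e: "Re (N s *\<^sub>R (1 - exp (- (- \<i> * of_real \<xi>) * of_real s))) = N s * (1 - cos (\<xi> * s))" for s by (simp add: Re_exp)
 show "Re (levyexp N (- \<i> * of_real \<xi>)) = (\<integral>s. N s * (1 - cos (\<xi> * s)) \<partial>lborel)"
  unfolding levyexp_def using integral_Re[OF i] unfolding e by simp
 show "integrable lborel (\<lambda>s. N s * (1 - cos (\<xi> * s)))" using integrable_Re[OF i] unfolding e .
qed

lemma norm_char_id_law:
 assumes "levy N" "id_law N \<mu>"
 shows "norm (char \<mu> \<xi>) = exp (- (\<integral>s. N s * (1 - cos (\<xi> * s)) \<partial>lborel))"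
 unfolding char_id_law[OF assms] norm_exp_eq_Re using Re_levyexp_imaginary(1)[OF assms(1)] by simp

text \<open>The exponents are compared, not the transforms: they differ by the third order Taylor
  remainder of exp (i xi s) integrated against N, and exp is 1-Lipschitz on the left half-plane. No
  smallness of xi is needed.\<close>

lemma char_id_law_gauss:
 assumes N: "levy N" and \<mu>: "id_law N \<mu>"
  and i1: "integrable lborel (\<lambda>s. N s * s)" and i2: "integrable lborel (\<lambda>s. N s * s\<^sup>2)" and i3: "integrable lborel (\<lambda>s. N s * s ^ 3)"
 shows "norm (char \<mu> \<xi> * iexp (- (\<xi> * (\<integral>s. N s * s \<partial>lborel))) - of_real (exp (- ((\<integral>s. N s * s\<^sup>2 \<partial>lborel) * \<xi>\<^sup>2 / 2))))
  \<le> \<bar>\<xi>\<bar> ^ 3 / 6 * (\<integral>s. N s * s ^ 3 \<partial>lborel)"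
proof -
 let ?m = "\<integral>s. N s * s \<partial>lborel" and ?V = "\<integral>s. N s * s\<^sup>2 \<partial>lborel"
 let ?z = "- \<i> * of_real \<xi> :: complex"
 have iz: "integrable lborel (\<lambda>s. N s *\<^sub>R (1 - exp (- ?z * of_real s)))" by (rule levyexp_integrable[OF N]) simp
 have i1': "integrable lborel (\<lambda>s. (\<i> * of_real \<xi>) * complex_of_real (N s * s))" by (intro integrable_mult_right integrable_of_real i1)
 have i2': "integrable lborel (\<lambda>s. complex_of_real (\<xi>\<^sup>2 / 2) * complex_of_real (N s * s\<^sup>2))"
  by (intro integrable_mult_right integrable_of_real i2)
 have e1: "- levyexp N ?z - \<i> * of_real (\<xi> * ?m) + of_real (?V * \<xi>\<^sup>2 / 2)
   = (\<integral>s. - (N s *\<^sub>R (1 - exp (- ?z * of_real s))) - (\<i> * of_real \<xi>) * complex_of_real (N s * s)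
     + complex_of_real (\<xi>\<^sup>2 / 2) * complex_of_real (N s * s\<^sup>2) \<partial>lborel)"
 proof -
  have a: "(\<integral>s. (\<i> * of_real \<xi>) * complex_of_real (N s * s) \<partial>lborel) = \<i> * of_real (\<xi> * ?m)"
   by (simp only: integral_mult_right_zero integral_complex_of_real) simp
  have b: "(\<integral>s. complex_of_real (\<xi>\<^sup>2 / 2) * complex_of_real (N s * s\<^sup>2) \<partial>lborel) = of_real (?V * \<xi>\<^sup>2 / 2)"
   by (simp only: integral_mult_right_zero integral_complex_of_real) simp
  show ?thesis unfolding a[symmetric] b[symmetric] levyexp_def
   using iz i1' i2' by (simp only: Bochner_Integration.integral_add Bochner_Integration.integral_diff
    Bochner_Integration.integral_minus Bochner_Integration.integrable_diff integrable_minus)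
 qed
 have e2: "norm (- (N s *\<^sub>R (1 - exp (- ?z * of_real s))) - (\<i> * of_real \<xi>) * complex_of_real (N s * s)
     + complex_of_real (\<xi>\<^sup>2 / 2) * complex_of_real (N s * s\<^sup>2)) \<le> \<bar>\<xi>\<bar> ^ 3 / 6 * (N s * s ^ 3)" for s
 proof (cases "0 < s")
  case True
  have "- (N s *\<^sub>R (1 - exp (- ?z * of_real s))) - (\<i> * of_real \<xi>) * complex_of_real (N s * s)
     + complex_of_real (\<xi>\<^sup>2 / 2) * complex_of_real (N s * s\<^sup>2)
    = of_real (N s) * (iexp (\<xi> * s) - (\<Sum>k\<le>2. (\<i> * of_real (\<xi> * s)) ^ k / fact k))"
  proof -
   have S: "(\<Sum>k\<le>2. (\<i> * complex_of_real u) ^ k / fact k) = 1 + \<i> * of_real u - of_real u * of_real u / 2" for u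
    by (simp add: numeral_2_eq_2 algebra_simps)
   have E: "exp (- ?z * of_real s) = iexp (\<xi> * s)" by (simp add: mult.assoc)
   show ?thesis unfolding S E by (simp add: scaleR_conv_of_real power2_eq_square algebra_simps del: exp_of_real)
  qed
  then have "norm (- (N s *\<^sub>R (1 - exp (- ?z * of_real s))) - (\<i> * of_real \<xi>) * complex_of_real (N s * s)
     + complex_of_real (\<xi>\<^sup>2 / 2) * complex_of_real (N s * s\<^sup>2))
    = N s * norm (iexp (\<xi> * s) - (\<Sum>k\<le>2. (\<i> * of_real (\<xi> * s)) ^ k / fact k))"
   using levy_nonneg[OF N, of s] by (simp add: norm_mult)
  also have "\<dots> \<le> N s * (\<bar>\<xi> * s\<bar> ^ Suc 2 / fact (Suc 2))" by (intro mult_left_mono iexp_approx1 levy_nonneg[OF N])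
  also have "\<dots> = \<bar>\<xi>\<bar> ^ 3 / 6 * (N s * s ^ 3)" using True by (simp add: abs_mult power_mult_distrib fact_numeral numeral_3_eq_3)
  finally show ?thesis .
 qed (use levy_zero[OF N] in simp)
 have "norm (- levyexp N ?z - \<i> * of_real (\<xi> * ?m) + of_real (?V * \<xi>\<^sup>2 / 2))
   \<le> (\<integral>s. \<bar>\<xi>\<bar> ^ 3 / 6 * (N s * s ^ 3) \<partial>lborel)"
  unfolding e1 by (rule order_trans[OF integral_norm_bound], rule integral_mono)
   (use e2 iz i1' i2' i3 in \<open>auto intro!: integrable_norm Bochner_Integration.integrable_add Bochner_Integration.integrable_diff\<close>)
 also have "\<dots> = \<bar>\<xi>\<bar> ^ 3 / 6 * (\<integral>s. N s * s ^ 3 \<partial>lborel)" by (rule integral_mult_right_zero)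
 finally have *: "norm ((- levyexp N ?z - \<i> * of_real (\<xi> * ?m)) - (- of_real (?V * \<xi>\<^sup>2 / 2))) \<le> \<bar>\<xi>\<bar> ^ 3 / 6 * (\<integral>s. N s * s ^ 3 \<partial>lborel)"
  by simp
 have V0: "0 \<le> ?V" by (rule integral_nonneg_AE) (use levy_nonneg[OF N] in simp)
 have R0: "0 \<le> Re (levyexp N ?z)" unfolding Re_levyexp_imaginary(1)[OF N] by (rule integral_nonneg_AE) (use levy_nonneg[OF N] in simp)
 have "norm (exp (- levyexp N ?z - \<i> * of_real (\<xi> * ?m)) - exp (- of_real (?V * \<xi>\<^sup>2 / 2))) \<le> \<bar>\<xi>\<bar> ^ 3 / 6 * (\<integral>s. N s * s ^ 3 \<partial>lborel)"
  by (rule order_trans[OF norm_exp_diff_le *]) (use V0 R0 in auto)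
 moreover have "exp (- levyexp N ?z - \<i> * of_real (\<xi> * ?m)) = char \<mu> \<xi> * iexp (- (\<xi> * ?m))"
  unfolding char_id_law[OF N \<mu>] by (simp flip: exp_add)
 moreover have "exp (- complex_of_real (?V * \<xi>\<^sup>2 / 2)) = of_real (exp (- (?V * \<xi>\<^sup>2 / 2)))" by (simp flip: exp_of_real)
 ultimately show ?thesis by simp
qed

lemma std_normal_interval_ge:
 assumes "- c \<le> a" "a \<le> b" "b \<le> c"
 shows "exp (- c\<^sup>2 / 2) / sqrt (2 * pi) * (b - a) \<le> measure std_normal_distribution {a<..b}"
proof -
 interpret real_distribution std_normal_distribution by (rule real_dist_normal_dist)
 have "ennreal (exp (- c\<^sup>2 / 2) / sqrt (2 * pi) * (b - a)) = (\<integral>\<^sup>+x. ennreal (exp (- c\<^sup>2 / 2) / sqrt (2 * pi)) * indicator {a<..b} x \<partial>lborel)"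
  using assms by (simp add: nn_integral_cmult_indicator ennreal_mult[symmetric])
 also have "\<dots> \<le> (\<integral>\<^sup>+x. ennreal (std_normal_density x) * indicator {a<..b} x \<partial>lborel)"
 proof (rule nn_integral_mono)
  fix x
  show "ennreal (exp (- c\<^sup>2 / 2) / sqrt (2 * pi)) * indicator {a<..b} x \<le> ennreal (std_normal_density x) * indicator {a<..b} x"
  proof (cases "x \<in> {a<..b}")
   case True
   then have "\<bar>x\<bar> \<le> \<bar>c\<bar>" using assms by auto
   then have "x\<^sup>2 \<le> c\<^sup>2" by (simp add: abs_le_square_iff)
   then have "exp (- c\<^sup>2 / 2) / sqrt (2 * pi) \<le> std_normal_density x" unfolding std_normal_density_def by (simp add: divide_right_mono)
   then show ?thesis using True by (simp add: ennreal_leI)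
  qed simp
 qed
 also have "\<dots> = emeasure std_normal_distribution {a<..b}" by (subst emeasure_density) auto
 finally show ?thesis using assms by (simp add: emeasure_eq_measure)
qed

text \<open>Dominated convergence along L = 1/(n+1), and monotonicity in L for the values in
  between. \<open>L\<close> will be the normalised third moment, the second entry of the minimum the
  decay of the characteristic functions.\<close>

lemma small_min_integral:
 fixes \<epsilon> B :: real
 assumes "0 < \<epsilon>" "0 \<le> B"
 shows "\<exists>L0>0. \<forall>L. 0 \<le> L \<longrightarrow> L \<le> L0 \<longrightarrow> (\<integral>x. min (L * \<bar>x\<bar> ^ 3) (B / (1 + x\<^sup>2)) \<partial>lborel) \<le> \<epsilon>"
proof -
 have iB: "integrable lborel (\<lambda>x::real. B / (1 + x\<^sup>2))" using cauchy_integral_scaled(1)[of 1 B] by simp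
 let ?f = "\<lambda>L (x::real). min (L * \<bar>x\<bar> ^ 3) (B / (1 + x\<^sup>2)) :: real"
 have "(\<lambda>n. \<integral>x. ?f (inverse (real (Suc n))) x \<partial>lborel) \<longlonglongrightarrow> (\<integral>x. 0 \<partial>(lborel :: real measure))"
 proof (rule integral_dominated_convergence[OF _ _ iB])
  show "AE x in lborel. (\<lambda>n. ?f (inverse (real (Suc n))) x) \<longlonglongrightarrow> 0"
  proof (rule AE_I2)
   fix x :: real
   have "(\<lambda>n. ?f (inverse (real (Suc n))) x) \<longlonglongrightarrow> ?f 0 x" by (intro tendsto_intros LIMSEQ_inverse_real_of_nat)
   then show "(\<lambda>n. ?f (inverse (real (Suc n))) x) \<longlonglongrightarrow> 0" using assms by (simp add: min_def)
  qed
  show "AE x in lborel. norm (?f (inverse (real (Suc n))) x) \<le> B / (1 + x\<^sup>2)" for n using assms by (intro AE_I2) auto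
 qed auto
 then have "(\<lambda>n. \<integral>x. ?f (inverse (real (Suc n))) x \<partial>lborel) \<longlonglongrightarrow> 0" by simp
 from order_tendstoD(2)[OF this assms(1)] obtain n where n: "(\<integral>x. ?f (inverse (real (Suc n))) x \<partial>lborel) < \<epsilon>"
  by (auto simp: eventually_sequentially)
 have iL: "integrable lborel (?f L)" if "0 \<le> L" for L using that assms by (intro Bochner_Integration.integrable_bound[OF iB]) auto
 show ?thesis
 proof (intro exI[of _ "inverse (real (Suc n))"] conjI allI impI)
  fix L :: real assume L: "0 \<le> L" "L \<le> inverse (real (Suc n))"
  have "(\<integral>x. ?f L x \<partial>lborel) \<le> (\<integral>x. ?f (inverse (real (Suc n))) x \<partial>lborel)" by (intro integral_mono iL min.mono mult_right_mono L) auto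
  with n show "(\<integral>x. ?f L x \<partial>lborel) \<le> \<epsilon>" by simp
 qed simp
qed

text \<open>After centring and scaling by v, inversion bounds the difference to the normal mass of
  an interval by k times its length, while the normal mass itself is at least 2 k times the length.
  The numbers \<open>L0\<close> and \<open>k\<close> depend on \<open>C\<close> and
  \<open>c0\<close> alone, so the lemma applies uniformly in all tilts.\<close>

lemma local_clt:
 fixes C c0 :: real
 assumes "0 \<le> C"
 obtains L0 k :: real where "0 < L0" "0 < k"
  "\<And>N \<mu> v a b. levy N \<Longrightarrow> id_law N \<mu> \<Longrightarrow> (\<And>x. measure \<mu> {x} = 0) \<Longrightarrow> 0 < v \<Longrightarrow>
   integrable lborel (\<lambda>s. N s * s) \<Longrightarrow> integrable lborel (\<lambda>s. N s * s\<^sup>2) \<Longrightarrow> integrable lborel (\<lambda>s. N s * s ^ 3) \<Longrightarrow>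
   (\<integral>s. N s * s\<^sup>2 \<partial>lborel) = v\<^sup>2 \<Longrightarrow> (\<integral>s. N s * s ^ 3 \<partial>lborel) \<le> L0 * v ^ 3 \<Longrightarrow>
   (\<And>\<xi>. norm (char \<mu> \<xi>) \<le> C / (1 + v\<^sup>2 * \<xi>\<^sup>2)) \<Longrightarrow> a \<le> b \<Longrightarrow>
   (\<integral>s. N s * s \<partial>lborel) - c0 * v \<le> a \<Longrightarrow> b \<le> (\<integral>s. N s * s \<partial>lborel) + c0 * v \<Longrightarrow>
   k / v * (b - a) \<le> measure \<mu> {a<..b}"
proof -
 \<comment> \<open>Half the minimum of the standard normal density on [-c0, c0]; the other half is
   spent on the error.\<close>
 define k where "k = exp (- c0\<^sup>2 / 2) / sqrt (2 * pi) / 2"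
 have k: "0 < k" by (simp add: k_def)
 \<comment> \<open>The factor 2 pi cancels the prefactor of the inversion formula, and C + 2 adds
   the decay constant 2 of the normal characteristic function.\<close>
 obtain L0 where L0: "0 < L0" and L0b: "\<And>L. 0 \<le> L \<Longrightarrow> L \<le> L0 \<Longrightarrow> (\<integral>x. min (L * \<bar>x\<bar> ^ 3) ((C + 2) / (1 + x\<^sup>2)) \<partial>lborel) \<le> 2 * pi * k"
  using small_min_integral[of "2 * pi * k" "C + 2"] k assms by auto
 show ?thesis
 proof (rule that[OF L0 k])
  fix N \<mu> v a b
  assume N: "levy N" and \<mu>: "id_law N \<mu>" and na: "\<And>x. measure \<mu> {x} = 0" and v: "0 < v"
   and i: "integrable lborel (\<lambda>s. N s * s)" "integrable lborel (\<lambda>s. N s * s\<^sup>2)" "integrable lborel (\<lambda>s. N s * s ^ 3)"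
   and v2: "(\<integral>s. N s * s\<^sup>2 \<partial>lborel) = v\<^sup>2" and v3: "(\<integral>s. N s * s ^ 3 \<partial>lborel) \<le> L0 * v ^ 3"
   and cb: "\<And>\<xi>. norm (char \<mu> \<xi>) \<le> C / (1 + v\<^sup>2 * \<xi>\<^sup>2)" and ab: "a \<le> b"
   and la: "(\<integral>s. N s * s \<partial>lborel) - c0 * v \<le> a" and lb: "b \<le> (\<integral>s. N s * s \<partial>lborel) + c0 * v"
  let ?m = "\<integral>s. N s * s \<partial>lborel"
  interpret real_distribution \<mu> using \<mu> by (simp add: id_law_def nonneg_dist_def)
  let ?\<nu> = "distr \<mu> borel (\<lambda>x. (x - ?m) / v)"
  have rd: "real_distribution ?\<nu>" by (auto simp: real_distribution_def real_distribution_axioms_def intro!: prob_space_distr)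
  interpret V: real_distribution ?\<nu> by (rule rd)
  have meas: "measure ?\<nu> {x<..y} = measure \<mu> {v * x + ?m<..v * y + ?m}" for x y
  proof -
   have "(\<lambda>u. (u - ?m) / v) -` {x<..y} \<inter> space \<mu> = {v * x + ?m<..v * y + ?m}" using v by (auto simp: field_simps)
   then show ?thesis by (subst measure_distr) auto
  qed
  have at0: "measure ?\<nu> {x} = 0" for x
  proof -
   have "(\<lambda>u. (u - ?m) / v) -` {x} \<inter> space \<mu> = {v * x + ?m}" using v by (auto simp: field_simps)
   then show ?thesis using na by (subst measure_distr) auto
  qed
  have ch: "char ?\<nu> \<eta> = char \<mu> (\<eta> / v) * iexp (- (\<eta> / v * ?m))" for \<eta>
  proof -
   have "char ?\<nu> \<eta> = (CLINT x|\<mu>. iexp (\<eta> * ((x - ?m) / v)))" unfolding char_def by (rule integral_distr) auto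
   also have "\<dots> = (CLINT x|\<mu>. iexp (\<eta> / v * x) * iexp (- (\<eta> / v * ?m)))"
    by (intro Bochner_Integration.integral_cong refl) (simp add: exp_add[symmetric] diff_divide_distrib right_diff_distrib)
   also have "\<dots> = char \<mu> (\<eta> / v) * iexp (- (\<eta> / v * ?m))" unfolding char_def by (rule integral_mult_left_zero)
   finally show ?thesis .
  qed
  have nch: "norm (char ?\<nu> \<eta>) \<le> C / (1 + \<eta>\<^sup>2)" for \<eta> using cb[of "\<eta> / v"] v unfolding ch by (simp add: norm_mult power_divide)
  have ich: "integrable lborel (char ?\<nu>)" by (rule char_bound_upper(2)[OF rd at0 zero_less_one _ order_refl[of 0]]) (use nch in simp)
  let ?G = std_normal_distribution
  have chG: "char ?G \<eta> = of_real (exp (- (\<eta>\<^sup>2) / 2))" for \<eta> by (simp add: char_std_normal_distribution)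
  have gb: "exp (- (\<eta>\<^sup>2) / 2) \<le> 2 / (1 + \<eta>\<^sup>2)" for \<eta> :: real
  proof -
   have "1 + \<eta>\<^sup>2 / 2 \<le> exp (\<eta>\<^sup>2 / 2)" by (rule exp_ge_add_one_self)
   then have "inverse (exp (\<eta>\<^sup>2 / 2)) \<le> inverse (1 + \<eta>\<^sup>2 / 2)" by (rule le_imp_inverse_le) (simp add: add_pos_nonneg)
   also have "\<dots> \<le> 2 / (1 + \<eta>\<^sup>2)" by (simp add: divide_inverse[symmetric] inverse_eq_divide field_simps add_pos_nonneg)
   finally show ?thesis by (simp add: exp_minus)
  qed
  have atG: "measure ?G {x} = 0" for x
  proof -
   have "emeasure ?G {x} = (\<integral>\<^sup>+y. ennreal (std_normal_density y) * indicator {x} y \<partial>lborel)" by (rule emeasure_density) auto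
   also have "\<dots> = 0" by (simp add: nn_integral_indicator_singleton)
   finally show ?thesis by (simp add: measure_def)
  qed
  have icG: "integrable lborel (char ?G)"
   by (rule char_bound_upper(2)[OF real_dist_normal_dist atG zero_less_one _ order_refl[of 0], where C=2]) (use gb chG in simp)
  let ?L = "(\<integral>s. N s * s ^ 3 \<partial>lborel) / v ^ 3"
  have L: "0 \<le> ?L" "?L \<le> L0"
  proof -
   have "0 \<le> (\<integral>s. N s * s ^ 3 \<partial>lborel)"
   proof (rule integral_nonneg_AE, rule AE_I2)
    fix s show "0 \<le> N s * s ^ 3" using levy_nonneg[OF N, of s] levy_zero[OF N, of s] by (cases "0 < s") auto
   qed
   then show "0 \<le> ?L" using v by simp
   show "?L \<le> L0" using v3 v by (simp add: divide_le_eq)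
  qed
  have db: "norm (char ?\<nu> \<eta> - char ?G \<eta>) \<le> min (?L * \<bar>\<eta>\<bar> ^ 3) ((C + 2) / (1 + \<eta>\<^sup>2))" for \<eta>
  proof (rule min.boundedI)
   have "norm (char ?\<nu> \<eta> - char ?G \<eta>) \<le> \<bar>\<eta> / v\<bar> ^ 3 / 6 * (\<integral>s. N s * s ^ 3 \<partial>lborel)"
    using char_id_law_gauss[OF N \<mu> i, of "\<eta> / v"] v unfolding ch chG v2 by (simp add: power_divide)
   also have "\<dots> = (?L * \<bar>\<eta>\<bar> ^ 3) / 6" using v by (simp add: abs_divide power_divide)
   also have "\<dots> \<le> ?L * \<bar>\<eta>\<bar> ^ 3"
   proof -
    have h: "x / 6 \<le> x" if "0 \<le> x" for x :: real using that by simp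
    show ?thesis by (rule h) (intro mult_nonneg_nonneg L(1), simp)
   qed
   finally show "norm (char ?\<nu> \<eta> - char ?G \<eta>) \<le> ?L * \<bar>\<eta>\<bar> ^ 3" .
   have "norm (char ?\<nu> \<eta> - char ?G \<eta>) \<le> C / (1 + \<eta>\<^sup>2) + 2 / (1 + \<eta>\<^sup>2)"
    using norm_triangle_ineq4[of "char ?\<nu> \<eta>" "char ?G \<eta>"] nch[of \<eta>] gb[of \<eta>] unfolding chG by simp
   then show "norm (char ?\<nu> \<eta> - char ?G \<eta>) \<le> (C + 2) / (1 + \<eta>\<^sup>2)" by (simp add: add_divide_distrib)
  qed
  have iC: "integrable lborel (\<lambda>x::real. (C + 2) / (1 + x\<^sup>2))" using cauchy_integral_scaled(1)[of 1 "C + 2"] by simp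
  have "(\<integral>\<eta>. norm (char ?\<nu> \<eta> - char ?G \<eta>) \<partial>lborel) \<le> (\<integral>x. min (?L * \<bar>x\<bar> ^ 3) ((C + 2) / (1 + x\<^sup>2)) \<partial>lborel)"
  proof (rule integral_mono[OF _ _ db])
   show "integrable lborel (\<lambda>\<eta>. norm (char ?\<nu> \<eta> - char ?G \<eta>))" using ich icG by simp
   show "integrable lborel (\<lambda>x. min (?L * \<bar>x\<bar> ^ 3) ((C + 2) / (1 + x\<^sup>2)))"
   proof (rule Bochner_Integration.integrable_bound[OF iC])
    show "AE x in lborel. norm (min (?L * \<bar>x\<bar> ^ 3) ((C + 2) / (1 + x\<^sup>2))) \<le> norm ((C + 2) / (1 + x\<^sup>2))"
    proof (rule AE_I2)
     fix x :: real
     have a: "0 \<le> ?L * \<bar>x\<bar> ^ 3" by (rule mult_nonneg_nonneg[OF L(1)]) simp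
     have b: "0 \<le> (C + 2) / (1 + x\<^sup>2)" using assms by simp
     show "norm (min (?L * \<bar>x\<bar> ^ 3) ((C + 2) / (1 + x\<^sup>2))) \<le> norm ((C + 2) / (1 + x\<^sup>2))"
      unfolding real_norm_def abs_of_nonneg[OF b] abs_of_nonneg[OF min.boundedI[OF a b]] by (rule min.cobounded2)
    qed
   qed simp
  qed
  also have "\<dots> \<le> 2 * pi * k" by (rule L0b[OF L])
  finally have D: "(\<integral>\<eta>. norm (char ?\<nu> \<eta> - char ?G \<eta>) \<partial>lborel) \<le> 2 * pi * k" .
  let ?a = "(a - ?m) / v" and ?b = "(b - ?m) / v"
  have ab': "?a \<le> ?b" using ab v by (simp add: divide_right_mono)
  have "\<bar>measure ?\<nu> {?a<..?b} - measure ?G {?a<..?b}\<bar> \<le> (?b - ?a) / (2 * pi) * (\<integral>\<eta>. norm (char ?\<nu> \<eta> - char ?G \<eta>) \<partial>lborel)"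
   by (rule measure_interval_diff_char[OF rd ich real_dist_normal_dist icG ab' at0 at0 atG atG])
  also have "\<dots> \<le> (?b - ?a) / (2 * pi) * (2 * pi * k)" using ab' D by (intro mult_left_mono) auto
  also have "\<dots> = (?b - ?a) * k" by simp
  finally have 1: "measure ?G {?a<..?b} - (?b - ?a) * k \<le> measure ?\<nu> {?a<..?b}" by linarith
  have "exp (- c0\<^sup>2 / 2) / sqrt (2 * pi) * (?b - ?a) \<le> measure ?G {?a<..?b}"
   by (rule std_normal_interval_ge) (use la lb v ab' in \<open>auto simp: field_simps\<close>)
  then have "2 * k * (?b - ?a) \<le> measure ?G {?a<..?b}" by (simp add: k_def)
  moreover have "g - d * k \<le> n \<Longrightarrow> 2 * k * d \<le> g \<Longrightarrow> k * d \<le> n" for g d n :: real by (simp add: algebra_simps)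
  ultimately have 2: "k * (?b - ?a) \<le> measure ?\<nu> {?a<..?b}" using 1 by blast
  have 3: "k / v * (b - a) = k * (?b - ?a)" using v by (simp add: field_simps)
  have 4: "measure ?\<nu> {?a<..?b} = measure \<mu> {a<..b}" using v by (simp add: meas)
  show "k / v * (b - a) \<le> measure \<mu> {a<..b}" using 2 unfolding 3 4 .
 qed
qed

section \<open>Functionals of the Levy density\<close>

definition lint :: "(real \<Rightarrow> real) \<Rightarrow> (real \<Rightarrow> real) \<Rightarrow> real" where
 "lint N f = (\<integral>s. N s * f s \<partial>lborel)"

text \<open>Test functions that are integrable against every Levy density, so that
  \<open>lint\<close> is linear and monotone on them without further integrability
  conditions.\<close>

definition lbnd :: "(real \<Rightarrow> real) \<Rightarrow> bool" where
 "lbnd f \<longleftrightarrow> f \<in> borel_measurable borel \<and> (\<exists>C. \<forall>s>0. \<bar>f s\<bar> \<le> C * min 1 s)"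

lemma lbndI: "f \<in> borel_measurable borel \<Longrightarrow> (\<And>s. 0 < s \<Longrightarrow> \<bar>f s\<bar> \<le> C * min 1 s) \<Longrightarrow> lbnd f"
 by (auto simp: lbnd_def)

lemma lbnd_cmult: "lbnd f \<Longrightarrow> lbnd (\<lambda>s. c * f s)"
proof -
 assume "lbnd f"
 then obtain C where C: "f \<in> borel_measurable borel" "\<And>s. 0 < s \<Longrightarrow> \<bar>f s\<bar> \<le> C * min 1 s" by (auto simp: lbnd_def)
 show ?thesis
 proof (rule lbndI[where C="\<bar>c\<bar> * C"])
  fix s :: real assume "0 < s"
  then show "\<bar>c * f s\<bar> \<le> \<bar>c\<bar> * C * min 1 s" using C(2)[of s] by (simp add: abs_mult mult.assoc mult_left_mono)
 qed (use C(1) in measurable)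
qed

lemma lbnd_add: "lbnd f \<Longrightarrow> lbnd g \<Longrightarrow> lbnd (\<lambda>s. f s + g s)"
proof -
 assume "lbnd f" "lbnd g"
 then obtain C D where C: "f \<in> borel_measurable borel" "\<And>s. 0 < s \<Longrightarrow> \<bar>f s\<bar> \<le> C * min 1 s"
  and D: "g \<in> borel_measurable borel" "\<And>s. 0 < s \<Longrightarrow> \<bar>g s\<bar> \<le> D * min 1 s" by (auto simp: lbnd_def)
 show ?thesis
 proof (rule lbndI[where C="C + D"])
  fix s :: real assume "0 < s"
  then show "\<bar>f s + g s\<bar> \<le> (C + D) * min 1 s" using C(2)[of s] D(2)[of s] by (simp add: distrib_right)
 qed (use C(1) D(1) in measurable)
qed

lemma lbnd_diff: "lbnd f \<Longrightarrow> lbnd g \<Longrightarrow> lbnd (\<lambda>s. f s - g s)"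
 using lbnd_add[of f "\<lambda>s. - 1 * g s"] lbnd_cmult[of g "- 1"] by simp

lemma lbnd_integrable: "levy N \<Longrightarrow> lbnd f \<Longrightarrow> integrable lborel (\<lambda>s. N s * f s)"
 unfolding lbnd_def by (auto intro: levy_integrable_real)

lemma lint_mono: "levy N \<Longrightarrow> lbnd f \<Longrightarrow> lbnd g \<Longrightarrow> (\<And>s. 0 < s \<Longrightarrow> f s \<le> g s) \<Longrightarrow> lint N f \<le> lint N g"
 unfolding lint_def by (rule levy_integral_mono) (auto intro: lbnd_integrable)

lemma lint_cong: "levy N \<Longrightarrow> (\<And>s. 0 < s \<Longrightarrow> f s = g s) \<Longrightarrow> lint N f = lint N g"
 unfolding lint_def
proof (rule Bochner_Integration.integral_cong[OF refl])
 fix s assume a: "levy N" "\<And>s. 0 < s \<Longrightarrow> f s = g s"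
 show "N s * f s = N s * g s" using a(2)[of s] levy_zero[OF a(1), of s] by (cases "0 < s") auto
qed

lemma lint_cmult: "lint N (\<lambda>s. c * f s) = c * lint N f"
proof -
 have "lint N (\<lambda>s. c * f s) = (\<integral>s. c * (N s * f s) \<partial>lborel)" unfolding lint_def by (simp only: mult.left_commute)
 then show ?thesis by (simp only: lint_def integral_mult_right_zero)
qed

lemma lint_scale: "lint (\<lambda>s. c * N s) f = c * lint N f"
proof -
 have "lint (\<lambda>s. c * N s) f = (\<integral>s. c * (N s * f s) \<partial>lborel)" unfolding lint_def by (simp only: mult.assoc)
 then show ?thesis by (simp only: lint_def integral_mult_right_zero)
qed

lemma lint_add: "levy N \<Longrightarrow> lbnd f \<Longrightarrow> lbnd g \<Longrightarrow> lint N (\<lambda>s. f s + g s) = lint N f + lint N g"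
 unfolding lint_def distrib_left by (rule Bochner_Integration.integral_add) (auto intro: lbnd_integrable)

lemma lint_diff: "levy N \<Longrightarrow> lbnd f \<Longrightarrow> lbnd g \<Longrightarrow> lint N (\<lambda>s. f s - g s) = lint N f - lint N g"
 unfolding lint_def right_diff_distrib by (rule Bochner_Integration.integral_diff) (auto intro: lbnd_integrable)

lemma lint_nonneg: "levy N \<Longrightarrow> (\<And>s. 0 < s \<Longrightarrow> 0 \<le> f s) \<Longrightarrow> 0 \<le> lint N f"
 unfolding lint_def
proof (rule integral_nonneg_AE, rule AE_I2)
 fix s assume a: "levy N" "\<And>s. 0 < s \<Longrightarrow> 0 \<le> f s"
 show "0 \<le> N s * f s" using a(2)[of s] levy_zero[OF a(1), of s] levy_nonneg[OF a(1), of s] by (cases "0 < s") auto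
qed

lemma lint_abs_le: "levy N \<Longrightarrow> lbnd f \<Longrightarrow> lbnd g \<Longrightarrow> (\<And>s. 0 < s \<Longrightarrow> \<bar>f s\<bar> \<le> g s) \<Longrightarrow> \<bar>lint N f\<bar> \<le> lint N g"
proof -
 assume a: "levy N" "lbnd f" "lbnd g" "\<And>s. 0 < s \<Longrightarrow> \<bar>f s\<bar> \<le> g s"
 have "lint N f \<le> lint N g" by (rule lint_mono[OF a(1-3)]) (use a(4) in fastforce)
 moreover have "lint N (\<lambda>s. - 1 * f s) \<le> lint N g" by (rule lint_mono[OF a(1) lbnd_cmult[OF a(2)] a(3)]) (use a(4) in fastforce)
 ultimately show ?thesis unfolding lint_cmult by linarith
qed

definition mom :: "(real \<Rightarrow> real) \<Rightarrow> nat \<Rightarrow> real \<Rightarrow> real" where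
 "mom N j l = lint N (\<lambda>s. s ^ j * exp (- l * s))"

text \<open>The kernel of H: substituting the integrals for phi(l) - l phi'(l) gives the integrand
  \<open>hfun\<close> at l s.\<close>

definition hfun :: "real \<Rightarrow> real" where "hfun u = 1 - (1 + u) * exp (- u)"

definition HH :: "(real \<Rightarrow> real) \<Rightarrow> real \<Rightarrow> real" where "HH N l = lint N (\<lambda>s. hfun (l * s))"

text \<open>The truncated second moment at scale r, normalised by the square of r. Together with the
  tail \<open>ww\<close> it is comparable to H(1/r); under lower scaling it alone is.\<close>

definition KK :: "(real \<Rightarrow> real) \<Rightarrow> real \<Rightarrow> real" where
 "KK N r = lint N (\<lambda>s. if s \<le> r then (s / r)\<^sup>2 else 0)"

definition ww :: "(real \<Rightarrow> real) \<Rightarrow> real \<Rightarrow> real" where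
 "ww N r = lint N (\<lambda>s. if r < s then 1 else 0)"

text \<open>The value of \<open>hfun\<close> at 1, and the best constant in h u^2 <=
  \<open>hfun\<close> u on [0,1].\<close>

definition hconst :: real where "hconst = 1 - 2 * exp (- 1)"

section \<open>Elementary inequalities for the kernels\<close>

lemma exp1_ge: "27 / 10 \<le> exp (1::real)"
proof -
 have "(\<Sum>k<5. (1::real) ^ k /\<^sub>R fact k) \<le> exp 1" unfolding exp_def by (intro sum_le_suminf summable_exp_generic) auto
 then show ?thesis by (simp add: eval_nat_numeral)
qed

text \<open>Here the constants 2 e and 8 e^2 of the statement are justified: the third inequality
  puts \<open>s0 t\<close> below \<open>rho t\<close>, and the fourth leaves only the fraction 2/15
  of y in \<open>chernoff_exponent\<close>.\<close>

lemma hconst_pos: "1 / 4 \<le> hconst" "hconst \<le> 1" "1 \<le> hconst * (2 * exp 1)" "15 \<le> 8 * (exp 1)\<^sup>2 * hconst"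
proof -
 have e: "exp (- 1) = 1 / exp (1::real)" by (simp add: exp_minus divide_inverse)
 show "1 / 4 \<le> hconst" unfolding hconst_def e using exp1_ge by (simp add: field_simps)
 show "hconst \<le> 1" unfolding hconst_def by simp
 have "hconst * (2 * exp 1) = 2 * exp 1 - 4" unfolding hconst_def e by (simp add: field_simps)
 then show "1 \<le> hconst * (2 * exp 1)" using exp1_ge by simp
 have "8 * (exp 1)\<^sup>2 * hconst = 8 * ((exp 1 - 1)\<^sup>2 - 1)" unfolding hconst_def e by (simp add: field_simps power2_eq_square)
 moreover have "(17 / 10)\<^sup>2 \<le> (exp 1 - 1 :: real)\<^sup>2" using exp1_ge by (intro power_mono) auto
 ultimately show "15 \<le> 8 * (exp 1)\<^sup>2 * hconst" by (simp add: power2_eq_square)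
qed

lemma hfun_deriv: "(hfun has_real_derivative u * exp (- u)) (at u)"
 unfolding hfun_def by (auto intro!: derivative_eq_intros simp: algebra_simps)

lemma hfun_mono: "0 \<le> u \<Longrightarrow> u \<le> v \<Longrightarrow> hfun u \<le> hfun v"
 by (rule DERIV_nonneg_imp_nondecreasing) (use hfun_deriv in fastforce)+

lemma hfun_nonneg: "0 \<le> u \<Longrightarrow> 0 \<le> hfun u"
 using hfun_mono[of 0 u] by (simp add: hfun_def)

lemma hfun_le: "0 \<le> u \<Longrightarrow> hfun u \<le> 1" "0 \<le> u \<Longrightarrow> hfun u \<le> u\<^sup>2"
proof -
 assume u: "0 \<le> u"
 then show "hfun u \<le> 1" unfolding hfun_def by simp
 have "(1 + u) * (1 - u) \<le> (1 + u) * exp (- u)" using u exp_ge_add_one_self[of "- u"] by (intro mult_left_mono) auto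
 then show "hfun u \<le> u\<^sup>2" unfolding hfun_def by (simp add: algebra_simps power2_eq_square)
qed

lemma hfun_ge_1: "1 \<le> u \<Longrightarrow> hconst \<le> hfun u"
 using hfun_mono[of 1 u] by (simp add: hfun_def hconst_def)

text \<open>The difference of the two sides vanishes at 0 and at 1, and its derivative changes sign
  once, from plus to minus. Depending on the sign at u, it is compared with its value at 0 or at
  1.\<close>

lemma hfun_ge_sq:
 assumes "0 \<le> u" "u \<le> 1"
 shows "hconst * u\<^sup>2 \<le> hfun u"
proof -
 let ?g = "\<lambda>u. hfun u - hconst * u\<^sup>2"
 have d: "(?g has_real_derivative v * (exp (- v) - 2 * hconst)) (at v)" for v
  by (rule DERIV_cong) (auto intro!: derivative_eq_intros hfun_deriv simp: algebra_simps)
 have "0 \<le> ?g u"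
 proof (cases "2 * hconst \<le> exp (- u)")
  case True
  have "?g 0 \<le> ?g u"
  proof (rule DERIV_nonneg_imp_nondecreasing[OF assms(1)])
   fix v assume v: "0 \<le> v" "v \<le> u"
   then have "exp (- u) \<le> exp (- v)" by simp
   then have "0 \<le> v * (exp (- v) - 2 * hconst)" using v True by (intro mult_nonneg_nonneg) linarith+
   then show "\<exists>y. (?g has_real_derivative y) (at v) \<and> 0 \<le> y" using d by blast
  qed
  then show ?thesis by (simp add: hfun_def)
 next
  case False
  have "?g 1 \<le> ?g u"
  proof (rule DERIV_nonpos_imp_nonincreasing[OF assms(2)])
   fix v assume v: "u \<le> v" "v \<le> 1"
   then have "exp (- v) \<le> exp (- u)" by simp
   then have "v * (exp (- v) - 2 * hconst) \<le> 0" using v False assms by (intro mult_nonneg_nonpos) linarith+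
   then show "\<exists>y. (?g has_real_derivative y) (at v) \<and> y \<le> 0" using d by blast
  qed
  then show ?thesis by (simp add: hfun_def hconst_def)
 qed
 then show ?thesis by simp
qed

lemma exp_ge_exp1_mult: "exp 1 * v \<le> exp (v::real)"
 using exp_ge_add_one_self[of "v - 1"] by (simp add: exp_diff field_simps)

lemma sq_exp_le: "0 \<le> u \<Longrightarrow> u\<^sup>2 * exp (- u) \<le> (1::real)"
proof -
 assume u: "0 \<le> u"
 have "2 * (u / 2) \<le> exp 1 * (u / 2)" using exp1_ge u by (intro mult_right_mono) auto
 then have "u \<le> exp (u / 2)" using exp_ge_exp1_mult[of "u / 2"] by linarith
 then have "u\<^sup>2 \<le> (exp (u / 2))\<^sup>2" using u by (intro power_mono) auto
 also have "\<dots> = exp u" by (simp add: power2_eq_square flip: exp_add)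
 finally show ?thesis by (simp add: exp_minus field_simps)
qed

lemma cube_exp_le: "0 \<le> u \<Longrightarrow> u ^ 3 * exp (- u) \<le> (2::real)"
proof -
 assume u: "0 \<le> u"
 have "27 / 10 * (u / 3) \<le> exp 1 * (u / 3)" using exp1_ge u by (intro mult_right_mono) auto
 then have "9 / 10 * u \<le> exp (u / 3)" using exp_ge_exp1_mult[of "u / 3"] by linarith
 then have "(9 / 10 * u) ^ 3 \<le> (exp (u / 3)) ^ 3" using u by (intro power_mono) auto
 also have "\<dots> = exp u" by (simp add: power3_eq_cube flip: exp_add)
 finally have "729 * u ^ 3 \<le> 1000 * exp u" by (simp add: power_mult_distrib power_divide)
 then have "u ^ 3 \<le> 2 * exp u" using exp_gt_zero[of u] by linarith
 then show ?thesis by (simp add: exp_minus field_simps)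
qed

lemma lbnd_one_minus_exp: "0 \<le> l \<Longrightarrow> lbnd (\<lambda>s. 1 - exp (- l * s))"
proof (rule lbndI[where C="1 + l"])
 fix s :: real assume l: "0 \<le> l" and s: "0 < s"
 have a: "0 \<le> 1 - exp (- l * s)" using l s by simp
 have b: "1 - exp (- l * s) \<le> 1" by simp
 have c: "1 - exp (- l * s) \<le> l * s" using exp_ge_add_one_self[of "- l * s"] by simp
 show "\<bar>1 - exp (- l * s)\<bar> \<le> (1 + l) * min 1 s"
 proof (cases "1 \<le> s")
  case True
  then have "1 \<le> (1 + l) * min 1 s" using l by simp
  then show ?thesis unfolding abs_of_nonneg[OF a] using b by linarith
 next
  case False
  then have "l * s \<le> (1 + l) * min 1 s" using s by (simp add: distrib_right)
  then show ?thesis unfolding abs_of_nonneg[OF a] using c by linarith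
 qed
qed measurable

lemma lbnd_mom: "0 < l \<Longrightarrow> 1 \<le> j \<Longrightarrow> lbnd (\<lambda>s. s ^ j * exp (- l * s))"
proof (rule lbndI[where C="1 + fact j / l ^ j"])
 fix s :: real assume l: "0 < l" and j: "1 \<le> j" and s: "0 < s"
 have a: "0 \<le> s ^ j * exp (- l * s)" using s by simp
 show "\<bar>s ^ j * exp (- l * s)\<bar> \<le> (1 + fact j / l ^ j) * min 1 s"
 proof (cases "s \<le> 1")
  case True
  have "s ^ j * exp (- l * s) \<le> s ^ j * 1" using l s by (intro mult_left_mono) auto
  also have "\<dots> \<le> s" using power_decreasing[OF j, of s] s True by simp
  also have "\<dots> \<le> (1 + fact j / l ^ j) * s" using l s by (simp add: distrib_right)
  finally show ?thesis using True a by simp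
 next
  case False
  have "(\<Sum>k\<in>{j}. (l * s) ^ k /\<^sub>R fact k) \<le> exp (l * s)" unfolding exp_def using l s by (intro sum_le_suminf summable_exp_generic) auto
  then have "l ^ j * s ^ j \<le> fact j * exp (l * s)" by (simp add: power_mult_distrib field_simps)
  then have "s ^ j * exp (- l * s) \<le> fact j / l ^ j" using l by (simp add: exp_minus field_simps)
  then show ?thesis using False a by simp
 qed
qed measurable

lemma lbnd_hfun: "0 < l \<Longrightarrow> lbnd (\<lambda>s. hfun (l * s))"
proof (rule lbndI[where C="1 + l\<^sup>2"])
 fix s :: real assume l: "0 < l" and s: "0 < s"
 have a: "0 \<le> hfun (l * s)" "hfun (l * s) \<le> 1" "hfun (l * s) \<le> (l * s)\<^sup>2" using hfun_nonneg[of "l * s"] hfun_le[of "l * s"] l s by auto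
 show "\<bar>hfun (l * s)\<bar> \<le> (1 + l\<^sup>2) * min 1 s"
 proof (cases "1 \<le> s")
  case True then show ?thesis using a by (simp add: add_increasing2)
 next
  case False
  have "l\<^sup>2 * (s * s) \<le> l\<^sup>2 * (1 * s)" using False s by (intro mult_left_mono mult_right_mono) auto
  then have "hfun (l * s) \<le> l\<^sup>2 * s" using a(3) by (simp add: power_mult_distrib power2_eq_square mult.assoc mult.left_commute)
  then show ?thesis using a(1) False s by (simp add: distrib_right)
 qed
qed (simp add: hfun_def)

lemma lbnd_KK: "0 < r \<Longrightarrow> lbnd (\<lambda>s. if s \<le> r then (s / r)\<^sup>2 else 0)"
proof (rule lbndI[where C="1 + 1 / r"])
 fix s :: real assume r: "0 < r" and s: "0 < s"
 show "\<bar>if s \<le> r then (s / r)\<^sup>2 else 0\<bar> \<le> (1 + 1 / r) * min 1 s"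
 proof (cases "s \<le> r")
  case True
  have a: "s / r \<le> 1" using True r by simp
  have b: "(s / r)\<^sup>2 \<le> s / r" using power_decreasing[of 1 2 "s / r"] r s a by simp
  then show ?thesis using True a r s by (cases "1 \<le> s") (auto simp: distrib_right add_increasing2 intro: order_trans)
 qed (use r s in auto)
qed measurable

lemma lbnd_ww: "0 < r \<Longrightarrow> lbnd (\<lambda>s. if r < s then 1 else 0)"
proof (rule lbndI[where C="1 + 1 / r"])
 fix s :: real assume r: "0 < r" and s: "0 < s"
 show "\<bar>if r < s then 1 else 0\<bar> \<le> (1 + 1 / r) * min 1 s"
 proof (cases "r < s \<and> s < 1")
  case True
  then have "1 \<le> (1 / r) * s" using r by (simp add: field_simps)
  then show ?thesis using True s by (simp add: distrib_right)
 qed (use r s in auto)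
qed measurable

section \<open>Differentiation of the moments\<close>

lemma exp_taylor2: "\<bar>exp x - 1 - x\<bar> \<le> x\<^sup>2 * exp \<bar>x::real\<bar>"
proof (cases "0 \<le> x")
 case True
 have a: "exp x - 1 \<le> x * exp x" using exp_ge_add_one_self[of "- x"] by (simp add: exp_minus field_simps)
 then have "exp x - 1 - x \<le> x * (exp x - 1)" by (simp add: algebra_simps)
 also have "\<dots> \<le> x * (x * exp x)" using a True by (rule mult_left_mono)
 finally have "exp x - 1 - x \<le> x\<^sup>2 * exp x" by (simp add: power2_eq_square)
 moreover have "0 \<le> exp x - 1 - x" using exp_ge_add_one_self[of x] by linarith
 ultimately show ?thesis using True by simp
next
 case False
 have "exp x * (1 - x) \<le> 1" using exp_ge_add_one_self[of "- x"] by (simp add: exp_minus field_simps)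
 then have "exp x - 1 - x \<le> x * (exp x - 1)" by (simp add: algebra_simps)
 also have "\<dots> = (- x) * (1 - exp x)" by (simp add: algebra_simps)
 also have "\<dots> \<le> (- x) * (- x)" using exp_ge_add_one_self[of x] False by (intro mult_left_mono) linarith+
 also have "\<dots> = x\<^sup>2 * 1" by (simp add: power2_eq_square)
 also have "\<dots> \<le> x\<^sup>2 * exp \<bar>x\<bar>" by (intro mult_left_mono) auto
 finally have "exp x - 1 - x \<le> x\<^sup>2 * exp \<bar>x\<bar>" .
 moreover have "0 \<le> exp x - 1 - x" using exp_ge_add_one_self[of x] by linarith
 ultimately show ?thesis by simp
qed

text \<open>Replaces differentiation under the integral: a quadratic bound for the increment of the
  kernel integrates to a quadratic bound for the functional.\<close>

lemma DERIV_quadratic_bound: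
 fixes f :: "real \<Rightarrow> real"
 assumes d: "0 < d" and b: "\<And>h. \<bar>h\<bar> \<le> d \<Longrightarrow> \<bar>f (x + h) - f x - D * h\<bar> \<le> C * h\<^sup>2"
 shows "(f has_real_derivative D) (at x)"
proof -
 have "((\<lambda>h. (f (x + h) - f x) / h - D) \<longlongrightarrow> 0) (at 0)"
 proof (rule Lim_null_comparison[where g="\<lambda>h. C * \<bar>h\<bar>"])
  have "\<forall>\<^sub>F h in at 0. h \<noteq> 0 \<and> dist h 0 < d" using d by (auto simp: eventually_at)
  then show "\<forall>\<^sub>F h in at 0. norm ((f (x + h) - f x) / h - D) \<le> C * \<bar>h\<bar>"
  proof eventually_elim
   case (elim h)
   have "(f (x + h) - f x) / h - D = (f (x + h) - f x - D * h) / h" using elim by (simp add: field_simps)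
   then have "norm ((f (x + h) - f x) / h - D) = \<bar>f (x + h) - f x - D * h\<bar> / \<bar>h\<bar>" by (simp add: abs_divide)
   also have "\<dots> \<le> (C * h\<^sup>2) / \<bar>h\<bar>" using b[of h] elim by (intro divide_right_mono) auto
   also have "\<dots> = C * \<bar>h\<bar>" using elim by (simp add: power2_eq_square field_simps abs_if)
   finally show ?case .
  qed
  show "((\<lambda>h. C * \<bar>h\<bar>) \<longlongrightarrow> 0) (at 0)" using tendsto_mult[OF tendsto_const[of C "at 0"] tendsto_rabs[OF tendsto_ident_at[of 0 UNIV]]] by simp
 qed
 then show ?thesis unfolding DERIV_def by (rule LIM_zero_cancel)
qed

text \<open>An increment of at most l/2 spends half of the exponential decay; the other half keeps
  the remainder a finite moment, taken at l/2.\<close>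

lemma exp_kernel_taylor:
 fixes h l s :: real
 assumes "0 < s" "\<bar>h\<bar> \<le> l / 2"
 shows "\<bar>s ^ j * exp (- (l + h) * s) - s ^ j * exp (- l * s) + h * (s ^ Suc j * exp (- l * s))\<bar>
  \<le> h\<^sup>2 * (s ^ (j + 2) * exp (- (l / 2) * s))"
proof -
 have "s ^ j * exp (- (l + h) * s) - s ^ j * exp (- l * s) + h * (s ^ Suc j * exp (- l * s))
   = s ^ j * exp (- l * s) * (exp (- h * s) - 1 - (- h * s))"
 proof -
  have e: "exp (- (l + h) * s) = exp (- l * s) * exp (- h * s)" by (simp add: exp_add[symmetric] algebra_simps)
  show ?thesis unfolding e by (simp add: algebra_simps)
 qed
 then have "\<bar>s ^ j * exp (- (l + h) * s) - s ^ j * exp (- l * s) + h * (s ^ Suc j * exp (- l * s))\<bar>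
   = s ^ j * exp (- l * s) * \<bar>exp (- h * s) - 1 - (- h * s)\<bar>"
  using assms by (simp add: abs_mult)
 also have "\<dots> \<le> s ^ j * exp (- l * s) * ((- h * s)\<^sup>2 * exp \<bar>- h * s\<bar>)" using assms by (intro mult_left_mono exp_taylor2) auto
 also have "\<dots> = h\<^sup>2 * (s ^ (j + 2) * (exp (- l * s) * exp (\<bar>h\<bar> * s)))"
  using assms by (simp add: abs_mult power_mult_distrib power_add power2_eq_square)
 also have "\<dots> \<le> h\<^sup>2 * (s ^ (j + 2) * exp (- (l / 2) * s))"
 proof (intro mult_left_mono)
  have "exp (- l * s) * exp (\<bar>h\<bar> * s) = exp ((\<bar>h\<bar> - l) * s)" by (simp flip: exp_add add: algebra_simps)
  also have "(\<bar>h\<bar> - l) * s \<le> (- (l / 2)) * s" using assms by (intro mult_right_mono) linarith+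
  finally show "exp (- l * s) * exp (\<bar>h\<bar> * s) \<le> exp (- (l / 2) * s)" by simp
 qed (use assms in auto)
 finally show ?thesis .
qed

lemma mom_deriv:
 assumes N: "levy N" and l: "0 < l" and j: "1 \<le> j"
 shows "(mom N j has_real_derivative - mom N (Suc j) l) (at l)"
proof (rule DERIV_quadratic_bound[where d="l / 2" and C="mom N (j + 2) (l / 2)"])
 fix h :: real assume h: "\<bar>h\<bar> \<le> l / 2"
 then have lh: "0 < l + h" using l by linarith
 have f0: "lbnd (\<lambda>s. s ^ j * exp (- (l + h) * s))" by (rule lbnd_mom[OF lh j])
 have f1: "lbnd (\<lambda>s. s ^ j * exp (- l * s))" by (rule lbnd_mom[OF l j])
 have f2: "lbnd (\<lambda>s. h * (s ^ Suc j * exp (- l * s)))" by (rule lbnd_cmult[OF lbnd_mom[OF l]]) simp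
 have f3: "lbnd (\<lambda>s. h\<^sup>2 * (s ^ (j + 2) * exp (- (l / 2) * s)))" by (rule lbnd_cmult[OF lbnd_mom]) (use l in auto)
 have E: "mom N j (l + h) - mom N j l - (- mom N (Suc j) l) * h
  = lint N (\<lambda>s. s ^ j * exp (- (l + h) * s) - s ^ j * exp (- l * s) + h * (s ^ Suc j * exp (- l * s)))"
  unfolding mom_def lint_add[OF N lbnd_diff[OF f0 f1] f2] lint_diff[OF N f0 f1] lint_cmult by simp
 have "\<bar>mom N j (l + h) - mom N j l - (- mom N (Suc j) l) * h\<bar> \<le> lint N (\<lambda>s. h\<^sup>2 * (s ^ (j + 2) * exp (- (l / 2) * s)))"
  unfolding E by (rule lint_abs_le[OF N lbnd_add[OF lbnd_diff[OF f0 f1] f2] f3]) (rule exp_kernel_taylor[OF _ h])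
 also have "\<dots> = mom N (j + 2) (l / 2) * h\<^sup>2" unfolding mom_def lint_cmult by simp
 finally show "\<bar>mom N j (l + h) - mom N j l - (- mom N (Suc j) l) * h\<bar> \<le> mom N (j + 2) (l / 2) * h\<^sup>2" .
qed (use l in simp)

lemma lexp_lint: "lexp N l = lint N (\<lambda>s. 1 - exp (- l * s))"
 by (simp add: lexp_def lint_def)

lemma lexp_deriv:
 assumes N: "levy N" and l: "0 < l"
 shows "(lexp N has_real_derivative mom N 1 l) (at l)"
proof (rule DERIV_quadratic_bound[where d="l / 2" and C="mom N 2 (l / 2)"])
 fix h :: real assume h: "\<bar>h\<bar> \<le> l / 2"
 then have lh: "0 < l + h" using l by linarith
 have f0: "lbnd (\<lambda>s. 1 - exp (- (l + h) * s))" by (rule lbnd_one_minus_exp) (use lh in simp)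
 have f1: "lbnd (\<lambda>s. 1 - exp (- l * s))" by (rule lbnd_one_minus_exp) (use l in simp)
 have f2: "lbnd (\<lambda>s. h * (s ^ 1 * exp (- l * s)))" by (rule lbnd_cmult[OF lbnd_mom[OF l]]) simp
 have f3: "lbnd (\<lambda>s. h\<^sup>2 * (s ^ 2 * exp (- (l / 2) * s)))" by (rule lbnd_cmult[OF lbnd_mom]) (use l in auto)
 have E: "lexp N (l + h) - lexp N l - mom N 1 l * h
  = lint N (\<lambda>s. (1 - exp (- (l + h) * s)) - (1 - exp (- l * s)) - h * (s ^ 1 * exp (- l * s)))"
  unfolding mom_def lexp_lint lint_diff[OF N lbnd_diff[OF f0 f1] f2] lint_diff[OF N f0 f1] lint_cmult by simp
 have "\<bar>lexp N (l + h) - lexp N l - mom N 1 l * h\<bar> \<le> lint N (\<lambda>s. h\<^sup>2 * (s ^ 2 * exp (- (l / 2) * s)))" unfolding E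
 proof (rule lint_abs_le[OF N lbnd_diff[OF lbnd_diff[OF f0 f1] f2] f3])
  fix s :: real assume s: "0 < s"
  show "\<bar>(1 - exp (- (l + h) * s)) - (1 - exp (- l * s)) - h * (s ^ 1 * exp (- l * s))\<bar> \<le> h\<^sup>2 * (s ^ 2 * exp (- (l / 2) * s))"
  proof -
   have e: "(1 - exp (- (l + h) * s)) - (1 - exp (- l * s)) - h * (s ^ 1 * exp (- l * s))
    = - (s ^ 0 * exp (- (l + h) * s) - s ^ 0 * exp (- l * s) + h * (s ^ Suc 0 * exp (- l * s)))" by simp
   show ?thesis unfolding e abs_minus_cancel using exp_kernel_taylor[OF s h, of 0] by (simp only: add_0)
  qed
 qed
 also have "\<dots> = mom N 2 (l / 2) * h\<^sup>2" unfolding mom_def lint_cmult by simp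
 finally show "\<bar>lexp N (l + h) - lexp N l - mom N 1 l * h\<bar> \<le> mom N 2 (l / 2) * h\<^sup>2" .
qed (use l in simp)

lemma HH_eq: "levy N \<Longrightarrow> 0 < l \<Longrightarrow> HH N l = lexp N l - l * mom N 1 l"
proof -
 assume a: "levy N" "0 < l"
 have "HH N l = lint N (\<lambda>s. (1 - exp (- l * s)) - l * (s ^ 1 * exp (- l * s)))"
  unfolding HH_def hfun_def by (rule lint_cong[OF a(1)]) (simp add: algebra_simps)
 also have "\<dots> = lexp N l - l * mom N 1 l"
  unfolding mom_def lexp_lint lint_cmult[symmetric] using a by (intro lint_diff lbnd_cmult lbnd_mom lbnd_one_minus_exp) auto
 finally show ?thesis .
qed

lemma HH_deriv:
 assumes N: "levy N" and l: "0 < l"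
 shows "(HH N has_real_derivative l * mom N 2 l) (at l)"
proof -
 have "((\<lambda>l. lexp N l - l * mom N 1 l) has_real_derivative (mom N 1 l - (1 * mom N 1 l + - mom N 2 l * l))) (at l)"
  using mom_deriv[OF N l, of 1] by (intro DERIV_diff DERIV_mult DERIV_ident lexp_deriv[OF N l]) (simp add: numeral_2_eq_2)
 then have "((\<lambda>l. lexp N l - l * mom N 1 l) has_real_derivative l * mom N 2 l) (at l)" by (simp add: mult.commute)
 then show ?thesis
 proof (rule has_field_derivative_transform_within_open[where S="{0<..}"])
  show "lexp N x - x * mom N 1 x = HH N x" if "x \<in> {0<..}" for x using HH_eq[OF N, of x] that by simp
 qed (use l in auto)
qed

lemma mom_nonneg: "levy N \<Longrightarrow> 0 \<le> mom N j l"
 unfolding mom_def by (rule lint_nonneg) auto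

lemma HH_nonneg: "levy N \<Longrightarrow> 0 \<le> l \<Longrightarrow> 0 \<le> HH N l"
 unfolding HH_def by (rule lint_nonneg) (auto intro: hfun_nonneg)

lemma HH_mono: "levy N \<Longrightarrow> 0 < a \<Longrightarrow> a \<le> b \<Longrightarrow> HH N a \<le> HH N b"
 unfolding HH_def by (rule lint_mono) (auto intro!: lbnd_hfun hfun_mono mult_right_mono)

lemma KK_nonneg: "levy N \<Longrightarrow> 0 \<le> KK N r"
 unfolding KK_def by (rule lint_nonneg) auto

lemma ww_nonneg: "levy N \<Longrightarrow> 0 \<le> ww N r"
 unfolding ww_def by (rule lint_nonneg) auto

lemma ww_antimono: "levy N \<Longrightarrow> 0 < r \<Longrightarrow> r \<le> r' \<Longrightarrow> ww N r' \<le> ww N r"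
 unfolding ww_def by (rule lint_mono) (auto intro!: lbnd_ww)

section \<open>Comparison of H with moments, truncated moments and tails\<close>

text \<open>The derivative of H + a phi' at x is (x - a) times the second moment, which is
  nonnegative for x >= a.\<close>

lemma mom1_diff_le:
 assumes N: "levy N" and a: "0 < a" "a \<le> b"
 shows "a * (mom N 1 a - mom N 1 b) \<le> HH N b - HH N a"
proof -
 have "HH N a + a * mom N 1 a \<le> HH N b + a * mom N 1 b"
 proof (rule DERIV_nonneg_imp_nondecreasing[OF a(2)])
  fix x assume x: "a \<le> x" "x \<le> b"
  then have x0: "0 < x" using a by linarith
  have "((\<lambda>l. HH N l + a * mom N 1 l) has_real_derivative x * mom N 2 x + a * (- mom N 2 x)) (at x)"
   using mom_deriv[OF N x0, of 1] by (intro DERIV_add DERIV_cmult HH_deriv[OF N x0]) (simp add: numeral_2_eq_2)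
  moreover have "0 \<le> x * mom N 2 x + a * (- mom N 2 x)" using mult_right_mono[OF x(1) mom_nonneg[OF N]] by simp
  ultimately show "\<exists>y. ((\<lambda>l. HH N l + a * mom N 1 l) has_real_derivative y) (at x) \<and> 0 \<le> y" by blast
 qed
 then show ?thesis by (simp add: algebra_simps)
qed

lemma mom1_antimono: "levy N \<Longrightarrow> 0 < a \<Longrightarrow> a \<le> b \<Longrightarrow> mom N 1 b \<le> mom N 1 a"
 unfolding mom_def
proof (rule lint_mono)
 fix s :: real assume "a \<le> b" "0 < s"
 then show "s ^ 1 * exp (- b * s) \<le> s ^ 1 * exp (- a * s)" by (intro mult_left_mono) auto
qed (assumption | rule lbnd_cmult lbnd_add lbnd_mom lbnd_hfun lbnd_KK lbnd_ww | simp)+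

text \<open>This and the next two comparisons come from pointwise bounds of \<open>hfun\<close>,
  which behaves like u^2 on [0,1] and like a constant beyond.\<close>

lemma hconst_KK_le: "levy N \<Longrightarrow> 0 < r \<Longrightarrow> hconst * KK N r \<le> HH N (1 / r)"
 unfolding KK_def HH_def lint_cmult[symmetric]
proof (rule lint_mono)
 fix s :: real assume "0 < r" "0 < s"
 then show "hconst * (if s \<le> r then (s / r)\<^sup>2 else 0) \<le> hfun (1 / r * s)" using hfun_ge_sq[of "s / r"] hfun_nonneg[of "s / r"] by auto
qed (assumption | rule lbnd_cmult lbnd_add lbnd_mom lbnd_hfun lbnd_KK lbnd_ww | simp)+

lemma hconst_ww_le: "levy N \<Longrightarrow> 0 < r \<Longrightarrow> hconst * ww N r \<le> HH N (1 / r)"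
 unfolding ww_def HH_def lint_cmult[symmetric]
proof (rule lint_mono)
 fix s :: real assume "0 < r" "0 < s"
 then show "hconst * (if r < s then 1 else 0) \<le> hfun (1 / r * s)" using hfun_ge_1[of "s / r"] hfun_nonneg[of "s / r"] by auto
qed (assumption | rule lbnd_cmult lbnd_add lbnd_mom lbnd_hfun lbnd_KK lbnd_ww | simp)+

lemma HH_le_KK_ww: "levy N \<Longrightarrow> 0 < r \<Longrightarrow> HH N (1 / r) \<le> KK N r + ww N r"
proof -
 assume a: "levy N" "0 < r"
 have "HH N (1 / r) \<le> lint N (\<lambda>s. (if s \<le> r then (s / r)\<^sup>2 else 0) + (if r < s then 1 else 0))" unfolding HH_def
 proof (rule lint_mono)
  fix s :: real assume "0 < s"
  then show "hfun (1 / r * s) \<le> (if s \<le> r then (s / r)\<^sup>2 else 0) + (if r < s then 1 else 0)" using hfun_le[of "s / r"] a by auto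
 qed (insert a, (assumption | rule lbnd_cmult lbnd_add lbnd_mom lbnd_hfun lbnd_KK lbnd_ww | simp)+)
 also have "\<dots> = KK N r + ww N r" unfolding KK_def ww_def using a by (intro lint_add lbnd_KK lbnd_ww)
 finally show ?thesis .
qed

lemma min_sq_le_hfun: "0 \<le> u \<Longrightarrow> hconst * min 1 (u\<^sup>2) \<le> hfun u"
proof (cases "u \<le> 1")
 case True
 assume "0 \<le> u"
 moreover have "hconst * min 1 (u\<^sup>2) \<le> hconst * u\<^sup>2" using hconst_pos by (intro mult_left_mono) auto
 ultimately show ?thesis using hfun_ge_sq[of u] True by linarith
next
 case False
 have "hconst * min 1 (u\<^sup>2) \<le> hconst * 1" using hconst_pos by (intro mult_left_mono) auto
 then show ?thesis using hfun_ge_1[of u] False by linarith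
qed

lemma mom2_le: "levy N \<Longrightarrow> 0 < l \<Longrightarrow> hconst * (l\<^sup>2 * mom N 2 l) \<le> HH N l"
 unfolding mom_def HH_def lint_cmult[symmetric]
proof (rule lint_mono)
 fix s :: real assume a: "0 < l" "0 < s"
 have "(l * s)\<^sup>2 * exp (- (l * s)) \<le> min 1 ((l * s)\<^sup>2)" using a sq_exp_le[of "l * s"] by (auto simp: mult_le_cancel_left1)
 then have "hconst * ((l * s)\<^sup>2 * exp (- (l * s))) \<le> hconst * min 1 ((l * s)\<^sup>2)" using hconst_pos by (intro mult_left_mono) auto
 also have "\<dots> \<le> hfun (l * s)" using a by (intro min_sq_le_hfun) auto
 finally show "hconst * (l\<^sup>2 * (s\<^sup>2 * exp (- l * s))) \<le> hfun (l * s)" by (simp add: power_mult_distrib mult.assoc)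
qed (assumption | rule lbnd_cmult lbnd_add lbnd_mom lbnd_hfun lbnd_KK lbnd_ww | simp)+

text \<open>The third moment is controlled by H as well; this bounds the ratio of third moment to
  cubed standard deviation in the normal approximation.\<close>

lemma mom3_le: "levy N \<Longrightarrow> 0 < l \<Longrightarrow> hconst * (l ^ 3 * mom N 3 l) \<le> 2 * HH N l"
 unfolding mom_def HH_def lint_cmult[symmetric]
proof (rule lint_mono)
 fix s :: real assume a: "0 < l" "0 < s"
 have "(l * s) ^ 3 * exp (- (l * s)) \<le> 2 * min 1 ((l * s)\<^sup>2)"
 proof (cases "l * s \<le> 1")
  case True
  have "(l * s) ^ 3 * exp (- (l * s)) \<le> (l * s) ^ 2 * 1" using a True by (intro mult_mono power_decreasing) auto
  then have "(l * s) ^ 3 * exp (- (l * s)) \<le> (l * s)\<^sup>2" by simp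
  moreover have "(l * s)\<^sup>2 \<le> 1" using a True by (simp add: power_le_one)
  moreover have "0 \<le> (l * s)\<^sup>2" by simp
  moreover have "min 1 ((l * s)\<^sup>2) = (l * s)\<^sup>2" using calculation by simp
  ultimately show ?thesis by linarith
 next
  case False
  then have "1 \<le> (l * s)\<^sup>2" by (simp add: one_le_power)
  then show ?thesis using cube_exp_le[of "l * s"] a by (simp add: min_def)
 qed
 then have "hconst * ((l * s) ^ 3 * exp (- (l * s))) \<le> hconst * (2 * min 1 ((l * s)\<^sup>2))" using hconst_pos by (intro mult_left_mono) auto
 also have "\<dots> \<le> 2 * hfun (l * s)" using min_sq_le_hfun[of "l * s"] a by simp
 finally show "hconst * (l ^ 3 * (s ^ 3 * exp (- l * s))) \<le> 2 * hfun (l * s)" by (simp add: power_mult_distrib mult.assoc)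
qed (assumption | rule lbnd_cmult lbnd_add lbnd_mom lbnd_hfun lbnd_KK lbnd_ww | simp)+

lemma mom2_ge: "levy N \<Longrightarrow> 0 < r \<Longrightarrow> exp (- 1) * KK N r \<le> (1 / r)\<^sup>2 * mom N 2 (1 / r)"
 unfolding mom_def KK_def lint_cmult[symmetric]
proof (rule lint_mono)
 fix s :: real assume a: "0 < r" "0 < s"
 show "exp (- 1) * (if s \<le> r then (s / r)\<^sup>2 else 0) \<le> (1 / r)\<^sup>2 * (s\<^sup>2 * exp (- (1 / r) * s))"
 proof (cases "s \<le> r")
  case True
  then have "exp (- 1) \<le> exp (- (1 / r) * s)" using a by (simp add: field_simps)
  then have "exp (- 1) * (s / r)\<^sup>2 \<le> exp (- (1 / r) * s) * (s / r)\<^sup>2" by (rule mult_right_mono) simp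
  then show ?thesis using True by (simp add: power_divide mult.commute)
 qed simp
qed (assumption | rule lbnd_cmult lbnd_add lbnd_mom lbnd_hfun lbnd_KK lbnd_ww | simp)+

text \<open>Taylor: x^2 / 2 minus at most x^2 / 6 for |x| <= 1.\<close>

lemma one_minus_cos_ge: "\<bar>x\<bar> \<le> 1 \<Longrightarrow> x\<^sup>2 / 3 \<le> 1 - cos (x::real)"
proof -
 assume x: "\<bar>x\<bar> \<le> 1"
 have "cmod (iexp x - (\<Sum>k \<le> 2. (\<i> * x)^k / fact k)) \<le> \<bar>x\<bar> ^ 3 / 6"
  using iexp_approx1[of x 2] by (simp add: numeral_3_eq_3 numeral_2_eq_2 fact_numeral)
 then have "\<bar>Re (iexp x - (\<Sum>k \<le> 2. (\<i> * x)^k / fact k))\<bar> \<le> \<bar>x\<bar> ^ 3 / 6" using abs_Re_le_cmod order_trans by blast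
 moreover have "Re (iexp x - (\<Sum>k \<le> 2. (\<i> * x)^k / fact k)) = cos x - (1 - x\<^sup>2 / 2)" by (simp add: numeral_2_eq_2 Re_exp power2_eq_square)
 moreover have "\<bar>x\<bar> ^ 3 \<le> x\<^sup>2" using power_decreasing[of 2 3 "\<bar>x\<bar>"] x by simp
 ultimately show ?thesis by linarith
qed

lemma lbnd_cos: "0 \<le> l \<Longrightarrow> lbnd (\<lambda>s. exp (- l * s) * (1 - cos (\<xi> * s)))"
proof (rule lbndI[where C="2 + \<bar>\<xi>\<bar>"])
 fix s :: real assume l: "0 \<le> l" and s: "0 < s"
 have 1: "\<bar>1 - cos (\<xi> * s)\<bar> \<le> (2 + \<bar>\<xi>\<bar>) * min 1 s"
 proof -
  have "norm (1 - exp (- (- \<i> * of_real \<xi>) * complex_of_real s)) \<le> (2 + norm (- \<i> * complex_of_real \<xi>)) * min 1 s"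
   by (rule norm_one_minus_exp_le) (use s in auto)
  moreover have "\<bar>Re (1 - exp (- (- \<i> * of_real \<xi>) * complex_of_real s))\<bar> \<le> norm (1 - exp (- (- \<i> * of_real \<xi>) * complex_of_real s))"
   by (rule abs_Re_le_cmod)
  ultimately show ?thesis by (simp add: Re_exp norm_mult)
 qed
 have "exp (- l * s) * \<bar>1 - cos (\<xi> * s)\<bar> \<le> 1 * \<bar>1 - cos (\<xi> * s)\<bar>" using l s by (intro mult_right_mono) auto
 then show "\<bar>exp (- l * s) * (1 - cos (\<xi> * s))\<bar> \<le> (2 + \<bar>\<xi>\<bar>) * min 1 s" using 1 by (simp add: abs_mult)
qed measurable

text \<open>Only jumps up to r are kept: on them the tilt costs at most a factor e, and the cosine
  is bounded by its quadratic expansion. This is the decay of the characteristic function of the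
  tilted law.\<close>

lemma cos_exponent_ge:
 assumes N: "levy N" and r: "0 < r" "\<bar>\<xi>\<bar> * r \<le> 1" "l * r \<le> 1" "0 \<le> l"
 shows "exp (- 1) / 3 * (\<bar>\<xi>\<bar> * r)\<^sup>2 * KK N r \<le> lint N (\<lambda>s. exp (- l * s) * (1 - cos (\<xi> * s)))" unfolding KK_def lint_cmult[symmetric]
proof (rule lint_mono[OF N])
 fix s :: real assume s: "0 < s"
 show "exp (- 1) / 3 * (\<bar>\<xi>\<bar> * r)\<^sup>2 * (if s \<le> r then (s / r)\<^sup>2 else 0) \<le> exp (- l * s) * (1 - cos (\<xi> * s))"
 proof (cases "s \<le> r")
  case True
  have "l * s \<le> l * r" using True r by (intro mult_left_mono) auto
  then have e: "exp (- 1) \<le> exp (- l * s)" using r by simp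
  have "\<bar>\<xi>\<bar> * s \<le> \<bar>\<xi>\<bar> * r" using True by (intro mult_left_mono) auto
  then have "\<bar>\<xi> * s\<bar> \<le> 1" using r s by (simp add: abs_mult)
  then have "(\<xi> * s)\<^sup>2 / 3 \<le> 1 - cos (\<xi> * s)" by (rule one_minus_cos_ge)
  then have "exp (- 1) * ((\<xi> * s)\<^sup>2 / 3) \<le> exp (- l * s) * (1 - cos (\<xi> * s))" using e by (intro mult_mono) auto
  moreover have "(\<bar>\<xi>\<bar> * r)\<^sup>2 * (s / r)\<^sup>2 = (\<xi> * s)\<^sup>2" using r by (simp add: power_mult_distrib power_divide)
  ultimately show ?thesis using True by (simp add: mult.assoc)
 qed simp
qed (insert r, (assumption | rule lbnd_cmult lbnd_add lbnd_mom lbnd_hfun lbnd_KK lbnd_ww lbnd_cos | simp)+)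

text \<open>Continuity is what makes the generalised inverse exact, w(w^{-1}(u)) = u, in
  \<open>s0_props\<close>.\<close>

lemma ww_isCont:
 assumes N: "levy N" and r: "0 < r"
 shows "isCont (ww N) r" unfolding continuous_at_sequentially
proof (intro allI impI)
 fix x :: "nat \<Rightarrow> real" assume x: "x \<longlonglongrightarrow> r"
 have [measurable]: "N \<in> borel_measurable borel" by (rule levy_measurable[OF N])
 \<comment> \<open>Late members of the sequence stay above r/2, which provides an integrable
   majorant.\<close>
 have ev: "\<forall>\<^sub>F n in sequentially. r / 2 < x n" using order_tendstoD(1)[OF x, of "r / 2"] r by simp
 then obtain n0 where n0: "\<And>n. n0 \<le> n \<Longrightarrow> r / 2 < x n" by (auto simp: eventually_sequentially)
 have "(\<lambda>n. \<integral>s. N s * (if x (n + n0) < s then 1 else 0) \<partial>lborel) \<longlonglongrightarrow> (\<integral>s. N s * (if r < s then 1 else 0) \<partial>lborel)"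
 proof (rule integral_dominated_convergence[where w="\<lambda>s. N s * (if r / 2 < s then 1 else 0)"])
  show "integrable lborel (\<lambda>s. N s * (if r / 2 < s then 1 else 0))" using r by (intro lbnd_integrable[OF N] lbnd_ww) simp
  have xn: "(\<lambda>n. x (n + n0)) \<longlonglongrightarrow> r" using x by (rule LIMSEQ_ignore_initial_segment)
  have "AE s in lborel. s \<noteq> r" by (rule AE_lborel_singleton)
  then show "AE s in lborel. (\<lambda>n. N s * (if x (n + n0) < s then 1 else 0)) \<longlonglongrightarrow> N s * (if r < s then 1 else 0)"
  proof eventually_elim
   case (elim s)
   have "\<forall>\<^sub>F n in sequentially. (x (n + n0) < s) = (r < s)"
   proof (cases "r < s")
    case True then show ?thesis using order_tendstoD(2)[OF xn True] by (auto elim!: eventually_mono)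
   next
    case False
    then have "s < r" using elim by simp
    from order_tendstoD(1)[OF xn this] False show ?thesis by (auto elim!: eventually_mono)
   qed
   then show ?case by (intro tendsto_eventually) (auto elim!: eventually_mono)
  qed
  show "AE s in lborel. norm (N s * (if x (n + n0) < s then 1 else 0)) \<le> N s * (if r / 2 < s then 1 else 0)" for n
   using n0[of "n + n0"] levy_nonneg[OF N] by (intro AE_I2) auto
 qed measurable
 then have "(\<lambda>n. ww N (x (n + n0))) \<longlonglongrightarrow> ww N r" by (simp add: ww_def lint_def)
 then show "(ww N \<circ> x) \<longlonglongrightarrow> ww N r" unfolding comp_def by (rule LIMSEQ_offset)
qed

section \<open>Weak scaling\<close>

lemma lint_interval_ge:
 assumes N: "levy N" and f: "lbnd f" "\<And>s. 0 < s \<Longrightarrow> 0 \<le> f s" and uv: "0 \<le> u" "u \<le> v" and mc: "0 \<le> m" "0 \<le> c"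
  and g: "\<And>s. u < s \<Longrightarrow> s \<le> v \<Longrightarrow> m \<le> N s" "\<And>s. u < s \<Longrightarrow> s \<le> v \<Longrightarrow> c \<le> f s"
 shows "m * c * (v - u) \<le> lint N f"
proof -
 have "m * c * (v - u) = (\<integral>s. indicator {u<..v} s *\<^sub>R (m * c) \<partial>lborel)" using uv by (simp add: mult.commute)
 also have "\<dots> \<le> (\<integral>s. N s * f s \<partial>lborel)"
 proof (rule integral_mono)
  show "integrable lborel (\<lambda>s. indicator {u<..v} s *\<^sub>R (m * c))" using uv by simp
  show "integrable lborel (\<lambda>s. N s * f s)" by (rule lbnd_integrable[OF N f(1)])
  fix s
  show "indicator {u<..v} s *\<^sub>R (m * c) \<le> N s * f s"
  proof (cases "s \<in> {u<..v}")
   case True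
   then show ?thesis using mc g[of s] levy_nonneg[OF N, of s] by (auto intro!: mult_mono)
  next
   case False
   then show ?thesis using f(2)[of s] levy_nonneg[OF N, of s] levy_zero[OF N, of s] by (cases "0 < s") auto
  qed
 qed
 finally show ?thesis by (simp add: lint_def)
qed

lemma powr_tail_integral:
 assumes a: "0 < (a::real)" and r: "0 < r"
 shows "integrable lborel (\<lambda>s. indicator {r..} s * s powr (- 1 - a))"
  "(\<integral>s. indicator {r..} s * s powr (- 1 - a) \<partial>lborel) = r powr (- a) / a"
proof -
 have lim: "((\<lambda>s. - (s powr (- a)) / a) \<longlongrightarrow> 0) at_top"
 proof -
  have "((\<lambda>s::real. s powr (- a)) \<longlongrightarrow> 0) at_top" using a by (intro tendsto_neg_powr filterlim_ident) auto
  from tendsto_divide[OF tendsto_minus[OF this] tendsto_const[of a]] a show ?thesis by simp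
 qed
 have nn: "(\<integral>\<^sup>+s. ennreal (s powr (- 1 - a)) * indicator {r..} s \<partial>lborel) = ennreal (0 - (- (r powr (- a)) / a))"
 proof (rule nn_integral_FTC_atLeast[OF _ _ _ lim])
  fix s assume s: "r \<le> s"
  then have s0: "0 < s" using r by simp
  have "((\<lambda>s. s powr (- a)) has_real_derivative (- a) * s powr (- a - 1)) (at s)" by (rule has_real_derivative_powr[OF s0])
  from DERIV_cdivide[OF DERIV_minus[OF this], of a]
  show "((\<lambda>s. - (s powr (- a)) / a) has_real_derivative s powr (- 1 - a)) (at s)"
   using a by (simp add: diff_diff_eq add.commute minus_diff_commute)
 qed auto
 have e: "(\<integral>\<^sup>+s. ennreal (indicator {r..} s * s powr (- 1 - a)) \<partial>lborel) = ennreal (r powr (- a) / a)"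
  unfolding nn[simplified, symmetric] by (intro nn_integral_cong) (auto simp: indicator_def)
 have "has_bochner_integral lborel (\<lambda>s. indicator {r..} s * s powr (- 1 - a)) (r powr (- a) / a)"
  by (rule has_bochner_integral_nn_integral[OF _ _ _ e]) (use a in auto)
 then show "integrable lborel (\<lambda>s. indicator {r..} s * s powr (- 1 - a))"
  "(\<integral>s. indicator {r..} s * s powr (- 1 - a) \<partial>lborel) = r powr (- a) / a" by (auto simp: has_bochner_integral_iff)
qed

lemma KK_scale_ge: "levy N \<Longrightarrow> 0 < r \<Longrightarrow> r \<le> r' \<Longrightarrow> (r / r')\<^sup>2 * KK N r \<le> KK N r'"
 unfolding KK_def lint_cmult[symmetric]
proof (rule lint_mono)
 fix s :: real assume "0 < r" "r \<le> r'" "0 < s"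
 then show "(r / r')\<^sup>2 * (if s \<le> r then (s / r)\<^sup>2 else 0) \<le> (if s \<le> r' then (s / r')\<^sup>2 else 0)" by (auto simp: power_divide)
qed (assumption | rule lbnd_cmult lbnd_KK | simp)+

text \<open>\<open>AD\<close> is almost monotonicity from points of \<open>Y\<close> to everything
  on their right, even outside \<open>Y\<close>. \<open>VV\<close> bounds the growth towards 0, with
  an integer exponent so that ordinary powers suffice. \<open>LL\<close> is the lower scaling, asked
  for only up to \<open>R0\<close>. \<open>L\<close> is the largest scale at which the comparisons
  below are needed.\<close>

locale scaling =
 fixes N :: "real \<Rightarrow> real" and Y :: "real set" and R0 C0 a L :: real and k :: nat
 assumes N: "levy N" and Y_pos: "\<And>y. y \<in> Y \<Longrightarrow> 0 < y" and R0: "R0 \<in> Y"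
  and Y_down: "\<And>s y. 0 < s \<Longrightarrow> s \<le> y \<Longrightarrow> y \<in> Y \<Longrightarrow> s \<in> Y"
  and C0: "1 \<le> C0" and a_pos: "0 < a" and L: "R0 \<le> L"
  and N_pos: "\<And>y. y \<in> Y \<Longrightarrow> 0 < N y"
  and AD: "\<And>y s. y \<in> Y \<Longrightarrow> y \<le> s \<Longrightarrow> N s \<le> C0 * N y"
  and VV: "\<And>y s. y \<in> Y \<Longrightarrow> 0 < s \<Longrightarrow> s \<le> y \<Longrightarrow> N s \<le> C0 * (y / s) ^ k * N y"
  and LL: "\<And>r R. 0 < r \<Longrightarrow> r \<le> R \<Longrightarrow> R \<le> R0 \<Longrightarrow> (R / r) powr (1 + a) * N R \<le> C0 * N r"
begin

lemma R0_pos: "0 < R0" by (rule Y_pos[OF R0])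

lemma L_pos: "0 < L" using R0_pos L by simp

lemma N_nonneg: "0 \<le> N s" by (rule levy_nonneg[OF N])

lemma N_R0_pos: "0 < N R0" by (rule N_pos[OF R0])

text \<open>Up to \<open>R0\<close>, lower scaling bounds N s by a multiple of N r times the power
  -1-a of s/r; the integral of that power is explicit.\<close>

lemma ww_le_small:
 assumes r: "0 < r" "r \<le> R0"
 shows "ww N r \<le> C0 / a * r * N r + ww N R0"
proof -
 let ?g = "\<lambda>s. C0 * N r * r powr (1 + a) * (indicator {r..} s * s powr (- 1 - a))"
 have i1: "integrable lborel ?g" by (intro integrable_mult_right powr_tail_integral a_pos r)
 have i2: "integrable lborel (\<lambda>s. N s * (if R0 < s then 1 else 0))" by (rule lbnd_integrable[OF N lbnd_ww[OF R0_pos]])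
 have "ww N r \<le> (\<integral>s. ?g s + N s * (if R0 < s then 1 else 0) \<partial>lborel)" unfolding ww_def lint_def
 proof (rule integral_mono)
  show "integrable lborel (\<lambda>s. N s * (if r < s then 1 else 0))" by (rule lbnd_integrable[OF N lbnd_ww[OF r(1)]])
  show "integrable lborel (\<lambda>s. ?g s + N s * (if R0 < s then 1 else 0))" using i1 i2 by simp
  fix s
  show "N s * (if r < s then 1 else 0) \<le> ?g s + N s * (if R0 < s then 1 else 0)"
  proof (cases "r < s \<and> s \<le> R0")
   case True
   then have s: "0 < s" using r by simp
   have "(s / r) powr (1 + a) * N s \<le> C0 * N r" using True r by (intro LL) auto
   then have "s powr (1 + a) / r powr (1 + a) * N s \<le> C0 * N r" using s r by (simp add: powr_divide)
   then have "N s \<le> C0 * N r * (r powr (1 + a) / s powr (1 + a))" using s r by (simp add: field_simps)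
   also have "r powr (1 + a) / s powr (1 + a) = r powr (1 + a) * s powr (- 1 - a)"
    using s by (simp add: powr_minus_divide[of s "1 + a", simplified])
   finally show ?thesis using True by (simp add: mult.assoc)
  next
   case False
   then show ?thesis using N_nonneg C0 r by (auto intro!: mult_nonneg_nonneg)
  qed
 qed
 also have "\<dots> = (\<integral>s. ?g s \<partial>lborel) + ww N R0" unfolding ww_def lint_def by (rule Bochner_Integration.integral_add[OF i1 i2])
 also have "(\<integral>s. ?g s \<partial>lborel) = C0 * N r * r powr (1 + a) * (r powr (- a) / a)"
  by (simp only: integral_mult_right_zero powr_tail_integral(2)[OF a_pos r(1)])
 also have "\<dots> = C0 / a * r * N r" using r by (simp add: powr_add powr_minus field_simps)
 finally show ?thesis .
qed

text \<open>Lower scaling makes r N r almost decreasing up to \<open>R0\<close>; from there to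
  \<open>L\<close> only the polynomial bound \<open>VV\<close> is used. The lemma serves to absorb
  the constant \<open>ww N R0\<close> into r N r.\<close>

lemma rN_lower: "\<exists>c>0. \<forall>r\<in>Y. r \<le> L \<longrightarrow> c \<le> r * N r"
proof -
 define c where "c = min (R0 * N R0 / C0) (R0 * (N R0 / (C0 * (L / R0) ^ k)))"
 have Lk: "0 < (L / R0) ^ k" using L_pos R0_pos by simp
 have "0 < c" unfolding c_def using R0_pos N_R0_pos C0 Lk by simp
 moreover have "c \<le> r * N r" if "r \<in> Y" "r \<le> L" for r
 proof (cases "r \<le> R0")
  case True
  have r: "0 < r" by (rule Y_pos[OF that(1)])
  have x: "1 \<le> R0 / r" using True r by simp
  have "R0 / r \<le> (R0 / r) powr (1 + a)" using powr_mono[of 1 "1 + a" "R0 / r"] x a_pos r R0_pos by simp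
  then have "R0 / r * N R0 \<le> C0 * N r" using LL[OF r True order_refl] N_R0_pos by (meson less_imp_le mult_right_mono order_trans)
  then have "R0 * N R0 / C0 \<le> r * N r" using r C0 by (simp add: field_simps)
  then show ?thesis unfolding c_def by simp
 next
  case False
  have r: "0 < r" by (rule Y_pos[OF that(1)])
  have "N R0 \<le> C0 * (r / R0) ^ k * N r" using False R0_pos by (intro VV that) auto
  also have "\<dots> \<le> C0 * (L / R0) ^ k * N r"
   using that R0_pos C0 N_nonneg r by (intro mult_right_mono mult_left_mono power_mono divide_right_mono) auto
  finally have "N R0 / (C0 * (L / R0) ^ k) \<le> N r" using C0 Lk by (simp add: divide_le_eq mult.commute)
  then have "R0 * (N R0 / (C0 * (L / R0) ^ k)) \<le> r * N r" using False R0_pos N_R0_pos C0 Lk r by (intro mult_mono) auto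
  then show ?thesis unfolding c_def by simp
 qed
 ultimately show ?thesis by blast
qed

lemma ww_le: "\<exists>C>0. \<forall>r\<in>Y. r \<le> L \<longrightarrow> ww N r \<le> C * (r * N r)"
proof -
 obtain c where c: "0 < c" "\<And>r. r \<in> Y \<Longrightarrow> r \<le> L \<Longrightarrow> c \<le> r * N r" using rN_lower by blast
 show ?thesis
 proof (intro exI[of _ "C0 / a + ww N R0 / c"] conjI ballI impI)
  show "0 < C0 / a + ww N R0 / c" using C0 a_pos c ww_nonneg[OF N] by (intro add_pos_nonneg) auto
  fix r assume r: "r \<in> Y" "r \<le> L"
  have r0: "0 < r" by (rule Y_pos[OF r(1)])
  have 1: "ww N R0 \<le> ww N R0 / c * (r * N r)" using mult_left_mono[OF c(2)[OF r], of "ww N R0 / c"] c(1) ww_nonneg[OF N, of R0] by simp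
  have 2: "ww N r \<le> C0 / a * (r * N r) + ww N R0"
  proof (cases "r \<le> R0")
   case True then show ?thesis using ww_le_small[OF r0 True] by (simp add: mult.assoc)
  next
   case False
   have "0 \<le> C0 / a * (r * N r)" using C0 a_pos r0 N_nonneg by simp
   then show ?thesis using ww_antimono[OF N R0_pos, of r] False by linarith
  qed
  show "ww N r \<le> (C0 / a + ww N R0 / c) * (r * N r)" using 1 2 by (simp only: distrib_right)
 qed
qed

text \<open>Only the jumps in (r/2, r] are counted: there the kernel is at least 1/4 and N is at
  least N r / C0.\<close>

lemma KK_ge_rN:
 assumes "r \<in> Y"
 shows "r * N r / (8 * C0) \<le> KK N r"
proof -
 have r: "0 < r" by (rule Y_pos[OF assms])
 have "N r / C0 * (1 / 4) * (r - r / 2) \<le> KK N r" unfolding KK_def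
 proof (rule lint_interval_ge[OF N lbnd_KK[OF r]])
  fix s assume s: "r / 2 < s" "s \<le> r"
  have "N r \<le> C0 * N s" using s r by (intro AD Y_down[OF _ s(2) assms]) auto
  then show "N r / C0 \<le> N s" using C0 by (simp add: divide_le_eq mult.commute)
  have "1 / 2 \<le> s / r" using s r by (simp add: field_simps)
  then have "(1 / 2)\<^sup>2 \<le> (s / r)\<^sup>2" by (intro power_mono) auto
  then show "1 / 4 \<le> (if s \<le> r then (s / r)\<^sup>2 else 0)" using s by (simp add: power2_eq_square)
 qed (use r C0 N_nonneg in auto)
 then show ?thesis by (simp add: field_simps)
qed

lemma KK_pos: "0 < r \<Longrightarrow> 0 < KK N r"
proof -
 assume r: "0 < r"
 have 1: "0 < KK N r" if "r \<in> Y" for r using KK_ge_rN[OF that] Y_pos[OF that] N_pos[OF that] C0 by (auto intro: less_le_trans[rotated])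
 show ?thesis
 proof (cases "r \<le> R0")
  case True then show ?thesis using 1[OF Y_down[OF r True R0]] by simp
 next
  case False
  have "0 < (R0 / r)\<^sup>2 * KK N R0" using 1[OF R0] R0_pos r by simp
  also have "\<dots> \<le> KK N r" by (rule KK_scale_ge[OF N R0_pos]) (use False in simp)
  finally show ?thesis .
 qed
qed

text \<open>The tail at r is at most a multiple of r N r, hence of the truncated second moment.
  Beyond \<open>R0\<close> one falls back on \<open>R0\<close>, where a factor (L/R0)^2
  suffices.\<close>

lemma HH_le_KK: "\<exists>C>0. \<forall>r. 0 < r \<longrightarrow> r \<le> L \<longrightarrow> HH N (1 / r) \<le> C * KK N r"
proof -
 obtain C where C: "0 < C" "\<And>r. r \<in> Y \<Longrightarrow> r \<le> L \<Longrightarrow> ww N r \<le> C * (r * N r)" using ww_le by blast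
 define D where "D = 1 + C * (8 * C0)"
 have D1: "1 \<le> D" unfolding D_def using C C0 by simp
 have 1: "HH N (1 / r) \<le> D * KK N r" if "0 < r" "r \<le> R0" for r
 proof -
  have rY: "r \<in> Y" by (rule Y_down[OF that R0])
  have "C * (r * N r) \<le> C * (8 * C0 * KK N r)" using KK_ge_rN[OF rY] C C0 by (intro mult_left_mono) (auto simp: field_simps)
  then have "ww N r \<le> C * (8 * C0) * KK N r" using C(2)[OF rY] that L by simp
  then show ?thesis using HH_le_KK_ww[OF N that(1)] by (simp add: D_def distrib_right)
 qed
 show ?thesis
 proof (intro exI[of _ "D * (L / R0)\<^sup>2"] conjI allI impI)
  show "0 < D * (L / R0)\<^sup>2" using D1 L_pos R0_pos by simp
  fix r assume r: "0 < r" "r \<le> L"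
  have LR: "1 \<le> (L / R0)\<^sup>2" using L R0_pos by (simp add: one_le_power)
  show "HH N (1 / r) \<le> D * (L / R0)\<^sup>2 * KK N r"
  proof (cases "r \<le> R0")
   case True
   have "D * KK N r * 1 \<le> D * KK N r * (L / R0)\<^sup>2" using LR D1 KK_nonneg[OF N] by (intro mult_left_mono) auto
   then show ?thesis using 1[OF r(1) True] by (simp add: mult.commute mult.left_commute)
  next
   case False
   have "HH N (1 / r) \<le> HH N (1 / R0)" using False R0_pos r by (intro HH_mono[OF N] divide_left_mono) auto
   also have "\<dots> \<le> D * KK N R0" using 1[of R0] R0_pos by simp
   also have "KK N R0 \<le> (r / R0)\<^sup>2 * KK N r" using KK_scale_ge[OF N R0_pos, of r] False R0_pos r by (simp add: field_simps)
   also have "\<dots> \<le> (L / R0)\<^sup>2 * KK N r" using r R0_pos KK_nonneg[OF N] by (intro mult_right_mono power_mono divide_right_mono) auto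
   finally show ?thesis using D1 by (simp add: mult.assoc)
  qed
 qed
qed

text \<open>The substitution s = u/x transfers the scaling of N to \<open>KK\<close>; the Jacobian
  takes one of the 1 + a powers of x.\<close>

lemma KK_small_scale:
 assumes r: "0 < r" "r \<le> R0" and x: "1 \<le> x"
 shows "x powr a * KK N r \<le> C0 * KK N (r / x)"
proof -
 have [measurable]: "N \<in> borel_measurable borel" by (rule levy_measurable[OF N])
 have x0: "0 < x" using x by simp
 let ?f = "\<lambda>s. N s * (if s \<le> r / x then (s / (r / x))\<^sup>2 else 0)"
 have i: "integrable lborel ?f" by (rule lbnd_integrable[OF N lbnd_KK]) (use r x0 in simp)
 have "(\<integral>s. ?f s \<partial>lborel) = \<bar>1 / x\<bar> *\<^sub>R (\<integral>u. ?f (0 + (1 / x) * u) \<partial>lborel)" by (rule lborel_integral_real_affine) (use x0 in simp)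
 then have "(\<integral>u. ?f (0 + (1 / x) * u) \<partial>lborel) = x * KK N (r / x)"
  unfolding KK_def lint_def using x0 by (simp only: real_scaleR_def abs_divide abs_one abs_of_pos) simp
 moreover have "(\<integral>u. (x powr (1 + a) / C0) * (N u * (if u \<le> r then (u / r)\<^sup>2 else 0)) \<partial>lborel) \<le> (\<integral>u. ?f (0 + (1 / x) * u) \<partial>lborel)"
 proof (rule integral_mono)
  show "integrable lborel (\<lambda>u. (x powr (1 + a) / C0) * (N u * (if u \<le> r then (u / r)\<^sup>2 else 0)))"
   by (intro integrable_mult_right lbnd_integrable[OF N lbnd_KK[OF r(1)]])
  show "integrable lborel (\<lambda>u. ?f (0 + (1 / x) * u))" by (rule lborel_integrable_real_affine[OF i]) (use x0 in simp)
  fix u :: real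
  show "(x powr (1 + a) / C0) * (N u * (if u \<le> r then (u / r)\<^sup>2 else 0)) \<le> ?f (0 + (1 / x) * u)"
  proof (cases "0 < u \<and> u \<le> r")
   case True
   have "(u / (u / x)) powr (1 + a) * N u \<le> C0 * N (u / x)"
    using True r x0 x by (intro LL) (auto simp: divide_le_eq mult_left_le mult_le_cancel_left1)
   then have "x powr (1 + a) / C0 * N u \<le> N (u / x)" using True C0 x0 by (simp add: field_simps)
   then have "x powr (1 + a) / C0 * N u * (u / r)\<^sup>2 \<le> N (u / x) * (u / r)\<^sup>2" by (rule mult_right_mono) simp
   moreover have "u / x \<le> r / x" using True x0 by (simp add: divide_right_mono)
   ultimately show ?thesis using True x0 by (simp add: mult.assoc)
  next
   case False
   then have "(x powr (1 + a) / C0) * (N u * (if u \<le> r then (u / r)\<^sup>2 else 0)) = 0" using levy_zero[OF N, of u] by auto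
   moreover have "0 \<le> ?f (0 + (1 / x) * u)" using N_nonneg by (intro mult_nonneg_nonneg) auto
   ultimately show ?thesis by (simp only:)
  qed
 qed
 moreover have "(\<integral>u. (x powr (1 + a) / C0) * (N u * (if u \<le> r then (u / r)\<^sup>2 else 0)) \<partial>lborel) = x powr (1 + a) / C0 * KK N r"
  unfolding KK_def lint_def by (rule integral_mult_right_zero)
 ultimately have "x powr (1 + a) / C0 * KK N r \<le> x * KK N (r / x)" by (simp only:)
 then have "(1 / x) * (x powr (1 + a) / C0 * KK N r) \<le> KK N (r / x)" using x0 C0 by (simp add: field_simps split: if_splits)
 then have "x powr a / C0 * KK N r \<le> KK N (r / x)" using x0 by (simp add: powr_add)
 then show ?thesis using C0 by (simp add: field_simps)
qed

text \<open>The lower scaling of H with index a, inherited from \<open>KK\<close> up to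
  \<open>R0\<close> and extended to \<open>L\<close>. All later comparisons of scales rest on
  it.\<close>

lemma HH_scale: "\<exists>c>0. \<forall>r x. 0 < r \<longrightarrow> r \<le> L \<longrightarrow> 1 \<le> x \<longrightarrow> c * x powr a * HH N (1 / r) \<le> HH N (x / r)"
proof -
 obtain C where C: "0 < C" "\<And>r. 0 < r \<Longrightarrow> r \<le> L \<Longrightarrow> HH N (1 / r) \<le> C * KK N r" using HH_le_KK by blast
 define c where "c = min 1 (hconst / (C0 * C))"
 have hc: "0 < hconst" using hconst_pos by linarith
 have c0: "0 < c" "c \<le> 1" unfolding c_def using C C0 hc by auto
 have 1: "c * x powr a * HH N (1 / r) \<le> HH N (x / r)" if r: "0 < r" "r \<le> R0" and x: "1 \<le> x" for r x
 proof -
  have "c * x powr a * HH N (1 / r) \<le> hconst / (C0 * C) * x powr a * (C * KK N r)"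
   using C(2)[of r] r L HH_nonneg[OF N, of "1 / r"] C C0 hc c0 unfolding c_def by (intro mult_mono) auto
  also have "\<dots> = hconst * (x powr a * KK N r / C0)" using C by (simp add: field_simps)
  also have "\<dots> \<le> hconst * KK N (r / x)" using KK_small_scale[OF r x] hc C0 by (intro mult_left_mono) (auto simp: field_simps)
  also have "\<dots> \<le> HH N (1 / (r / x))" using r x by (intro hconst_KK_le[OF N]) auto
  finally show ?thesis by simp
 qed
 \<comment> \<open>For r between \<open>R0\<close> and \<open>L\<close>: if r <= x R0, scaling is
   started at \<open>R0\<close> with the factor x R0 / r; otherwise x <= L/R0, and monotonicity of H
   is enough. Both losses are paid by (R0/L)^a.\<close>
 define d where "d = c * (R0 / L) powr a"
 have RL: "0 < R0 / L" "R0 / L \<le> 1" using R0_pos L by auto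
 have RLa: "0 < (R0 / L) powr a" "(R0 / L) powr a \<le> 1" using RL a_pos by (auto simp: powr_le1)
 have dc: "0 < d" "d \<le> c" "d \<le> (R0 / L) powr a" unfolding d_def using RLa c0 by (auto simp: mult_left_le mult_left_le_one_le)
 show ?thesis
 proof (rule exI[of _ d], intro conjI allI impI)
  show "0 < d" by (rule dc)
  fix r x assume r: "0 < r" "r \<le> L" and x: "1 \<le> (x::real)"
  have h0: "0 \<le> x powr a * HH N (1 / r)" using HH_nonneg[OF N, of "1 / r"] r by simp
  show "d * x powr a * HH N (1 / r) \<le> HH N (x / r)"
  proof (cases "r \<le> R0")
   case True
   show ?thesis using 1[OF r(1) True x] mult_right_mono[OF dc(2) h0] by (simp add: mult.assoc)
  next
   case False
   show ?thesis
   proof (cases "r \<le> x * R0")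
    case True
    have xr: "1 \<le> x * R0 / r" using True r by simp
    have "d * x powr a * HH N (1 / r) = c * ((R0 / L) * x) powr a * HH N (1 / r)" unfolding d_def using RL x by (subst powr_mult) auto
    also have "\<dots> \<le> c * (x * R0 / r) powr a * HH N (1 / R0)"
    proof -
     have "x * R0 / L \<le> x * R0 / r" using r L_pos R0_pos x by (intro divide_left_mono) auto
     then have "((R0 / L) * x) powr a \<le> (x * R0 / r) powr a" using a_pos RL x
      by (intro powr_mono2) (use R0_pos L_pos in \<open>auto simp: mult.commute\<close>)
     then have p: "c * ((R0 / L) * x) powr a \<le> c * (x * R0 / r) powr a" using c0 by (intro mult_left_mono) auto
     have q: "HH N (1 / r) \<le> HH N (1 / R0)" using False R0_pos r by (intro HH_mono[OF N] divide_left_mono) auto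
     show ?thesis by (rule mult_mono[OF p q]) (use c0 HH_nonneg[OF N, of "1 / r"] r in simp_all)
    qed
    also have "\<dots> \<le> HH N (x * R0 / r / R0)" by (rule 1[OF R0_pos order_refl xr])
    finally show ?thesis using R0_pos by simp
   next
    case False
    have "d * x powr a \<le> (R0 / L) powr a * x powr a" using dc by (intro mult_right_mono) auto
    also have "\<dots> = (R0 / L * x) powr a" using RL x by (subst powr_mult) auto
    also have "\<dots> \<le> 1"
    proof (rule powr_le1)
     have "x * R0 \<le> L" using False r by linarith
     then have "R0 / L * x \<le> 1" using L_pos by (simp add: field_simps)
     moreover have "0 \<le> R0 / L * x" using R0_pos L_pos x by simp
     ultimately show "\<bar>R0 / L * x\<bar> \<le> 1" by simp
    qed (use a_pos in auto)
    finally have "d * x powr a * HH N (1 / r) \<le> 1 * HH N (1 / r)" using HH_nonneg[OF N, of "1 / r"] r by (intro mult_right_mono) auto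
    also have "\<dots> \<le> HH N (x / r)" using r x by (simp, intro HH_mono[OF N] divide_right_mono) auto
    finally show ?thesis .
   qed
  qed
 qed
qed

lemma mom_pos: "0 < l \<Longrightarrow> 0 < mom N 2 l"
proof -
 assume l: "0 < l"
 have "0 < exp (- 1) * KK N (1 / l)" using KK_pos[of "1 / l"] l by simp
 also have "\<dots> \<le> l\<^sup>2 * mom N 2 l" using mom2_ge[OF N, of "1 / l"] l by simp
 finally show ?thesis using l by (simp add: zero_less_mult_iff)
qed

lemma HH_strict_mono: "0 < l \<Longrightarrow> l < l' \<Longrightarrow> HH N l < HH N l'"
proof (rule DERIV_pos_imp_increasing[of l l' "HH N"])
 fix x assume "0 < l" "l \<le> x" "x \<le> l'"
 then have "0 < x" by linarith
 then show "\<exists>y. (HH N has_real_derivative y) (at x) \<and> 0 < y"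
  using HH_deriv[OF N, of x] mom_pos[of x] by (intro exI[of _ "x * mom N 2 x"] conjI) auto
qed

lemma HH_pos: "0 < l \<Longrightarrow> 0 < HH N l"
 using HH_strict_mono[of "l / 2" l] HH_nonneg[OF N, of "l / 2"] by simp

lemma mom1_strict_antimono: "0 < l \<Longrightarrow> l < l' \<Longrightarrow> mom N 1 l' < mom N 1 l"
proof (rule DERIV_neg_imp_decreasing[of l l' "mom N 1"])
 fix x assume "0 < l" "l \<le> x" "x \<le> l'"
 then have "0 < x" by linarith
 then show "\<exists>y. (mom N 1 has_real_derivative y) (at x) \<and> y < 0"
  using mom_deriv[OF N, of x 1] mom_pos[of x] by (intro exI[of _ "- mom N 2 x"] conjI) (auto simp: numeral_2_eq_2)
qed

section \<open>The scales \<open>rho\<close> and \<open>s0\<close>\<close>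

text \<open>H lies below phi, which tends to 0 at 0, and \<open>HH_scale\<close> makes H unbounded;
  the rest is the intermediate value theorem.\<close>

lemma HH_surj:
 assumes u: "0 < u"
 shows "\<exists>l>0. HH N l = u"
proof -
 obtain n where n: "lexp N (1 / real (Suc n)) < u"
  using order_tendstoD(2)[OF lexp_tendsto_0[OF N] u] by (auto simp: eventually_sequentially)
 define l1 where "l1 = 1 / real (Suc n)"
 have l1: "0 < l1" by (simp add: l1_def)
 have a1: "HH N l1 < u"
 proof -
  have "0 \<le> l1 * mom N 1 l1" using l1 mom_nonneg[OF N, of 1 l1] by simp
  then show ?thesis using HH_eq[OF N l1] n unfolding l1_def[symmetric] by linarith
 qed
 obtain c where c: "0 < c" "\<And>r x. 0 < r \<Longrightarrow> r \<le> L \<Longrightarrow> 1 \<le> x \<Longrightarrow> c * x powr a * HH N (1 / r) \<le> HH N (x / r)" using HH_scale by blast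
 define q where "q = c * HH N (1 / L)"
 have q: "0 < q" unfolding q_def using c HH_pos[of "1 / L"] L_pos by simp
 define x where "x = max 1 ((u / q) powr (1 / a))"
 have x: "1 \<le> x" by (simp add: x_def)
 have "u / q = ((u / q) powr (1 / a)) powr a" using u q a_pos by (simp add: powr_powr)
 also have "\<dots> \<le> x powr a" using a_pos by (intro powr_mono2) (auto simp: x_def)
 finally have "u \<le> q * x powr a" using q by (simp add: divide_le_eq mult.commute)
 also have "\<dots> \<le> HH N (x / L)" using c(2)[OF L_pos order_refl x] by (simp add: q_def mult_ac)
 finally have a2: "u \<le> HH N (x / L)" .
 have xl: "0 < x / L" using x L_pos by simp
 have le: "l1 \<le> x / L"
 proof (rule ccontr)
  assume "\<not> l1 \<le> x / L"
  then have "HH N (x / L) \<le> HH N l1" using xl by (intro HH_mono[OF N]) auto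
  then show False using a1 a2 by simp
 qed
 have "\<exists>l\<ge>l1. l \<le> x / L \<and> HH N l = u"
 proof (rule IVT[OF less_imp_le[OF a1] a2 le], intro allI impI)
  fix z assume "l1 \<le> z \<and> z \<le> x / L"
  then show "isCont (HH N) z" using HH_deriv[OF N, of z] l1 DERIV_isCont by force
 qed
 then obtain l where "l1 \<le> l" "HH N l = u" by blast
 then show ?thesis using l1 by (intro exI[of _ l]) auto
qed

definition rho :: "real \<Rightarrow> real" where "rho t = 1 / (THE l. 0 < l \<and> HH N l = 1 / t)"

lemma HH_inj: "0 < l \<Longrightarrow> 0 < l' \<Longrightarrow> HH N l = HH N l' \<Longrightarrow> l = l'"
 using HH_strict_mono[of l l'] HH_strict_mono[of l' l] by (cases l l' rule: linorder_cases) auto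

lemma rho_props:
 assumes "0 < t"
 shows "0 < rho t" "HH N (1 / rho t) = 1 / t"
proof -
 have "\<exists>!l. 0 < l \<and> HH N l = 1 / t" using HH_surj[of "1 / t"] assms HH_inj by auto
 from theI'[OF this] show "0 < rho t" "HH N (1 / rho t) = 1 / t" by (auto simp: rho_def)
qed

lemma le_rho_iff:
 assumes "0 < t" "0 < r"
 shows "r \<le> rho t \<longleftrightarrow> 1 \<le> t * HH N (1 / r)"
proof
 assume "r \<le> rho t"
 then have "HH N (1 / rho t) \<le> HH N (1 / r)" using assms rho_props(1)[OF assms(1)] by (intro HH_mono[OF N] divide_left_mono) auto
 then show "1 \<le> t * HH N (1 / r)" using assms rho_props(2)[OF assms(1)] by (simp add: field_simps)
next
 assume h: "1 \<le> t * HH N (1 / r)"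
 show "r \<le> rho t"
 proof (rule ccontr)
  assume "\<not> r \<le> rho t"
  then have "HH N (1 / r) < HH N (1 / rho t)" using assms rho_props(1)[OF assms(1)] by (intro HH_strict_mono divide_strict_left_mono) auto
  then show False using h assms rho_props(2)[OF assms(1)] by (simp add: field_simps)
 qed
qed

lemma rho_mono: "0 < t \<Longrightarrow> t \<le> t' \<Longrightarrow> rho t \<le> rho t'"
proof -
 assume t: "0 < t" "t \<le> t'"
 have "1 = t * HH N (1 / rho t)" using rho_props[OF t(1)] t by simp
 also have "\<dots> \<le> t' * HH N (1 / rho t)" using t rho_props(1)[OF t(1)] by (intro mult_right_mono HH_nonneg[OF N]) auto
 finally show ?thesis using t rho_props(1)[OF t(1)] by (subst le_rho_iff) auto
qed

definition s0 :: "real \<Rightarrow> real" where "s0 t = Inf {r. 0 < r \<and> ww N r \<le> 2 * exp 1 / t}"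

text \<open>At r = R0/x lower scaling makes N of order x^(1+a), and the interval (r/2, r] has length
  of order 1/x, so the tail grows like x^a. This keeps \<open>s0 t\<close> away from 0.\<close>

lemma ww_unbounded: "\<exists>r>0. u < ww N r"
proof -
 define c where "c = R0 * N R0 / (2 * C0 * C0)"
 have c: "0 < c" unfolding c_def using R0_pos N_R0_pos C0 by simp
 define x where "x = max 1 ((\<bar>u\<bar> / c + 1) powr (1 / a))"
 have x: "1 \<le> x" by (simp add: x_def)
 define r where "r = R0 / x"
 have r: "0 < r" "r \<le> R0" unfolding r_def using x R0_pos by (auto simp: divide_le_eq mult_le_cancel_left1)
 have "x powr (1 + a) * N R0 \<le> C0 * N r" using LL[OF r order_refl] x R0_pos by (simp add: r_def)
 then have n: "x powr (1 + a) * N R0 / C0 \<le> N r" using C0 by (simp add: divide_le_eq mult.commute)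
 have "N r / C0 * 1 * (r - r / 2) \<le> ww N (r / 2)" unfolding ww_def
 proof (rule lint_interval_ge[OF N lbnd_ww])
  fix s assume s: "r / 2 < s" "s \<le> r"
  have "N r \<le> C0 * N s" using s r by (intro AD Y_down[OF _ s(2) Y_down[OF r R0]]) auto
  then show "N r / C0 \<le> N s" using C0 by (simp add: divide_le_eq mult.commute)
 qed (use r C0 N_nonneg in auto)
 moreover have "c * x powr a \<le> N r / C0 * 1 * (r - r / 2)"
 proof -
  have "c * x powr a = (x powr (1 + a) * N R0 / C0) / C0 * (r / 2)" unfolding c_def r_def using x by (simp add: powr_add field_simps)
  also have "\<dots> \<le> N r / C0 * (r / 2)" using n C0 r by (intro mult_right_mono divide_right_mono) auto
  finally show ?thesis by simp
 qed
 moreover have "u < c * x powr a"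
 proof -
  have p: "0 < \<bar>u\<bar> / c + 1" using c by (intro add_nonneg_pos) auto
  have "\<bar>u\<bar> / c + 1 = ((\<bar>u\<bar> / c + 1) powr (1 / a)) powr a" using a_pos p by (simp add: powr_powr)
  also have "\<dots> \<le> x powr a" using a_pos by (intro powr_mono2) (auto simp: x_def)
  finally have "\<bar>u\<bar> / c < x powr a" by linarith
  then have "\<bar>u\<bar> < c * x powr a" using c by (simp add: divide_less_eq mult.commute)
  then show ?thesis by linarith
 qed
 ultimately have "u < ww N (r / 2)" by linarith
 then show ?thesis using r by (intro exI[of _ "r / 2"]) auto
qed

text \<open>The point \<open>rho t\<close> satisfies the inequality that defines the infimum,
  because h w(rho t) <= H(1/rho t) = 1/t and h 2 e >= 1 with h = \<open>hconst\<close>. The tail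
  equals its level at \<open>s0 t\<close> by one-sided limits from both sides.\<close>

lemma s0_props:
 assumes t: "0 < t"
 shows "0 < s0 t" "s0 t \<le> rho t" "ww N (s0 t) = 2 * exp 1 / t"
proof -
 let ?u = "2 * exp 1 / t" and ?A = "{r. 0 < r \<and> ww N r \<le> 2 * exp 1 / t}"
 have rin: "rho t \<in> ?A"
 proof -
  have "hconst * ww N (rho t) \<le> 1 / t" using hconst_ww_le[OF N rho_props(1)[OF t]] rho_props(2)[OF t] by simp
  also have "\<dots> \<le> hconst * (2 * exp 1) / t" using hconst_pos t by (intro divide_right_mono) auto
  finally have "hconst * ww N (rho t) \<le> hconst * ?u" by simp
  moreover have "0 < hconst" using hconst_pos by linarith
  ultimately have "ww N (rho t) \<le> ?u" by (simp only: mult_le_cancel_left_pos)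
  then show ?thesis using rho_props(1)[OF t] by simp
 qed
 have bb: "bdd_below ?A" by (rule bdd_belowI[of _ 0]) auto
 show le: "s0 t \<le> rho t" unfolding s0_def by (rule cInf_lower[OF rin bb])
 obtain r where r: "0 < r" "?u < ww N r" using ww_unbounded by blast
 have "r \<le> s0 t" unfolding s0_def
 proof (rule cInf_greatest)
  fix q assume "q \<in> ?A"
  then show "r \<le> q" using ww_antimono[OF N, of q r] r by (cases "r \<le> q") auto
 qed (use rin in auto)
 then show pos: "0 < s0 t" using r by simp
 have above: "ww N q \<le> ?u" if q: "s0 t < q" for q
 proof -
  obtain q' where "q' \<in> ?A" "q' < q" using cInf_lessD[of ?A q, OF _ q[unfolded s0_def]] rin by blast
  then show ?thesis using ww_antimono[OF N, of q' q] by auto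
 qed
 have below: "?u \<le> ww N q" if "0 < q" "q < s0 t" for q
 proof (rule ccontr)
  assume "\<not> ?u \<le> ww N q"
  then have "q \<in> ?A" using that by simp
  then have "s0 t \<le> q" unfolding s0_def by (rule cInf_lower[OF _ bb])
  then show False using that by simp
 qed
 have cont: "(ww N \<longlongrightarrow> ww N (s0 t)) (at (s0 t))" using ww_isCont[OF N pos] by (simp add: isCont_def)
 have 1: "ww N (s0 t) \<le> ?u"
 proof (rule tendsto_upperbound)
  show "(ww N \<longlongrightarrow> ww N (s0 t)) (at_right (s0 t))" using cont by (simp add: filterlim_at_split)
  show "\<forall>\<^sub>F q in at_right (s0 t). ww N q \<le> ?u" using above by (auto simp: eventually_at_filter)
 qed simp
 have 2: "?u \<le> ww N (s0 t)"
 proof (rule tendsto_lowerbound)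
  show "(ww N \<longlongrightarrow> ww N (s0 t)) (at_left (s0 t))" using cont by (simp add: filterlim_at_split)
  show "\<forall>\<^sub>F q in at_left (s0 t). ?u \<le> ww N q" using below pos by (intro eventually_at_left_field[THEN iffD2]) (auto intro!: exI[of _ 0])
 qed simp
 show "ww N (s0 t) = ?u" using 1 2 by simp
qed

end

section \<open>Tilted densities\<close>

lemma exp_neg_le_power:
 assumes "0 < (x::real)"
 shows "exp (- x) \<le> fact m / x ^ m"
proof -
 have "(\<Sum>k\<in>{m}. x ^ k /\<^sub>R fact k) \<le> exp x" unfolding exp_def using assms by (intro sum_le_suminf summable_exp_generic) auto
 then have "x ^ m \<le> fact m * exp x" by (simp add: field_simps)
 then show ?thesis using assms by (simp add: exp_minus field_simps)
qed

text \<open>The indicator removes the values on the negative axis, about which nothing is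
  known.\<close>

definition pos_density :: "(real \<Rightarrow> real) \<Rightarrow> real measure" where
 "pos_density f = density lborel (\<lambda>x. ennreal (indicator {0<..} x * f x))"

lemma pos_density_measurable:
 fixes f :: "real \<Rightarrow> real"
 assumes "continuous_on {0<..} f"
 shows "(\<lambda>x. indicator {0<..} x * f x) \<in> borel_measurable borel"
 using borel_measurable_continuous_on_indicator[of "{0<..}" f] assms by simp

lemma emeasure_pos_density:
 assumes "continuous_on {0<..} f" "B \<in> sets borel"
 shows "emeasure (pos_density f) B = (\<integral>\<^sup>+x. ennreal (indicator {0<..} x * f x) * indicator B x \<partial>lborel)"
 unfolding pos_density_def using pos_density_measurable[OF assms(1)] assms(2) by (subst emeasure_density) auto

lemma pos_density_atom:
 assumes "continuous_on {0<..} f"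
 shows "measure (pos_density f) {x} = 0"
proof -
 have "emeasure (pos_density f) {x} = 0" using assms by (simp add: emeasure_pos_density nn_integral_indicator_singleton)
 then show ?thesis by (simp add: measure_def)
qed

lemma pos_density_ge:
 assumes c: "continuous_on {0<..} f" and K: "0 \<le> K" and B: "B \<in> sets borel" and b: "\<And>x. x \<in> B \<Longrightarrow> 0 < x \<and> K \<le> f x"
 shows "ennreal K * emeasure lborel B \<le> emeasure (pos_density f) B"
proof -
 have "ennreal K * emeasure lborel B = (\<integral>\<^sup>+x. ennreal K * indicator B x \<partial>lborel)" using B by (simp add: nn_integral_cmult_indicator)
 also have "\<dots> \<le> emeasure (pos_density f) B"
  unfolding emeasure_pos_density[OF c B] using b by (intro nn_integral_mono) (auto simp: indicator_def ennreal_leI)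
 finally show ?thesis .
qed

lemma pos_density_le:
 assumes c: "continuous_on {0<..} f" and K: "0 \<le> K" and B: "B \<in> sets borel" and b: "\<And>x. x \<in> B \<Longrightarrow> 0 < x \<Longrightarrow> f x \<le> K"
 shows "emeasure (pos_density f) B \<le> ennreal K * emeasure lborel B"
proof -
 have "emeasure (pos_density f) B \<le> (\<integral>\<^sup>+x. ennreal K * indicator B x \<partial>lborel)"
  unfolding emeasure_pos_density[OF c B] using b K by (intro nn_integral_mono) (auto simp: indicator_def ennreal_leI)
 also have "\<dots> = ennreal K * emeasure lborel B" using B by (simp add: nn_integral_cmult_indicator)
 finally show ?thesis .
qed

lemma continuous_near:
 fixes f :: "real \<Rightarrow> real"
 assumes c: "continuous_on {0<..} f" and x: "0 < x" and d: "0 < d" and e: "0 < \<epsilon>"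
 obtains h where "0 < h" "h < x" "h < d" "\<And>z. \<bar>z - x\<bar> \<le> h \<Longrightarrow> \<bar>f z - f x\<bar> < \<epsilon>"
proof -
 obtain h0 where h0: "0 < h0" "\<And>z. z \<in> {0<..} \<Longrightarrow> dist z x < h0 \<Longrightarrow> dist (f z) (f x) < \<epsilon>"
  using c x e unfolding continuous_on_iff by (metis greaterThan_iff)
 define h where "h = min h0 (min x d) / 2"
 have h: "0 < h" "h < h0" "h < x" "h < d" unfolding h_def using h0(1) x d by auto
 show ?thesis
 proof (rule that[OF h(1,3,4)])
  fix z assume "\<bar>z - x\<bar> \<le> h"
  then have "0 < z" "dist z x < h0" using h by (auto simp: dist_real_def)
  then show "\<bar>f z - f x\<bar> < \<epsilon>" using h0(2)[of z] by (simp add: dist_real_def)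
 qed
qed

text \<open>If f x exceeded C, continuity would keep f above C + \<open>\<epsilon>\<close> on a
  short interval, whose mass would then be too large.\<close>

lemma pos_density_upper_point:
 assumes c: "continuous_on {0<..} f" and x: "0 < x" and d: "0 < d" and C: "0 \<le> C"
  and b: "\<And>h. 0 < h \<Longrightarrow> h < d \<Longrightarrow> emeasure (pos_density f) {x - h<..x + h} \<le> ennreal (C * (2 * h))"
 shows "f x \<le> C"
proof (rule ccontr)
 assume "\<not> f x \<le> C"
 define \<epsilon> where "\<epsilon> = (f x - C) / 2"
 have e: "0 < \<epsilon>" using \<open>\<not> f x \<le> C\<close> by (simp add: \<epsilon>_def)
 obtain h where h: "0 < h" "h < x" "h < d" "\<And>z. \<bar>z - x\<bar> \<le> h \<Longrightarrow> \<bar>f z - f x\<bar> < \<epsilon>" using continuous_near[OF c x d e] by blast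
 have ge: "C + \<epsilon> \<le> f z" if "\<bar>z - x\<bar> \<le> h" for z using h(4)[OF that] unfolding \<epsilon>_def abs_less_iff by (simp add: field_simps)
 have "ennreal (C + \<epsilon>) * emeasure lborel {x - h<..x + h} \<le> emeasure (pos_density f) {x - h<..x + h}"
  by (rule pos_density_ge[OF c]) (use C e h ge in \<open>auto simp: abs_le_iff\<close>)
 also have "\<dots> \<le> ennreal (C * (2 * h))" by (rule b) (use h in auto)
 finally have "ennreal ((C + \<epsilon>) * (2 * h)) \<le> ennreal (C * (2 * h))" using h C e by (simp add: ennreal_mult)
 then have "(C + \<epsilon>) * (2 * h) \<le> C * (2 * h)" using h C by (simp add: ennreal_le_iff)
 then show False using h e by (simp add: mult_le_cancel_right)
qed

lemma pos_density_lower_point: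
 assumes c: "continuous_on {0<..} f" and f: "\<And>z. 0 < z \<Longrightarrow> 0 \<le> f z" and x: "0 < x" and d: "0 < d" and C: "0 \<le> C"
  and b: "\<And>h. 0 < h \<Longrightarrow> h < d \<Longrightarrow> ennreal (C * (2 * h)) \<le> emeasure (pos_density f) {x - h<..x + h}"
 shows "C \<le> f x"
proof (rule ccontr)
 assume n: "\<not> C \<le> f x"
 define \<epsilon> where "\<epsilon> = (C - f x) / 2"
 have e: "0 < \<epsilon>" using n by (simp add: \<epsilon>_def)
 obtain h where h: "0 < h" "h < x" "h < d" "\<And>z. \<bar>z - x\<bar> \<le> h \<Longrightarrow> \<bar>f z - f x\<bar> < \<epsilon>" using continuous_near[OF c x d e] by blast
 have le: "f z \<le> C - \<epsilon>" if "\<bar>z - x\<bar> \<le> h" for z using h(4)[OF that] unfolding \<epsilon>_def abs_less_iff by (simp add: field_simps)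
 have Ce: "0 \<le> C - \<epsilon>" using f[OF x] e by (simp add: \<epsilon>_def)
 have "ennreal (C * (2 * h)) \<le> emeasure (pos_density f) {x - h<..x + h}" by (rule b) (use h in auto)
 also have "\<dots> \<le> ennreal (C - \<epsilon>) * emeasure lborel {x - h<..x + h}" by (rule pos_density_le[OF c Ce]) (use h le in \<open>auto simp: abs_le_iff\<close>)
 finally have "ennreal (C * (2 * h)) \<le> ennreal ((C - \<epsilon>) * (2 * h))" using h Ce by (simp add: ennreal_mult)
 then have "C * (2 * h) \<le> (C - \<epsilon>) * (2 * h)" using h Ce by (subst (asm) ennreal_le_iff) auto
 then show False using h e by (simp add: mult_le_cancel_right)
qed

lemma levy_tilt:
 assumes "levy N" "0 \<le> l"
 shows "levy (\<lambda>s. exp (- l * s) * N s)"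
proof -
 obtain \<mu> where "id_law N \<mu>" using id_law_exists[OF assms(1)] by blast
 from id_law_tilt(2)[OF assms(1) this assms(2)] show ?thesis .
qed

text \<open>As \<open>rho\<close> is increasing, \<open>rho_T\<close> keeps all scales
  \<open>rho t\<close> with t <= T in the range where the comparisons of the previous part
  hold.\<close>

locale subord_density = scaling +
 fixes p :: "real \<Rightarrow> real \<Rightarrow> real" and T :: real
 assumes T_pos: "0 < T" and rho_T: "rho T \<le> L"
  and p_nonneg: "\<And>t x. 0 < t \<Longrightarrow> 0 < x \<Longrightarrow> 0 \<le> p t x"
  and p_cont: "\<And>t. 0 < t \<Longrightarrow> continuous_on {0<..} (p t)"
  and p_law: "\<And>t. 0 < t \<Longrightarrow> id_law (\<lambda>s. t * N s) (pos_density (p t))"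
begin

lemma rho_le_L: "0 < t \<Longrightarrow> t \<le> T \<Longrightarrow> rho t \<le> L"
 using rho_mono[of t T] rho_T by linarith

lemma levy_t: "0 < t \<Longrightarrow> levy (\<lambda>s. t * N s)"
 by (rule levy_scale[OF N]) simp

lemma pl_dist: "0 < t \<Longrightarrow> real_distribution (pos_density (p t))"
 using p_law by (auto simp: id_law_def nonneg_dist_def)

section \<open>Decay of characteristic functions and bounds for tilted densities\<close>

text \<open>For |xi| r <= 1 the jumps up to r give a quadratic exponent. For larger frequencies the
  jumps up to 1/|xi| are used, and scaling of H makes the exponent at least a multiple of t H(1/r)
  (|xi| r)^a, whose exponential beats every power. The tilt is harmless because l r <= 1.\<close>

lemma char_bound:
 "\<exists>C\<ge>1. \<forall>t r l \<xi> \<mu>. 0 < t \<longrightarrow> t \<le> T \<longrightarrow> 0 < r \<longrightarrow> r \<le> rho t \<longrightarrow> 0 \<le> l \<longrightarrow> l * r \<le> 1 \<longrightarrow>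
   id_law (\<lambda>s. t * (exp (- l * s) * N s)) \<mu> \<longrightarrow> norm (char \<mu> \<xi>) \<le> C / (1 + t * HH N (1 / r) * r\<^sup>2 * \<xi>\<^sup>2)"
proof -
 obtain C2 where C2: "0 < C2" "\<And>r. 0 < r \<Longrightarrow> r \<le> L \<Longrightarrow> HH N (1 / r) \<le> C2 * KK N r" using HH_le_KK by blast
 obtain c3 where c3: "0 < c3" "\<And>r x. 0 < r \<Longrightarrow> r \<le> L \<Longrightarrow> 1 \<le> x \<Longrightarrow> c3 * x powr a * HH N (1 / r) \<le> HH N (x / r)" using HH_scale by blast
 define c2 where "c2 = exp (- 1) / 3 / C2"
 have c2: "0 < c2" unfolding c2_def using C2 by simp
 define c where "c = c2 * c3"
 have c: "0 < c" unfolding c_def using c2 c3 by simp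
 \<comment> \<open>With a m >= 2 the m-th power of z^a dominates z^2, and m >= 1 keeps the factor t
   H(1/r).\<close>
 obtain m where m: "2 / a + 1 \<le> real m" using real_arch_simple by blast
 define C where "C = 1 + 1 / c2 + 2 * (fact m / c ^ m)"
 show ?thesis
 proof (intro exI[of _ C] conjI allI impI)
  show "1 \<le> C" unfolding C_def using c2 c by simp
  fix t r l \<xi> \<mu>
  assume t: "0 < t" "t \<le> T" and r: "0 < r" "r \<le> rho t" and l: "0 \<le> l" "l * r \<le> 1"
   and \<mu>: "id_law (\<lambda>s. t * (exp (- l * s) * N s)) \<mu>"
  have rL: "r \<le> L" using r rho_le_L[OF t] by linarith
  define A where "A = t * HH N (1 / r)"
  have A: "1 \<le> A" unfolding A_def using le_rho_iff[OF t(1) r(1)] r by simp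
  have lv: "levy (\<lambda>s. t * (exp (- l * s) * N s))" by (rule levy_scale[OF levy_tilt[OF N l(1)]]) (use t in simp)
  define E where "E = t * lint N (\<lambda>s. exp (- l * s) * (1 - cos (\<xi> * s)))"
  have nE: "norm (char \<mu> \<xi>) = exp (- E)"
  proof -
   have "(\<integral>s. (t * (exp (- l * s) * N s)) * (1 - cos (\<xi> * s)) \<partial>lborel) = E" unfolding E_def lint_def integral_mult_right_zero[symmetric]
    by (intro Bochner_Integration.integral_cong refl) (simp add: mult_ac)
   then show ?thesis using norm_char_id_law[OF lv \<mu>, of \<xi>] by simp
  qed
  have low: "c2 * (t * HH N (1 / q)) * (\<bar>\<xi>\<bar> * q)\<^sup>2 \<le> E" if q: "0 < q" "q \<le> r" "\<bar>\<xi>\<bar> * q \<le> 1" for q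
  proof -
   have lq: "l * q \<le> 1" using mult_left_mono[OF q(2) l(1)] l(2) by linarith
   have "HH N (1 / q) / C2 \<le> KK N q" using C2 q rL by (simp add: divide_le_eq mult.commute)
   then have "t * (exp (- 1) / 3 * (\<bar>\<xi>\<bar> * q)\<^sup>2 * (HH N (1 / q) / C2)) \<le> t * (exp (- 1) / 3 * (\<bar>\<xi>\<bar> * q)\<^sup>2 * KK N q)"
    using t by (intro mult_left_mono) auto
   also have "\<dots> \<le> E" unfolding E_def using t by (intro mult_left_mono cos_exponent_ge[OF N q(1,3) lq l(1)]) auto
   finally show ?thesis unfolding c2_def by (simp add: mult_ac)
  qed
  have "exp (- E) \<le> C / (1 + A * (\<bar>\<xi>\<bar> * r)\<^sup>2)"
  proof (cases "\<bar>\<xi>\<bar> * r \<le> 1")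
   case True
   define X where "X = A * (\<bar>\<xi>\<bar> * r)\<^sup>2"
   have X: "0 \<le> X" unfolding X_def using A by simp
   have "c2 * X \<le> E" using low[OF r(1) order_refl True] unfolding X_def A_def by (simp add: mult.assoc)
   then have "exp (- E) \<le> exp (- (c2 * X))" by simp
   also have "\<dots> \<le> 1 / (1 + c2 * X)"
    using exp_ge_add_one_self[of "c2 * X"] X c2 by (simp add: exp_minus divide_inverse le_imp_inverse_le add_pos_nonneg)
   also have "\<dots> \<le> C / (1 + X)"
   proof -
    have "1 \<le> C" "1 \<le> C * c2" unfolding C_def using c2 c by (auto simp: distrib_right)
    then have "1 + X \<le> C + C * c2 * X" using X by (intro add_mono) (auto simp: mult_le_cancel_right1)
    then show ?thesis using X c2 by (simp add: field_simps add_pos_nonneg)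
   qed
   finally show ?thesis unfolding X_def .
  next
   case False
   define z where "z = \<bar>\<xi>\<bar> * r"
   have z: "1 < z" using False by (simp add: z_def)
   have xi: "0 < \<bar>\<xi>\<bar>" proof -
    have "\<xi> \<noteq> 0" using z unfolding z_def by auto
    then show ?thesis by simp
   qed
   define X where "X = A * z powr a"
   have za: "1 \<le> z powr a" using z a_pos by (simp add: ge_one_powr_ge_zero)
   have X: "1 \<le> X" unfolding X_def using mult_mono[OF A za] A by simp
   have q: "0 < 1 / \<bar>\<xi>\<bar>" "1 / \<bar>\<xi>\<bar> \<le> r" "\<bar>\<xi>\<bar> * (1 / \<bar>\<xi>\<bar>) \<le> 1" using xi z by (auto simp: z_def field_simps)
   have "c * X = c2 * (t * (c3 * z powr a * HH N (1 / r)))" unfolding c_def X_def A_def by (simp add: mult_ac)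
   also have "\<dots> \<le> c2 * (t * HH N (z / r))" using c3(2)[OF r(1) rL, of z] z c2 t by (intro mult_left_mono) auto
   also have "z / r = 1 / (1 / \<bar>\<xi>\<bar>)" using r by (simp add: z_def)
   also have "c2 * (t * HH N (1 / (1 / \<bar>\<xi>\<bar>))) \<le> E" using low[OF q] xi by simp
   finally have "exp (- E) \<le> exp (- (c * X))" by simp
   also have "\<dots> \<le> fact m / (c * X) ^ m" using c X by (intro exp_neg_le_power) simp
   also have "\<dots> = fact m / c ^ m / X ^ m" by (simp add: power_mult_distrib)
   also have "\<dots> \<le> fact m / c ^ m / (A * z\<^sup>2)"
   proof (intro divide_left_mono)
    have m1: "1 \<le> m" proof -
     have "0 < 2 / a" using a_pos by simp
     then have "1 \<le> real m" using m by linarith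
     then show ?thesis by simp
    qed
    have "A ^ 1 \<le> A ^ m" using A m1 by (intro power_increasing) auto
    moreover have "z\<^sup>2 \<le> (z powr a) ^ m"
    proof -
     have "2 \<le> a * real m" using m a_pos by (simp add: field_simps)
     then have "z powr 2 \<le> z powr (a * real m)" using z by (intro powr_mono) auto
     then show ?thesis using z by (simp add: powr_powr[symmetric] powr_realpow)
    qed
    ultimately have "A ^ 1 * z\<^sup>2 \<le> A ^ m * (z powr a) ^ m" using A by (intro mult_mono) auto
    then show "A * z\<^sup>2 \<le> X ^ m" unfolding X_def by (simp add: power_mult_distrib)
   qed (use c A z X in auto)
   also have "\<dots> \<le> C / (1 + A * z\<^sup>2)"
   proof -
    have "1 * 1 \<le> A * z\<^sup>2" using A z by (intro mult_mono) (auto simp: one_le_power)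
    then have Az: "1 \<le> A * z\<^sup>2" by simp
    define D where "D = fact m / c ^ m"
    have D: "0 < D" unfolding D_def using c by simp
    have CD: "2 * D \<le> C" unfolding C_def D_def using c2 by simp
    have "D * (1 + A * z\<^sup>2) \<le> D * (2 * (A * z\<^sup>2))" using D Az by (intro mult_left_mono) auto
    also have "\<dots> = 2 * D * (A * z\<^sup>2)" by simp
    also have "\<dots> \<le> C * (A * z\<^sup>2)" using CD Az by (intro mult_right_mono) auto
    finally have "D * (1 + A * z\<^sup>2) \<le> C * (A * z\<^sup>2)" .
    then show ?thesis unfolding D_def[symmetric] using Az by (simp add: divide_le_eq le_divide_eq)
   qed
   finally show ?thesis unfolding z_def .
  qed
  then show "norm (char \<mu> \<xi>) \<le> C / (1 + t * HH N (1 / r) * r\<^sup>2 * \<xi>\<^sup>2)" unfolding nE A_def by (simp add: power_mult_distrib mult_ac)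
 qed
qed

text \<open>The case of no tilt and r = \<open>rho t\<close>, where t H(1/r) = 1.\<close>

lemma p_sup: "\<exists>C\<ge>1. \<forall>t x. 0 < t \<longrightarrow> t \<le> T \<longrightarrow> 0 < x \<longrightarrow> p t x \<le> C / rho t"
proof -
 obtain C where C: "1 \<le> C" and cb: "\<And>t r l \<xi> \<mu>. 0 < t \<Longrightarrow> t \<le> T \<Longrightarrow> 0 < r \<Longrightarrow> r \<le> rho t \<Longrightarrow> 0 \<le> l \<Longrightarrow> l * r \<le> 1 \<Longrightarrow>
   id_law (\<lambda>s. t * (exp (- l * s) * N s)) \<mu> \<Longrightarrow> norm (char \<mu> \<xi>) \<le> C / (1 + t * HH N (1 / r) * r\<^sup>2 * \<xi>\<^sup>2)"
  using char_bound by blast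
 show ?thesis
 proof (intro exI[of _ C] conjI allI impI C)
  fix t x :: real assume t: "0 < t" "t \<le> T" and x: "0 < x"
  note r = rho_props[OF t(1)]
  interpret P: real_distribution "pos_density (p t)" by (rule pl_dist[OF t(1)])
  have b: "norm (char (pos_density (p t)) \<xi>) \<le> C / (1 + (rho t)\<^sup>2 * \<xi>\<^sup>2)" for \<xi>
   using cb[OF t r(1) order_refl, of 0 "pos_density (p t)" \<xi>] p_law[OF t(1)] r(2) t(1) by simp
  show "p t x \<le> C / rho t"
  proof (rule pos_density_upper_point[OF p_cont[OF t(1)] x zero_less_one])
   fix h :: real assume h: "0 < h"
   have "measure (pos_density (p t)) {x - h<..x + h} \<le> C / (2 * rho t) * ((x + h) - (x - h))"
    by (rule char_bound_upper(1)[OF pl_dist[OF t(1)] pos_density_atom[OF p_cont[OF t(1)]] r(1) b]) (use h in auto)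
   also have "\<dots> \<le> C / rho t * (2 * h)" using C r h by (simp add: field_simps)
   finally show "emeasure (pos_density (p t)) {x - h<..x + h} \<le> ennreal (C / rho t * (2 * h))"
    by (simp add: P.emeasure_eq_measure ennreal_leI)
  qed (use C r in auto)
 qed
qed

definition vv :: "real \<Rightarrow> real \<Rightarrow> real" where "vv t l = sqrt (t * mom N 2 l)"

lemma vv_pos: "0 < t \<Longrightarrow> 0 < l \<Longrightarrow> 0 < vv t l"
 unfolding vv_def using mom_pos by simp

lemma vv_sq: "0 < t \<Longrightarrow> 0 < l \<Longrightarrow> (vv t l)\<^sup>2 = t * mom N 2 l"
 unfolding vv_def using mom_pos[of l] by simp

text \<open>With \<open>vv_lower\<close> this says that the square of l v is comparable to t H(l):
  at the saddle point the standard deviation is sqrt (t H(l)) / l.\<close>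

lemma vv_upper: "0 < t \<Longrightarrow> 0 < l \<Longrightarrow> (l * vv t l)\<^sup>2 \<le> t * HH N l / hconst"
proof -
 assume a: "0 < t" "0 < l"
 have "t * (hconst * (l\<^sup>2 * mom N 2 l)) \<le> t * HH N l" using mom2_le[OF N a(2)] a by (intro mult_left_mono) auto
 moreover have "0 < hconst" using hconst_pos by linarith
 ultimately show ?thesis using a by (simp add: power_mult_distrib vv_sq field_simps)
qed

lemma vv_lower: "\<exists>c>0. \<forall>t l. 0 < t \<longrightarrow> 1 / L \<le> l \<longrightarrow> c * (t * HH N l) \<le> (l * vv t l)\<^sup>2"
proof -
 obtain C2 where C2: "0 < C2" "\<And>r. 0 < r \<Longrightarrow> r \<le> L \<Longrightarrow> HH N (1 / r) \<le> C2 * KK N r" using HH_le_KK by blast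
 show ?thesis
 proof (intro exI[of _ "exp (- 1) / C2"] conjI allI impI)
  show "0 < exp (- 1) / C2" using C2 by simp
  fix t l :: real assume t: "0 < t" and l: "1 / L \<le> l"
  have l0: "0 < l" using l L_pos by (auto intro: less_le_trans[rotated])
  have "1 / l \<le> L" using l l0 L_pos by (simp add: field_simps)
  then have "HH N l \<le> C2 * KK N (1 / l)" using C2(2)[of "1 / l"] l0 by simp
  then have "exp (- 1) / C2 * (t * HH N l) \<le> exp (- 1) / C2 * (t * (C2 * KK N (1 / l)))" using t C2 by (intro mult_left_mono) auto
  also have "\<dots> = t * (exp (- 1) * KK N (1 / l))" using C2 by simp
  also have "\<dots> \<le> t * (l\<^sup>2 * mom N 2 l)" using mom2_ge[OF N, of "1 / l"] l0 t by (intro mult_left_mono) auto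
  also have "\<dots> = (l * vv t l)\<^sup>2" using t l0 by (simp add: power_mult_distrib vv_sq)
  finally show "exp (- 1) / C2 * (t * HH N l) \<le> (l * vv t l)\<^sup>2" .
 qed
qed

lemma tilted_law:
 assumes "0 < t" "0 < l"
 shows "id_law (\<lambda>s. t * (exp (- l * s) * N s)) (pos_density (\<lambda>x. p t x * exp (t * lexp N l - l * x)))"
  and "continuous_on {0<..} (\<lambda>x. p t x * exp (t * lexp N l - l * x))"
  and "levy (\<lambda>s. t * (exp (- l * s) * N s))"
proof -
 have lx: "Re (levyexp (\<lambda>s. t * N s) (of_real l)) = t * lexp N l" by (simp add: levyexp_scale levyexp_of_real)
 have [measurable]: "(\<lambda>x. indicator {0<..} x * p t x) \<in> borel_measurable borel" by (rule pos_density_measurable[OF p_cont[OF assms(1)]])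
 have "density (pos_density (p t)) (\<lambda>x. ennreal (exp (- l * x) * exp (t * lexp N l)))
   = density lborel (\<lambda>x. ennreal (indicator {0<..} x * p t x) * ennreal (exp (- l * x) * exp (t * lexp N l)))"
  unfolding pos_density_def by (subst density_density_eq) auto
 also have "\<dots> = pos_density (\<lambda>x. p t x * exp (t * lexp N l - l * x))" unfolding pos_density_def
 proof (intro arg_cong[where f="density lborel"] ext)
  fix x :: real
  show "ennreal (indicator {0<..} x * p t x) * ennreal (exp (- l * x) * exp (t * lexp N l))
   = ennreal (indicator {0<..} x * (p t x * exp (t * lexp N l - l * x)))"
   using p_nonneg[OF assms(1), of x] by (cases "0 < x") (auto simp: ennreal_mult[symmetric] exp_add[symmetric] mult.assoc)
 qed
 finally have e: "density (pos_density (p t)) (\<lambda>x. ennreal (exp (- l * x) * exp (t * lexp N l)))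
   = pos_density (\<lambda>x. p t x * exp (t * lexp N l - l * x))" .
 note tl = id_law_tilt[OF levy_t[OF assms(1)] p_law[OF assms(1)] less_imp_le[OF assms(2)], unfolded lx e]
 show "id_law (\<lambda>s. t * (exp (- l * s) * N s)) (pos_density (\<lambda>x. p t x * exp (t * lexp N l - l * x)))"
  "levy (\<lambda>s. t * (exp (- l * s) * N s))" using tl by (simp_all only: mult.left_commute)
 show "continuous_on {0<..} (\<lambda>x. p t x * exp (t * lexp N l - l * x))" by (intro continuous_intros p_cont assms)
qed

text \<open>The case r = 1/l, where t H(l) / l^2 may be replaced by the variance thanks to
  \<open>vv_upper\<close>.\<close>

lemma tilted_char_bound:
 "\<exists>C\<ge>1. \<forall>t l \<xi>. 0 < t \<longrightarrow> t \<le> T \<longrightarrow> 1 / rho t \<le> l \<longrightarrow>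
   norm (char (pos_density (\<lambda>x. p t x * exp (t * lexp N l - l * x))) \<xi>) \<le> C / (1 + (vv t l)\<^sup>2 * \<xi>\<^sup>2)"
proof -
 obtain C where C: "1 \<le> C" and cb: "\<And>t r l \<xi> \<mu>. 0 < t \<Longrightarrow> t \<le> T \<Longrightarrow> 0 < r \<Longrightarrow> r \<le> rho t \<Longrightarrow> 0 \<le> l \<Longrightarrow> l * r \<le> 1 \<Longrightarrow>
   id_law (\<lambda>s. t * (exp (- l * s) * N s)) \<mu> \<Longrightarrow> norm (char \<mu> \<xi>) \<le> C / (1 + t * HH N (1 / r) * r\<^sup>2 * \<xi>\<^sup>2)"
  using char_bound by blast
 have hc: "0 < hconst" "hconst \<le> 1" using hconst_pos by linarith+
 show ?thesis
 proof (intro exI[of _ "C / hconst"] conjI allI impI)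
  show "1 \<le> C / hconst" using C hc by (simp add: le_divide_eq)
  fix t l \<xi> :: real assume t: "0 < t" "t \<le> T" and l: "1 / rho t \<le> l"
  note r = rho_props[OF t(1)]
  have l0: "0 < l" using l r by (auto intro: less_le_trans[rotated])
  have lr: "1 / l \<le> rho t" using l l0 r by (simp add: field_simps)
  let ?X = "t * HH N l * (1 / l)\<^sup>2 * \<xi>\<^sup>2"
  have X: "0 \<le> ?X" using t HH_nonneg[OF N, of l] l0 by simp
  have "norm (char (pos_density (\<lambda>x. p t x * exp (t * lexp N l - l * x))) \<xi>) \<le> C / (1 + ?X)"
   using cb[OF t _ lr less_imp_le[OF l0] _ tilted_law(1)[OF t(1) l0], of \<xi>] l0 by simp
  also have "\<dots> \<le> C / hconst / (1 + (vv t l)\<^sup>2 * \<xi>\<^sup>2)"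
  proof -
   have "(vv t l)\<^sup>2 \<le> t * HH N l / hconst * (1 / l)\<^sup>2"
   proof -
    have "l\<^sup>2 * (vv t l)\<^sup>2 \<le> t * HH N l / hconst" using vv_upper[OF t(1) l0] by (simp add: power_mult_distrib)
    then have "(l\<^sup>2 * (vv t l)\<^sup>2) * (1 / l)\<^sup>2 \<le> t * HH N l / hconst * (1 / l)\<^sup>2" by (rule mult_right_mono) simp
    then show ?thesis using l0 by (simp add: power_divide)
   qed
   then have "(vv t l)\<^sup>2 * \<xi>\<^sup>2 \<le> t * HH N l / hconst * (1 / l)\<^sup>2 * \<xi>\<^sup>2" by (rule mult_right_mono) simp
   also have "\<dots> = ?X / hconst" by simp
   finally have "hconst * ((vv t l)\<^sup>2 * \<xi>\<^sup>2) \<le> hconst * (?X / hconst)" using hc by (intro mult_left_mono) auto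
   also have "\<dots> = ?X" using hc by simp
   finally have "hconst * ((vv t l)\<^sup>2 * \<xi>\<^sup>2) \<le> ?X" .
   then have "hconst * (1 + (vv t l)\<^sup>2 * \<xi>\<^sup>2) \<le> 1 + ?X" using hc by (simp add: distrib_left)
   moreover have "0 < hconst * (1 + (vv t l)\<^sup>2 * \<xi>\<^sup>2)" using hc by (simp add: add_pos_nonneg)
   ultimately have "C / (1 + ?X) \<le> C / (hconst * (1 + (vv t l)\<^sup>2 * \<xi>\<^sup>2))" using C by (intro divide_left_mono) (auto intro: mult_pos_pos)
   then show ?thesis by simp
  qed
  finally show "norm (char (pos_density (\<lambda>x. p t x * exp (t * lexp N l - l * x))) \<xi>) \<le> C / hconst / (1 + (vv t l)\<^sup>2 * \<xi>\<^sup>2)" .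
 qed
qed

text \<open>The tilted density is bounded by C/v everywhere; undoing the tilt gives the exponential,
  which becomes exp (-t H(l)) at the mean x = t phi'(l).\<close>

lemma tilt_upper: "\<exists>C\<ge>1. \<forall>t l x. 0 < t \<longrightarrow> t \<le> T \<longrightarrow> 1 / rho t \<le> l \<longrightarrow> 0 < x \<longrightarrow>
   p t x \<le> C / vv t l * exp (l * x - t * lexp N l)"
proof -
 obtain C where C: "1 \<le> C" and cb: "\<And>t l \<xi>. 0 < t \<Longrightarrow> t \<le> T \<Longrightarrow> 1 / rho t \<le> l \<Longrightarrow>
   norm (char (pos_density (\<lambda>x. p t x * exp (t * lexp N l - l * x))) \<xi>) \<le> C / (1 + (vv t l)\<^sup>2 * \<xi>\<^sup>2)"
  using tilted_char_bound by blast
 show ?thesis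
 proof (intro exI[of _ C] conjI allI impI C)
  fix t l x :: real assume t: "0 < t" "t \<le> T" and l: "1 / rho t \<le> l" and x: "0 < (x::real)"
  note r = rho_props[OF t(1)]
  have l0: "0 < l" using l r by (auto intro: less_le_trans[rotated])
  note tl = tilted_law[OF t(1) l0]
  have rd: "real_distribution (pos_density (\<lambda>x. p t x * exp (t * lexp N l - l * x)))"
   using tl(1) by (simp add: id_law_def nonneg_dist_def)
  interpret P: real_distribution "pos_density (\<lambda>x. p t x * exp (t * lexp N l - l * x))" by (rule rd)
  note v = vv_pos[OF t(1) l0]
  have "p t x * exp (t * lexp N l - l * x) \<le> C / vv t l"
  proof (rule pos_density_upper_point[OF tl(2) x zero_less_one])
   fix h :: real assume h: "0 < h"
   have "measure (pos_density (\<lambda>x. p t x * exp (t * lexp N l - l * x))) {x - h<..x + h} \<le> C / (2 * vv t l) * ((x + h) - (x - h))"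
    by (rule char_bound_upper(1)[OF rd pos_density_atom[OF tl(2)] v cb[OF t l]]) (use h in auto)
   also have "\<dots> \<le> C / vv t l * (2 * h)" using C v h by (simp add: field_simps)
   finally show "emeasure (pos_density (\<lambda>x. p t x * exp (t * lexp N l - l * x))) {x - h<..x + h} \<le> ennreal (C / vv t l * (2 * h))"
    by (simp add: P.emeasure_eq_measure ennreal_leI)
  qed (use C v in auto)
  then have "p t x * exp (t * lexp N l - l * x) * exp (l * x - t * lexp N l) \<le> C / vv t l * exp (l * x - t * lexp N l)"
   by (rule mult_right_mono) simp
  then show "p t x \<le> C / vv t l * exp (l * x - t * lexp N l)" by (simp add: mult.assoc exp_add[symmetric])
 qed
qed

text \<open>The smallness of the third moment stays a hypothesis because it is verified in two ways:
  for large t H(l) in \<open>saddle_lower\<close>, and at l = 1/rho t in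
  \<open>near_diagonal\<close> when jumps of size \<open>rho t\<close> are rare.\<close>

lemma tilt_lower:
 assumes c0: "0 \<le> c0"
 shows "\<exists>L0>0. \<exists>k>0. \<forall>t l x. 0 < t \<longrightarrow> t \<le> T \<longrightarrow> 1 / rho t \<le> l \<longrightarrow> 0 < x \<longrightarrow> t * mom N 3 l \<le> L0 * vv t l ^ 3 \<longrightarrow>
   \<bar>x - t * mom N 1 l\<bar> \<le> c0 * vv t l \<longrightarrow> k / vv t l * exp (l * x - t * lexp N l) \<le> p t x"
proof -
 obtain C where C: "1 \<le> C" and cb: "\<And>t l \<xi>. 0 < t \<Longrightarrow> t \<le> T \<Longrightarrow> 1 / rho t \<le> l \<Longrightarrow>
   norm (char (pos_density (\<lambda>x. p t x * exp (t * lexp N l - l * x))) \<xi>) \<le> C / (1 + (vv t l)\<^sup>2 * \<xi>\<^sup>2)"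
  using tilted_char_bound by blast
 have C0: "0 \<le> C" using C by simp
 obtain L0 k :: real where L0: "0 < L0" and k: "0 < k" and clt:
  "\<And>N \<mu> v a b. levy N \<Longrightarrow> id_law N \<mu> \<Longrightarrow> (\<And>x. measure \<mu> {x} = 0) \<Longrightarrow> 0 < v \<Longrightarrow>
   integrable lborel (\<lambda>s. N s * s) \<Longrightarrow> integrable lborel (\<lambda>s. N s * s\<^sup>2) \<Longrightarrow> integrable lborel (\<lambda>s. N s * s ^ 3) \<Longrightarrow>
   (\<integral>s. N s * s\<^sup>2 \<partial>lborel) = v\<^sup>2 \<Longrightarrow> (\<integral>s. N s * s ^ 3 \<partial>lborel) \<le> L0 * v ^ 3 \<Longrightarrow>
   (\<And>\<xi>. norm (char \<mu> \<xi>) \<le> C / (1 + v\<^sup>2 * \<xi>\<^sup>2)) \<Longrightarrow> a \<le> b \<Longrightarrow>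
   (\<integral>s. N s * s \<partial>lborel) - (c0 + 1) * v \<le> a \<Longrightarrow> b \<le> (\<integral>s. N s * s \<partial>lborel) + (c0 + 1) * v \<Longrightarrow>
   k / v * (b - a) \<le> measure \<mu> {a<..b}"
  \<comment> \<open>The additional standard deviation makes room for the intervals x - h, x + h with
    h below v.\<close>
  by (rule local_clt[OF C0, of "c0 + 1"]) blast
 show ?thesis
 proof (rule exI[of _ L0], rule conjI[OF L0], rule exI[of _ k], rule conjI[OF k], intro allI impI)
  fix t l x :: real assume t: "0 < t" "t \<le> T" and l: "1 / rho t \<le> l" and x: "0 < x" and m3: "t * mom N 3 l \<le> L0 * vv t l ^ 3"
   and d: "\<bar>x - t * mom N 1 l\<bar> \<le> c0 * vv t l"
  note r = rho_props[OF t(1)]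
  have l0: "0 < l" using l r by (auto intro: less_le_trans[rotated])
  note tl = tilted_law[OF t(1) l0]
  let ?P = "pos_density (\<lambda>x. p t x * exp (t * lexp N l - l * x))"
  have rd: "real_distribution ?P" using tl(1) by (simp add: id_law_def nonneg_dist_def)
  interpret P: real_distribution ?P by (rule rd)
  note v = vv_pos[OF t(1) l0]
  have m: "(\<lambda>s. (t * (exp (- l * s) * N s)) * s ^ j) = (\<lambda>s. t * (N s * (s ^ j * exp (- l * s))))" for j by (auto simp: mult_ac)
  have int: "integrable lborel (\<lambda>s. (t * (exp (- l * s) * N s)) * s ^ j)" if "1 \<le> j" for j
   unfolding m by (intro integrable_mult_right lbnd_integrable[OF N] lbnd_mom l0 that)
  have val: "(\<integral>s. (t * (exp (- l * s) * N s)) * s ^ j \<partial>lborel) = t * mom N j l" for j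
   unfolding m mom_def lint_def by (rule integral_mult_right_zero)
  have "k / vv t l \<le> p t x * exp (t * lexp N l - l * x)"
  proof (rule pos_density_lower_point[OF tl(2) _ x v])
   fix h assume h: "0 < h" "h < vv t l"
   have "k / vv t l * ((x + h) - (x - h)) \<le> measure ?P {x - h<..x + h}"
   proof (rule clt[OF tl(3,1) pos_density_atom[OF tl(2)] v])
    show "integrable lborel (\<lambda>s. (t * (exp (- l * s) * N s)) * s)" using int[of 1] by simp
    show "integrable lborel (\<lambda>s. (t * (exp (- l * s) * N s)) * s\<^sup>2)" by (rule int) simp
    show "integrable lborel (\<lambda>s. (t * (exp (- l * s) * N s)) * s ^ 3)" by (rule int) simp
    show "(\<integral>s. (t * (exp (- l * s) * N s)) * s\<^sup>2 \<partial>lborel) = (vv t l)\<^sup>2" unfolding val vv_sq[OF t(1) l0] ..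
    show "(\<integral>s. (t * (exp (- l * s) * N s)) * s ^ 3 \<partial>lborel) \<le> L0 * vv t l ^ 3" unfolding val by (rule m3)
    show "norm (char ?P \<xi>) \<le> C / (1 + (vv t l)\<^sup>2 * \<xi>\<^sup>2)" for \<xi> by (rule cb[OF t l])
    have v1: "(\<integral>s. (t * (exp (- l * s) * N s)) * s \<partial>lborel) = t * mom N 1 l" using val[of 1] by simp
    show "(\<integral>s. (t * (exp (- l * s) * N s)) * s \<partial>lborel) - (c0 + 1) * vv t l \<le> x - h"
     "x + h \<le> (\<integral>s. (t * (exp (- l * s) * N s)) * s \<partial>lborel) + (c0 + 1) * vv t l"
     unfolding v1 distrib_right using d h by (simp_all add: abs_le_iff)
   qed (use h in auto)
   then show "ennreal (k / vv t l * (2 * h)) \<le> emeasure ?P {x - h<..x + h}" by (simp add: P.emeasure_eq_measure ennreal_leI)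
  qed (use k v p_nonneg[OF t(1)] in auto)
  then have "k / vv t l * exp (l * x - t * lexp N l) \<le> p t x * exp (t * lexp N l - l * x) * exp (l * x - t * lexp N l)"
   by (rule mult_right_mono) simp
  then show "k / vv t l * exp (l * x - t * lexp N l) \<le> p t x" by (simp add: mult.assoc exp_add[symmetric])
 qed
qed

lemma lexp_eq: "0 < l \<Longrightarrow> l * (t * mom N 1 l) - t * lexp N l = - (t * HH N l)"
 using arg_cong[OF HH_eq[OF N, of l], of "\<lambda>u. t * u"] by (simp add: algebra_simps)

text \<open>For \<open>t * HH N l\<close> large the tilted law is close to a normal law.\<close>

lemma saddle_lower:
 "\<exists>M>1. \<exists>k>0. \<forall>t l x. 0 < t \<longrightarrow> t \<le> T \<longrightarrow> 0 < l \<longrightarrow> M \<le> t * HH N l \<longrightarrow> 0 < x \<longrightarrow>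
   \<bar>x - t * mom N 1 l\<bar> \<le> vv t l \<longrightarrow> k / vv t l * exp (l * x - t * lexp N l) \<le> p t x"
proof -
 obtain L0 k where L0: "0 < L0" and k: "0 < k" and tl: "\<And>t l x. 0 < t \<Longrightarrow> t \<le> T \<Longrightarrow> 1 / rho t \<le> l \<Longrightarrow> 0 < x \<Longrightarrow> t * mom N 3 l \<le> L0 * vv t l ^ 3 \<Longrightarrow>
   \<bar>x - t * mom N 1 l\<bar> \<le> 1 * vv t l \<Longrightarrow> k / vv t l * exp (l * x - t * lexp N l) \<le> p t x"
  using tilt_lower[of 1] by auto
 obtain c where c: "0 < c" and vl: "\<And>t l. 0 < t \<Longrightarrow> 1 / L \<le> l \<Longrightarrow> c * (t * HH N l) \<le> (l * vv t l)\<^sup>2" using vv_lower by blast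
 have hc: "0 < hconst" using hconst_pos by linarith
 \<comment> \<open>With w = l v, the third moment is at most 2 w^2 / (h c l^3), h =
   \<open>hconst\<close>; this is below L0 v^3 as soon as w >= q, and t H(l) >= M forces w^2 >= c M
   >= q^2.\<close>
 define q where "q = 2 / (hconst * L0 * c)"
 have q: "0 < q" unfolding q_def using hc L0 c by simp
 define M where "M = 1 + 1 + q\<^sup>2 / c"
 show ?thesis
 proof (rule exI[of _ M], rule conjI, simp add: M_def add_pos_nonneg c less_imp_le, rule exI[of _ k], rule conjI[OF k], intro allI impI)
  fix t l x :: real assume t: "0 < t" "t \<le> T" and l: "0 < l" and MM: "M \<le> t * HH N l" and x: "0 < (x::real)" and d: "\<bar>x - t * mom N 1 l\<bar> \<le> vv t l"
  have M1: "1 \<le> M" using c by (simp add: M_def)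
  have "1 / l \<le> rho t" using le_rho_iff[OF t(1), of "1 / l"] l MM M1 by simp
  then have lr: "1 / rho t \<le> l" using rho_props(1)[OF t(1)] l by (simp add: field_simps)
  have "1 / l \<le> L" using \<open>1 / l \<le> rho t\<close> rho_le_L[OF t] by (rule order_trans)
  then have lL: "1 / L \<le> l" using l L_pos by (simp add: field_simps)
  define w where "w = l * vv t l"
  have w: "0 < w" unfolding w_def using vv_pos[OF t(1) l] l by simp
  have w2: "c * (t * HH N l) \<le> w\<^sup>2" unfolding w_def by (rule vl[OF t(1) lL])
  have "q\<^sup>2 \<le> c * M" unfolding M_def using c by (simp add: distrib_left)
  also have "\<dots> \<le> c * (t * HH N l)" using MM c by (intro mult_left_mono) auto
  also have "\<dots> \<le> w\<^sup>2" by (rule w2)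
  finally have qw: "q \<le> w" by (rule power2_le_imp_le) (use w in simp)
  have "hconst * (l ^ 3 * (t * mom N 3 l)) \<le> 2 * (t * HH N l)" using mult_left_mono[OF mom3_le[OF N l], of t] t by (simp add: mult_ac)
  also have "\<dots> \<le> 2 * (w\<^sup>2 / c)" using w2 c by (simp add: field_simps)
  also have "\<dots> = hconst * L0 * q * w\<^sup>2" unfolding q_def using hc L0 c by (simp add: field_simps)
  also have "\<dots> \<le> hconst * L0 * w * w\<^sup>2" using qw hc L0 by (intro mult_right_mono mult_left_mono) auto
  also have "\<dots> = hconst * (l ^ 3 * (L0 * vv t l ^ 3))" unfolding w_def by (simp add: power2_eq_square power3_eq_cube)
  finally have "hconst * (l ^ 3 * (t * mom N 3 l)) \<le> hconst * (l ^ 3 * (L0 * vv t l ^ 3))" .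
  then have "t * mom N 3 l \<le> L0 * vv t l ^ 3" using hc zero_less_power[OF l, of 3] by (simp only: mult_le_cancel_left_pos)
  then show "k / vv t l * exp (l * x - t * lexp N l) \<le> p t x" using tl[OF t lr x] d by simp
 qed
qed

end

section \<open>Lower bounds near the centre and by a single jump\<close>

context subord_density begin

definition cc :: "real \<Rightarrow> real" where "cc t = t * mom N 1 (1 / rho t)"

definition xM :: "real \<Rightarrow> real \<Rightarrow> real" where "xM M t = t * mom N 1 (1 / rho (t / M))"

text \<open>A predicate in the threshold, so that all lemmas share one \<open>M\<close>: the saddle
  point bound covers x <= \<open>xM M t\<close>, and the lower bounds to the right of it start
  exactly there.\<close>

definition saddle :: "real \<Rightarrow> bool" where
 "saddle M \<longleftrightarrow> 1 < M \<and> (\<exists>k>0. \<forall>t l x. 0 < t \<longrightarrow> t \<le> T \<longrightarrow> 0 < l \<longrightarrow> M \<le> t * HH N l \<longrightarrow> 0 < x \<longrightarrow>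
   \<bar>x - t * mom N 1 l\<bar> \<le> vv t l \<longrightarrow> k / vv t l * exp (l * x - t * lexp N l) \<le> p t x)"

lemma saddle_exists: "\<exists>M. saddle M"
 using saddle_lower unfolding saddle_def by blast

lemma mom1_pos: "0 < l \<Longrightarrow> 0 < mom N 1 l"
 using mom1_strict_antimono[of l "l + 1"] mom_nonneg[OF N, of 1 "l + 1"] by simp

lemma xM_pos: "0 < t \<Longrightarrow> 0 < M \<Longrightarrow> 0 < xM M t"
 unfolding xM_def using rho_props(1)[of "t / M"] mom1_pos by simp

text \<open>Scaling of H from \<open>rho t\<close>, where t H = 1: if t H(1/r) stays bounded, r
  cannot be a small fraction of \<open>rho t\<close>.\<close>

lemma rho_ratio:
 assumes "1 \<le> M"
 shows "\<exists>D\<ge>1. \<forall>t r. 0 < t \<longrightarrow> t \<le> T \<longrightarrow> 0 < r \<longrightarrow> t * HH N (1 / r) \<le> M \<longrightarrow> rho t \<le> D * r"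
proof -
 obtain c3 where c3: "0 < c3" "\<And>r x. 0 < r \<Longrightarrow> r \<le> L \<Longrightarrow> 1 \<le> x \<Longrightarrow> c3 * x powr a * HH N (1 / r) \<le> HH N (x / r)" using HH_scale by blast
 define D where "D = 1 + (M / c3) powr (1 / a)"
 show ?thesis
 proof (intro exI[of _ D] conjI allI impI)
  show "1 \<le> D" by (simp add: D_def)
  fix t r :: real assume t: "0 < t" "t \<le> T" and r: "0 < r" and h: "t * HH N (1 / r) \<le> M"
  note rt = rho_props[OF t(1)]
  show "rho t \<le> D * r"
  proof (cases "rho t \<le> r")
   case True
   moreover have "1 * r \<le> D * r" using r by (intro mult_right_mono) (auto simp: D_def)
   ultimately show ?thesis by linarith
  next
   case False
   define x where "x = rho t / r"
   have x: "1 \<le> x" using False r by (simp add: x_def)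
   have "c3 * x powr a * HH N (1 / rho t) \<le> HH N (x / rho t)" by (rule c3(2)[OF rt(1) rho_le_L[OF t] x])
   also have "x / rho t = 1 / r" using rt by (simp add: x_def)
   finally have "c3 * x powr a * (1 / t) \<le> HH N (1 / r)" using rt(2) by simp
   then have "c3 * x powr a \<le> t * HH N (1 / r)" using t by (simp add: field_simps)
   then have "x powr a \<le> M / c3" using h c3 by (simp add: field_simps)
   then have "(x powr a) powr (1 / a) \<le> (M / c3) powr (1 / a)" using a_pos by (intro powr_mono2) auto
   then have "x \<le> D" using a_pos x by (simp add: powr_powr D_def)
   then show ?thesis using r by (simp add: x_def divide_le_eq)
  qed
 qed
qed

section \<open>Windows of positive density around the centre\<close>

text \<open>At the parameter with t H(l) = M the standard deviation is comparable to
  \<open>rho t\<close>. The saddle point bound therefore reaches a fixed fraction of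
  \<open>rho t\<close> to the right, and there the exponential factor is at least exp (-M).\<close>

lemma base_window:
 assumes "saddle M"
 shows "\<exists>w>0. \<exists>c>0. \<forall>t x. 0 < t \<longrightarrow> t \<le> T \<longrightarrow> xM M t \<le> x \<longrightarrow> x \<le> xM M t + w * rho t \<longrightarrow> c / rho t \<le> p t x"
proof -
 have M: "1 < M" using assms by (simp add: saddle_def)
 obtain k where k: "0 < k" and sd: "\<And>t l x. 0 < t \<Longrightarrow> t \<le> T \<Longrightarrow> 0 < l \<Longrightarrow> M \<le> t * HH N l \<Longrightarrow> 0 < x \<Longrightarrow>
   \<bar>x - t * mom N 1 l\<bar> \<le> vv t l \<Longrightarrow> k / vv t l * exp (l * x - t * lexp N l) \<le> p t x"
  using assms unfolding saddle_def by blast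
 obtain D where D: "1 \<le> D" and rr: "\<And>t r. 0 < t \<Longrightarrow> t \<le> T \<Longrightarrow> 0 < r \<Longrightarrow> t * HH N (1 / r) \<le> M \<Longrightarrow> rho t \<le> D * r" using rho_ratio[of M] M by auto
 obtain c where c: "0 < c" and vl: "\<And>t l. 0 < t \<Longrightarrow> 1 / L \<le> l \<Longrightarrow> c * (t * HH N l) \<le> (l * vv t l)\<^sup>2" using vv_lower by blast
 \<comment> \<open>Chosen so that w \<open>rho t\<close> is at most one standard deviation.\<close>
 define w where "w = sqrt (c * M) / D"
 have w: "0 < w" unfolding w_def using c M D by simp
 define c' where "c' = k * exp (- M) / (2 * sqrt M)"
 have c': "0 < c'" unfolding c'_def using k M by simp
 show ?thesis
 proof (rule exI[of _ w], rule conjI[OF w], rule exI[of _ c'], rule conjI[OF c'], intro allI impI)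
  fix t x assume t: "0 < t" "t \<le> T" and x: "xM M t \<le> x" "x \<le> xM M t + w * rho t"
  define r where "r = rho (t / M)"
  have tM: "0 < t / M" using t M by simp
  note rp = rho_props[OF tM, folded r_def]
  note rt = rho_props[OF t(1)]
  define l where "l = 1 / r"
  have l: "0 < l" using rp by (simp add: l_def)
  have HM: "t * HH N l = M" using rp(2) t M by (simp add: l_def)
  have rrho: "r \<le> rho t" unfolding r_def using t M by (intro rho_mono) (auto simp: divide_le_eq)
  have rL: "r \<le> L" using rrho rho_le_L[OF t] by simp
  have lL: "1 / L \<le> l" unfolding l_def using rL rp L_pos by (intro divide_left_mono) auto
  have v: "0 < vv t l" by (rule vv_pos[OF t(1) l])
  have Dr: "rho t \<le> D * r" by (rule rr[OF t rp(1)]) (use HM in \<open>simp add: l_def\<close>)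
  have "sqrt (c * M) \<le> sqrt ((l * vv t l)\<^sup>2)" using vl[OF t(1) lL] HM by (intro real_sqrt_le_mono) simp
  then have lo: "sqrt (c * M) \<le> l * vv t l" using l v by simp
  have "w * rho t \<le> w * (D * r)" using Dr w by (intro mult_left_mono) auto
  also have "\<dots> = sqrt (c * M) * r" unfolding w_def using D by simp
  also have "\<dots> \<le> l * vv t l * r" using lo rp by (intro mult_right_mono) auto
  also have "\<dots> = vv t l" using rp by (simp add: l_def)
  finally have wv: "w * rho t \<le> vv t l" .
  have "(l * vv t l)\<^sup>2 \<le> M / hconst" using vv_upper[OF t(1) l] HM by simp
  also have "\<dots> \<le> M / (1 / 4)" using hconst_pos M by (intro divide_left_mono) auto
  finally have "sqrt ((l * vv t l)\<^sup>2) \<le> sqrt (4 * M)" by (intro real_sqrt_le_mono) simp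
  then have "l * vv t l \<le> 2 * sqrt M" using l v by (simp add: real_sqrt_mult)
  then have "vv t l \<le> 2 * sqrt M * r" using rp by (simp add: l_def field_simps)
  also have "\<dots> \<le> 2 * sqrt M * rho t" using rrho M by (intro mult_left_mono) auto
  finally have vu: "vv t l \<le> 2 * sqrt M * rho t" .
  have xMl: "xM M t = t * mom N 1 l" unfolding xM_def l_def r_def ..
  have xp: "0 < x" using xM_pos[OF t(1), of M] M x by simp
  have "c' / rho t = k / (2 * sqrt M * rho t) * exp (- M)" unfolding c'_def using rt by simp
  also have "\<dots> \<le> k / vv t l * exp (l * x - t * lexp N l)"
  proof (rule mult_mono)
   show "k / (2 * sqrt M * rho t) \<le> k / vv t l" using vu v k rt M by (intro divide_left_mono) auto
   have "l * (t * mom N 1 l) \<le> l * x" using x xMl l by (intro mult_left_mono) auto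
   then show "exp (- M) \<le> exp (l * x - t * lexp N l)" using lexp_eq[OF l, of t] HM by simp
  qed (use k v in auto)
  also have "\<dots> \<le> p t x" by (rule sd[OF t l _ xp]) (use HM x wv xMl in auto)
  finally show "c' / rho t \<le> p t x" .
 qed
qed

text \<open>A portion \<open>q\<close> of the jumps in [u, u+d], of total mass t m d, is split off.
  The law without it keeps half of the lower bound c / rho t on the window: what it lost is at most
  (t m d) C / rho t <= c / (2 rho t). Putting back exactly one such jump then gives the bound at x.
  As m is only a lower bound for N, the mass may be made small at will.\<close>

lemma jump_step:
 assumes t: "0 < t" "t \<le> T" and c: "0 < c" and C: "0 < C" "\<And>z. 0 < z \<Longrightarrow> p t z \<le> C / rho t"
  and lo: "0 \<le> lo" and win: "\<And>z. lo < z \<Longrightarrow> z < hi \<Longrightarrow> c / rho t \<le> p t z"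
  and u: "0 < u" "0 < d" and x: "lo < x - u - d" "x - u < hi"
  and m: "0 \<le> m" "\<And>s. u \<le> s \<Longrightarrow> s \<le> u + d \<Longrightarrow> m \<le> N s"
  and lam: "t * m * d \<le> 1" "t * m * d \<le> c / (2 * C)"
 shows "exp (- 1) * (t * m * d) * (c / (2 * rho t)) \<le> p t x"
proof -
 note rt = rho_props[OF t(1)]
 define q where "q s = t * m * indicator {u..u + d} s" for s :: real
 have [measurable]: "q \<in> borel_measurable borel" unfolding q_def by measurable
 have q0: "0 \<le> q s" for s unfolding q_def using t m by simp
 have qN: "q s \<le> t * N s" for s unfolding q_def using t m(2)[of s] N_nonneg[of s] by (cases "s \<in> {u..u + d}") (auto simp: mult_left_mono)
 have qi: "integrable lborel q" unfolding q_def by (intro integrable_mult_right integrable_real_indicator) (use u in auto)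
 define lm where "lm = t * m * d"
 have qint: "integral\<^sup>L lborel q = lm" unfolding q_def lm_def using u by simp
 have lm0: "0 \<le> lm" unfolding lm_def using t m u by simp
 have qnn: "(\<integral>\<^sup>+s. ennreal (q s) \<partial>lborel) = ennreal lm" using nn_integral_eq_integral[OF qi] q0 qint by simp
 let ?\<mu> = "pos_density (p t)"
 interpret P: real_distribution ?\<mu> by (rule pl_dist[OF t(1)])
 have lq: "levy (\<lambda>s. t * N s - q s)" by (rule levy_diff[OF levy_t[OF t(1)]]) (use q0 qN in auto)
 obtain \<mu>' where \<mu>': "id_law (\<lambda>s. t * N s - q s) \<mu>'" using id_law_exists[OF lq] by blast
 interpret M: real_distribution \<mu>' using \<mu>' by (simp add: id_law_def nonneg_dist_def)
 note sp = id_law_split[OF levy_t[OF t(1)] _ q0 qN qi p_law[OF t(1)] \<mu>', unfolded qint]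
 have sh: "(\<integral>\<^sup>+x. indicator {a<..b} (s + x) \<partial>\<nu>) = emeasure \<nu> {a - s<..b - s}"
  if "sets \<nu> = sets borel" for s a b :: real and \<nu> :: "real measure"
 proof -
  have "(\<integral>\<^sup>+x. indicator {a<..b} (s + x) \<partial>\<nu>) = (\<integral>\<^sup>+x. indicator {a - s<..b - s} x \<partial>\<nu>)"
   by (intro nn_integral_cong) (auto simp: indicator_def)
  then show ?thesis using that by simp
 qed
 \<comment> \<open>The law without the split-off jumps has no given density, so its lower bound is
   kept as a bound for intervals inside the window.\<close>
 have low': "ennreal (c / (2 * rho t) * (2 * h)) \<le> emeasure \<mu>' {y - h<..y + h}"
  if h: "0 < h" "lo < y - h" "y + h < hi" for y h
 proof -
  have "ennreal (c / rho t * (2 * h)) = ennreal (c / rho t) * emeasure lborel {y - h<..y + h}"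
   using h c rt by (simp add: ennreal_mult[symmetric])
  also have "\<dots> \<le> emeasure ?\<mu> {y - h<..y + h}" by (rule pos_density_ge[OF p_cont[OF t(1)]]) (use c rt h lo win in auto)
  also have "\<dots> \<le> emeasure \<mu>' {y - h<..y + h} + (\<integral>\<^sup>+s. ennreal (q s) * emeasure ?\<mu> {y - h - s<..y + h - s} \<partial>lborel)"
   using sp(3)[of "indicator {y - h<..y + h}"] by (simp add: sh)
  also have "(\<integral>\<^sup>+s. ennreal (q s) * emeasure ?\<mu> {y - h - s<..y + h - s} \<partial>lborel)
    \<le> (\<integral>\<^sup>+s. ennreal (q s) * ennreal (C / rho t * (2 * h)) \<partial>lborel)"
  proof (intro nn_integral_mono mult_left_mono)
   fix s
   have "emeasure ?\<mu> {y - h - s<..y + h - s} \<le> ennreal (C / rho t) * emeasure lborel {y - h - s<..y + h - s}"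
    by (rule pos_density_le[OF p_cont[OF t(1)]]) (use C rt in auto)
   also have "\<dots> = ennreal (C / rho t * (2 * h))" using h C rt by (simp add: ennreal_mult[symmetric])
   finally show "emeasure ?\<mu> {y - h - s<..y + h - s} \<le> ennreal (C / rho t * (2 * h))" .
  qed simp
  also have "\<dots> = ennreal lm * ennreal (C / rho t * (2 * h))" by (subst nn_integral_multc) (auto simp: qnn)
  also have "\<dots> = ennreal (lm * (C / rho t * (2 * h)))" using lm0 C rt h by (intro ennreal_mult[symmetric]) auto
  finally have "ennreal (c / rho t * (2 * h)) \<le> ennreal (measure \<mu>' {y - h<..y + h} + lm * (C / rho t * (2 * h)))"
   using lm0 C rt h by (simp add: M.emeasure_eq_measure add_left_mono)
  then have 1: "c / rho t * (2 * h) \<le> measure \<mu>' {y - h<..y + h} + lm * (C / rho t * (2 * h))"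
   using lm0 C rt h by (subst (asm) ennreal_le_iff) auto
  have "lm * (C / rho t * (2 * h)) \<le> c / (2 * C) * (C / rho t * (2 * h))"
   using lam(2) C rt h unfolding lm_def by (intro mult_right_mono) auto
  also have "\<dots> = c / (2 * rho t) * (2 * h)" using C by simp
  finally have "c / (2 * rho t) * (2 * h) \<le> measure \<mu>' {y - h<..y + h}" using 1 rt by (simp add: field_simps)
  then show ?thesis by (simp add: M.emeasure_eq_measure ennreal_leI)
 qed
 \<comment> \<open>For h below this margin, x - s with radius h stays in the window for every jump s
   in [u, u+d].\<close>
 define D where "D = min (x - u - d - lo) (hi - (x - u))"
 have D: "0 < D" unfolding D_def using x by simp
 show ?thesis
 proof (rule pos_density_lower_point[OF p_cont[OF t(1)] p_nonneg[OF t(1)] _ D])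
  show "0 < x" using lo x u by linarith
  show "0 \<le> exp (- 1) * (t * m * d) * (c / (2 * rho t))" using t m u c rt by simp
  fix h assume h: "0 < h" "h < D"
  have e1: "exp (- 1) \<le> exp (- lm)" using lam(1) unfolding lm_def by simp
  have "ennreal (exp (- 1) * lm * (c / (2 * rho t)) * (2 * h)) \<le> ennreal (exp (- lm) * (lm * (c / (2 * rho t) * (2 * h))))"
  proof (rule ennreal_leI)
   have "0 \<le> lm * (c / (2 * rho t) * (2 * h))" using lm0 c rt h by simp
   from mult_right_mono[OF e1 this]
   show "exp (- 1) * lm * (c / (2 * rho t)) * (2 * h) \<le> exp (- lm) * (lm * (c / (2 * rho t) * (2 * h)))" by (simp only: mult.assoc)
  qed
  also have "\<dots> = ennreal (exp (- lm)) * (ennreal lm * ennreal (c / (2 * rho t) * (2 * h)))"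
  proof -
   have gen: "ennreal (x * (y * z)) = ennreal x * (ennreal y * ennreal z)" if "0 \<le> x" "0 \<le> y" "0 \<le> z" for x y z
    using that by (simp add: ennreal_mult)
   show ?thesis by (rule gen) (use lm0 c rt h in simp_all)
  qed
  also have "ennreal lm * ennreal (c / (2 * rho t) * (2 * h)) = (\<integral>\<^sup>+s. ennreal (q s) * ennreal (c / (2 * rho t) * (2 * h)) \<partial>lborel)"
   by (subst nn_integral_multc) (auto simp: qnn)
  also have "\<dots> \<le> (\<integral>\<^sup>+s. ennreal (q s) * emeasure \<mu>' {x - h - s<..x + h - s} \<partial>lborel)"
  proof (rule nn_integral_mono)
   fix s :: real
   show "ennreal (q s) * ennreal (c / (2 * rho t) * (2 * h)) \<le> ennreal (q s) * emeasure \<mu>' {x - h - s<..x + h - s}"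
   proof (cases "s \<in> {u..u + d}")
    case True
    have "ennreal (c / (2 * rho t) * (2 * h)) \<le> emeasure \<mu>' {(x - s) - h<..(x - s) + h}"
     by (rule low') (use True h in \<open>auto simp: D_def\<close>)
    then show ?thesis by (intro mult_left_mono) (auto simp: algebra_simps)
   qed (simp add: q_def)
  qed
  also have "ennreal (exp (- lm)) * (\<integral>\<^sup>+s. ennreal (q s) * emeasure \<mu>' {x - h - s<..x + h - s} \<partial>lborel) \<le> emeasure ?\<mu> {x - h<..x + h}"
   using sp(2)[of "indicator {x - h<..x + h}"] by (simp add: sh)
  finally show "ennreal (exp (- 1) * (t * m * d) * (c / (2 * rho t)) * (2 * h)) \<le> emeasure ?\<mu> {x - h<..x + h}"
   unfolding lm_def by (simp add: mult_left_mono)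
 qed
qed

text \<open>If all jumps up to a multiple of \<open>rho t\<close> are frequent, each application of
  \<open>jump_step\<close> moves the right end of the window by a fixed multiple of
  \<open>rho t\<close>. The number of steps depends on B only, and so does the loss.\<close>

lemma window_extend:
 assumes M: "saddle M" and d2: "0 < \<delta>" and eta: "0 < \<eta>"
 shows "\<exists>c>0. \<forall>t x. 0 < t \<longrightarrow> t \<le> T \<longrightarrow> (\<forall>s. 0 < s \<longrightarrow> s \<le> \<eta> * rho t \<longrightarrow> \<delta> \<le> t * rho t * N s) \<longrightarrow>
  xM M t \<le> x \<longrightarrow> x \<le> xM M t + B * rho t \<longrightarrow> c / rho t \<le> p t x"
proof -
 have M1: "1 < M" using M by (simp add: saddle_def)
 obtain w c0 where w: "0 < w" and c0: "0 < c0" and base: "\<And>t x. 0 < t \<Longrightarrow> t \<le> T \<Longrightarrow> xM M t \<le> x \<Longrightarrow> x \<le> xM M t + w * rho t \<Longrightarrow> c0 / rho t \<le> p t x"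
  using base_window[OF M] by blast
 obtain C where C: "1 \<le> C" and sup: "\<And>t x. 0 < t \<Longrightarrow> t \<le> T \<Longrightarrow> 0 < x \<Longrightarrow> p t x \<le> C / rho t" using p_sup by blast
 \<comment> \<open>Jumps between \<open>\<epsilon> * rho t\<close> and twice that are added: they
   must be frequent, hence below \<open>\<eta> * rho t\<close>, and short enough that the starting
   point stays to the right of \<open>xM M t\<close>.\<close>
 define \<epsilon> where "\<epsilon> = min (\<eta> / 2) (w / 4)"
 have e: "0 < \<epsilon>" "2 * \<epsilon> \<le> \<eta>" "4 * \<epsilon> \<le> w" unfolding \<epsilon>_def using eta w by auto
 have step: "\<exists>c>0. \<forall>t x. 0 < t \<longrightarrow> t \<le> T \<longrightarrow> (\<forall>s. 0 < s \<longrightarrow> s \<le> \<eta> * rho t \<longrightarrow> \<delta> \<le> t * rho t * N s) \<longrightarrow>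
  xM M t \<le> x \<longrightarrow> x \<le> xM M t + (w + real j * (\<epsilon> / 2)) * rho t \<longrightarrow> c / rho t \<le> p t x" for j
 proof (induction j)
  case 0
  show ?case using base c0 by (intro exI[of _ c0]) auto
 next
  case (Suc j)
  then obtain c where c: "0 < c" and IH: "\<And>t x. 0 < t \<Longrightarrow> t \<le> T \<Longrightarrow> (\<And>s. 0 < s \<Longrightarrow> s \<le> \<eta> * rho t \<Longrightarrow> \<delta> \<le> t * rho t * N s) \<Longrightarrow>
    xM M t \<le> x \<Longrightarrow> x \<le> xM M t + (w + real j * (\<epsilon> / 2)) * rho t \<Longrightarrow> c / rho t \<le> p t x" by blast
  \<comment> \<open>Only the fraction \<open>\<kappa>\<close> of the available jumps is used, to
    keep the mass in \<open>jump_step\<close> below 1 and c / (2 C).\<close>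
  define \<kappa> where "\<kappa> = min 1 (min 1 (c / (2 * C)) / (\<delta> * \<epsilon>))"
  have k: "0 < \<kappa>" "\<kappa> \<le> 1" unfolding \<kappa>_def using c C d2 e by auto
  have k2: "\<kappa> * (\<delta> * \<epsilon>) \<le> min 1 (c / (2 * C))"
  proof -
   have "\<kappa> * (\<delta> * \<epsilon>) \<le> min 1 (c / (2 * C)) / (\<delta> * \<epsilon>) * (\<delta> * \<epsilon>)" unfolding \<kappa>_def using d2 e by (intro mult_right_mono) auto
   then show ?thesis using d2 e by simp
  qed
  define c' where "c' = min c (exp (- 1) * (\<kappa> * (\<delta> * \<epsilon>)) * (c / 2))"
  have c': "0 < c'" unfolding c'_def using c k d2 e by simp
  show ?case
  proof (rule exI[of _ c'], rule conjI[OF c'], intro allI impI)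
   fix t x assume t: "0 < t" "t \<le> T" and Ns: "\<forall>s. 0 < s \<longrightarrow> s \<le> \<eta> * rho t \<longrightarrow> \<delta> \<le> t * rho t * N s"
    and x: "xM M t \<le> x" "x \<le> xM M t + (w + real (Suc j) * (\<epsilon> / 2)) * rho t"
   note rt = rho_props[OF t(1)]
   show "c' / rho t \<le> p t x"
   proof (cases "x \<le> xM M t + (w + real j * (\<epsilon> / 2)) * rho t")
    case True
    have "c' / rho t \<le> c / rho t" unfolding c'_def using rt by (intro divide_right_mono) auto
    also have "\<dots> \<le> p t x" by (rule IH[OF t _ x(1) True]) (use Ns in auto)
    finally show ?thesis .
   next
    case False
    define m where "m = \<kappa> * \<delta> / (t * rho t)"
    have tm: "t * m * (\<epsilon> * rho t) = \<kappa> * (\<delta> * \<epsilon>)" unfolding m_def using t rt by simp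
    have er: "0 < \<epsilon> * rho t" using e rt by simp
    have ww: "4 * \<epsilon> * rho t \<le> w * rho t" using e rt by (intro mult_right_mono) auto
    have jj: "0 \<le> real j * (\<epsilon> / 2) * rho t" using e rt by simp
    have "exp (- 1) * (t * m * (\<epsilon> * rho t)) * (c / (2 * rho t)) \<le> p t x"
    proof (rule jump_step[OF t c _ sup[OF t], where lo="xM M t" and hi="xM M t + (w + real j * (\<epsilon> / 2)) * rho t" and u="\<epsilon> * rho t"])
     show "0 \<le> xM M t" using xM_pos[OF t(1), of M] M1 by simp
     show "c / rho t \<le> p t z" if "xM M t < z" "z < xM M t + (w + real j * (\<epsilon> / 2)) * rho t" for z
      by (rule IH[OF t]) (use Ns that in auto)
     show "xM M t < x - \<epsilon> * rho t - \<epsilon> * rho t" using False ww jj er by (simp add: algebra_simps)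
     show "x - \<epsilon> * rho t < xM M t + (w + real j * (\<epsilon> / 2)) * rho t"
     proof -
      have "(w + real (Suc j) * (\<epsilon> / 2)) * rho t = (w + real j * (\<epsilon> / 2)) * rho t + \<epsilon> * rho t / 2" by (simp add: algebra_simps)
      then show ?thesis using x er by linarith
     qed
     show "m \<le> N s" if s: "\<epsilon> * rho t \<le> s" "s \<le> \<epsilon> * rho t + \<epsilon> * rho t" for s
     proof -
      have "s \<le> 2 * \<epsilon> * rho t" using s by simp
      also have "\<dots> \<le> \<eta> * rho t" using e rt by (intro mult_right_mono) auto
      finally have "\<delta> \<le> t * rho t * N s" using Ns s er by auto
      moreover have "\<kappa> * \<delta> \<le> \<delta>" using k d2 by simp
      ultimately have "\<kappa> * \<delta> \<le> t * rho t * N s" by linarith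
      then show ?thesis unfolding m_def using t rt by (simp add: divide_le_eq mult.commute)
     qed
    qed (use C er k k2 d2 t rt tm in \<open>auto simp: m_def\<close>)
    then have "exp (- 1) * (\<kappa> * (\<delta> * \<epsilon>)) * (c / 2) / rho t \<le> p t x" unfolding tm by simp
    moreover have "c' / rho t \<le> exp (- 1) * (\<kappa> * (\<delta> * \<epsilon>)) * (c / 2) / rho t" unfolding c'_def using rt by (intro divide_right_mono) auto
    ultimately show ?thesis by linarith
   qed
  qed
 qed
 obtain j where j: "B / (\<epsilon> / 2) \<le> real j" using real_arch_simple by blast
 have jB: "B \<le> w + real j * (\<epsilon> / 2)" using j e w by (simp add: divide_le_eq)
 obtain c where c: "0 < c" and S: "\<And>t x. 0 < t \<Longrightarrow> t \<le> T \<Longrightarrow> (\<And>s. 0 < s \<Longrightarrow> s \<le> \<eta> * rho t \<Longrightarrow> \<delta> \<le> t * rho t * N s) \<Longrightarrow>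
    xM M t \<le> x \<Longrightarrow> x \<le> xM M t + (w + real j * (\<epsilon> / 2)) * rho t \<Longrightarrow> c / rho t \<le> p t x"
  using step[of j] by blast
 show ?thesis
 proof (rule exI[of _ c], rule conjI[OF c], intro allI impI)
  fix t x assume t: "0 < t" "t \<le> T" and Ns: "\<forall>s. 0 < s \<longrightarrow> s \<le> \<eta> * rho t \<longrightarrow> \<delta> \<le> t * rho t * N s"
   and x: "xM M t \<le> x" "x \<le> xM M t + B * rho t"
  have "B * rho t \<le> (w + real j * (\<epsilon> / 2)) * rho t" using jB rho_props(1)[OF t(1)] by (intro mult_right_mono) auto
  then show "c / rho t \<le> p t x" using S[OF t _ x(1)] Ns x(2) by auto
 qed
qed

text \<open>Jumps below a small multiple of \<open>rho t\<close> contribute little to the third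
  moment because one factor s is small. The others are controlled by N (rho t) and the exponential
  tilt, hence are few when t rho t N (rho t) is small.\<close>

lemma mom3_small:
 assumes e: "0 < \<epsilon>"
 shows "\<exists>\<delta>>0. \<forall>t. 0 < t \<longrightarrow> rho t \<in> Y \<longrightarrow> t * rho t * N (rho t) \<le> \<delta> \<longrightarrow> t * mom N 3 (1 / rho t) \<le> \<epsilon> * rho t ^ 3"
proof -
 \<comment> \<open>As t \<open>KK N (rho t)\<close> is at most 1 / \<open>hconst\<close> <= 4, the
   small jumps take at most half of \<open>\<epsilon>\<close>.\<close>
 define \<kappa> where "\<kappa> = min 1 (\<epsilon> / 8)"
 have k: "0 < \<kappa>" "\<kappa> \<le> 1" "8 * \<kappa> \<le> \<epsilon>" unfolding \<kappa>_def using e by auto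
 \<comment> \<open>The factor 120 = 5! comes from exp (-u) <= 5!/u^5, which leaves the integrable
   power s^(-2) and its integral 1 / (\<open>\<kappa>\<close> r).\<close>
 define E where "E = 120 * C0 * (1 / \<kappa>) ^ k / \<kappa>"
 have E: "0 < E" unfolding E_def using C0 k by simp
 have k1: "1 \<le> (1 / \<kappa>) ^ k" using k by (intro one_le_power) auto
 show ?thesis
 proof (rule exI[of _ "\<epsilon> / (2 * E)"], rule conjI, use e E in simp, intro allI impI)
  fix t assume t: "0 < t" and rY: "rho t \<in> Y" and d: "t * rho t * N (rho t) \<le> \<epsilon> / (2 * E)"
  note rt = rho_props[OF t]
  define r where "r = rho t"
  have r: "0 < r" unfolding r_def by (rule rt)
  have l: "0 < 1 / r" using r by simp
  let ?g = "\<lambda>s. (C0 * (1 / \<kappa>) ^ k * N r * 120 * r ^ 5) * (indicator {\<kappa> * r..} s * s powr (- 1 - 1))"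
  have kr: "0 < \<kappa> * r" using k r by simp
  have ig: "integrable lborel ?g" by (intro integrable_mult_right powr_tail_integral kr) simp
  have iK: "integrable lborel (\<lambda>s. (\<kappa> * r ^ 3) * (N s * (if s \<le> r then (s / r)\<^sup>2 else 0)))"
   by (intro integrable_mult_right lbnd_integrable[OF N lbnd_KK[OF r]])
  have "mom N 3 (1 / r) \<le> (\<integral>s. (\<kappa> * r ^ 3) * (N s * (if s \<le> r then (s / r)\<^sup>2 else 0)) + ?g s \<partial>lborel)" unfolding mom_def lint_def
  proof (rule integral_mono)
   show "integrable lborel (\<lambda>s. N s * (s ^ 3 * exp (- (1 / r) * s)))" by (rule lbnd_integrable[OF N lbnd_mom[OF l]]) simp
   show "integrable lborel (\<lambda>s. (\<kappa> * r ^ 3) * (N s * (if s \<le> r then (s / r)\<^sup>2 else 0)) + ?g s)"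
    by (rule Bochner_Integration.integrable_add[OF iK ig])
   fix s :: real
   have g0: "0 \<le> ?g s" using C0 k r N_nonneg by (intro mult_nonneg_nonneg) auto
   have K0: "0 \<le> (\<kappa> * r ^ 3) * (N s * (if s \<le> r then (s / r)\<^sup>2 else 0))" using k r N_nonneg by (intro mult_nonneg_nonneg) auto
   show "N s * (s ^ 3 * exp (- (1 / r) * s)) \<le> (\<kappa> * r ^ 3) * (N s * (if s \<le> r then (s / r)\<^sup>2 else 0)) + ?g s"
   proof (cases "0 < s")
    case False
    then have "N s * (s ^ 3 * exp (- (1 / r) * s)) = 0" using levy_zero[OF N, of s] by simp
    then show ?thesis using g0 K0 by linarith
   next
    case s: True
    show ?thesis
    proof (cases "s < \<kappa> * r")
     case True
     have sr: "s \<le> r" using True mult_right_mono[OF k(2), of r] r by linarith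
     have "s ^ 3 * exp (- (1 / r) * s) \<le> s ^ 3 * 1" using s r by (intro mult_left_mono) auto
     also have "\<dots> = s * s\<^sup>2" by (simp add: power3_eq_cube power2_eq_square)
     also have "\<dots> \<le> (\<kappa> * r) * s\<^sup>2" using True by (intro mult_right_mono) auto
     also have "\<dots> = \<kappa> * r ^ 3 * (s / r)\<^sup>2" using r by (simp add: power_divide power3_eq_cube power2_eq_square)
     finally have "N s * (s ^ 3 * exp (- (1 / r) * s)) \<le> N s * (\<kappa> * r ^ 3 * (s / r)\<^sup>2)" by (rule mult_left_mono[OF _ N_nonneg])
     also have "\<dots> = (\<kappa> * r ^ 3) * (N s * (if s \<le> r then (s / r)\<^sup>2 else 0))" using sr by (simp add: mult_ac)
     finally show ?thesis using g0 by linarith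
    next
     case False
     have Ns: "N s \<le> C0 * (1 / \<kappa>) ^ k * N r"
     proof (cases "s \<le> r")
      case True
      have "N s \<le> C0 * (r / s) ^ k * N r" by (rule VV[OF rY[folded r_def] s True])
      also have "\<dots> \<le> C0 * (1 / \<kappa>) ^ k * N r"
      proof (intro mult_right_mono mult_left_mono power_mono)
       show "r / s \<le> 1 / \<kappa>" using False s k by (simp add: field_simps)
      qed (use C0 N_nonneg r s in auto)
      finally show ?thesis .
     next
      case False
      have "N s \<le> C0 * N r" using False by (intro AD rY[folded r_def]) auto
      also have "\<dots> \<le> C0 * (1 / \<kappa>) ^ k * N r" using k1 C0 N_nonneg by (intro mult_right_mono) (auto simp: mult_le_cancel_left1)
      finally show ?thesis .
     qed
     have "exp (- (s / r)) \<le> fact 5 / (s / r) ^ 5" by (rule exp_neg_le_power) (use s r in simp)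
     also have "\<dots> = 120 * r ^ 5 / s ^ 5" by (simp add: fact_numeral power_divide)
     finally have "s ^ 3 * exp (- (s / r)) \<le> s ^ 3 * (120 * r ^ 5 / s ^ 5)" using s by (intro mult_left_mono) auto
     also have "\<dots> = 120 * r ^ 5 * (s powr (- 1 - 1))"
      using s by (simp add: powr_minus_divide power3_eq_cube power2_eq_square eval_nat_numeral)
     finally have "N s * (s ^ 3 * exp (- (s / r))) \<le> (C0 * (1 / \<kappa>) ^ k * N r) * (120 * r ^ 5 * (s powr (- 1 - 1)))"
     proof (rule mult_mono[OF Ns])
      show "0 \<le> C0 * (1 / \<kappa>) ^ k * N r" using C0 k N_nonneg by (intro mult_nonneg_nonneg) auto
      show "0 \<le> s ^ 3 * exp (- (s / r))" using s by simp
     qed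
     also have "\<dots> = ?g s" using False by (simp add: mult_ac)
     finally show ?thesis using K0 by simp
    qed
   qed
  qed
  also have "\<dots> = (\<integral>s. (\<kappa> * r ^ 3) * (N s * (if s \<le> r then (s / r)\<^sup>2 else 0)) \<partial>lborel) + (\<integral>s. ?g s \<partial>lborel)"
   by (rule Bochner_Integration.integral_add[OF iK ig])
  also have "(\<integral>s. ?g s \<partial>lborel) = C0 * (1 / \<kappa>) ^ k * N r * 120 * r ^ 5 * ((\<kappa> * r) powr (- 1) / 1)"
   by (simp only: integral_mult_right_zero powr_tail_integral(2)[OF zero_less_one kr])
  also have "\<dots> = E * (r * N r) * r ^ 3" using kr k r unfolding E_def by (simp add: powr_minus_divide eval_nat_numeral field_simps)
  also have "(\<integral>s. (\<kappa> * r ^ 3) * (N s * (if s \<le> r then (s / r)\<^sup>2 else 0)) \<partial>lborel) = \<kappa> * r ^ 3 * KK N r"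
   unfolding KK_def lint_def by (rule integral_mult_right_zero)
  finally have m3: "mom N 3 (1 / r) \<le> \<kappa> * r ^ 3 * KK N r + E * (r * N r) * r ^ 3" .
  have KK4: "t * KK N r \<le> 4"
  proof -
   have "hconst * (t * KK N r) \<le> 1" using hconst_KK_le[OF N r] rt(2) t unfolding r_def by (simp add: field_simps)
   moreover have "1 / 4 * (t * KK N r) \<le> hconst * (t * KK N r)" using hconst_pos t KK_nonneg[OF N, of r] by (intro mult_right_mono) auto
   ultimately show ?thesis by linarith
  qed
  have "t * mom N 3 (1 / r) \<le> t * (\<kappa> * r ^ 3 * KK N r + E * (r * N r) * r ^ 3)" using m3 t by (intro mult_left_mono) auto
  also have "\<dots> = (\<kappa> * (t * KK N r) + E * (t * r * N r)) * r ^ 3" by (simp add: algebra_simps)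
  also have "\<dots> \<le> \<epsilon> * r ^ 3"
  proof (rule mult_right_mono)
   have "\<kappa> * (t * KK N r) \<le> \<kappa> * 4" using KK4 k by (intro mult_left_mono) auto
   moreover have "E * (t * r * N r) \<le> E * (\<epsilon> / (2 * E))" using d E unfolding r_def by (intro mult_left_mono) auto
   moreover have "E * (\<epsilon> / (2 * E)) = \<epsilon> / 2" using E by simp
   ultimately show "\<kappa> * (t * KK N r) + E * (t * r * N r) \<le> \<epsilon>" using k by linarith
  qed (use r in simp)
  finally show "t * mom N 3 (1 / rho t) \<le> \<epsilon> * rho t ^ 3" unfolding r_def .
 qed
qed

text \<open>Apply \<open>mom1_diff_le\<close> between 1 / rho t and 1 / rho (t/M): there t H
  increases from 1 to M.\<close>

lemma cc_xM:
 assumes t: "0 < t" and M: "1 < M"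
 shows "xM M t \<le> cc t" "cc t \<le> xM M t + (M - 1) * rho t"
proof -
 have tM: "0 < t / M" using t M by simp
 note rp = rho_props[OF tM] and rt = rho_props[OF t]
 have rr: "rho (t / M) \<le> rho t" using t M by (intro rho_mono) (auto simp: divide_le_eq)
 then have i: "1 / rho t \<le> 1 / rho (t / M)" using rp by (intro divide_left_mono) auto
 have i0: "0 < 1 / rho t" using rt by simp
 show "xM M t \<le> cc t" unfolding xM_def cc_def using t by (intro mult_left_mono mom1_antimono[OF N i0 i]) auto
 have "1 / rho t * (mom N 1 (1 / rho t) - mom N 1 (1 / rho (t / M))) \<le> HH N (1 / rho (t / M)) - HH N (1 / rho t)"
  by (rule mom1_diff_le[OF N i0 i])
 also have "\<dots> = (M - 1) / t" using rp rt t M by (simp add: field_simps)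
 finally have "(mom N 1 (1 / rho t) - mom N 1 (1 / rho (t / M))) \<le> rho t * ((M - 1) / t)" using rt by (simp add: field_simps)
 then have "t * (mom N 1 (1 / rho t) - mom N 1 (1 / rho (t / M))) \<le> t * (rho t * ((M - 1) / t))" using t by (intro mult_left_mono) auto
 also have "\<dots> = (M - 1) * rho t" using t by simp
 finally show "cc t \<le> xM M t + (M - 1) * rho t" unfolding xM_def cc_def by (simp add: algebra_simps)
qed

text \<open>\<open>A\<close> is arbitrary: the normal approximation works within any fixed number of
  standard deviations, and \<open>window_extend\<close> reaches any fixed multiple of
  \<open>rho t\<close>. The alternatives are separated by the size of t rho t N (rho t).\<close>

lemma near_diagonal:
 assumes M: "saddle M" and A: "0 \<le> A"
 shows "\<exists>c>0. \<forall>t x. 0 < t \<longrightarrow> t \<le> T \<longrightarrow> xM M t \<le> x \<longrightarrow> x \<le> cc t + A * rho t \<longrightarrow> c / rho t \<le> p t x"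
proof -
 have M1: "1 < M" using M by (simp add: saddle_def)
 obtain c where c: "0 < c" and vl: "\<And>t l. 0 < t \<Longrightarrow> 1 / L \<le> l \<Longrightarrow> c * (t * HH N l) \<le> (l * vv t l)\<^sup>2" using vv_lower by blast
 define B where "B = A + M"
 define c0 where "c0 = B / sqrt c"
 have c0: "0 \<le> c0" unfolding c0_def B_def using A M1 c by simp
 obtain L0 k' where L0: "0 < L0" and k': "0 < k'" and tl: "\<And>t l x. 0 < t \<Longrightarrow> t \<le> T \<Longrightarrow> 1 / rho t \<le> l \<Longrightarrow> 0 < x \<Longrightarrow>
   t * mom N 3 l \<le> L0 * vv t l ^ 3 \<Longrightarrow> \<bar>x - t * mom N 1 l\<bar> \<le> c0 * vv t l \<Longrightarrow> k' / vv t l * exp (l * x - t * lexp N l) \<le> p t x"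
  using tilt_lower[OF c0] by blast
 have "0 < L0 * sqrt c ^ 3" using L0 c by simp
 from mom3_small[OF this] obtain \<delta> where \<delta>: "0 < \<delta>" and m3: "\<And>t. 0 < t \<Longrightarrow> rho t \<in> Y \<Longrightarrow> t * rho t * N (rho t) \<le> \<delta> \<Longrightarrow>
   t * mom N 3 (1 / rho t) \<le> L0 * sqrt c ^ 3 * rho t ^ 3" by blast
 \<comment> \<open>The first entry covers \<open>rho t\<close> in \<open>Y\<close>, by almost
   monotonicity. Otherwise \<open>rho t\<close> exceeds \<open>R0\<close>, so t is at least 1 /
   H(1/R0), and the second entry bounds t rho t N s from below for s up to
   \<open>R0\<close>.\<close>
 define \<delta>2 where "\<delta>2 = min (\<delta> / C0) (R0 * N R0 / (C0 * HH N (1 / R0)))"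
 have HR: "0 < HH N (1 / R0)" using HH_pos R0_pos by simp
 have \<delta>2: "0 < \<delta>2" unfolding \<delta>2_def using \<delta> C0 R0_pos N_R0_pos HR by simp
 \<comment> \<open>Since \<open>rho t\<close> is at most \<open>L\<close>, this keeps
   \<open>\<eta> * rho t\<close> below \<open>R0\<close>, where N is bounded from below even if
   \<open>rho t\<close> is not in \<open>Y\<close>.\<close>
 define \<eta> where "\<eta> = R0 / L"
 have \<eta>: "0 < \<eta>" "\<eta> \<le> 1" unfolding \<eta>_def using R0_pos L L_pos by auto
 obtain k2 where k2: "0 < k2" and we: "\<And>t x. 0 < t \<Longrightarrow> t \<le> T \<Longrightarrow> (\<And>s. 0 < s \<Longrightarrow> s \<le> \<eta> * rho t \<Longrightarrow> \<delta>2 \<le> t * rho t * N s) \<Longrightarrow>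
   xM M t \<le> x \<Longrightarrow> x \<le> xM M t + B * rho t \<Longrightarrow> k2 / rho t \<le> p t x"
  using window_extend[OF M \<delta>2 \<eta>(1), of B] by blast
 define c1 where "c1 = min k2 (k' * exp (- M) / 2)"
 have c1: "0 < c1" unfolding c1_def using k2 k' by simp
 show ?thesis
 proof (rule exI[of _ c1], rule conjI[OF c1], intro allI impI)
  fix t x assume t: "0 < t" "t \<le> T" and x: "xM M t \<le> x" "x \<le> cc t + A * rho t"
  note rt = rho_props[OF t(1)]
  note cx = cc_xM[OF t(1) M1]
  have xp: "0 < x" using xM_pos[OF t(1), of M] M1 x by simp
  have xB: "x \<le> xM M t + B * rho t" using x(2) cx(2) rt unfolding B_def by (simp add: algebra_simps)
  have c1le: "c1 / rho t \<le> k2 / rho t" "c1 / rho t \<le> k' * exp (- M) / 2 / rho t"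
  proof -
   have "c1 \<le> k2" "c1 \<le> k' * exp (- M) / 2" unfolding c1_def by (rule min.cobounded1, rule min.cobounded2)
   then show "c1 / rho t \<le> k2 / rho t" "c1 / rho t \<le> k' * exp (- M) / 2 / rho t"
    using rt by (simp_all only: divide_right_mono less_imp_le)
  qed
  show "c1 / rho t \<le> p t x"
  proof (cases "rho t \<in> Y \<and> t * rho t * N (rho t) \<le> \<delta>")
   case True
   define l where "l = 1 / rho t"
   have l: "0 < l" using rt by (simp add: l_def)
   have H1: "t * HH N l = 1" using rt t by (simp add: l_def)
   have v: "0 < vv t l" by (rule vv_pos[OF t(1) l])
   have lL: "1 / L \<le> l" unfolding l_def using rho_le_L[OF t] rt L_pos by (intro divide_left_mono) auto
   have "sqrt c \<le> sqrt ((l * vv t l)\<^sup>2)" using vl[OF t(1) lL] H1 by (intro real_sqrt_le_mono) simp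
   then have "sqrt c \<le> l * vv t l" using l v by simp
   then have vlo: "sqrt c * rho t \<le> vv t l" using rt by (simp add: l_def field_simps)
   have "(l * vv t l)\<^sup>2 \<le> 1 / hconst" using vv_upper[OF t(1) l] H1 by simp
   also have "\<dots> \<le> 1 / (1 / 4)" using hconst_pos by (intro divide_left_mono) auto
   finally have "(l * vv t l)\<^sup>2 \<le> 2\<^sup>2" by simp
   then have "l * vv t l \<le> 2" by (rule power2_le_imp_le) simp
   then have vup: "vv t l \<le> 2 * rho t" using rt by (simp add: l_def field_simps)
   have a1: "t * mom N 3 l \<le> L0 * vv t l ^ 3"
   proof -
    have "t * mom N 3 l \<le> L0 * (sqrt c * rho t) ^ 3" using m3[OF t(1)] True by (simp add: l_def power_mult_distrib mult.assoc)
    also have "\<dots> \<le> L0 * vv t l ^ 3" using vlo c rt L0 by (intro mult_left_mono power_mono) auto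
    finally show ?thesis .
   qed
   have ccl: "cc t = t * mom N 1 l" unfolding cc_def l_def ..
   have a2: "\<bar>x - t * mom N 1 l\<bar> \<le> c0 * vv t l"
   proof -
    have "\<bar>x - cc t\<bar> \<le> B * rho t"
    proof -
     have "0 \<le> A * rho t" "0 \<le> M * rho t" using A rt M1 by auto
     then show ?thesis using x cx rt unfolding B_def abs_le_iff by (auto simp: algebra_simps)
    qed
    also have "\<dots> = c0 * (sqrt c * rho t)" unfolding c0_def using c by simp
    also have "\<dots> \<le> c0 * vv t l" using vlo c0 by (intro mult_left_mono) auto
    finally show ?thesis unfolding ccl .
   qed
   have "k' * exp (- M) / 2 / rho t = k' / (2 * rho t) * exp (- M)" by simp
   also have "\<dots> \<le> k' / vv t l * exp (l * x - t * lexp N l)"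
   proof (rule mult_mono)
    show "k' / (2 * rho t) \<le> k' / vv t l" using vup v k' rt by (intro divide_left_mono) auto
    have "cc t - (M - 1) * rho t \<le> x" using x cx by linarith
    then have "l * (cc t - (M - 1) * rho t) \<le> l * x" using l by (intro mult_left_mono) auto
    then have "l * cc t - (M - 1) \<le> l * x" using rt by (simp add: l_def algebra_simps)
    then show "exp (- M) \<le> exp (l * x - t * lexp N l)" using lexp_eq[OF l, of t] H1 ccl by simp
   qed (use k' v in auto)
   also have "\<dots> \<le> p t x" by (rule tl[OF t _ xp a1 a2]) (simp add: l_def)
   finally show ?thesis using c1le by linarith
  next
   case False
   have "k2 / rho t \<le> p t x"
   proof (rule we[OF t _ x(1) xB])
    fix s assume s: "0 < s" "s \<le> \<eta> * rho t"
    show "\<delta>2 \<le> t * rho t * N s"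
    proof (cases "rho t \<in> Y")
     case True
     then have d: "\<delta> \<le> t * rho t * N (rho t)" using False by simp
     have sr: "s \<le> rho t" using s(2) mult_right_mono[OF \<eta>(2), of "rho t"] rt(1) by linarith
     have "N (rho t) \<le> C0 * N s" by (rule AD[OF Y_down[OF s(1) sr True] sr])
     then have "t * rho t * N (rho t) \<le> t * rho t * (C0 * N s)" using t rt by (intro mult_left_mono) auto
     then have "\<delta> / C0 \<le> t * rho t * N s" using d C0 by (simp add: divide_le_eq mult_ac)
     then show ?thesis unfolding \<delta>2_def by simp
    next
     case False
     have rR: "R0 < rho t"
     proof (rule ccontr)
      assume "\<not> R0 < rho t"
      then show False using Y_down[OF rt(1) _ R0] False by simp
     qed
     have "\<eta> * rho t \<le> \<eta> * L" using rho_le_L[OF t] \<eta> by (intro mult_left_mono) auto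
     then have sR: "s \<le> R0" using s(2) L_pos by (simp add: \<eta>_def)
     have "N R0 \<le> C0 * N s" by (rule AD[OF Y_down[OF s(1) sR R0] sR])
     then have Ns: "N R0 / C0 \<le> N s" using C0 by (simp add: divide_le_eq mult.commute)
     have "1 \<le> t * HH N (1 / R0)" using le_rho_iff[OF t(1) R0_pos] rR by simp
     then have "1 / HH N (1 / R0) \<le> t" using HR by (simp add: divide_le_eq)
     then have "1 / HH N (1 / R0) * R0 * (N R0 / C0) \<le> t * rho t * N s"
      using Ns rR R0_pos HR N_R0_pos C0 t rt by (intro mult_mono) auto
     moreover have "\<delta>2 \<le> 1 / HH N (1 / R0) * R0 * (N R0 / C0)" unfolding \<delta>2_def by (simp add: mult_ac)
     ultimately show ?thesis by linarith
    qed
   qed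
   then show ?thesis using c1le by linarith
  qed
 qed
qed

section \<open>Lower bound by one large jump\<close>

text \<open>t H(1/rho t) = 1 bounds the number of jumps near \<open>rho t\<close>. In
  \<open>jump_lower\<close> this lets a fixed fraction of the jumps of size about y satisfy the mass
  condition of \<open>jump_step\<close>.\<close>

lemma tNrho_le:
 assumes t: "0 < t" and y: "y \<in> Y" "rho t \<le> y"
 shows "t * N y * rho t \<le> 32 * C0\<^sup>2"
proof -
 note rt = rho_props[OF t]
 have rY: "rho t \<in> Y" by (rule Y_down[OF rt(1) y(2,1)])
 have "rho t * N (rho t) / (8 * C0) \<le> KK N (rho t)" by (rule KK_ge_rN[OF rY])
 then have "1 / 4 * (rho t * N (rho t) / (8 * C0)) \<le> hconst * KK N (rho t)"
  using hconst_pos KK_nonneg[OF N] rt N_nonneg C0 by (intro mult_mono) auto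
 also have "\<dots> \<le> 1 / t" using hconst_KK_le[OF N rt(1)] rt(2) by simp
 finally have "t * (rho t * N (rho t)) \<le> 32 * C0" using t C0 by (simp add: field_simps)
 moreover have "N y \<le> C0 * N (rho t)" by (rule AD[OF rY y(2)])
 then have "t * N y * rho t \<le> t * (C0 * N (rho t)) * rho t" using t rt by (intro mult_right_mono mult_left_mono) auto
 moreover have "C0 * (t * (rho t * N (rho t))) \<le> C0 * (32 * C0)" using calculation(1) C0 by (intro mult_left_mono) auto
 ultimately show ?thesis by (simp add: power2_eq_square mult_ac)
qed

lemma jump_lower:
 "\<exists>c>0. \<forall>t y. 0 < t \<longrightarrow> t \<le> T \<longrightarrow> y \<in> Y \<longrightarrow> rho t \<le> y \<longrightarrow> c * (t * N y) \<le> p t (cc t + y)"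
proof -
 obtain M where M: "saddle M" using saddle_exists by blast
 have M1: "1 < M" using M by (simp add: saddle_def)
 obtain c where c: "0 < c" and nd: "\<And>t x. 0 < t \<Longrightarrow> t \<le> T \<Longrightarrow> xM M t \<le> x \<Longrightarrow> x \<le> cc t + 1 * rho t \<Longrightarrow> c / rho t \<le> p t x"
  using near_diagonal[OF M, of 1] by auto
 obtain C where C: "1 \<le> C" and sup: "\<And>t x. 0 < t \<Longrightarrow> t \<le> T \<Longrightarrow> 0 < x \<Longrightarrow> p t x \<le> C / rho t" using p_sup by blast
 define \<kappa> where "\<kappa> = min 1 (min 1 (c / (2 * C)) / (8 * C0))"
 have k: "0 < \<kappa>" "\<kappa> \<le> 1" unfolding \<kappa>_def using c C C0 by auto
 have k2: "\<kappa> * (8 * C0) \<le> min 1 (c / (2 * C))"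
 proof -
  have "\<kappa> * (8 * C0) \<le> min 1 (c / (2 * C)) / (8 * C0) * (8 * C0)" unfolding \<kappa>_def using C0 by (intro mult_right_mono) auto
  then show ?thesis using C0 by simp
 qed
 define c' where "c' = exp (- 1) * (\<kappa> / (4 * C0)) * (c / 2)"
 have c': "0 < c'" unfolding c'_def using k C0 c by simp
 show ?thesis
 proof (rule exI[of _ c'], rule conjI[OF c'], intro allI impI)
  fix t y assume t: "0 < t" "t \<le> T" and y: "y \<in> Y" "rho t \<le> y"
  note rt = rho_props[OF t(1)]
  note cx = cc_xM[OF t(1) M1]
  define m where "m = \<kappa> * (N y / C0)"
  have m0: "0 \<le> m" unfolding m_def using k N_nonneg C0 by simp
  have "t * m * (rho t / 4) = \<kappa> / (4 * C0) * (t * N y * rho t)" unfolding m_def by (simp add: mult_ac)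
  also have "\<dots> \<le> \<kappa> / (4 * C0) * (32 * C0\<^sup>2)" using tNrho_le[OF t(1) y] k C0 by (intro mult_left_mono) auto
  also have "\<dots> = \<kappa> * (8 * C0)" using C0 by (simp add: power2_eq_square)
  finally have lam: "t * m * (rho t / 4) \<le> min 1 (c / (2 * C))" using k2 by linarith
  have "exp (- 1) * (t * m * (rho t / 4)) * (c / (2 * rho t)) \<le> p t (cc t + y)"
  \<comment> \<open>Jumps between y - rho t / 2 and y - rho t / 4 lead to cc t + y from points
    between cc t + rho t / 4 and cc t + rho t / 2, well inside the window; being below y, they have
    density at least N y / C0.\<close>
  proof (rule jump_step[OF t c _ sup[OF t], where lo="xM M t" and hi="cc t + rho t" and u="y - rho t / 2"])
   show "0 \<le> xM M t" using xM_pos[OF t(1), of M] M1 by simp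
   show "c / rho t \<le> p t z" if "xM M t < z" "z < cc t + rho t" for z by (rule nd[OF t]) (use that in auto)
   show "m \<le> N s" if s: "y - rho t / 2 \<le> s" "s \<le> y - rho t / 2 + rho t / 4" for s
   proof -
    have sp: "0 < s" "s \<le> y" using s y rt by auto
    have "N y \<le> C0 * N s" by (rule AD[OF Y_down[OF sp y(1)] sp(2)])
    then have "N y / C0 \<le> N s" using C0 by (simp add: divide_le_eq mult.commute)
    moreover have "\<kappa> * (N y / C0) \<le> 1 * (N y / C0)" using k N_nonneg C0 by (intro mult_right_mono) auto
    ultimately show ?thesis unfolding m_def by linarith
   qed
  qed (use C m0 lam cx y rt in auto)
  moreover have "exp (- 1) * (t * m * (rho t / 4)) * (c / (2 * rho t)) = c' * (t * N y)"
   unfolding c'_def m_def using rt by (simp add: field_simps)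
  ultimately show "c' * (t * N y) \<le> p t (cc t + y)" by simp
 qed
qed

end

section \<open>Lower bound by chaining\<close>

context scaling begin

lemma scale_ratio:
 "\<exists>D\<ge>1. \<forall>q r. 0 < q \<longrightarrow> q \<le> L \<longrightarrow> 0 < r \<longrightarrow> HH N (1 / r) \<le> 2 * HH N (1 / q) \<longrightarrow> q \<le> D * r"
proof -
 obtain c3 where c3: "0 < c3" "\<And>r x. 0 < r \<Longrightarrow> r \<le> L \<Longrightarrow> 1 \<le> x \<Longrightarrow> c3 * x powr a * HH N (1 / r) \<le> HH N (x / r)" using HH_scale by blast
 define D where "D = 1 + (2 / c3) powr (1 / a)"
 show ?thesis
 proof (intro exI[of _ D] conjI allI impI)
  show "1 \<le> D" by (simp add: D_def)
  fix q r assume q: "0 < q" "q \<le> L" and r: "0 < r" and h: "HH N (1 / r) \<le> 2 * HH N (1 / q)"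
  show "q \<le> D * r"
  proof (cases "q \<le> r")
   case True
   moreover have "1 * r \<le> D * r" using r by (intro mult_right_mono) (auto simp: D_def)
   ultimately show ?thesis by linarith
  next
   case False
   define x where "x = q / r"
   have x: "1 \<le> x" using False r by (simp add: x_def)
   have Hq: "0 < HH N (1 / q)" using HH_pos q by simp
   have "c3 * x powr a * HH N (1 / q) \<le> HH N (x / q)" by (rule c3(2)[OF q x])
   also have "x / q = 1 / r" using q by (simp add: x_def)
   finally have "c3 * x powr a * HH N (1 / q) \<le> 2 * HH N (1 / q)" using h by linarith
   then have "c3 * x powr a \<le> 2" using Hq by (simp only: mult_le_cancel_right_pos)
   then have "x powr a \<le> 2 / c3" using c3 by (simp add: field_simps)
   then have "(x powr a) powr (1 / a) \<le> (2 / c3) powr (1 / a)" using a_pos by (intro powr_mono2) auto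
   then have "x \<le> D" using a_pos x by (simp add: powr_powr D_def)
   then show ?thesis using r by (simp add: x_def divide_le_eq)
  qed
 qed
qed

text \<open>A jump s up to q contributes at most s^2 / r, because exp (-u) >= 1 - u; a larger one
  contributes at most r', because u exp (-u) <= 1. In the chaining this measures how far the centre
  of a short step lies from its share of \<open>cc t\<close>.\<close>

lemma mom1_diff_upper:
 assumes q: "0 < q" and r: "0 < r" and rr: "0 < r'"
 shows "mom N 1 (1 / r') - mom N 1 (1 / r) \<le> q\<^sup>2 / r * KK N q + r' * ww N q"
proof -
 have "mom N 1 (1 / r') - mom N 1 (1 / r) = lint N (\<lambda>s. s ^ 1 * exp (- (1 / r') * s) - s ^ 1 * exp (- (1 / r) * s))"
  unfolding mom_def by (rule lint_diff[symmetric, OF N lbnd_mom lbnd_mom]) (use r rr in auto)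
 also have "\<dots> \<le> lint N (\<lambda>s. q\<^sup>2 / r * (if s \<le> q then (s / q)\<^sup>2 else 0) + r' * (if q < s then 1 else 0))"
 proof (rule lint_mono[OF N])
  show "lbnd (\<lambda>s. s ^ 1 * exp (- (1 / r') * s) - s ^ 1 * exp (- (1 / r) * s))"
   by (rule lbnd_diff[OF lbnd_mom lbnd_mom]) (use r rr in auto)
  show "lbnd (\<lambda>s. q\<^sup>2 / r * (if s \<le> q then (s / q)\<^sup>2 else 0) + r' * (if q < s then 1 else 0))"
   by (intro lbnd_add lbnd_cmult lbnd_KK lbnd_ww q)
  fix s :: real assume s: "0 < s"
  show "s ^ 1 * exp (- (1 / r') * s) - s ^ 1 * exp (- (1 / r) * s)
   \<le> q\<^sup>2 / r * (if s \<le> q then (s / q)\<^sup>2 else 0) + r' * (if q < s then 1 else 0)"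
  proof (cases "s \<le> q")
   case True
   have "s * exp (- (1 / r') * s) \<le> s * 1" using s rr by (intro mult_left_mono) auto
   moreover have "s * (1 - s / r) \<le> s * exp (- (1 / r) * s)"
    using s exp_ge_add_one_self[of "- (1 / r) * s"] by (intro mult_left_mono) auto
   moreover have "q\<^sup>2 / r * (s / q)\<^sup>2 = s * (s / r)" using q by (simp add: power_divide power2_eq_square)
   moreover have "s * (1 - s / r) = s - s * (s / r)" by (simp add: algebra_simps)
   ultimately have "s * exp (- (1 / r') * s) - s * exp (- (1 / r) * s) \<le> q\<^sup>2 / r * (s / q)\<^sup>2" by linarith
   then show ?thesis using True by simp
  next
   case False
   have "s / r' \<le> exp (s / r')" using exp_ge_add_one_self[of "s / r'"] by linarith
   then have "s / r' * exp (- (s / r')) \<le> exp (s / r') * exp (- (s / r'))" by (rule mult_right_mono) simp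
   also have "\<dots> = 1" by (simp flip: exp_add)
   finally have "s / r' * exp (- (s / r')) \<le> 1" .
   then have "r' * (s / r' * exp (- (s / r'))) \<le> r' * 1" using rr by (intro mult_left_mono) auto
   then have "s * exp (- (1 / r') * s) \<le> r'" using rr by simp
   moreover have "0 \<le> s * exp (- (1 / r) * s)" using s by simp
   ultimately have "s * exp (- (1 / r') * s) - s * exp (- (1 / r) * s) \<le> r'" by linarith
   then show ?thesis using False by simp
  qed
 qed
 also have "\<dots> = q\<^sup>2 / r * KK N q + r' * ww N q"
  unfolding KK_def ww_def lint_cmult[symmetric] by (rule lint_add[OF N]) (intro lbnd_cmult lbnd_KK lbnd_ww q)+
 finally show ?thesis .
qed

lemma t_ww_le: "0 < t \<Longrightarrow> s0 t \<le> q \<Longrightarrow> t * ww N q \<le> 2 * exp 1"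
proof -
 assume t: "0 < t" and q: "s0 t \<le> q"
 have "ww N q \<le> 2 * exp 1 / t" using ww_antimono[OF N s0_props(1)[OF t] q] s0_props(3)[OF t] by simp
 then show ?thesis using t by (simp add: field_simps)
qed

lemma hconst_tKK: "0 < t \<Longrightarrow> 0 < q \<Longrightarrow> hconst * (t * KK N q) \<le> t * HH N (1 / q)"
 using mult_left_mono[OF hconst_KK_le[OF N, of q], of t] by (simp add: mult_ac)

end

context subord_density begin

section \<open>Convolution of windows\<close>

lemma nn_integral_pl:
 assumes "0 < t" and g: "g \<in> borel_measurable borel"
 shows "(\<integral>\<^sup>+x. g x \<partial>pos_density (p t)) = (\<integral>\<^sup>+x. ennreal (indicator {0<..} x * p t x) * g x \<partial>lborel)"
 unfolding pos_density_def using pos_density_measurable[OF p_cont[OF assms(1)]] g by (subst nn_integral_density) auto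

lemma pl_conv:
 assumes "0 < s" "0 < t"
 shows "pos_density (p (s + t)) = (pos_density (p s) \<star> pos_density (p t))"
proof -
 have "id_law (\<lambda>x. s * N x + t * N x) (pos_density (p s) \<star> pos_density (p t))"
  by (rule id_law_conv[OF levy_t levy_t p_law p_law]) (use assms in auto)
 then have "id_law (\<lambda>x. (s + t) * N x) (pos_density (p s) \<star> pos_density (p t))" by (simp only: distrib_right)
 then show ?thesis using id_law_unique[OF p_law[of "s + t"]] assms by auto
qed

text \<open>The deviation w of z from a1 + a2 is shared equally. The first point ranges over an
  interval of length r/2 around a1 + w/2, and the second then stays within r of a2. The radius r is
  recovered in full, so the step can be iterated.\<close>

lemma conv_step:
 assumes s: "0 < s" and t: "0 < t" and r: "0 < r" and k: "0 \<le> k1" "0 \<le> k2" and a: "r < a1" "r < a2"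
  and p1: "\<And>x. \<bar>x - a1\<bar> \<le> r \<Longrightarrow> k1 \<le> p s x" and p2: "\<And>x. \<bar>x - a2\<bar> \<le> r \<Longrightarrow> k2 \<le> p t x"
  and z: "\<bar>z - (a1 + a2)\<bar> \<le> r"
 shows "k1 * k2 * (r / 2) \<le> p (s + t) z"
proof -
 have st: "0 < s + t" using s t by simp
 define w where "w = z - (a1 + a2)"
 have w: "\<bar>w\<bar> \<le> r" using z by (simp add: w_def)
 let ?U = "{a1 + w / 2 - r / 4..a1 + w / 2 + r / 4}"
 have nd: "nonneg_dist (pos_density (p s))" "nonneg_dist (pos_density (p t))" using p_law s t by (auto simp: id_law_def)
 interpret Q: real_distribution "pos_density (p t)" by (rule pl_dist[OF t])
 have r4: "0 < r / 4" using r by simp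
 show ?thesis
 proof (rule pos_density_lower_point[OF p_cont[OF st] p_nonneg[OF st] _ r4])
  show "0 < z" using z a r by (simp add: abs_le_iff)
  show "0 \<le> k1 * k2 * (r / 2)" using k r by simp
  fix h assume h: "0 < h" "h < r / 4"
  let ?B = "{z - h<..z + h}"
  have sh: "(\<integral>\<^sup>+y. indicator ?B (x + y) \<partial>pos_density (p t)) = emeasure (pos_density (p t)) {z - h - x<..z + h - x}" for x
  proof -
   have "(\<integral>\<^sup>+y. indicator ?B (x + y) \<partial>pos_density (p t)) = (\<integral>\<^sup>+y. indicator {z - h - x<..z + h - x} y \<partial>pos_density (p t))"
    by (intro nn_integral_cong) (auto simp: indicator_def)
   then show ?thesis by simp
  qed
  have [measurable]: "(\<lambda>x. emeasure (pos_density (p t)) {z - h - x<..z + h - x}) \<in> borel_measurable borel"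
   unfolding sh[symmetric] by measurable
  have "ennreal (k1 * k2 * (r / 2) * (2 * h)) = ennreal (k1 * (k2 * (2 * h))) * emeasure lborel ?U"
   using k h r by (simp add: ennreal_mult[symmetric] mult_ac)
  also have "\<dots> = (\<integral>\<^sup>+x. ennreal (k1 * (k2 * (2 * h))) * indicator ?U x \<partial>lborel)" by (rule nn_integral_cmult_indicator[symmetric]) simp
  also have "\<dots> \<le> (\<integral>\<^sup>+x. ennreal (indicator {0<..} x * p s x) * emeasure (pos_density (p t)) {z - h - x<..z + h - x} \<partial>lborel)"
  proof (rule nn_integral_mono)
   fix x :: real
   show "ennreal (k1 * (k2 * (2 * h))) * indicator ?U x \<le> ennreal (indicator {0<..} x * p s x) * emeasure (pos_density (p t)) {z - h - x<..z + h - x}"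
   proof (cases "x \<in> ?U")
    case True
    have xa: "\<bar>x - a1\<bar> \<le> r" using True w unfolding abs_le_iff by auto
    then have x0: "0 < x" using a r by (simp add: abs_le_iff)
    have "ennreal (k2 * (2 * h)) = ennreal k2 * emeasure lborel {z - h - x<..z + h - x}"
     using k h by (simp add: ennreal_mult[symmetric])
    also have "\<dots> \<le> emeasure (pos_density (p t)) {z - h - x<..z + h - x}"
    proof (rule pos_density_ge[OF p_cont[OF t] k(2)])
     fix u assume u: "u \<in> {z - h - x<..z + h - x}"
     have zw: "z = a1 + a2 + w" by (simp add: w_def)
     have w1: "w \<le> r" "- w \<le> r" using w by (auto simp: abs_le_iff)
     have x1: "a1 + w / 2 - r / 4 \<le> x" "x \<le> a1 + w / 2 + r / 4" using True by auto
     have u1: "z - h - x < u" "u \<le> z + h - x" using u by auto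
     have "u - a2 \<le> r" using x1 u1 w1 h zw by linarith
     moreover have "a2 - u \<le> r" using x1 u1 w1 h zw by linarith
     ultimately have "\<bar>u - a2\<bar> \<le> r" by (simp add: abs_le_iff)
     then show "0 < u \<and> k2 \<le> p t u" using p2 a r by (auto simp: abs_le_iff)
    qed simp
    finally have "ennreal k1 * ennreal (k2 * (2 * h)) \<le> ennreal (p s x) * emeasure (pos_density (p t)) {z - h - x<..z + h - x}"
     using p1[OF xa] by (intro mult_mono ennreal_leI) auto
    then show ?thesis using True x0 k h by (simp add: ennreal_mult)
   qed simp
  qed
  also have "\<dots> = (\<integral>\<^sup>+x. emeasure (pos_density (p t)) {z - h - x<..z + h - x} \<partial>pos_density (p s))"
   by (rule nn_integral_pl[symmetric, OF s]) measurable
  also have "\<dots> = (\<integral>\<^sup>+x. \<integral>\<^sup>+y. indicator ?B (x + y) \<partial>pos_density (p t) \<partial>pos_density (p s))" unfolding sh ..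
  also have "\<dots> = (\<integral>\<^sup>+x. indicator ?B x \<partial>pos_density (p (s + t)))"
   unfolding pl_conv[OF s t] by (rule nn_integral_conv_nonneg_dist[OF nd, symmetric]) simp
  also have "\<dots> = emeasure (pos_density (p (s + t))) ?B" by (simp add: pos_density_def)
  finally show "ennreal (k1 * k2 * (r / 2) * (2 * h)) \<le> emeasure (pos_density (p (s + t))) ?B" .
 qed
qed

lemma chain:
 assumes t: "0 < \<tau>" and r: "0 < r" "r < x" and kk: "0 \<le> \<kappa>" and pk: "\<And>z. \<bar>z - x\<bar> \<le> r \<Longrightarrow> \<kappa> / r \<le> p \<tau> z"
 shows "\<bar>z - real (Suc n) * x\<bar> \<le> r \<Longrightarrow> \<kappa> / r * (\<kappa> / 2) ^ n \<le> p (real (Suc n) * \<tau>) z"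
proof (induction n arbitrary: z)
 case 0
 then show ?case using pk by simp
next
 case (Suc n)
 have x0: "0 < x" using r by simp
 have "x \<le> real (Suc n) * x" using x0 by (simp add: distrib_right)
 then have rx: "r < real (Suc n) * x" using r by linarith
 have st: "0 < real (Suc n) * \<tau>" using t by simp
 have z: "\<bar>z - (real (Suc n) * x + x)\<bar> \<le> r" using Suc.prems by (simp add: algebra_simps)
 have "\<kappa> / r * (\<kappa> / 2) ^ n * (\<kappa> / r) * (r / 2) \<le> p (real (Suc n) * \<tau> + \<tau>) z"
  by (rule conv_step[OF st t r(1) _ _ rx r(2) Suc.IH pk z]) (use kk r in auto)
 moreover have "\<kappa> / r * (\<kappa> / 2) ^ n * (\<kappa> / r) * (r / 2) = \<kappa> / r * (\<kappa> / 2) ^ Suc n" using r by simp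
 moreover have "real (Suc n) * \<tau> + \<tau> = real (Suc (Suc n)) * \<tau>" by (simp add: algebra_simps)
 ultimately show ?case by simp
qed

text \<open>The time is cut into n = ceiling of t H(1/q) steps, so that \<open>rho\<close> of a
  single step is comparable to q. The advance (cc t + y)/n required per step exceeds the centre of
  the step by at least one and at most boundedly many units of this scale, so
  \<open>near_diagonal\<close> applies to every step.\<close>

lemma chain_lower:
 "\<exists>c>0. \<exists>K>0. \<forall>t q y. 0 < t \<longrightarrow> t \<le> T \<longrightarrow> s0 t \<le> q \<longrightarrow> q \<le> rho t \<longrightarrow> rho t \<le> y \<longrightarrow>
   y = 8 * (exp 1)\<^sup>2 * (t * q * HH N (1 / q)) \<longrightarrow> c / rho t * exp (- K * y / q) \<le> p t (cc t + y)"
proof -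
 define e8 :: real where "e8 = 8 * (exp 1)\<^sup>2"
 have e8: "2 \<le> e8"
 proof -
  have "(27 / 10)\<^sup>2 \<le> (exp 1 :: real)\<^sup>2" using exp1_ge by (intro power_mono) auto
  then show ?thesis unfolding e8_def by (simp add: power2_eq_square)
 qed
 obtain M where M: "saddle M" using saddle_exists by blast
 have M1: "1 < M" using M by (simp add: saddle_def)
 obtain D where D: "1 \<le> D" and sr: "\<And>q r. 0 < q \<Longrightarrow> q \<le> L \<Longrightarrow> 0 < r \<Longrightarrow> HH N (1 / r) \<le> 2 * HH N (1 / q) \<Longrightarrow> q \<le> D * r" using scale_ratio by blast
 \<comment> \<open>The summands bound, in units of the step scale r: small jumps (4 D^2), large
   jumps (6 e8 D), the share y/n (e8 D), and the radius of the window (1).\<close>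
 define A where "A = 4 * D\<^sup>2 + 7 * e8 * D + 1"
 have A: "0 \<le> A" unfolding A_def using D e8 by simp
 obtain c where c: "0 < c" and nd: "\<And>t x. 0 < t \<Longrightarrow> t \<le> T \<Longrightarrow> xM M t \<le> x \<Longrightarrow> x \<le> cc t + A * rho t \<Longrightarrow> c / rho t \<le> p t x"
  using near_diagonal[OF M A] by blast
 define c' where "c' = min c 1"
 have c': "0 < c'" "c' \<le> 1" "c' \<le> c" unfolding c'_def using c by auto
 \<comment> \<open>Each step costs the factor c'/2, and there are at most 2 t H(1/q) = 2 y / (e8 q)
   of them.\<close>
 define K where "K = - ln (c' / 2) * (2 / e8)"
 have lnc: "ln (c' / 2) < 0" using c' by (simp add: ln_less_zero)
 have K: "0 < K" unfolding K_def using lnc e8 by (intro mult_pos_pos) auto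
 show ?thesis
 proof (rule exI[of _ c'], rule conjI[OF c'(1)], rule exI[of _ K], rule conjI[OF K], intro allI impI)
  fix t q y assume t: "0 < t" "t \<le> T" and q: "s0 t \<le> q" "q \<le> rho t" and y: "rho t \<le> y"
   and yq: "y = 8 * (exp 1)\<^sup>2 * (t * q * HH N (1 / q))"
  note rt = rho_props[OF t(1)]
  have q0: "0 < q" using s0_props(1)[OF t(1)] q by linarith
  have qL: "q \<le> L" using q rho_le_L[OF t] by linarith
  define X where "X = t * HH N (1 / q)"
  have X: "1 \<le> X" unfolding X_def using le_rho_iff[OF t(1) q0] q by simp
  have yX: "y = e8 * (X * q)" unfolding yq e8_def X_def by simp
  define n where "n = nat \<lceil>X\<rceil>"
  have n1: "X \<le> real n" unfolding n_def by linarith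
  have n2: "real n \<le> 2 * X" unfolding n_def using X by linarith
  have n0: "0 < real n" using n1 X by linarith
  then obtain n' where n': "n = Suc n'" by (cases n) auto
  define \<tau> where "\<tau> = t / real n"
  have \<tau>: "0 < \<tau>" "\<tau> \<le> T" unfolding \<tau>_def using t n0 n1 X by (auto simp: divide_le_eq intro: order_trans)
  have n\<tau>: "real n * \<tau> = t" unfolding \<tau>_def using n0 by simp
  have \<tau>t: "\<tau> \<le> t" unfolding \<tau>_def using t n1 X by (simp add: divide_le_eq)
  define r where "r = rho \<tau>"
  note rp = rho_props[OF \<tau>(1), folded r_def]
  have Hr: "HH N (1 / r) = real n / t" using rp(2) t n0 unfolding \<tau>_def by simp
  have rq: "r \<le> q"
  proof (rule ccontr)
   assume "\<not> r \<le> q"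
   then have "HH N (1 / r) < HH N (1 / q)" using q0 rp by (intro HH_strict_mono divide_strict_left_mono) auto
   then have "real n < X" using Hr t unfolding X_def by (simp add: divide_less_eq mult.commute)
   then show False using n1 by simp
  qed
  have "HH N (1 / r) \<le> 2 * HH N (1 / q)" unfolding Hr using n2 t unfolding X_def by (simp add: divide_le_eq mult_ac)
  then have qD: "q \<le> D * r" by (rule sr[OF q0 qL rp(1)])
  have rrho: "r \<le> rho t" using rq q by simp
  define x where "x = (cc t + y) / real n"
  have ccx: "x = \<tau> * mom N 1 (1 / rho t) + y / real n" unfolding x_def cc_def \<tau>_def by (simp add: add_divide_distrib)
  have yn1: "y / real n \<le> e8 * q"
  proof -
   have "y \<le> e8 * (real n * q)" unfolding yX using n1 q0 e8 by (intro mult_left_mono mult_right_mono) auto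
   then show ?thesis using n0 by (simp add: divide_le_eq mult_ac)
  qed
  have yn2: "r \<le> y / real n"
  proof -
   have "r * real n \<le> q * (2 * X)" using rq n2 q0 n0 by (intro mult_mono) auto
   also have "\<dots> = 2 * (X * q)" by simp
   also have "\<dots> \<le> y" unfolding yX using e8 X q0 by (intro mult_right_mono) auto
   finally show ?thesis using n0 by (simp add: le_divide_eq)
  qed
  have cc\<tau>: "cc \<tau> = \<tau> * mom N 1 (1 / r)" unfolding cc_def r_def ..
  have low: "cc \<tau> + r \<le> x"
  proof -
   have "mom N 1 (1 / r) \<le> mom N 1 (1 / rho t)" using rrho rp rt by (intro mom1_antimono[OF N] divide_left_mono) auto
   then have "\<tau> * mom N 1 (1 / r) \<le> \<tau> * mom N 1 (1 / rho t)" using \<tau> by (intro mult_left_mono) auto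
   then show ?thesis unfolding ccx cc\<tau> using yn2 by linarith
  qed
  have up: "x + r \<le> cc \<tau> + A * r"
  proof -
   have "mom N 1 (1 / rho t) - mom N 1 (1 / r) \<le> q\<^sup>2 / r * KK N q + rho t * ww N q" by (rule mom1_diff_upper[OF q0 rp(1) rt(1)])
   then have "\<tau> * (mom N 1 (1 / rho t) - mom N 1 (1 / r)) \<le> \<tau> * (q\<^sup>2 / r * KK N q + rho t * ww N q)"
    using \<tau> by (intro mult_left_mono) auto
   then have d: "\<tau> * mom N 1 (1 / rho t) - \<tau> * mom N 1 (1 / r) \<le> q\<^sup>2 / r * (\<tau> * KK N q) + rho t * (\<tau> * ww N q)"
    by (simp add: algebra_simps)
   have "\<tau> * KK N q \<le> 4"
   proof -
    have "real n * (hconst * (\<tau> * KK N q)) = hconst * (t * KK N q)" using n\<tau> by (simp flip: n\<tau>)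
    also have "\<dots> \<le> X" unfolding X_def by (rule hconst_tKK[OF t(1) q0])
    also have "\<dots> \<le> real n * 1" using n1 by simp
    finally have "hconst * (\<tau> * KK N q) \<le> 1" using n0 by (simp only: mult_le_cancel_left_pos)
    moreover have "1 / 4 * (\<tau> * KK N q) \<le> hconst * (\<tau> * KK N q)"
     using hconst_pos \<tau> KK_nonneg[OF N, of q] by (intro mult_right_mono) auto
    ultimately show ?thesis by linarith
   qed
   moreover have "q\<^sup>2 / r \<le> D\<^sup>2 * r"
   proof -
    have "q\<^sup>2 \<le> (D * r)\<^sup>2" using qD q0 by (intro power_mono) auto
    then show ?thesis using rp by (simp add: divide_le_eq power2_eq_square mult_ac)
   qed
   ultimately have d1: "q\<^sup>2 / r * (\<tau> * KK N q) \<le> D\<^sup>2 * r * 4" using \<tau> KK_nonneg[OF N, of q] rp by (intro mult_mono) auto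
   \<comment> \<open>Here q >= s0 t matters: the expected number t w(q) of jumps above q is at most
     2 e <= 6, and each counts at most \<open>rho t\<close> <= y.\<close>
   have "rho t * (\<tau> * ww N q) \<le> 6 * (e8 * D * r)"
   proof -
    have e6: "2 * exp 1 \<le> (6::real)" using exp_le by simp
    have "real n * (\<tau> * ww N q) = t * ww N q" by (simp flip: n\<tau>)
    also have "\<dots> \<le> 6" using t_ww_le[OF t(1) q(1)] e6 by linarith
    finally have "\<tau> * ww N q \<le> 6 / real n" using n0 by (simp add: le_divide_eq mult.commute)
    then have "rho t * (\<tau> * ww N q) \<le> y * (6 / real n)" using y rt \<tau> ww_nonneg[OF N, of q] by (intro mult_mono) auto
    also have "\<dots> = 6 * (y / real n)" by simp
    also have "\<dots> \<le> 6 * (e8 * (D * r))"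
    proof -
     have "e8 * q \<le> e8 * (D * r)" using qD e8 by (intro mult_left_mono) auto
     then show ?thesis using yn1 by (intro mult_left_mono) auto
    qed
    finally show ?thesis by (simp add: mult_ac)
   qed
   moreover have "y / real n \<le> e8 * D * r"
   proof -
    have "e8 * q \<le> e8 * (D * r)" using qD e8 by (intro mult_left_mono) auto
    then show ?thesis using yn1 by (simp add: mult.assoc)
   qed
   ultimately show ?thesis unfolding ccx cc\<tau> A_def using d d1 by (simp add: algebra_simps)
  qed
  have cc0: "0 < cc \<tau>" unfolding cc\<tau> using \<tau> mom1_pos rp by simp
  have win: "c' / r \<le> p \<tau> z" if "\<bar>z - x\<bar> \<le> r" for z
  proof -
   have "c' / r \<le> c / r" using c' rp by (intro divide_right_mono) auto
   also have "\<dots> \<le> p \<tau> z" unfolding r_def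
   proof (rule nd[OF \<tau>])
    show "xM M \<tau> \<le> z" using cc_xM(1)[OF \<tau>(1) M1] low that by (simp add: abs_le_iff)
    show "z \<le> cc \<tau> + A * rho \<tau>" using up that unfolding r_def[symmetric] by (simp add: abs_le_iff)
   qed
   finally show ?thesis .
  qed
  have rx: "r < x" using low cc0 by linarith
  have nx: "real (Suc n') * x = cc t + y" unfolding x_def n'[symmetric] using n0 by simp
  have "c' / r * (c' / 2) ^ n' \<le> p (real (Suc n') * \<tau>) (cc t + y)" by (rule chain[OF \<tau>(1) rp(1) rx _ win]) (use c' nx rp in auto)
  then have ch: "c' / r * (c' / 2) ^ n' \<le> p t (cc t + y)" using n\<tau> n' by simp
  have "exp (- K * y / q) \<le> (c' / 2) ^ n'"
  proof -
   have "K * y / q = - ln (c' / 2) * (2 * X)" unfolding K_def yX using e8 q0 by simp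
   moreover have "real n' \<le> 2 * X" using n2 n' by simp
   then have "- ln (c' / 2) * real n' \<le> - ln (c' / 2) * (2 * X)" using lnc by (intro mult_left_mono) auto
   ultimately have "- K * y / q \<le> real n' * ln (c' / 2)" by (simp add: mult.commute)
   then have "exp (- K * y / q) \<le> exp (real n' * ln (c' / 2))" by simp
   also have "\<dots> = (c' / 2) ^ n'" using c' by (simp add: exp_of_nat_mult)
   finally show ?thesis .
  qed
  then have "c' / rho t * exp (- K * y / q) \<le> c' / r * (c' / 2) ^ n'" using c' rrho rp rt by (intro mult_mono divide_left_mono) auto
  with ch show "c' / rho t * exp (- K * y / q) \<le> p t (cc t + y)" by linarith
 qed
qed

end

section \<open>Upper bound to the right of the centre\<close>

text \<open>Only shifts \<open>s\<close> with \<open>q s \<noteq> 0\<close> contribute, and for each point \<open>x\<close> of \<open>A\<close> they fill a set of length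
  at most \<open>b - a\<close>.\<close>

lemma shift_integral_le:
 fixes \<mu> :: "real measure"
 assumes "real_distribution \<mu>" and [measurable]: "q \<in> borel_measurable borel" and K: "0 \<le> K" "\<And>s. q s \<le> K" and ab: "a \<le> b"
  and A: "A \<in> sets borel" "\<And>s x. 0 < q s \<Longrightarrow> a < s + x \<Longrightarrow> s + x \<le> b \<Longrightarrow> x \<in> A"
 shows "(\<integral>\<^sup>+s. ennreal (q s) * (\<integral>\<^sup>+x. indicator {a<..b} (s + x) \<partial>\<mu>) \<partial>lborel) \<le> ennreal (K * (b - a)) * emeasure \<mu> A"
proof -
 interpret real_distribution \<mu> by fact
 interpret pair_sigma_finite lborel \<mu> ..
 have "(\<integral>\<^sup>+s. ennreal (q s) * (\<integral>\<^sup>+x. indicator {a<..b} (s + x) \<partial>\<mu>) \<partial>lborel)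
   = (\<integral>\<^sup>+s. \<integral>\<^sup>+x. ennreal (q s) * indicator {a<..b} (s + x) \<partial>\<mu> \<partial>lborel)"
  by (intro nn_integral_cong nn_integral_cmult[symmetric]) measurable
 also have "\<dots> \<le> (\<integral>\<^sup>+s. \<integral>\<^sup>+x. ennreal K * indicator {a<..b} (s + x) * indicator A x \<partial>\<mu> \<partial>lborel)"
 proof (intro nn_integral_mono)
  fix s x :: real
  show "ennreal (q s) * indicator {a<..b} (s + x) \<le> ennreal K * indicator {a<..b} (s + x) * indicator A x"
  proof (cases "0 < q s \<and> s + x \<in> {a<..b}")
   case True
   then show ?thesis using A(2)[of s x] K(2)[of s] by (simp add: ennreal_leI)
  next
   case False
   then have z: "ennreal (q s) * indicator {a<..b} (s + x) = 0" by (auto simp: not_less ennreal_neg)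
   show ?thesis unfolding z by (rule zero_le)
  qed
 qed
 also have "\<dots> = (\<integral>\<^sup>+x. \<integral>\<^sup>+s. ennreal K * indicator {a<..b} (s + x) * indicator A x \<partial>lborel \<partial>\<mu>)"
 proof -
  have [measurable]: "A \<in> sets borel" by (rule A)
  have "(\<lambda>(s, x). ennreal K * indicator {a<..b} (s + x) * indicator A x) \<in> borel_measurable (lborel \<Otimes>\<^sub>M \<mu>)" by measurable
  from Fubini'[OF this] show ?thesis by simp
 qed
 also have "\<dots> = (\<integral>\<^sup>+x. ennreal (K * (b - a)) * indicator A x \<partial>\<mu>)"
 proof (rule nn_integral_cong)
  fix x
  have "(\<integral>\<^sup>+s. ennreal K * indicator {a<..b} (s + x) * indicator A x \<partial>lborel)
    = (\<integral>\<^sup>+s. (ennreal K * indicator A x) * indicator {a - x<..b - x} s \<partial>lborel)"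
   by (intro nn_integral_cong) (auto simp: indicator_def)
  also have "\<dots> = (ennreal K * indicator A x) * ennreal (b - a)" using ab by (subst nn_integral_cmult_indicator) auto
  finally show "(\<integral>\<^sup>+s. ennreal K * indicator {a<..b} (s + x) * indicator A x \<partial>lborel) = ennreal (K * (b - a)) * indicator A x"
   using K ab by (simp add: ennreal_mult mult_ac)
 qed
 also have "\<dots> = ennreal (K * (b - a)) * emeasure \<mu> A" using A(1) by (simp add: nn_integral_cmult_indicator)
 finally show ?thesis .
qed

text \<open>If \<open>u + v\<close> lies in \<open>{a<..b}\<close> then one of the two summands is at least \<open>a / 2\<close>.\<close>

lemma half_split:
 fixes \<nu> :: "real measure"
 assumes nd: "nonneg_dist \<nu>" and K: "0 \<le> K" "\<And>x y. x \<le> y \<Longrightarrow> emeasure \<nu> {x<..y} \<le> ennreal (K * (y - x))" and ab: "a \<le> b"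
 shows "emeasure (\<nu> \<star> \<nu>) {a<..b} \<le> ennreal (2 * K * (b - a)) * emeasure \<nu> {a / 2..}"
proof -
 interpret real_distribution \<nu> using nd by (simp add: nonneg_dist_def)
 interpret P: pair_sigma_finite \<nu> \<nu> ..
 let ?I = "\<integral>\<^sup>+u. \<integral>\<^sup>+v. indicator {a / 2..} u * indicator {a<..b} (u + v) \<partial>\<nu> \<partial>\<nu>"
 have m: "(\<lambda>(u, v). indicator {a / 2..} u * indicator {a<..b} (u + v) :: ennreal) \<in> borel_measurable (\<nu> \<Otimes>\<^sub>M \<nu>)" by measurable
 have "emeasure (\<nu> \<star> \<nu>) {a<..b} = (\<integral>\<^sup>+x. indicator {a<..b} x \<partial>(\<nu> \<star> \<nu>))" by simp
 also have "\<dots> = (\<integral>\<^sup>+u. \<integral>\<^sup>+v. indicator {a<..b} (u + v) \<partial>\<nu> \<partial>\<nu>)" by (rule nn_integral_conv_nonneg_dist[OF nd nd]) simp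
 also have "\<dots> \<le> (\<integral>\<^sup>+u. \<integral>\<^sup>+v. indicator {a / 2..} u * indicator {a<..b} (u + v) + indicator {a / 2..} v * indicator {a<..b} (u + v) \<partial>\<nu> \<partial>\<nu>)"
 proof (intro nn_integral_mono)
  fix u v :: real
  have "a / 2 \<le> u \<or> a / 2 \<le> v \<or> u + v < a" by linarith
  then show "indicator {a<..b} (u + v) \<le> (indicator {a / 2..} u * indicator {a<..b} (u + v) + indicator {a / 2..} v * indicator {a<..b} (u + v) :: ennreal)"
   by (auto simp: indicator_def)
 qed
 also have "\<dots> = ?I + (\<integral>\<^sup>+u. \<integral>\<^sup>+v. indicator {a / 2..} v * indicator {a<..b} (u + v) \<partial>\<nu> \<partial>\<nu>)"
  by (subst nn_integral_add[symmetric]) (auto intro!: nn_integral_cong nn_integral_add)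
 also have "(\<integral>\<^sup>+u. \<integral>\<^sup>+v. indicator {a / 2..} v * indicator {a<..b} (u + v) \<partial>\<nu> \<partial>\<nu>) = ?I" using P.Fubini'[OF m] by (simp add: add.commute)
 also have "?I \<le> (\<integral>\<^sup>+u. indicator {a / 2..} u * ennreal (K * (b - a)) \<partial>\<nu>)"
 proof (rule nn_integral_mono)
  fix u :: real
  have "(\<integral>\<^sup>+v. indicator {a / 2..} u * indicator {a<..b} (u + v) \<partial>\<nu>) = indicator {a / 2..} u * (\<integral>\<^sup>+v. indicator {a - u<..b - u} v \<partial>\<nu>)"
   by (subst nn_integral_cmult[symmetric]) (auto intro!: nn_integral_cong simp: indicator_def)
  also have "\<dots> \<le> indicator {a / 2..} u * ennreal (K * (b - a))" using K(2)[of "a - u" "b - u"] ab by (intro mult_left_mono) auto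
  finally show "(\<integral>\<^sup>+v. indicator {a / 2..} u * indicator {a<..b} (u + v) \<partial>\<nu>) \<le> indicator {a / 2..} u * ennreal (K * (b - a))" .
 qed
 also have "(\<integral>\<^sup>+u. indicator {a / 2..} u * ennreal (K * (b - a)) \<partial>\<nu>) = ennreal (K * (b - a)) * emeasure \<nu> {a / 2..}"
  by (subst mult.commute, rule nn_integral_cmult_indicator) simp
 finally have "emeasure (\<nu> \<star> \<nu>) {a<..b} \<le> ennreal (K * (b - a)) * emeasure \<nu> {a / 2..} + ennreal (K * (b - a)) * emeasure \<nu> {a / 2..}"
  by (simp add: add_mono)
 also have "\<dots> = ennreal (2 * K * (b - a)) * emeasure \<nu> {a / 2..}"
 proof -
  have "ennreal (2 * K * (b - a)) = ennreal (K * (b - a)) + ennreal (K * (b - a))" using K ab by (simp flip: ennreal_plus)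
  then show ?thesis by (simp add: distrib_right)
 qed
 finally show ?thesis .
qed

context subord_density begin

definition Nle :: "real \<Rightarrow> real \<Rightarrow> real" where "Nle r s = (if s \<le> r then N s else 0)"

text \<open>The law at time t of the jumps of size at most r. Laws with a given Levy density are
  unique, so the choice is immaterial.\<close>

definition tl :: "real \<Rightarrow> real \<Rightarrow> real measure" where "tl t r = (SOME \<mu>. id_law (\<lambda>s. t * Nle r s) \<mu>)"

lemma N_meas [measurable]: "N \<in> borel_measurable borel"
 by (rule levy_measurable[OF N])

lemma levy_Nle: "levy (Nle r)"
 unfolding Nle_def by (rule levy_le[OF N]) (use N_nonneg in auto)

lemma levy_tNle: "0 < t \<Longrightarrow> levy (\<lambda>s. t * Nle r s)"
 by (rule levy_scale[OF levy_Nle]) simp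

lemma tl_law: "0 < t \<Longrightarrow> id_law (\<lambda>s. t * Nle r s) (tl t r)"
 unfolding tl_def by (rule someI_ex) (metis id_law_exists levy_tNle)

lemma tl_dist: "0 < t \<Longrightarrow> real_distribution (tl t r)" "0 < t \<Longrightarrow> nonneg_dist (tl t r)"
 using tl_law[of t r] by (auto simp: id_law_def nonneg_dist_def)

text \<open>The exponent at parameter 1/r is centred at \<open>cc t\<close>, the mean of the tilted
  and not of the truncated law. Pointwise the error is at most 2 s^2 / (r q) for jumps up to q and 2
  for larger ones. The first sums to 2 y / (15 r) because 15 <= 8 e^2 h, h = \<open>hconst\<close>;
  the second to 4 e because t w(q) <= 2 e for q >= s0 t.\<close>

lemma chernoff_exponent:
 assumes t: "0 < t" and q: "s0 t \<le> q" "q \<le> rho t" and r: "q \<le> r"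
  and y: "8 * (exp 1)\<^sup>2 * (t * q * HH N (1 / q)) \<le> y"
 shows "t * lint N (\<lambda>s. if s \<le> r then exp (s / r) - 1 else 0) - cc t / r \<le> 2 / 15 * y / r + 4 * exp 1"
proof -
 note rt = rho_props[OF t]
 have q0: "0 < q" using s0_props(1)[OF t] q by linarith
 have r0: "0 < r" using q0 r by linarith
 have b1: "lbnd (\<lambda>s. if s \<le> r then exp (s / r) - 1 else 0)"
 proof (rule lbndI[where C="2 / r + 2"])
  fix s :: real assume s: "0 < s"
  show "\<bar>if s \<le> r then exp (s / r) - 1 else 0\<bar> \<le> (2 / r + 2) * min 1 s"
  proof (cases "s \<le> r")
   case True
   have u: "0 \<le> s / r" "s / r \<le> 1" using s r0 True by auto
   have "exp (s / r) \<le> 1 + s / r + (s / r)\<^sup>2" by (rule exp_bound) (use u in auto)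
   also have "(s / r)\<^sup>2 \<le> s / r" using power_decreasing[of 1 2 "s / r"] u by simp
   finally have e: "exp (s / r) - 1 \<le> 2 * (s / r)" by simp
   have e0: "0 \<le> exp (s / r) - 1" using u by simp
   have "2 * (s / r) \<le> (2 / r + 2) * min 1 s"
   proof (cases "s \<le> 1")
    case True then show ?thesis using s r0 by (simp add: distrib_right)
   next
    case False
    have "2 * (s / r) \<le> 2" using u by simp
    also have "2 \<le> 2 / r + 2" using r0 by simp
    finally show ?thesis using False by simp
   qed
   then show ?thesis using True e e0 by simp
  qed (use s r0 in auto)
 qed measurable
 have b2: "lbnd (\<lambda>s. (1 / r) * (s ^ 1 * exp (- (1 / rho t) * s)))" by (rule lbnd_cmult[OF lbnd_mom]) (use rt in auto)
 have "lint N (\<lambda>s. if s \<le> r then exp (s / r) - 1 else 0) - (1 / r) * mom N 1 (1 / rho t)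
   = lint N (\<lambda>s. (if s \<le> r then exp (s / r) - 1 else 0) - (1 / r) * (s ^ 1 * exp (- (1 / rho t) * s)))"
  unfolding mom_def lint_cmult[symmetric] by (rule lint_diff[symmetric, OF N b1 b2])
 also have "\<dots> \<le> lint N (\<lambda>s. (2 * q / r) * (if s \<le> q then (s / q)\<^sup>2 else 0) + 2 * (if q < s then 1 else 0))"
 proof (rule lint_mono[OF N lbnd_diff[OF b1 b2]])
  show "lbnd (\<lambda>s. (2 * q / r) * (if s \<le> q then (s / q)\<^sup>2 else 0) + 2 * (if q < s then 1 else 0))"
   by (intro lbnd_add lbnd_cmult lbnd_KK lbnd_ww q0)
  fix s :: real assume s: "0 < s"
  have e0: "0 \<le> (1 / r) * (s ^ 1 * exp (- (1 / rho t) * s))" using s r0 by simp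
  show "(if s \<le> r then exp (s / r) - 1 else 0) - (1 / r) * (s ^ 1 * exp (- (1 / rho t) * s))
    \<le> (2 * q / r) * (if s \<le> q then (s / q)\<^sup>2 else 0) + 2 * (if q < s then 1 else 0)"
  proof (cases "s \<le> r")
   case sr: True
   have u: "0 \<le> s / r" "s / r \<le> 1" using s r0 sr by auto
   have e: "exp (s / r) \<le> 1 + s / r + (s / r)\<^sup>2" by (rule exp_bound) (use u in auto)
   show ?thesis
   proof (cases "s \<le> q")
    case True
    have "(s / r) * (1 - s / rho t) \<le> (s / r) * exp (- (1 / rho t) * s)"
     using u exp_ge_add_one_self[of "- (1 / rho t) * s"] by (intro mult_left_mono) auto
    moreover have "(s / r) * (1 - s / rho t) = s / r - s\<^sup>2 / (r * rho t)" by (simp add: power2_eq_square right_diff_distrib)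
    moreover have "s\<^sup>2 / (r * rho t) \<le> s\<^sup>2 / (r * q)" using q q0 r0 rt by (intro divide_left_mono mult_left_mono) auto
    moreover have "(s / r)\<^sup>2 \<le> s\<^sup>2 / (r * q)" unfolding power_divide power2_eq_square[of r] using r q0 r0 by (intro divide_left_mono mult_left_mono) auto
    moreover have "(2 * q / r) * (s / q)\<^sup>2 = 2 * (s\<^sup>2 / (r * q))" using q0 by (simp add: power_divide power2_eq_square)
    moreover have "(1 / r) * (s ^ 1 * exp (- (1 / rho t) * s)) = (s / r) * exp (- (1 / rho t) * s)" by simp
    moreover have "A \<le> E \<Longrightarrow> A = x - P \<Longrightarrow> P \<le> S \<Longrightarrow> Q \<le> S \<Longrightarrow> R = 2 * S \<Longrightarrow> F = E \<Longrightarrow> X \<le> 1 + x + Q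
      \<Longrightarrow> X - 1 - F \<le> R" for A E x P S Q R F X :: real by linarith
    ultimately have "exp (s / r) - 1 - (1 / r) * (s ^ 1 * exp (- (1 / rho t) * s)) \<le> (2 * q / r) * (s / q)\<^sup>2" using e by blast
    then show ?thesis using True sr by simp
   next
    case False
    have "(s / r)\<^sup>2 \<le> 1" using u by (simp add: power_le_one)
    then have "exp (s / r) - 1 \<le> 2" using e u by linarith
    then show ?thesis using False sr e0 by simp
   qed
  next
   case False
   then show ?thesis using r e0 by simp
  qed
 qed
 also have "\<dots> = (2 * q / r) * KK N q + 2 * ww N q"
  unfolding KK_def ww_def lint_cmult[symmetric] by (rule lint_add[OF N]) (intro lbnd_cmult lbnd_KK lbnd_ww q0)+
 finally have "t * (lint N (\<lambda>s. if s \<le> r then exp (s / r) - 1 else 0) - (1 / r) * mom N 1 (1 / rho t))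
   \<le> t * ((2 * q / r) * KK N q + 2 * ww N q)" using t by (intro mult_left_mono) auto
 then have "t * lint N (\<lambda>s. if s \<le> r then exp (s / r) - 1 else 0) - cc t / r \<le> 2 / r * (q * (t * KK N q)) + 2 * (t * ww N q)"
  unfolding cc_def by (simp add: algebra_simps)
 also have "\<dots> \<le> 2 / r * (y / 15) + 2 * (2 * exp 1)"
 proof (intro add_mono mult_left_mono t_ww_le[OF t q(1)])
  have h: "0 < hconst" using hconst_pos by linarith
  have "15 * (q * (t * KK N q)) \<le> 8 * (exp 1)\<^sup>2 * hconst * (q * (t * KK N q))"
   using hconst_pos q0 t KK_nonneg[OF N, of q] by (intro mult_right_mono) auto
  also have "\<dots> = 8 * (exp 1)\<^sup>2 * (q * (hconst * (t * KK N q)))" by simp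
  also have "\<dots> \<le> 8 * (exp 1)\<^sup>2 * (q * (t * HH N (1 / q)))" using hconst_tKK[OF t q0] q0 by (intro mult_left_mono) auto
  also have "\<dots> \<le> y" using y by (simp add: mult_ac)
  finally show "q * (t * KK N q) \<le> y / 15" by simp
 qed (use r0 in auto)
 finally show ?thesis by simp
qed

text \<open>The fraction \<open>\<theta>\<close> of time is 1 when levels of jumps are removed, and
  1/2 when the law without large jumps is written as a convolution square.\<close>

lemma tl_chernoff:
 assumes t: "0 < t" and q: "s0 t \<le> q" "q \<le> rho t" and r: "q \<le> r"
  and y: "8 * (exp 1)\<^sup>2 * (t * q * HH N (1 / q)) \<le> y" and th: "0 < \<theta>" "\<theta> \<le> 1"
 shows "measure (tl (\<theta> * t) r) {\<theta> * (cc t + w)..} \<le> exp (\<theta> * (- w / r + 2 / 15 * y / r) + 4 * exp 1)"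
proof -
 have q0: "0 < q" using s0_props(1)[OF t] q by linarith
 have r0: "0 < r" using q0 r by linarith
 have tt: "0 < \<theta> * t" using t th by simp
 interpret real_distribution "tl (\<theta> * t) r" by (rule tl_dist[OF tt])
 have "emeasure (tl (\<theta> * t) r) {\<theta> * (cc t + w)..} \<le> ennreal (exp (- (1 / r) * (\<theta> * (cc t + w)) + (\<integral>s. (\<theta> * t * Nle r s) * (exp (1 / r * s) - 1) \<partial>lborel)))"
  by (rule id_law_chernoff[where r=r, OF levy_tNle[OF tt] _ _ tl_law[OF tt]]) (use r0 in \<open>auto simp: Nle_def\<close>)
 also have "(\<integral>s. (\<theta> * t * Nle r s) * (exp (1 / r * s) - 1) \<partial>lborel) = \<theta> * t * lint N (\<lambda>s. if s \<le> r then exp (s / r) - 1 else 0)"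
  unfolding lint_def integral_mult_right_zero[symmetric]
  by (intro Bochner_Integration.integral_cong refl) (simp add: Nle_def)
 finally have m: "measure (tl (\<theta> * t) r) {\<theta> * (cc t + w)..} \<le> exp (- (1 / r) * (\<theta> * (cc t + w)) + \<theta> * t * lint N (\<lambda>s. if s \<le> r then exp (s / r) - 1 else 0))"
  by (simp add: emeasure_eq_measure)
 have "- (1 / r) * (\<theta> * (cc t + w)) + \<theta> * t * lint N (\<lambda>s. if s \<le> r then exp (s / r) - 1 else 0)
   = \<theta> * (- w / r + (t * lint N (\<lambda>s. if s \<le> r then exp (s / r) - 1 else 0) - cc t / r))"
  using r0 by (simp add: field_simps)
 also have "\<dots> \<le> \<theta> * (- w / r + (2 / 15 * y / r + 4 * exp 1))"
  using chernoff_exponent[OF t q r y] th by (intro mult_left_mono add_left_mono) auto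
 also have "\<dots> = \<theta> * (- w / r + 2 / 15 * y / r) + \<theta> * (4 * exp 1)" by (simp add: algebra_simps)
 also have "\<dots> \<le> \<theta> * (- w / r + 2 / 15 * y / r) + 1 * (4 * exp 1)" using th by (intro add_left_mono mult_right_mono) auto
 finally have "- (1 / r) * (\<theta> * (cc t + w)) + \<theta> * t * lint N (\<lambda>s. if s \<le> r then exp (s / r) - 1 else 0)
   \<le> \<theta> * (- w / r + 2 / 15 * y / r) + 4 * exp 1" by simp
 then show ?thesis using m by (meson exp_le_cancel_iff order_trans)
qed

lemma truncate_split:
 assumes t: "0 < t" and r: "0 < r'" "r' \<le> r" and [measurable]: "g \<in> borel_measurable borel"
 shows "(\<integral>\<^sup>+x. g x \<partial>tl t r) \<le> (\<integral>\<^sup>+x. g x \<partial>tl t r')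
  + (\<integral>\<^sup>+s. ennreal (t * N s * indicator {r'<..r} s) * (\<integral>\<^sup>+x. g (s + x) \<partial>tl t r) \<partial>lborel)"
proof (rule id_law_split(3)[OF levy_tNle[OF t] _ _ _ _ tl_law[OF t]])
 have e: "(\<lambda>s. t * Nle r s - t * N s * indicator {r'<..r} s) = (\<lambda>s. t * Nle r' s)" using r by (auto simp: Nle_def indicator_def)
 show "id_law (\<lambda>s. t * Nle r s - t * N s * indicator {r'<..r} s) (tl t r')" unfolding e by (rule tl_law[OF t])
 show "integrable lborel (\<lambda>s. t * N s * indicator {r'<..r} s)"
 proof (rule Bochner_Integration.integrable_bound)
  show "integrable lborel (\<lambda>s. t * (N s * (if r' < s then 1 else 0)))" by (intro integrable_mult_right lbnd_integrable[OF N] lbnd_ww r)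
  show "AE s in lborel. norm (t * N s * indicator {r'<..r} s) \<le> norm (t * (N s * (if r' < s then 1 else 0)))"
   by (rule AE_I2) (auto simp: indicator_def)
 qed measurable
qed (use t N_nonneg in \<open>auto simp: Nle_def indicator_def\<close>)

lemma truncate_split_full:
 assumes t: "0 < t" and r: "0 < r" and [measurable]: "g \<in> borel_measurable borel"
 shows "(\<integral>\<^sup>+x. g x \<partial>pos_density (p t)) \<le> (\<integral>\<^sup>+x. g x \<partial>tl t r)
   + (\<integral>\<^sup>+s. ennreal (t * N s * indicator {r<..} s) * (\<integral>\<^sup>+x. g (s + x) \<partial>pos_density (p t)) \<partial>lborel)"
  and "ennreal (exp (- (t * ww N r))) * (\<integral>\<^sup>+x. g x \<partial>tl t r) \<le> (\<integral>\<^sup>+x. g x \<partial>pos_density (p t))"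
proof -
 have e: "(\<lambda>s. t * N s - t * N s * indicator {r<..} s) = (\<lambda>s. t * Nle r s)" by (auto simp: Nle_def indicator_def)
 have f: "(\<lambda>s. t * N s * indicator {r<..} s) = (\<lambda>s. t * (N s * (if r < s then 1 else 0)))" by (auto simp: indicator_def)
 have i: "integrable lborel (\<lambda>s. t * N s * indicator {r<..} s)"
  unfolding f by (intro integrable_mult_right lbnd_integrable[OF N] lbnd_ww r)
 have v: "integral\<^sup>L lborel (\<lambda>s. t * N s * indicator {r<..} s) = t * ww N r" unfolding f ww_def lint_def by (rule integral_mult_right_zero)
 have m: "(\<lambda>s. t * N s * indicator {r<..} s) \<in> borel_measurable borel" by measurable
 have n: "0 \<le> t * N s * indicator {r<..} s" "t * N s * indicator {r<..} s \<le> t * N s" for s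
  using t N_nonneg[of s] by (auto simp: indicator_def)
 have l: "id_law (\<lambda>s. t * N s - t * N s * indicator {r<..} s) (tl t r)" unfolding e by (rule tl_law[OF t])
 note sp = id_law_split[OF levy_t[OF t] m n i p_law[OF t] l assms(3), unfolded v]
 show "(\<integral>\<^sup>+x. g x \<partial>pos_density (p t)) \<le> (\<integral>\<^sup>+x. g x \<partial>tl t r)
   + (\<integral>\<^sup>+s. ennreal (t * N s * indicator {r<..} s) * (\<integral>\<^sup>+x. g (s + x) \<partial>pos_density (p t)) \<partial>lborel)" by (rule sp(3))
 show "ennreal (exp (- (t * ww N r))) * (\<integral>\<^sup>+x. g x \<partial>tl t r) \<le> (\<integral>\<^sup>+x. g x \<partial>pos_density (p t))" by (rule sp(1))
qed

end

section \<open>Removal of jumps level by level\<close>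

context subord_density begin

text \<open>With u = y / (4 r): the density of jumps of order r contributes C0 (8 u)^k, the
  exponential bound (k+1)!/u^(k+1) and exp (4 e), and the remaining power of 1/u equals 4 r /
  y.\<close>

definition lev_const :: real where
 "lev_const = C0 * 8 ^ k * fact (Suc k) * 4 * exp (4 * exp 1)"

lemma lev_const_pos: "0 < lev_const"
 unfolding lev_const_def using C0 by simp

text \<open>A jump in (r', r] has density at most a multiple of t (y/r)^k N y, and the other jumps
  must still cover y/2, which costs exp (-y / (4 r)). One power more than k of y/r is taken from the
  exponential, so that the cost r/y is summable over halvings.\<close>

lemma level_step:
 assumes t: "0 < t" and q: "s0 t \<le> q" "q \<le> rho t" and yY: "y \<in> Y"
  and y: "8 * (exp 1)\<^sup>2 * (t * q * HH N (1 / q)) \<le> y"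
  and r: "q \<le> r'" "r / 2 \<le> r'" "r' \<le> r" "r \<le> y / 2" and h: "0 < h" "h \<le> y / 10"
 shows "measure (tl t r) {cc t + y - h<..cc t + y + h} \<le>
  measure (tl t r') {cc t + y - h<..cc t + y + h} + lev_const * (r / y) * (t * N y) * (2 * h)"
proof -
 have q0: "0 < q" using s0_props(1)[OF t] q by linarith
 have r0: "0 < r'" "0 < r" using q0 r by linarith+
 have y0: "0 < y" by (rule Y_pos[OF yY])
 interpret R: real_distribution "tl t r" by (rule tl_dist[OF t])
 interpret R': real_distribution "tl t r'" by (rule tl_dist[OF t])
 let ?a = "cc t + y - h" and ?b = "cc t + y + h"
 define K where "K = t * (C0 * (2 * y / r) ^ k * N y)"
 have K0: "0 \<le> K" unfolding K_def using t C0 y0 r0 N_nonneg by simp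
 let ?A = "{cc t + (y / 2 - h)..}"
 have "emeasure (tl t r) {?a<..?b} = (\<integral>\<^sup>+x. indicator {?a<..?b} x \<partial>tl t r)" by simp
 also have "\<dots> \<le> (\<integral>\<^sup>+x. indicator {?a<..?b} x \<partial>tl t r')
  + (\<integral>\<^sup>+s. ennreal (t * N s * indicator {r'<..r} s) * (\<integral>\<^sup>+x. indicator {?a<..?b} (s + x) \<partial>tl t r) \<partial>lborel)"
  by (rule truncate_split[OF t r0(1) r(3)]) simp
 also have "(\<integral>\<^sup>+x. indicator {?a<..?b} x \<partial>tl t r') = emeasure (tl t r') {?a<..?b}" by simp
 also have "(\<integral>\<^sup>+s. ennreal (t * N s * indicator {r'<..r} s) * (\<integral>\<^sup>+x. indicator {?a<..?b} (s + x) \<partial>tl t r) \<partial>lborel)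
   \<le> ennreal (K * (?b - ?a)) * emeasure (tl t r) ?A"
 proof (rule shift_integral_le[OF tl_dist(1)[OF t] _ K0])
  fix s
  show "t * N s * indicator {r'<..r} s \<le> K"
  proof (cases "s \<in> {r'<..r}")
   case True
   then have s: "0 < s" "s \<le> y" using r0 r y0 by auto
   have "N s \<le> C0 * (y / s) ^ k * N y" by (rule VV[OF yY s])
   also have "\<dots> \<le> C0 * (2 * y / r) ^ k * N y"
   proof (intro mult_right_mono mult_left_mono power_mono)
    have "r / 2 \<le> s" using True r by auto
    then have "y / s \<le> y / (r / 2)" using y0 r0 s by (intro divide_left_mono) auto
    then show "y / s \<le> 2 * y / r" by (simp add: mult.commute)
   qed (use C0 N_nonneg y0 s in auto)
   finally show ?thesis using True t unfolding K_def by (simp add: mult_left_mono)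
  qed (use K0 in simp)
 next
  fix s x assume "0 < t * N s * indicator {r'<..r} s" and x: "?a < s + x"
  then have "s \<le> r" by (cases "s \<in> {r'<..r}") auto
  then show "x \<in> ?A" using x r by simp
 qed (use h in auto)
 finally have "ennreal (measure (tl t r) {?a<..?b}) \<le> ennreal (measure (tl t r') {?a<..?b} + K * (2 * h) * measure (tl t r) ?A)"
  using K0 h by (simp add: R.emeasure_eq_measure R'.emeasure_eq_measure ennreal_mult[symmetric] ennreal_plus[symmetric] del: ennreal_plus)
 then have 1: "measure (tl t r) {?a<..?b} \<le> measure (tl t r') {?a<..?b} + K * (2 * h) * measure (tl t r) ?A"
  using K0 h by (subst (asm) ennreal_le_iff) auto
 have "measure (tl (1 * t) r) {1 * (cc t + (y / 2 - h))..} \<le> exp (1 * (- (y / 2 - h) / r + 2 / 15 * y / r) + 4 * exp 1)"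
  by (rule tl_chernoff[OF t q _ y]) (use r in auto)
 then have "measure (tl t r) ?A \<le> exp (- (y / 2 - h) / r + 2 / 15 * y / r + 4 * exp 1)" by simp
 also have "\<dots> \<le> exp (- (y / (4 * r)) + 4 * exp 1)"
 proof -
  \<comment> \<open>1/2 - 1/10 - 2/15 = 4/15 exceeds 1/4.\<close>
  have "(- (y / 2 - h) + 2 / 15 * y) / r \<le> (- (y / 4)) / r" using h r0 by (intro divide_right_mono) auto
  moreover have "(- (y / 2 - h) + 2 / 15 * y) / r = - (y / 2 - h) / r + 2 / 15 * y / r" using r0 by (simp add: field_simps)
  moreover have "(- (y / 4)) / r = - (y / (4 * r))" by simp
  ultimately have "- (y / 2 - h) / r + 2 / 15 * y / r \<le> - (y / (4 * r))" by (simp only:)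
  then show ?thesis by (simp only: exp_le_cancel_iff add_le_cancel_right)
 qed
 also have "\<dots> = exp (- (y / (4 * r))) * exp (4 * exp 1)" by (rule exp_add)
 also have "\<dots> \<le> fact (Suc k) / (y / (4 * r)) ^ Suc k * exp (4 * exp 1)" using y0 r0 by (intro mult_right_mono exp_neg_le_power) auto
 finally have P: "measure (tl t r) ?A \<le> fact (Suc k) / (y / (4 * r)) ^ Suc k * exp (4 * exp 1)" .
 define u where "u = y / (4 * r)"
 have u: "0 < u" unfolding u_def using y0 r0 by simp
 have yr: "2 * y / r = 8 * u" "r / y = 1 / (4 * u)" unfolding u_def using r0 y0 by simp_all
 have "K * (2 * h) * measure (tl t r) ?A \<le> K * (2 * h) * (fact (Suc k) / u ^ Suc k * exp (4 * exp 1))"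
  using P K0 h unfolding u_def by (intro mult_left_mono) auto
 also have "\<dots> = lev_const * (r / y) * (t * N y) * (2 * h)"
  unfolding K_def lev_const_def yr using u by (simp add: power_mult_distrib field_simps)
 finally show ?thesis using 1 by linarith
qed

text \<open>Each halving of r halves the cost of the level, so the sum is at most twice the first
  cost. The last step may be shorter and ends at q itself.\<close>

lemma dyadic_bound:
 assumes t: "0 < t" and q: "s0 t \<le> q" "q \<le> rho t" and yY: "y \<in> Y"
  and y: "8 * (exp 1)\<^sup>2 * (t * q * HH N (1 / q)) \<le> y" and h: "0 < h" "h \<le> y / 10"
 shows "q \<le> r \<Longrightarrow> r \<le> y / 2 \<Longrightarrow> r \<le> 2 ^ n * q \<Longrightarrow> measure (tl t r) {cc t + y - h<..cc t + y + h} \<le>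
  measure (tl t q) {cc t + y - h<..cc t + y + h} + 2 * lev_const * (r / y) * (t * N y) * (2 * h)"
proof (induction n arbitrary: r)
 case 0
 have "0 \<le> 2 * lev_const * (r / y) * (t * N y) * (2 * h)"
  using lev_const_pos Y_pos[OF yY] t N_nonneg h 0 s0_props(1)[OF t] q by (intro mult_nonneg_nonneg divide_nonneg_nonneg) auto
 moreover have "r = q" using 0 by simp
 ultimately show ?case by simp
next
 case (Suc n)
 have q0: "0 < q" using s0_props(1)[OF t] q by linarith
 define B where "B = (t * N y) * (2 * h) / y"
 have B: "0 \<le> B" unfolding B_def using Y_pos[OF yY] t N_nonneg h by simp
 have eB: "c * (x / y) * (t * N y) * (2 * h) = c * x * B" for c x unfolding B_def by simp
 show ?case
 proof (cases "r / 2 \<le> q")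
  case True
  have "measure (tl t r) {cc t + y - h<..cc t + y + h} \<le>
   measure (tl t q) {cc t + y - h<..cc t + y + h} + lev_const * (r / y) * (t * N y) * (2 * h)"
   by (rule level_step[OF t q yY y order_refl True Suc.prems(1,2) h])
  moreover have "0 \<le> lev_const * r * B" using lev_const_pos B Suc.prems q0 by (intro mult_nonneg_nonneg) auto
  ultimately show ?thesis unfolding eB by linarith
 next
  case False
  then have qr: "q \<le> r / 2" by simp
  have r0: "0 < r" using qr q0 by linarith
  have "measure (tl t r) {cc t + y - h<..cc t + y + h} \<le>
   measure (tl t (r / 2)) {cc t + y - h<..cc t + y + h} + lev_const * (r / y) * (t * N y) * (2 * h)"
   by (rule level_step[OF t q yY y qr order_refl _ Suc.prems(2) h]) (use r0 in simp)
  moreover have "measure (tl t (r / 2)) {cc t + y - h<..cc t + y + h} \<le>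
   measure (tl t q) {cc t + y - h<..cc t + y + h} + 2 * lev_const * (r / 2 / y) * (t * N y) * (2 * h)"
   by (rule Suc.IH[OF qr]) (use Suc.prems r0 in auto)
  moreover have "2 * lev_const * (r / 2) * B = lev_const * r * B" by simp
  ultimately show ?thesis unfolding eB by linarith
 qed
qed

text \<open>Chernoff's inequality bounds tails, not densities. So the law is written as a
  convolution square at time t/2: one factor must pass half of the distance, which Chernoff makes
  unlikely, and the other has a bounded density. The latter holds because dropping the jumps above q
  at time t/2 costs at most exp e, as t w(q) <= 2 e.\<close>

lemma truncated_small_bound:
 "\<exists>C>0. \<forall>t q y h. 0 < t \<longrightarrow> t \<le> T \<longrightarrow> s0 t \<le> q \<longrightarrow> q \<le> rho t \<longrightarrow> 0 < h \<longrightarrow> h \<le> y / 10 \<longrightarrow>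
   8 * (exp 1)\<^sup>2 * (t * q * HH N (1 / q)) \<le> y \<longrightarrow>
   measure (tl t q) {cc t + y - h<..cc t + y + h} \<le> C / rho t * exp (- (y / (8 * q))) * (2 * h)"
proof -
 obtain C where C: "1 \<le> C" and sup: "\<And>t x. 0 < t \<Longrightarrow> t \<le> T \<Longrightarrow> 0 < x \<Longrightarrow> p t x \<le> C / rho t" using p_sup by blast
 obtain D where D: "1 \<le> D" and rr: "\<And>t r. 0 < t \<Longrightarrow> t \<le> T \<Longrightarrow> 0 < r \<Longrightarrow> t * HH N (1 / r) \<le> 2 \<Longrightarrow> rho t \<le> D * r" using rho_ratio[of 2] by auto
 define E where "E = 2 * (exp (exp 1) * (C * D)) * exp (4 * exp 1)"
 have E: "0 < E" unfolding E_def using C D by simp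
 show ?thesis
 proof (rule exI[of _ E], rule conjI[OF E], intro allI impI)
  fix t q y h assume t: "0 < t" "t \<le> T" and q: "s0 t \<le> q" "q \<le> rho t" and h: "0 < h" "h \<le> y / 10"
   and y: "8 * (exp 1)\<^sup>2 * (t * q * HH N (1 / q)) \<le> y"
  note rt = rho_props[OF t(1)]
  have q0: "0 < q" using s0_props(1)[OF t(1)] q by linarith
  have y0: "0 < y" using h by linarith
  have t2: "0 < t / 2" "t / 2 \<le> T" using t by auto
  note r2 = rho_props[OF t2(1)]
  have "rho t \<le> D * rho (t / 2)" by (rule rr[OF t r2(1)]) (use r2 t in simp)
  then have Dr: "C / rho (t / 2) \<le> C * D / rho t" using C rt r2 D by (simp add: field_simps)
  let ?\<nu> = "tl (t / 2) q"
  interpret V: real_distribution ?\<nu> by (rule tl_dist[OF t2(1)])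
  interpret Q: real_distribution "pos_density (p (t / 2))" by (rule pl_dist[OF t2(1)])
  have eq: "tl t q = (?\<nu> \<star> ?\<nu>)"
  proof -
   have "id_law (\<lambda>s. t / 2 * Nle q s + t / 2 * Nle q s) (?\<nu> \<star> ?\<nu>)"
    by (rule id_law_conv[OF levy_tNle levy_tNle tl_law tl_law]) (use t2 in auto)
   then have "id_law (\<lambda>s. t * Nle q s) (?\<nu> \<star> ?\<nu>)" by (simp add: field_simps)
   then show ?thesis using id_law_unique[OF tl_law[OF t(1)]] by blast
  qed
  define K where "K = exp (exp 1) * (C * D / rho t)"
  have K0: "0 \<le> K" unfolding K_def using C D rt by simp
  have dens: "emeasure ?\<nu> {x<..z} \<le> ennreal (K * (z - x))" if "x \<le> z" for x z
  proof -
   have "ennreal (exp (- (t / 2 * ww N q))) * (\<integral>\<^sup>+w. indicator {x<..z} w \<partial>?\<nu>) \<le> (\<integral>\<^sup>+w. indicator {x<..z} w \<partial>pos_density (p (t / 2)))"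
    by (rule truncate_split_full(2)[OF t2(1) q0]) simp
   also have "\<dots> = emeasure (pos_density (p (t / 2))) {x<..z}" by (simp add: pos_density_def)
   also have "\<dots> \<le> ennreal (C / rho (t / 2)) * emeasure lborel {x<..z}"
    by (rule pos_density_le[OF p_cont[OF t2(1)]]) (use C r2 sup[OF t2] in auto)
   also have "\<dots> = ennreal (C / rho (t / 2) * (z - x))" using that C r2 by (simp add: ennreal_mult[symmetric])
   finally have "ennreal (exp (- (t / 2 * ww N q)) * measure ?\<nu> {x<..z}) \<le> ennreal (C / rho (t / 2) * (z - x))"
    by (simp add: V.emeasure_eq_measure ennreal_mult)
   then have 1: "exp (- (t / 2 * ww N q)) * measure ?\<nu> {x<..z} \<le> C / rho (t / 2) * (z - x)"
    using that C r2 by (subst (asm) ennreal_le_iff) auto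
   have "t / 2 * ww N q \<le> exp 1" using t_ww_le[OF t(1) q(1)] by simp
   then have "exp (- exp 1) * measure ?\<nu> {x<..z} \<le> exp (- (t / 2 * ww N q)) * measure ?\<nu> {x<..z}" by (intro mult_right_mono) auto
   also note 1
   also have "C / rho (t / 2) * (z - x) \<le> C * D / rho t * (z - x)" using Dr that by (intro mult_right_mono) auto
   finally have "exp (exp 1) * (exp (- exp 1) * measure ?\<nu> {x<..z}) \<le> exp (exp 1) * (C * D / rho t * (z - x))"
    by (intro mult_left_mono) auto
   then have "measure ?\<nu> {x<..z} \<le> K * (z - x)" unfolding K_def by (simp add: mult.assoc[symmetric] exp_add[symmetric])
   then show ?thesis by (simp add: V.emeasure_eq_measure ennreal_leI)
  qed
  let ?a = "cc t + y - h" and ?b = "cc t + y + h"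
  interpret W: real_distribution "tl t q" by (rule tl_dist[OF t(1)])
  have "emeasure (tl t q) {?a<..?b} \<le> ennreal (2 * K * (?b - ?a)) * emeasure ?\<nu> {?a / 2..}"
   unfolding eq by (rule half_split[OF tl_dist(2)[OF t2(1)] K0 dens]) (use h in auto)
  also have "\<dots> = ennreal (2 * K * (2 * h) * measure ?\<nu> {?a / 2..})" using K0 h by (simp add: V.emeasure_eq_measure ennreal_mult)
  finally have 2: "measure (tl t q) {?a<..?b} \<le> 2 * K * (2 * h) * measure ?\<nu> {?a / 2..}"
   using K0 h unfolding W.emeasure_eq_measure by (subst (asm) ennreal_le_iff) auto
  have "measure (tl (1 / 2 * t) q) {1 / 2 * (cc t + (y - h))..} \<le> exp (1 / 2 * (- (y - h) / q + 2 / 15 * y / q) + 4 * exp 1)"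
   by (rule tl_chernoff[OF t(1) q order_refl y]) auto
  then have "measure ?\<nu> {?a / 2..} \<le> exp (1 / 2 * (- (y - h) / q + 2 / 15 * y / q) + 4 * exp 1)" by (simp add: add_diff_eq)
  also have "\<dots> \<le> exp (- (y / (8 * q)) + 4 * exp 1)"
  proof -
   \<comment> \<open>Half of 1 - 1/10 - 2/15 is more than 1/8, the constant in the exponent of the
     statement.\<close>
   have "(1 / 2 * (- (y - h) + 2 / 15 * y)) / q \<le> (- (y / 8)) / q" using h q0 by (intro divide_right_mono) auto
   moreover have "(1 / 2 * (- (y - h) + 2 / 15 * y)) / q = 1 / 2 * (- (y - h) / q + 2 / 15 * y / q)" using q0 by (simp add: field_simps)
   moreover have "(- (y / 8)) / q = - (y / (8 * q))" by simp
   ultimately have "1 / 2 * (- (y - h) / q + 2 / 15 * y / q) \<le> - (y / (8 * q))" by (simp only:)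
   then show ?thesis by (simp only: exp_le_cancel_iff add_le_cancel_right)
  qed
  finally have "measure ?\<nu> {?a / 2..} \<le> exp (- (y / (8 * q))) * exp (4 * exp 1)" by (simp only: exp_add)
  then have "2 * K * (2 * h) * measure ?\<nu> {?a / 2..} \<le> 2 * K * (2 * h) * (exp (- (y / (8 * q))) * exp (4 * exp 1))"
   using K0 h by (intro mult_left_mono) auto
  also have "\<dots> = E / rho t * exp (- (y / (8 * q))) * (2 * h)" unfolding E_def K_def by simp
  finally show "measure (tl t q) {?a<..?b} \<le> E / rho t * exp (- (y / (8 * q))) * (2 * h)" using 2 by linarith
 qed
qed

text \<open>A jump above y/2 already costs t N y, so nothing is asked of the remaining jumps. Below
  y/2 \<open>dyadic_bound\<close> descends to q, where \<open>truncated_small_bound\<close> takes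
  over.\<close>

lemma upper_main:
 "\<exists>C>0. \<forall>t q y. 0 < t \<longrightarrow> t \<le> T \<longrightarrow> s0 t \<le> q \<longrightarrow> q \<le> rho t \<longrightarrow> y \<in> Y \<longrightarrow> 2 * rho t \<le> y \<longrightarrow>
   8 * (exp 1)\<^sup>2 * (t * q * HH N (1 / q)) \<le> y \<longrightarrow>
   p t (cc t + y) \<le> C * (t * N y + 1 / rho t * exp (- (y / (8 * q))))"
proof -
 obtain B where B: "0 < B" and tb: "\<And>t q y h. 0 < t \<Longrightarrow> t \<le> T \<Longrightarrow> s0 t \<le> q \<Longrightarrow> q \<le> rho t \<Longrightarrow> 0 < h \<Longrightarrow> h \<le> y / 10 \<Longrightarrow>
   8 * (exp 1)\<^sup>2 * (t * q * HH N (1 / q)) \<le> y \<Longrightarrow>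
   measure (tl t q) {cc t + y - h<..cc t + y + h} \<le> B / rho t * exp (- (y / (8 * q))) * (2 * h)"
  using truncated_small_bound by blast
 define E where "E = C0 * (C0 * 2 ^ k) + lev_const + B"
 have E0: "0 < C0 * (C0 * 2 ^ k)" using C0 by simp
 have E: "0 < E" unfolding E_def using E0 lev_const_pos B by simp
 show ?thesis
 proof (rule exI[of _ E], rule conjI[OF E], intro allI impI)
  fix t q y assume t: "0 < t" "t \<le> T" and q: "s0 t \<le> q" "q \<le> rho t" and yY: "y \<in> Y" and yr: "2 * rho t \<le> y"
   and y: "8 * (exp 1)\<^sup>2 * (t * q * HH N (1 / q)) \<le> y"
  note rt = rho_props[OF t(1)]
  have q0: "0 < q" using s0_props(1)[OF t(1)] q by linarith
  have y0: "0 < y" by (rule Y_pos[OF yY])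
  have qy: "q \<le> y / 2" using q yr by simp
  have cp: "0 < cc t" unfolding cc_def using t mom1_pos rt by simp
  interpret P: real_distribution "pos_density (p t)" by (rule pl_dist[OF t(1)])
  interpret R: real_distribution "tl t (y / 2)" by (rule tl_dist[OF t(1)])
  define F where "F = C0 * (C0 * 2 ^ k) * (t * N y) + lev_const * (t * N y) + B / rho t * exp (- (y / (8 * q)))"
  have tN: "0 \<le> t * N y" using t N_nonneg by simp
  have F0: "0 \<le> F" unfolding F_def using tN E0 lev_const_pos B rt by simp
  have "p t (cc t + y) \<le> F"
  proof (rule pos_density_upper_point[OF p_cont[OF t(1)] _ _ F0])
   show "0 < cc t + y" using cp y0 by simp
   show "0 < y / 10" using y0 by simp
   fix h assume h: "0 < h" "h < y / 10"
   then have h': "h \<le> y / 10" by simp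
   let ?a = "cc t + y - h" and ?b = "cc t + y + h"
   \<comment> \<open>Beyond y/2 the density is at most C0 N (y/2) by almost monotonicity, and
     \<open>VV\<close> leads back to N y.\<close>
   define K where "K = t * (C0 * (C0 * 2 ^ k * N y))"
   have K0: "0 \<le> K" unfolding K_def using t C0 N_nonneg by simp
   have "emeasure (pos_density (p t)) {?a<..?b} = (\<integral>\<^sup>+x. indicator {?a<..?b} x \<partial>pos_density (p t))" by simp
   also have "\<dots> \<le> (\<integral>\<^sup>+x. indicator {?a<..?b} x \<partial>tl t (y / 2))
    + (\<integral>\<^sup>+s. ennreal (t * N s * indicator {y / 2<..} s) * (\<integral>\<^sup>+x. indicator {?a<..?b} (s + x) \<partial>pos_density (p t)) \<partial>lborel)"
    by (rule truncate_split_full(1)[OF t(1)]) (use y0 in auto)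
   also have "(\<integral>\<^sup>+x. indicator {?a<..?b} x \<partial>tl t (y / 2)) = emeasure (tl t (y / 2)) {?a<..?b}" by simp
   also have "(\<integral>\<^sup>+s. ennreal (t * N s * indicator {y / 2<..} s) * (\<integral>\<^sup>+x. indicator {?a<..?b} (s + x) \<partial>pos_density (p t)) \<partial>lborel)
     \<le> ennreal (K * (?b - ?a)) * emeasure (pos_density (p t)) UNIV"
   proof (rule shift_integral_le[OF pl_dist[OF t(1)] _ K0])
    fix s
    show "t * N s * indicator {y / 2<..} s \<le> K"
    proof (cases "y / 2 < s")
     case True
     have y2: "y / 2 \<in> Y" by (rule Y_down[OF _ _ yY]) (use y0 in auto)
     have "N s \<le> C0 * N (y / 2)" by (rule AD[OF y2]) (use True in simp)
     also have "N (y / 2) \<le> C0 * (y / (y / 2)) ^ k * N y" by (rule VV[OF yY]) (use y0 in auto)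
     finally have "N s \<le> C0 * (C0 * 2 ^ k * N y)" using C0 y0 by simp
     then show ?thesis using True t unfolding K_def by (simp add: mult_left_mono)
    qed (use K0 in simp)
   qed (use h in auto)
   finally have "ennreal (measure (pos_density (p t)) {?a<..?b}) \<le> ennreal (measure (tl t (y / 2)) {?a<..?b} + K * (2 * h))"
    using K0 h P.emeasure_space_1 by (simp add: P.emeasure_eq_measure R.emeasure_eq_measure P.prob_space[simplified] ennreal_plus[symmetric] del: ennreal_plus)
   then have 1: "measure (pos_density (p t)) {?a<..?b} \<le> measure (tl t (y / 2)) {?a<..?b} + K * (2 * h)"
    using K0 h by (subst (asm) ennreal_le_iff) auto
   obtain n where n: "y / 2 / q < 2 ^ n" using real_arch_pow[of 2 "y / 2 / q"] by auto
   have n': "y / 2 \<le> 2 ^ n * q" using n q0 by (simp add: divide_less_eq)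
   have "measure (tl t (y / 2)) {?a<..?b} \<le> measure (tl t q) {?a<..?b} + 2 * lev_const * (y / 2 / y) * (t * N y) * (2 * h)"
    by (rule dyadic_bound[OF t(1) q yY y h(1) h' qy order_refl n'])
   also have "2 * lev_const * (y / 2 / y) * (t * N y) * (2 * h) = lev_const * (t * N y) * (2 * h)" using y0 by simp
   finally have 2: "measure (tl t (y / 2)) {?a<..?b} \<le> measure (tl t q) {?a<..?b} + lev_const * (t * N y) * (2 * h)" .
   have 3: "measure (tl t q) {?a<..?b} \<le> B / rho t * exp (- (y / (8 * q))) * (2 * h)" by (rule tb[OF t q h(1) h' y])
   have "K * (2 * h) = C0 * (C0 * 2 ^ k) * (t * N y) * (2 * h)" unfolding K_def by simp
   then have "measure (pos_density (p t)) {?a<..?b} \<le> F * (2 * h)" using 1 2 3 unfolding F_def by (simp only: distrib_right)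
   then show "emeasure (pos_density (p t)) {?a<..?b} \<le> ennreal (F * (2 * h))" by (simp add: P.emeasure_eq_measure ennreal_leI)
  qed
  also have "F \<le> E * (t * N y + 1 / rho t * exp (- (y / (8 * q))))"
  proof -
   define G where "G = 1 / rho t * exp (- (y / (8 * q)))"
   have G: "0 \<le> G" unfolding G_def using rt by simp
   have "F = C0 * (C0 * 2 ^ k) * (t * N y) + lev_const * (t * N y) + B * G" unfolding F_def G_def by simp
   moreover have "E * (t * N y + G) = C0 * (C0 * 2 ^ k) * (t * N y) + lev_const * (t * N y) + B * G
     + (B * (t * N y) + C0 * (C0 * 2 ^ k) * G + lev_const * G)" unfolding E_def by (simp add: algebra_simps)
   moreover have "0 \<le> B * (t * N y) + C0 * (C0 * 2 ^ k) * G + lev_const * G"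
    using mult_nonneg_nonneg[OF less_imp_le[OF B] tN] mult_nonneg_nonneg[OF less_imp_le[OF E0] G]
     mult_nonneg_nonneg[OF less_imp_le[OF lev_const_pos] G] by linarith
   ultimately show ?thesis unfolding G_def by linarith
  qed
  finally show "p t (cc t + y) \<le> E * (t * N y + 1 / rho t * exp (- (y / (8 * q))))" .
 qed
qed

end

section \<open>The two-sided profile\<close>

context subord_density begin

abbreviation e8 :: real where "e8 \<equiv> 8 * (exp 1)\<^sup>2"

lemma e8_ge: "2 \<le> e8"
proof -
 have "(27 / 10)\<^sup>2 \<le> (exp 1 :: real)\<^sup>2" using exp1_ge by (intro power_mono) auto
 then show ?thesis by (simp add: power2_eq_square)
qed

lemma KK_split:
 assumes q: "0 < u" "u \<le> q" and B0: "0 \<le> B" and B: "\<And>s. u < s \<Longrightarrow> s \<le> q \<Longrightarrow> N s \<le> B"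
 shows "KK N q \<le> (u / q)\<^sup>2 * KK N u + B * q"
proof -
 have q0: "0 < q" using q by linarith
 have i1: "integrable lborel (\<lambda>s. (u / q)\<^sup>2 * (N s * (if s \<le> u then (s / u)\<^sup>2 else 0)))"
  by (intro integrable_mult_right lbnd_integrable[OF N lbnd_KK[OF q(1)]])
 have i2: "integrable lborel (\<lambda>s. indicator {u<..q} s *\<^sub>R B)" using q by simp
 have "KK N q \<le> (\<integral>s. (u / q)\<^sup>2 * (N s * (if s \<le> u then (s / u)\<^sup>2 else 0)) + indicator {u<..q} s *\<^sub>R B \<partial>lborel)" unfolding KK_def lint_def
 proof (rule integral_mono[OF lbnd_integrable[OF N lbnd_KK[OF q0]] Bochner_Integration.integrable_add[OF i1 i2]])
  fix s :: real
  show "N s * (if s \<le> q then (s / q)\<^sup>2 else 0) \<le> (u / q)\<^sup>2 * (N s * (if s \<le> u then (s / u)\<^sup>2 else 0)) + indicator {u<..q} s *\<^sub>R B"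
  proof (cases "s \<le> u")
   case True
   then show ?thesis using q q0 by (simp add: power_divide)
  next
   case False
   show ?thesis
   proof (cases "s \<le> q")
    case True
    have "(s / q)\<^sup>2 \<le> 1" using True False q q0 by (intro power_le_one) auto
    then have "N s * (s / q)\<^sup>2 \<le> N s * 1" by (intro mult_left_mono N_nonneg)
    then show ?thesis using B[of s] True False by simp
   qed (use False in simp)
  qed
 qed
 also have "\<dots> = (u / q)\<^sup>2 * KK N u + (q - u) * B"
  unfolding Bochner_Integration.integral_add[OF i1 i2] KK_def lint_def integral_mult_right_zero using q by simp
 also have "(q - u) * B \<le> q * B" using q B0 by (intro mult_right_mono) auto
 finally show ?thesis by (simp add: mult.commute)
qed

text \<open>The hypothesis says that s H(1/s) is nearly maximal at q among the scales from
  \<open>s0 t\<close> to q. It prevents jumps below a small fraction of q from carrying more than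
  half of H(1/q), so the jumps comparable to q carry the rest, and t H(1/q) >= 1. If
  \<open>s0 t\<close> is itself comparable to q, the tail t w(s0 t) = 2 e gives the bound
  directly.\<close>

lemma tqN_lower:
 "\<exists>c>0. \<forall>t q. 0 < t \<longrightarrow> t \<le> T \<longrightarrow> q \<in> Y \<longrightarrow> s0 t \<le> q \<longrightarrow> q \<le> rho t \<longrightarrow>
   (\<forall>s. s0 t \<le> s \<longrightarrow> s \<le> q \<longrightarrow> s * HH N (1 / s) \<le> e8 * (q * HH N (1 / q))) \<longrightarrow> c \<le> t * (q * N q)"
proof -
 obtain C2 where C2: "0 < C2" "\<And>r. 0 < r \<Longrightarrow> r \<le> L \<Longrightarrow> HH N (1 / r) \<le> C2 * KK N r" using HH_le_KK by blast
 obtain Cw where Cw: "0 < Cw" "\<And>r. r \<in> Y \<Longrightarrow> r \<le> L \<Longrightarrow> ww N r \<le> Cw * (r * N r)" using ww_le by blast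
 have hc: "0 < hconst" using hconst_pos by linarith
 have e80: "0 < e8" using e8_ge by linarith
 \<comment> \<open>Makes the contribution of jumps below \<open>\<epsilon> * q\<close> to C2
   \<open>KK N q\<close> at most half of H(1/q).\<close>
 define \<epsilon> where "\<epsilon> = min (1 / 2) (hconst / (2 * C2 * e8))"
 have e: "0 < \<epsilon>" "\<epsilon> \<le> 1 / 2" unfolding \<epsilon>_def using C2 hc e80 by auto
 have e2: "C2 * (\<epsilon> * e8 / hconst) \<le> 1 / 2"
 proof -
  have "C2 * (\<epsilon> * e8 / hconst) \<le> C2 * (hconst / (2 * C2 * e8) * e8 / hconst)"
   unfolding \<epsilon>_def using C2 hc e80 by (intro mult_left_mono divide_right_mono mult_right_mono) auto
  also have "\<dots> = 1 / 2" using C2 hc e80 by (simp add: field_simps)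
  finally show ?thesis .
 qed
 define J where "J = C0 * (1 / \<epsilon>) ^ k"
 have J: "0 < J" unfolding J_def using C0 e by simp
 define c where "c = min (1 / (2 * C2 * J)) (1 / (Cw * J))"
 have c: "0 < c" unfolding c_def using C2 J Cw by simp
 show ?thesis
 proof (rule exI[of _ c], rule conjI[OF c], intro allI impI)
  fix t q assume t: "0 < t" "t \<le> T" and qY: "q \<in> Y" and q: "s0 t \<le> q" "q \<le> rho t"
   and g: "\<forall>s. s0 t \<le> s \<longrightarrow> s \<le> q \<longrightarrow> s * HH N (1 / s) \<le> e8 * (q * HH N (1 / q))"
  note sp = s0_props[OF t(1)]
  have q0: "0 < q" using sp q by linarith
  have qL: "q \<le> L" using q rho_le_L[OF t] by linarith
  have NJ: "N s \<le> J * N q" if "\<epsilon> * q \<le> s" "s \<le> q" for s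
  proof -
   have s0: "0 < s" using that(1) e q0 by (meson less_le_trans mult_pos_pos)
   have "N s \<le> C0 * (q / s) ^ k * N q" by (rule VV[OF qY s0 that(2)])
   also have "\<dots> \<le> C0 * (1 / \<epsilon>) ^ k * N q"
   proof (intro mult_right_mono mult_left_mono power_mono)
    show "q / s \<le> 1 / \<epsilon>" using that e s0 by (simp add: field_simps)
   qed (use C0 N_nonneg q0 s0 in auto)
   finally show ?thesis unfolding J_def .
  qed
  show "c \<le> t * (q * N q)"
  proof (cases "s0 t \<le> \<epsilon> * q")
   case True
   have u0: "0 < \<epsilon> * q" using e q0 by simp
   have uq: "\<epsilon> * q \<le> q" using e q0 by simp
   define H where "H = HH N (1 / q)"
   have KKq: "KK N q \<le> (\<epsilon> * q / q)\<^sup>2 * KK N (\<epsilon> * q) + J * N q * q"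
    by (rule KK_split[OF u0 uq]) (use NJ uq N_nonneg[of q] order_trans[OF N_nonneg[of q] NJ[OF uq order_refl]] in auto)
   have "hconst * KK N (\<epsilon> * q) \<le> HH N (1 / (\<epsilon> * q))" by (rule hconst_KK_le[OF N u0])
   moreover have "\<epsilon> * q * HH N (1 / (\<epsilon> * q)) \<le> e8 * (q * H)" unfolding H_def using g True uq by blast
   then have "q * (\<epsilon> * HH N (1 / (\<epsilon> * q))) \<le> q * (e8 * H)" by (simp add: mult_ac)
   then have "\<epsilon> * HH N (1 / (\<epsilon> * q)) \<le> e8 * H" using q0 by (simp only: mult_le_cancel_left_pos)
   ultimately have "\<epsilon> * (hconst * KK N (\<epsilon> * q)) \<le> e8 * H" using e by (meson less_imp_le mult_left_mono order_trans)
   then have "\<epsilon> * KK N (\<epsilon> * q) \<le> e8 * H / hconst" using hc by (simp add: le_divide_eq mult_ac)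
   then have "\<epsilon> * (\<epsilon> * KK N (\<epsilon> * q)) \<le> \<epsilon> * (e8 * H / hconst)" using e by (intro mult_left_mono) auto
   moreover have "(\<epsilon> * q / q)\<^sup>2 * KK N (\<epsilon> * q) = \<epsilon> * (\<epsilon> * KK N (\<epsilon> * q))" using q0 by (simp add: power2_eq_square)
   ultimately have "KK N q \<le> \<epsilon> * (e8 * H / hconst) + J * N q * q" using KKq by linarith
   then have "C2 * KK N q \<le> C2 * (\<epsilon> * (e8 * H / hconst) + J * N q * q)" using C2 by (intro mult_left_mono) auto
   then have "H \<le> C2 * (\<epsilon> * (e8 * H / hconst) + J * N q * q)" using C2(2)[OF q0 qL] unfolding H_def by linarith
   also have "\<dots> = C2 * (\<epsilon> * e8 / hconst) * H + C2 * (J * N q * q)" by (simp add: algebra_simps)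
   also have "C2 * (\<epsilon> * e8 / hconst) * H \<le> 1 / 2 * H"
    unfolding H_def using e2 HH_nonneg[OF N, of "1 / q"] q0 by (intro mult_right_mono) auto
   finally have "H \<le> 2 * C2 * J * (q * N q)" by (simp add: mult_ac)
   then have "t * H \<le> t * (2 * C2 * J * (q * N q))" using t by (intro mult_left_mono) auto
   moreover have "1 \<le> t * H" unfolding H_def using le_rho_iff[OF t(1) q0] q by simp
   ultimately have "1 \<le> 2 * C2 * J * (t * (q * N q))" by (simp add: mult_ac)
   then have "1 / (2 * C2 * J) \<le> t * (q * N q)" using C2 J by (simp add: divide_le_eq mult_ac)
   then show ?thesis unfolding c_def by simp
  next
   case False
   have s0Y: "s0 t \<in> Y" by (rule Y_down[OF sp(1) q(1) qY])
   have "ww N (s0 t) \<le> Cw * (s0 t * N (s0 t))" by (rule Cw(2)[OF s0Y]) (use q qL in simp)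
   then have "t * (2 * exp 1 / t) \<le> t * (Cw * (s0 t * N (s0 t)))" using sp t by (intro mult_left_mono) auto
   moreover have "1 \<le> 2 * exp (1::real)" using exp1_ge by linarith
   ultimately have "1 \<le> t * (Cw * (s0 t * N (s0 t)))" using t by simp
   also have "\<dots> \<le> t * (Cw * (q * (J * N q)))" using NJ[of "s0 t"] False q N_nonneg sp Cw t q0 by (intro mult_left_mono mult_mono) auto
   also have "\<dots> = Cw * J * (t * (q * N q))" by simp
   finally have "1 / (Cw * J) \<le> t * (q * N q)" using Cw J by (simp add: divide_le_eq mult_ac)
   then show ?thesis unfolding c_def by simp
  qed
 qed
qed

definition DD :: "real \<Rightarrow> real" where
 "DD t = t * (GREATEST m. m \<in> (\<lambda>s. s * HH N (1 / s)) ` {s0 t..rho t})"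

definition th :: "real \<Rightarrow> real \<Rightarrow> real" where
 "th t y = (if y < rho t then rho t else if y \<le> DD t then
   (LEAST s. s \<in> {s0 t..rho t} \<and> t * s * HH N (1 / s) = y) else s0 t)"

lemma g_cont:
 assumes "0 < t"
 shows "continuous_on {s0 t..rho t} (\<lambda>s. s * HH N (1 / s))"
proof -
 have c: "continuous_on {0<..} (HH N)" by (rule continuous_at_imp_continuous_on) (use HH_deriv[OF N] DERIV_isCont in auto)
 have "continuous_on {s0 t..rho t} (\<lambda>s. HH N (1 / s))"
  by (rule continuous_on_compose2[OF c]) (use s0_props(1)[OF assms] in \<open>auto intro!: continuous_intros\<close>)
 then show ?thesis by (intro continuous_intros)
qed

lemma DD_props:
 assumes t: "0 < t"
 shows "\<And>s. s0 t \<le> s \<Longrightarrow> s \<le> rho t \<Longrightarrow> t * s * HH N (1 / s) \<le> DD t"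
  and "\<exists>s. s0 t \<le> s \<and> s \<le> rho t \<and> t * s * HH N (1 / s) = DD t"
  and "rho t \<le> DD t"
proof -
 let ?g = "\<lambda>s. s * HH N (1 / s)"
 have "\<exists>s\<in>{s0 t..rho t}. \<forall>u\<in>{s0 t..rho t}. ?g u \<le> ?g s"
  by (rule continuous_attains_sup[OF _ _ g_cont[OF t]]) (use s0_props(2)[OF t] in auto)
 then obtain s where s: "s \<in> {s0 t..rho t}" "\<And>u. u \<in> {s0 t..rho t} \<Longrightarrow> ?g u \<le> ?g s" by blast
 have "(GREATEST m. m \<in> ?g ` {s0 t..rho t}) = ?g s" by (rule Greatest_equality) (use s in auto)
 then have D: "DD t = t * ?g s" by (simp add: DD_def)
 show a: "t * u * HH N (1 / u) \<le> DD t" if "s0 t \<le> u" "u \<le> rho t" for u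
  unfolding D using mult_left_mono[OF s(2)[of u], of t] that t by (simp add: mult.assoc)
 show "\<exists>s. s0 t \<le> s \<and> s \<le> rho t \<and> t * s * HH N (1 / s) = DD t" using s(1) D by (auto simp: mult.assoc)
 show "rho t \<le> DD t" using a[OF s0_props(2)[OF t] order_refl] rho_props[OF t] t by simp
qed

text \<open>At \<open>rho t\<close> the function t s H(1/s) equals \<open>rho t\<close> <= y and its
  maximum is \<open>DD t\<close>, so for y <= \<open>DD t\<close> the equation has a solution. The
  solutions form a compact set, hence the least one exists and \<open>LEAST\<close> denotes
  it.\<close>

lemma th_props:
 assumes t: "0 < t" and y: "rho t \<le> y"
 shows "s0 t \<le> th t y" "th t y \<le> rho t" "t * th t y * HH N (1 / th t y) \<le> y"
  "t * th t y * HH N (1 / th t y) = y \<or> (DD t < y \<and> th t y = s0 t)"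
proof -
 have "s0 t \<le> th t y \<and> th t y \<le> rho t \<and> t * th t y * HH N (1 / th t y) \<le> y \<and>
  (t * th t y * HH N (1 / th t y) = y \<or> (DD t < y \<and> th t y = s0 t))"
 proof (cases "y \<le> DD t")
  case True
  let ?S = "{s \<in> {s0 t..rho t}. t * (s * HH N (1 / s)) = y}"
  have cont: "continuous_on {s0 t..rho t} (\<lambda>s. t * (s * HH N (1 / s)))" by (intro continuous_intros g_cont[OF t])
  obtain m where m: "s0 t \<le> m" "m \<le> rho t" "t * m * HH N (1 / m) = DD t" using DD_props(2)[OF t] by blast
  have "\<exists>x\<ge>m. x \<le> rho t \<and> t * (x * HH N (1 / x)) = y"
  proof (rule IVT2'[where f="\<lambda>s. t * (s * HH N (1 / s))"])
   show "t * (rho t * HH N (1 / rho t)) \<le> y" using rho_props[OF t] t y by simp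
   show "y \<le> t * (m * HH N (1 / m))" using m True by (simp add: mult.assoc)
   show "continuous_on {m..rho t} (\<lambda>s. t * (s * HH N (1 / s)))" by (rule continuous_on_subset[OF cont]) (use m in auto)
  qed (use m in auto)
  then have ne: "?S \<noteq> {}" using m by fastforce
  have "closed ?S" using continuous_closed_preimage[OF cont closed_atLeastAtMost, of "{y}"] by (simp add: vimage_def Int_def)
  moreover have "bounded ?S" by (rule bounded_subset[OF bounded_closed_interval[of "s0 t" "rho t"]]) auto
  ultimately have "compact ?S" using compact_eq_bounded_closed by blast
  from compact_attains_inf[OF this ne] obtain s where s: "s \<in> ?S" "\<And>u. u \<in> ?S \<Longrightarrow> s \<le> u" by blast
  have "(LEAST s. s \<in> {s0 t..rho t} \<and> t * s * HH N (1 / s) = y) = s" by (rule Least_equality) (use s in \<open>auto simp: mult.assoc\<close>)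
  then have "th t y = s" using True y by (simp add: th_def)
  then show ?thesis using s(1) by (auto simp: mult.assoc)
 next
  case False
  then have "th t y = s0 t" using y by (simp add: th_def)
  moreover have "t * s0 t * HH N (1 / s0 t) \<le> DD t" by (rule DD_props(1)[OF t order_refl s0_props(2)[OF t]])
  ultimately show ?thesis using False s0_props[OF t] by auto
 qed
 then show "s0 t \<le> th t y" "th t y \<le> rho t" "t * th t y * HH N (1 / th t y) \<le> y"
  "t * th t y * HH N (1 / th t y) = y \<or> (DD t < y \<and> th t y = s0 t)" by auto
qed

text \<open>A lower bound for \<open>t * q * N q\<close> lets the polynomial lower bound for \<open>N\<close> absorb an exponential.\<close>

lemma exp_absorbed:
 assumes c: "0 < c" and K: "0 < K"
 shows "\<exists>F>0. \<forall>t q y. 0 < t \<longrightarrow> y \<in> Y \<longrightarrow> 0 < q \<longrightarrow> q \<le> y \<longrightarrow> q \<le> rho t \<longrightarrow> c \<le> t * (q * N q) \<longrightarrow>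
  1 / rho t * exp (- (K * y / q)) \<le> F * (t * N y)"
proof -
 define F where "F = C0 / c * (fact k / K ^ k)"
 have F: "0 < F" unfolding F_def using C0 c K by simp
 show ?thesis
 proof (rule exI[of _ F], rule conjI[OF F], intro allI impI)
  fix t q y assume t: "0 < t" and yY: "y \<in> Y" and q: "0 < q" "q \<le> y" "q \<le> rho t" and h: "c \<le> t * (q * N q)"
  define v where "v = y / q"
  have v: "0 < v" unfolding v_def using q Y_pos[OF yY] by simp
  have "N q \<le> C0 * v ^ k * N y" unfolding v_def by (rule VV[OF yY q(1,2)])
  then have "t * (q * N q) \<le> t * (q * (C0 * v ^ k * N y))" using t q by (intro mult_left_mono) auto
  then have "c \<le> t * (q * (C0 * v ^ k * N y))" using h by linarith
  then have "1 / q \<le> C0 / c * v ^ k * (t * N y)" using c q by (simp add: field_simps)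
  moreover have "1 / rho t \<le> 1 / q" using q by (intro divide_left_mono) (auto intro: mult_pos_pos less_le_trans)
  ultimately have r: "1 / rho t \<le> C0 / c * v ^ k * (t * N y)" by linarith
  have "exp (- (K * v)) \<le> fact k / (K * v) ^ k" using K v by (intro exp_neg_le_power) simp
  then have "1 / rho t * exp (- (K * v)) \<le> C0 / c * v ^ k * (t * N y) * (fact k / (K * v) ^ k)"
   using r C0 c v t N_nonneg rho_props(1)[OF t] by (intro mult_mono) auto
  also have "\<dots> = F * (t * N y)" unfolding F_def using v K by (simp add: power_mult_distrib)
  finally show "1 / rho t * exp (- (K * y / q)) \<le> F * (t * N y)" by (simp add: v_def)
 qed
qed

section \<open>Assembly of the estimates to the right of the centre\<close>

text \<open>The real form of \<open>right_profile\<close> for positive y, with multiplication by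
  \<open>rho t\<close> in place of division by \<open>H_inv\<close>.\<close>

definition prof :: "real \<Rightarrow> real \<Rightarrow> real \<Rightarrow> real" where
 "prof \<kappa> t y = 1 / rho t * min 1 (t * N y * rho t + exp (- (\<kappa> * y / th t (y / e8))))"

lemma prof_le:
 assumes "0 < t"
 shows "prof \<kappa> t y \<le> 1 / rho t" "prof \<kappa> t y \<le> t * N y + 1 / rho t * exp (- (\<kappa> * y / th t (y / e8)))"
proof -
 note r = rho_props(1)[OF assms]
 have "prof \<kappa> t y \<le> 1 / rho t * 1" unfolding prof_def using r by (intro mult_left_mono) auto
 then show "prof \<kappa> t y \<le> 1 / rho t" by simp
 have "prof \<kappa> t y \<le> 1 / rho t * (t * N y * rho t + exp (- (\<kappa> * y / th t (y / e8))))"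
  unfolding prof_def using r by (intro mult_left_mono) auto
 also have "\<dots> = t * N y + 1 / rho t * exp (- (\<kappa> * y / th t (y / e8)))" using r by (simp add: distrib_left)
 finally show "prof \<kappa> t y \<le> t * N y + 1 / rho t * exp (- (\<kappa> * y / th t (y / e8)))" .
qed

text \<open>Evaluating \<open>th\<close> at y / e8 yields a scale q with e8 t q H(1/q) <= y, the
  hypothesis of \<open>upper_main\<close>. For y < e8 rho t the exponential term of the profile is
  at least exp (-e8/8), and the uniform bound of the density suffices.\<close>

lemma upper_profile:
 "\<exists>C>0. \<forall>t y. 0 < t \<longrightarrow> t \<le> T \<longrightarrow> y \<in> Y \<longrightarrow> p t (cc t + y) \<le> C * prof (1 / 8) t y"
proof -
 obtain C where C: "1 \<le> C" and sup: "\<And>t x. 0 < t \<Longrightarrow> t \<le> T \<Longrightarrow> 0 < x \<Longrightarrow> p t x \<le> C / rho t" using p_sup by blast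
 obtain B where B: "0 < B" and um: "\<And>t q y. 0 < t \<Longrightarrow> t \<le> T \<Longrightarrow> s0 t \<le> q \<Longrightarrow> q \<le> rho t \<Longrightarrow> y \<in> Y \<Longrightarrow> 2 * rho t \<le> y \<Longrightarrow>
   e8 * (t * q * HH N (1 / q)) \<le> y \<Longrightarrow> p t (cc t + y) \<le> B * (t * N y + 1 / rho t * exp (- (y / (8 * q))))"
  using upper_main by blast
 define E where "E = max B (C * exp (e8 / 8))"
 have CE: "C \<le> C * exp (e8 / 8)" using C e8_ge by simp
 have E: "0 < E" "B \<le> E" "C \<le> E" "C * exp (e8 / 8) \<le> E" unfolding E_def using B CE by auto
 show ?thesis
 proof (rule exI[of _ E], rule conjI[OF E(1)], intro allI impI)
  fix t y assume t: "0 < t" "t \<le> T" and yY: "y \<in> Y"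
  note rt = rho_props[OF t(1)]
  have y0: "0 < y" by (rule Y_pos[OF yY])
  have cp: "0 < cc t" unfolding cc_def using t mom1_pos rt by simp
  have pC: "p t (cc t + y) \<le> C / rho t" by (rule sup[OF t]) (use cp y0 in simp)
  have e80: "0 < e8" using e8_ge by linarith
  define q where "q = th t (y / e8)"
  define V where "V = t * N y * rho t + exp (- (1 / 8 * y / q))"
  have V0: "0 < V" unfolding V_def using t N_nonneg rt by (intro add_nonneg_pos mult_nonneg_nonneg) auto
  have pr: "E * prof (1 / 8) t y = E * min 1 V / rho t" unfolding prof_def V_def q_def by simp
  have "p t (cc t + y) \<le> E * min 1 V / rho t"
  proof (cases "y / e8 < rho t")
   case True
   then have q: "q = rho t" unfolding q_def th_def by simp
   have "y / rho t \<le> e8" using True rt e80 by (simp add: divide_less_eq divide_le_eq mult.commute)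
   then have "exp (- (e8 / 8)) \<le> exp (- (1 / 8 * y / q))" unfolding q by simp
   also have "\<dots> \<le> V" unfolding V_def using t N_nonneg rt by simp
   finally have "exp (- (e8 / 8)) \<le> min 1 V" using e80 by simp
   then have "C * exp (e8 / 8) * exp (- (e8 / 8)) \<le> E * min 1 V" using E C by (intro mult_mono) auto
   then have "C \<le> E * min 1 V" by (simp add: mult.assoc exp_add[symmetric])
   then have "C / rho t \<le> E * min 1 V / rho t" using rt by (intro divide_right_mono) auto
   with pC show ?thesis by linarith
  next
   case False
   then have yr: "rho t \<le> y / e8" by simp
   note tp = th_props[OF t(1) yr, folded q_def]
   have q0: "0 < q" using tp s0_props(1)[OF t(1)] by linarith
   have "2 * rho t \<le> e8 * rho t" using e8_ge rt by (intro mult_right_mono) auto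
   also have "\<dots> \<le> y" using yr e80 by (simp add: le_divide_eq mult.commute)
   finally have y2: "2 * rho t \<le> y" .
   have "p t (cc t + y) \<le> B * (t * N y + 1 / rho t * exp (- (y / (8 * q))))"
    by (rule um[OF t tp(1,2) yY y2]) (use tp(3) e80 in \<open>simp add: le_divide_eq mult.commute\<close>)
   also have "\<dots> = B * V / rho t" unfolding V_def using rt by (simp add: field_simps)
   also have "\<dots> \<le> E * V / rho t" using E V0 rt by (intro divide_right_mono mult_right_mono) auto
   finally have 1: "p t (cc t + y) \<le> E * V / rho t" .
   have "C / rho t \<le> E * 1 / rho t" using E rt by (intro divide_right_mono) auto
   with pC have 2: "p t (cc t + y) \<le> E * 1 / rho t" by linarith
   show ?thesis using 1 2 by (cases "1 \<le> V") (auto simp: min_def)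
  qed
  then show "p t (cc t + y) \<le> E * prof (1 / 8) t y" unfolding pr .
 qed
qed

text \<open>Three ranges: for y < e8 rho t the near-diagonal bound; if the scale solves t q H(1/q) =
  y / e8, half of the profile comes from a single jump and half from chaining; if the scale is
  \<open>s0 t\<close>, a single jump covers the exponential too.\<close>

lemma lower_profile:
 "\<exists>c>0. \<exists>\<kappa>>0. \<forall>t y. 0 < t \<longrightarrow> t \<le> T \<longrightarrow> y \<in> Y \<longrightarrow> c * prof \<kappa> t y \<le> p t (cc t + y)"
proof -
 obtain M where M: "saddle M" using saddle_exists by blast
 have M1: "1 < M" using M by (simp add: saddle_def)
 have e80: "0 < e8" using e8_ge by linarith
 obtain c1 where c1: "0 < c1" and nd: "\<And>t x. 0 < t \<Longrightarrow> t \<le> T \<Longrightarrow> xM M t \<le> x \<Longrightarrow> x \<le> cc t + e8 * rho t \<Longrightarrow> c1 / rho t \<le> p t x"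
  using near_diagonal[OF M less_imp_le[OF e80]] by blast
 obtain c2 where c2: "0 < c2" and jl: "\<And>t y. 0 < t \<Longrightarrow> t \<le> T \<Longrightarrow> y \<in> Y \<Longrightarrow> rho t \<le> y \<Longrightarrow> c2 * (t * N y) \<le> p t (cc t + y)" using jump_lower by blast
 obtain c3 K where c3: "0 < c3" and K: "0 < K" and cl: "\<And>t q y. 0 < t \<Longrightarrow> t \<le> T \<Longrightarrow> s0 t \<le> q \<Longrightarrow> q \<le> rho t \<Longrightarrow> rho t \<le> y \<Longrightarrow>
   y = e8 * (t * q * HH N (1 / q)) \<Longrightarrow> c3 / rho t * exp (- K * y / q) \<le> p t (cc t + y)"
  using chain_lower by blast
 obtain c4 where c4: "0 < c4" and tq: "\<And>t q. 0 < t \<Longrightarrow> t \<le> T \<Longrightarrow> q \<in> Y \<Longrightarrow> s0 t \<le> q \<Longrightarrow> q \<le> rho t \<Longrightarrow>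
   (\<And>s. s0 t \<le> s \<Longrightarrow> s \<le> q \<Longrightarrow> s * HH N (1 / s) \<le> e8 * (q * HH N (1 / q))) \<Longrightarrow> c4 \<le> t * (q * N q)"
  using tqN_lower by blast
 obtain F where F: "0 < F" and ea: "\<And>t q y. 0 < t \<Longrightarrow> y \<in> Y \<Longrightarrow> 0 < q \<Longrightarrow> q \<le> y \<Longrightarrow> q \<le> rho t \<Longrightarrow> c4 \<le> t * (q * N q) \<Longrightarrow>
  1 / rho t * exp (- (K * y / q)) \<le> F * (t * N y)"
  using exp_absorbed[OF c4 K] by blast
 define c where "c = min c1 (min (min c2 c3 / 2) (c2 / (1 + F)))"
 have c: "0 < c" "c \<le> c1" "c \<le> min c2 c3 / 2" "c \<le> c2 / (1 + F)" unfolding c_def using c1 c2 c3 F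
  by (auto simp only: min_less_iff_conj min.cobounded1 intro!: divide_pos_pos min.coboundedI1 min.coboundedI2)
 show ?thesis
 proof (rule exI[of _ c], rule conjI[OF c(1)], rule exI[of _ K], rule conjI[OF K], intro allI impI)
  fix t y assume t: "0 < t" "t \<le> T" and yY: "y \<in> Y"
  note rt = rho_props[OF t(1)]
  have y0: "0 < y" by (rule Y_pos[OF yY])
  have tN: "0 \<le> t * N y" using t N_nonneg by simp
  define q where "q = th t (y / e8)"
  define G where "G = 1 / rho t * exp (- (K * y / q))"
  have G: "0 \<le> G" unfolding G_def using rt by simp
  have pf: "prof K t y \<le> 1 / rho t" "prof K t y \<le> t * N y + G" using prof_le[OF t(1), of K y] unfolding G_def q_def by auto
  show "c * prof K t y \<le> p t (cc t + y)"
  proof (cases "y / e8 < rho t")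
   case True
   have ye: "y \<le> e8 * rho t" using True e80 by (simp add: divide_less_eq mult.commute)
   have "c * prof K t y \<le> c * (1 / rho t)" using pf c by (intro mult_left_mono) auto
   also have "\<dots> \<le> c1 / rho t" using c rt by (simp add: divide_right_mono)
   also have "\<dots> \<le> p t (cc t + y)" by (rule nd[OF t]) (use cc_xM(1)[OF t(1) M1] y0 ye in auto)
   finally show ?thesis .
  next
   case False
   then have yr: "rho t \<le> y / e8" by simp
   note tp = th_props[OF t(1) yr, folded q_def]
   have q0: "0 < q" using tp s0_props(1)[OF t(1)] by linarith
   have "1 * rho t \<le> e8 * rho t" using e8_ge rt by (intro mult_right_mono) auto
   also have "\<dots> \<le> y" using yr e80 by (simp add: le_divide_eq mult.commute)
   finally have ry: "rho t \<le> y" by simp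
   have J: "c2 * (t * N y) \<le> p t (cc t + y)" by (rule jl[OF t yY ry])
   have cp: "c * prof K t y \<le> c * (t * N y + G)" using pf c by (intro mult_left_mono) auto
   show ?thesis
   proof (cases "t * q * HH N (1 / q) = y / e8")
    case True
    have "y = e8 * (t * q * HH N (1 / q))" unfolding True using e80 by simp
    from cl[OF t tp(1,2) ry this] have E: "c3 * G \<le> p t (cc t + y)" unfolding G_def by (simp add: mult_ac)
    have "c * (t * N y + G) \<le> min c2 c3 / 2 * (t * N y + G)" using c tN G by (intro mult_right_mono) auto
    also have "\<dots> = (min c2 c3 * (t * N y) + min c2 c3 * G) / 2" by (simp add: distrib_left)
    also have "\<dots> \<le> (c2 * (t * N y) + c3 * G) / 2" using tN G by (intro divide_right_mono add_mono mult_right_mono) auto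
    also have "\<dots> \<le> p t (cc t + y)" using J E by simp
    finally show ?thesis using cp by linarith
   next
    case False
    then have qs: "q = s0 t" using tp(4) by simp
    have qy: "q \<le> y" using tp(2) ry by linarith
    have qY: "q \<in> Y" by (rule Y_down[OF q0 qy yY])
    have "c4 \<le> t * (q * N q)"
    proof (rule tq[OF t qY tp(1,2)])
     \<comment> \<open>The only admissible scale is q = s0 t itself.\<close>
     fix s assume "s0 t \<le> s" "s \<le> q"
     then have sq: "s = q" using qs by simp
     have "0 \<le> q * HH N (1 / q)" using q0 HH_nonneg[OF N, of "1 / q"] by simp
     then have "1 * (q * HH N (1 / q)) \<le> e8 * (q * HH N (1 / q))" using e8_ge by (intro mult_right_mono) auto
     then show "s * HH N (1 / s) \<le> e8 * (q * HH N (1 / q))" unfolding sq by simp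
    qed
    then have "G \<le> F * (t * N y)" unfolding G_def by (rule ea[OF t(1) yY q0 qy tp(2)])
    then have "t * N y + G \<le> (1 + F) * (t * N y)" by (simp only: distrib_right mult_1_left)
    then have "c * (t * N y + G) \<le> c2 / (1 + F) * ((1 + F) * (t * N y))" using c tN G F c2 by (intro mult_mono) auto
    also have "\<dots> = c2 * (t * N y)" using F by simp
    finally show ?thesis using cp J by linarith
   qed
  qed
 qed
qed

text \<open>The slack e8 in \<open>tqN_lower\<close> is made for this case: y exceeds the maximum of
  t s H(1/s), so a scale q with y <= e8 t q H(1/q) is maximal up to the factor e8. Then t q N q is
  bounded below and the exponential is absorbed.\<close>

lemma jump_upper:
 "\<exists>C>0. \<forall>t y. 0 < t \<longrightarrow> t \<le> T \<longrightarrow> y \<in> Y \<longrightarrow> DD t < y \<longrightarrow> p t (cc t + y) \<le> C * (t * N y)"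
proof -
 have e80: "0 < e8" using e8_ge by linarith
 obtain C where C: "1 \<le> C" and sup: "\<And>t x. 0 < t \<Longrightarrow> t \<le> T \<Longrightarrow> 0 < x \<Longrightarrow> p t x \<le> C / rho t" using p_sup by blast
 obtain B where B: "0 < B" and um: "\<And>t q y. 0 < t \<Longrightarrow> t \<le> T \<Longrightarrow> s0 t \<le> q \<Longrightarrow> q \<le> rho t \<Longrightarrow> y \<in> Y \<Longrightarrow> 2 * rho t \<le> y \<Longrightarrow>
   e8 * (t * q * HH N (1 / q)) \<le> y \<Longrightarrow> p t (cc t + y) \<le> B * (t * N y + 1 / rho t * exp (- (y / (8 * q))))"
  using upper_main by blast
 obtain c4 where c4: "0 < c4" and tq: "\<And>t q. 0 < t \<Longrightarrow> t \<le> T \<Longrightarrow> q \<in> Y \<Longrightarrow> s0 t \<le> q \<Longrightarrow> q \<le> rho t \<Longrightarrow>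
   (\<And>s. s0 t \<le> s \<Longrightarrow> s \<le> q \<Longrightarrow> s * HH N (1 / s) \<le> e8 * (q * HH N (1 / q))) \<Longrightarrow> c4 \<le> t * (q * N q)"
  using tqN_lower by blast
 obtain F where F: "0 < F" and ea: "\<And>t q y. 0 < t \<Longrightarrow> y \<in> Y \<Longrightarrow> 0 < q \<Longrightarrow> q \<le> y \<Longrightarrow> q \<le> rho t \<Longrightarrow> c4 \<le> t * (q * N q) \<Longrightarrow>
  1 / rho t * exp (- (1 / 8 * y / q)) \<le> F * (t * N y)"
  using exp_absorbed[OF c4, of "1 / 8"] by auto
 define E where "E = C * exp (e8 / 8) * F + B * (1 + F)"
 have E1: "0 < C * exp (e8 / 8) * F" "0 < B * (1 + F)" using C B F by auto
 have E: "0 < E" unfolding E_def using E1 by linarith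
 show ?thesis
 proof (rule exI[of _ E], rule conjI[OF E], intro allI impI)
  fix t y assume t: "0 < t" "t \<le> T" and yY: "y \<in> Y" and D: "DD t < y"
  note rt = rho_props[OF t(1)]
  have y0: "0 < y" by (rule Y_pos[OF yY])
  have tN: "0 \<le> t * N y" using t N_nonneg by simp
  have cp: "0 < cc t" unfolding cc_def using t mom1_pos rt by simp
  have ry: "rho t < y" using DD_props(3)[OF t(1)] D by linarith
  have below: "s * HH N (1 / s) \<le> e8 * (q * HH N (1 / q))"
   if "s0 t \<le> s" "s \<le> q" "q \<le> rho t" "y \<le> e8 * (t * (q * HH N (1 / q)))" for s q
  proof -
   have "t * (s * HH N (1 / s)) \<le> DD t" using DD_props(1)[OF t(1), of s] that by (simp add: mult.assoc)
   then have "t * (s * HH N (1 / s)) \<le> t * (e8 * (q * HH N (1 / q)))" using D that(4) by (simp add: mult.left_commute)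
   then show ?thesis using t by (simp only: mult_le_cancel_left_pos)
  qed
  have final: "x * (t * N y) \<le> E * (t * N y)" if "x \<le> E" for x using that tN by (rule mult_right_mono)
  show "p t (cc t + y) \<le> E * (t * N y)"
  proof (cases "y / e8 < rho t")
   case True
   \<comment> \<open>For y between \<open>DD t\<close> and e8 rho t the scale is
     \<open>rho t\<close> and the density is only bounded by C / rho t; this is a multiple of t N y
     because t rho t N (rho t) is bounded below.\<close>
   have rY: "rho t \<in> Y" by (rule Y_down[OF rt(1) _ yY]) (use ry in simp)
   have ye: "y < e8 * rho t" using True e80 by (simp add: divide_less_eq mult.commute)
   have "c4 \<le> t * (rho t * N (rho t))"
   proof (rule tq[OF t rY s0_props(2)[OF t(1)] order_refl])
    fix s assume "s0 t \<le> s" "s \<le> rho t"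
    then show "s * HH N (1 / s) \<le> e8 * (rho t * HH N (1 / rho t))" by (rule below[OF _ _ order_refl]) (use ye rt t in simp)
   qed
   then have "1 / rho t * exp (- (1 / 8 * y / rho t)) \<le> F * (t * N y)" by (rule ea[OF t(1) yY rt(1) less_imp_le[OF ry] order_refl])
   moreover have "exp (- (e8 / 8)) \<le> exp (- (1 / 8 * y / rho t))" using ye rt by (simp add: divide_le_eq)
   then have "1 / rho t * exp (- (e8 / 8)) \<le> 1 / rho t * exp (- (1 / 8 * y / rho t))" using rt by (intro mult_left_mono) auto
   ultimately have "1 / rho t * exp (- (e8 / 8)) \<le> F * (t * N y)" by linarith
   then have "C * exp (e8 / 8) * (1 / rho t * exp (- (e8 / 8))) \<le> C * exp (e8 / 8) * (F * (t * N y))"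
    using C by (intro mult_left_mono) auto
   moreover have "C * exp (e8 / 8) * (1 / rho t * exp (- (e8 / 8))) = C / rho t" using mult_exp_exp[of "e8 / 8" "- (e8 / 8)"] by simp
   ultimately have "C / rho t \<le> (C * exp (e8 / 8) * F) * (t * N y)" by (simp only: mult.assoc)
   also have "\<dots> \<le> E * (t * N y)" by (rule final) (use E1 E_def in linarith)
   finally have 1: "C / rho t \<le> E * (t * N y)" .
   have "p t (cc t + y) \<le> C / rho t" by (rule sup[OF t]) (use cp y0 in simp)
   then show ?thesis using 1 by linarith
  next
   case False
   then have yr: "rho t \<le> y / e8" by simp
   define q where "q = th t (y / e8)"
   note tp = th_props[OF t(1) yr, folded q_def]
   have q0: "0 < q" using tp s0_props(1)[OF t(1)] by linarith
   have qy: "q \<le> y" using tp(2) ry by linarith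
   have qY: "q \<in> Y" by (rule Y_down[OF q0 qy yY])
   have "2 * rho t \<le> e8 * rho t" using e8_ge rt by (intro mult_right_mono) auto
   also have "\<dots> \<le> y" using yr e80 by (simp add: le_divide_eq mult.commute)
   finally have y2: "2 * rho t \<le> y" .
   have "c4 \<le> t * (q * N q)"
   proof (rule tq[OF t qY tp(1,2)])
    fix s assume s: "s0 t \<le> s" "s \<le> q"
    show "s * HH N (1 / s) \<le> e8 * (q * HH N (1 / q))"
    proof (cases "t * q * HH N (1 / q) = y / e8")
     case True
     then have "y \<le> e8 * (t * (q * HH N (1 / q)))" using e80 by (simp add: mult.assoc)
     then show ?thesis by (rule below[OF s tp(2)])
    next
     case False
     then have sq: "s = q" using tp(4) s by simp
     have "0 \<le> q * HH N (1 / q)" using q0 HH_nonneg[OF N, of "1 / q"] by simp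
     then have "1 * (q * HH N (1 / q)) \<le> e8 * (q * HH N (1 / q))" using e8_ge by (intro mult_right_mono) auto
     then show ?thesis unfolding sq by simp
    qed
   qed
   then have "1 / rho t * exp (- (1 / 8 * y / q)) \<le> F * (t * N y)" by (rule ea[OF t(1) yY q0 qy tp(2)])
   then have "t * N y + 1 / rho t * exp (- (y / (8 * q))) \<le> (1 + F) * (t * N y)" by (simp add: distrib_right)
   then have "B * (t * N y + 1 / rho t * exp (- (y / (8 * q)))) \<le> B * ((1 + F) * (t * N y))" using B by (intro mult_left_mono) auto
   moreover have "p t (cc t + y) \<le> B * (t * N y + 1 / rho t * exp (- (y / (8 * q))))"
    by (rule um[OF t tp(1,2) yY y2]) (use tp(3) e80 in \<open>simp add: le_divide_eq mult.commute\<close>)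
   moreover have "B * ((1 + F) * (t * N y)) \<le> E * (t * N y)" using final[of "B * (1 + F)"] E1 unfolding E_def by (simp add: mult.assoc)
   ultimately show ?thesis by linarith
  qed
 qed
qed

section \<open>Assembly of the estimates to the left of the centre\<close>

text \<open>Parameters with t H(l) above the threshold are covered by the saddle point bound. For t
  H(l) between 1 and M the point lies between \<open>xM M t\<close> and \<open>cc t\<close>, where
  the density is of order 1 / rho t, and v is at least a multiple of \<open>rho t\<close>.\<close>

lemma saddle_bounds:
 "\<exists>c\<ge>1. \<forall>t l. 0 < t \<longrightarrow> t \<le> T \<longrightarrow> 1 / rho t \<le> l \<longrightarrow>
   1 / c / vv t l * exp (- (t * HH N l)) \<le> p t (t * mom N 1 l) \<and> p t (t * mom N 1 l) \<le> c / vv t l * exp (- (t * HH N l))"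
proof -
 obtain C where C: "1 \<le> C" and tu: "\<And>t l x. 0 < t \<Longrightarrow> t \<le> T \<Longrightarrow> 1 / rho t \<le> l \<Longrightarrow> 0 < x \<Longrightarrow>
   p t x \<le> C / vv t l * exp (l * x - t * lexp N l)" using tilt_upper by blast
 obtain M where M: "saddle M" using saddle_exists by blast
 have M1: "1 < M" using M by (simp add: saddle_def)
 obtain k' where k': "0 < k'" and sd: "\<And>t l x. 0 < t \<Longrightarrow> t \<le> T \<Longrightarrow> 0 < l \<Longrightarrow> M \<le> t * HH N l \<Longrightarrow> 0 < x \<Longrightarrow>
   \<bar>x - t * mom N 1 l\<bar> \<le> vv t l \<Longrightarrow> k' / vv t l * exp (l * x - t * lexp N l) \<le> p t x"
  using M unfolding saddle_def by blast
 obtain c1 where c1: "0 < c1" and nd: "\<And>t x. 0 < t \<Longrightarrow> t \<le> T \<Longrightarrow> xM M t \<le> x \<Longrightarrow> x \<le> cc t + 0 * rho t \<Longrightarrow> c1 / rho t \<le> p t x"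
  using near_diagonal[OF M order_refl] by blast
 obtain D where D: "1 \<le> D" and rr: "\<And>t r. 0 < t \<Longrightarrow> t \<le> T \<Longrightarrow> 0 < r \<Longrightarrow> t * HH N (1 / r) \<le> M \<Longrightarrow> rho t \<le> D * r" using rho_ratio[of M] M1 by auto
 obtain c where c: "0 < c" and vl: "\<And>t l. 0 < t \<Longrightarrow> 1 / L \<le> l \<Longrightarrow> c * (t * HH N l) \<le> (l * vv t l)\<^sup>2" using vv_lower by blast
 \<comment> \<open>From v >= sqrt c / l and 1/l >= rho t / D.\<close>
 define c2 where "c2 = c1 * sqrt c / D"
 have c2: "0 < c2" unfolding c2_def using c1 c D by simp
 define E where "E = C + 1 / k' + 1 / c2"
 have E: "1 \<le> E" "C \<le> E" "1 / k' \<le> E" "1 / c2 \<le> E" unfolding E_def using C k' c2 zero_less_divide_1_iff[of k'] zero_less_divide_1_iff[of c2] by linarith+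
 have E': "1 / E \<le> k'" "1 / E \<le> c2" using E k' c2 by (auto simp: divide_le_eq mult.commute)
 show ?thesis
 proof (rule exI[of _ E], rule conjI[OF E(1)], intro allI impI)
  fix t l assume t: "0 < t" "t \<le> T" and l: "1 / rho t \<le> l"
  note rt = rho_props[OF t(1)]
  have l0: "0 < l" using l rt by (auto intro: less_le_trans[rotated])
  have lr: "1 / l \<le> rho t" using l l0 rt by (simp add: field_simps)
  have lL: "1 / L \<le> l"
  proof -
   have "1 / L \<le> 1 / rho t" using rho_le_L[OF t] rt L_pos by (intro divide_left_mono) auto
   then show ?thesis using l by linarith
  qed
  have v: "0 < vv t l" by (rule vv_pos[OF t(1) l0])
  define x where "x = t * mom N 1 l"
  have x: "0 < x" unfolding x_def using t mom1_pos[OF l0] by simp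
  have lx: "l * x - t * lexp N l = - (t * HH N l)" unfolding x_def by (rule lexp_eq[OF l0])
  have A1: "1 \<le> t * HH N l" using le_rho_iff[OF t(1), of "1 / l"] lr l0 by simp
  have up: "p t x \<le> E / vv t l * exp (- (t * HH N l))"
  proof -
   have "p t x \<le> C / vv t l * exp (- (t * HH N l))" using tu[OF t l x] lx by simp
   also have "\<dots> \<le> E / vv t l * exp (- (t * HH N l))" using E v by (intro mult_right_mono divide_right_mono) auto
   finally show ?thesis .
  qed
  have lo: "1 / E / vv t l * exp (- (t * HH N l)) \<le> p t x"
  proof (cases "M \<le> t * HH N l")
   case True
   have "1 / E / vv t l * exp (- (t * HH N l)) \<le> k' / vv t l * exp (- (t * HH N l))"
    using E' v by (intro mult_right_mono divide_right_mono) auto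
   also have "\<dots> \<le> p t x" using sd[OF t l0 True x] lx v unfolding x_def by simp
   finally show ?thesis .
  next
   case False
   have tM: "0 < t / M" using t M1 by simp
   note rm = rho_props[OF tM]
   have lm: "l \<le> 1 / rho (t / M)"
   proof (rule ccontr)
    assume "\<not> l \<le> 1 / rho (t / M)"
    then have "HH N (1 / rho (t / M)) < HH N l" using rm by (intro HH_strict_mono) auto
    then show False using False rm t M1 by (simp add: field_simps)
   qed
   have "xM M t \<le> x" unfolding xM_def x_def using t lm l0 by (intro mult_left_mono mom1_antimono[OF N]) auto
   moreover have "x \<le> cc t" unfolding x_def cc_def using t l rt by (intro mult_left_mono mom1_antimono[OF N]) auto
   ultimately have p1: "c1 / rho t \<le> p t x" using nd[OF t, of x] by simp
   have "rho t \<le> D * (1 / l)" by (rule rr[OF t]) (use l0 False in auto)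
   moreover have "sqrt c \<le> l * vv t l"
   proof -
    have "c * 1 \<le> c * (t * HH N l)" using A1 c by (intro mult_left_mono) auto
    then have "sqrt c \<le> sqrt ((l * vv t l)\<^sup>2)" using vl[OF t(1) lL] by (intro real_sqrt_le_mono) linarith
    then show ?thesis using l0 v by simp
   qed
   ultimately have "sqrt c * rho t \<le> (l * vv t l) * (D * (1 / l))" using c l0 v rt by (intro mult_mono) auto
   then have "sqrt c * rho t / D \<le> vv t l" using l0 D by (simp add: field_simps)
   then have "c1 * (sqrt c * rho t / D) \<le> c1 * vv t l" using c1 by (intro mult_left_mono) auto
   then have "c2 * rho t \<le> c1 * vv t l" unfolding c2_def by simp
   then have "c2 / vv t l \<le> c1 / rho t" using v rt by (simp add: field_simps)
   moreover have "1 / E / vv t l \<le> c2 / vv t l" using E' v by (intro divide_right_mono) auto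
   moreover have "1 / E / vv t l * exp (- (t * HH N l)) \<le> 1 / E / vv t l * 1" using E v A1 by (intro mult_left_mono) auto
   ultimately show ?thesis using p1 by linarith
  qed
  show "1 / E / vv t l * exp (- (t * HH N l)) \<le> p t (t * mom N 1 l) \<and> p t (t * mom N 1 l) \<le> E / vv t l * exp (- (t * HH N l))"
   using up lo unfolding x_def by simp
 qed
qed

text \<open>With A = t H(l): v <= 2 A / l <= 2 exp A rho t in one direction; in the other, scaling
  of H bounds l rho t by a power of A, and rho t / v is at most a multiple of l rho t. The powers of
  A are absorbed by part of the exponential, which explains the factors 2 and 1/2 in the
  exponents.\<close>

lemma vv_compare:
 "\<exists>c\<ge>1. \<forall>t l. 0 < t \<longrightarrow> t \<le> T \<longrightarrow> 1 / rho t \<le> l \<longrightarrow>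
   1 / c * (1 / rho t) * exp (- 2 * t * HH N l) \<le> 1 / vv t l * exp (- (t * HH N l)) \<and>
   1 / vv t l * exp (- (t * HH N l)) \<le> c * (1 / rho t) * exp (- (t / 2) * HH N l)"
proof -
 obtain c where c: "0 < c" and vl: "\<And>t l. 0 < t \<Longrightarrow> 1 / L \<le> l \<Longrightarrow> c * (t * HH N l) \<le> (l * vv t l)\<^sup>2" using vv_lower by blast
 obtain c3 where c3: "0 < c3" "\<And>r x. 0 < r \<Longrightarrow> r \<le> L \<Longrightarrow> 1 \<le> x \<Longrightarrow> c3 * x powr a * HH N (1 / r) \<le> HH N (x / r)" using HH_scale by blast
 obtain m where m: "1 / a \<le> real m" using real_arch_simple by blast
 define E where "E = 2 + (1 / c3) powr (1 / a) * (fact m * 2 ^ m) / sqrt c"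
 have E0: "0 \<le> (1 / c3) powr (1 / a) * (fact m * 2 ^ m) / sqrt c" using c by simp
 have E: "1 \<le> E" "2 \<le> E" unfolding E_def using E0 by linarith+
 show ?thesis
 proof (rule exI[of _ E], rule conjI[OF E(1)], intro allI impI)
  fix t l assume t: "0 < t" "t \<le> T" and l: "1 / rho t \<le> l"
  note rt = rho_props[OF t(1)]
  have l0: "0 < l" using l rt by (auto intro: less_le_trans[rotated])
  have lr: "1 / l \<le> rho t" using l l0 rt by (simp add: field_simps)
  have lL: "1 / L \<le> l"
  proof -
   have "1 / L \<le> 1 / rho t" using rho_le_L[OF t] rt L_pos by (intro divide_left_mono) auto
   then show ?thesis using l by linarith
  qed
  have v: "0 < vv t l" by (rule vv_pos[OF t(1) l0])
  define A where "A = t * HH N l"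
  have A1: "1 \<le> A" unfolding A_def using le_rho_iff[OF t(1), of "1 / l"] lr l0 by simp
  have "(l * vv t l)\<^sup>2 \<le> A / hconst" unfolding A_def by (rule vv_upper[OF t(1) l0])
  also have "\<dots> \<le> A / (1 / 4)" using hconst_pos A1 by (intro divide_left_mono) auto
  also have "\<dots> \<le> 4 * A\<^sup>2" using A1 by (simp add: power2_eq_square)
  also have "\<dots> = (2 * A)\<^sup>2" by (simp add: power_mult_distrib)
  finally have "l * vv t l \<le> 2 * A" by (rule power2_le_imp_le) (use A1 in simp)
  then have "vv t l \<le> 2 * A * (1 / l)" using l0 by (simp add: field_simps)
  also have "\<dots> \<le> 2 * A * rho t" using lr A1 by (intro mult_left_mono) auto
  also have "\<dots> \<le> 2 * exp A * rho t"
  proof -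
   have "A \<le> exp A" using exp_ge_add_one_self[of A] by linarith
   then show ?thesis using rt by (intro mult_right_mono) auto
  qed
  finally have vu: "vv t l \<le> 2 * exp A * rho t" .
  have "1 / E * (1 / rho t) * exp (- 2 * A) \<le> 1 / 2 * (1 / rho t) * exp (- 2 * A)"
   using E rt by (intro mult_right_mono divide_left_mono) auto
  also have "\<dots> = 1 / (2 * exp A * rho t) * exp (- A)"
  proof -
   have "exp (- 2 * A) = exp (- A) * exp (- A)" by (simp flip: exp_add)
   moreover have "exp (- A) = 1 / exp A" by (simp add: exp_minus divide_inverse)
   ultimately show ?thesis by simp
  qed
  also have "\<dots> \<le> 1 / vv t l * exp (- A)" using vu v rt by (intro mult_right_mono divide_left_mono) auto
  finally have lo: "1 / E * (1 / rho t) * exp (- 2 * A) \<le> 1 / vv t l * exp (- A)" .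
  have "sqrt c \<le> l * vv t l"
  proof -
   have "c * 1 \<le> c * (t * HH N l)" using A1 c unfolding A_def by (intro mult_left_mono) auto
   then have "sqrt c \<le> sqrt ((l * vv t l)\<^sup>2)" using vl[OF t(1) lL] by (intro real_sqrt_le_mono) linarith
   then show ?thesis using l0 v by simp
  qed
  then have v1: "1 / vv t l \<le> l / sqrt c" using c v by (simp add: field_simps)
  define z where "z = l * rho t"
  have z: "1 \<le> z" unfolding z_def using l rt by (simp add: field_simps)
  have "c3 * z powr a * HH N (1 / rho t) \<le> HH N (z / rho t)" by (rule c3(2)[OF rt(1) rho_le_L[OF t] z])
  then have "c3 * z powr a \<le> A" using rt t unfolding z_def A_def by (simp add: field_simps)
  then have "z powr a \<le> 1 / c3 * A" using c3 by (simp add: field_simps)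
  then have "(z powr a) powr (1 / a) \<le> (1 / c3 * A) powr (1 / a)" using a_pos by (intro powr_mono2) auto
  then have "z \<le> (1 / c3 * A) powr (1 / a)" using a_pos z by (simp add: powr_powr)
  also have "\<dots> = (1 / c3) powr (1 / a) * A powr (1 / a)" by (rule powr_mult)
  also have "\<dots> \<le> (1 / c3) powr (1 / a) * A ^ m"
  proof -
   have "A powr (1 / a) \<le> A powr (real m)" using A1 m by (intro powr_mono) auto
   then show ?thesis using A1 by (intro mult_left_mono) (auto simp: powr_realpow)
  qed
  finally have zA: "z \<le> (1 / c3) powr (1 / a) * A ^ m" .
  have "exp (- (A / 2)) \<le> fact m / (A / 2) ^ m" using A1 by (intro exp_neg_le_power) simp
  then have "A ^ m * exp (- (A / 2)) \<le> A ^ m * (fact m / (A / 2) ^ m)" using A1 by (intro mult_left_mono) auto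
  also have "\<dots> = fact m * 2 ^ m" using A1 by (simp add: power_divide)
  finally have Am: "A ^ m * exp (- (A / 2)) \<le> fact m * 2 ^ m" .
  have "z * exp (- A) = z * exp (- (A / 2)) * exp (- (A / 2))" by (simp add: mult.assoc flip: exp_add)
  also have "\<dots> \<le> (1 / c3) powr (1 / a) * A ^ m * exp (- (A / 2)) * exp (- (A / 2))" using zA by (intro mult_right_mono) auto
  also have "\<dots> = (1 / c3) powr (1 / a) * (A ^ m * exp (- (A / 2))) * exp (- (A / 2))" by simp
  also have "\<dots> \<le> (1 / c3) powr (1 / a) * (fact m * 2 ^ m) * exp (- (A / 2))" using Am by (intro mult_right_mono mult_left_mono) auto
  finally have zz: "z * exp (- A) \<le> (1 / c3) powr (1 / a) * (fact m * 2 ^ m) * exp (- (A / 2))" .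
  have "1 / vv t l * exp (- A) \<le> l / sqrt c * exp (- A)" using v1 by (intro mult_right_mono) auto
  also have "\<dots> = 1 / sqrt c * (1 / rho t) * (z * exp (- A))" unfolding z_def using rt by simp
  also have "\<dots> \<le> 1 / sqrt c * (1 / rho t) * ((1 / c3) powr (1 / a) * (fact m * 2 ^ m) * exp (- (A / 2)))"
   using zz c rt by (intro mult_left_mono) auto
  also have "\<dots> = ((1 / c3) powr (1 / a) * (fact m * 2 ^ m) / sqrt c) * ((1 / rho t) * exp (- (A / 2)))" by simp
  also have "\<dots> \<le> E * ((1 / rho t) * exp (- (A / 2)))" unfolding E_def using rt by (intro mult_right_mono) auto
  finally have up: "1 / vv t l * exp (- A) \<le> E * (1 / rho t) * exp (- (A / 2))" by (simp only: mult.assoc)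
  show "1 / E * (1 / rho t) * exp (- 2 * t * HH N l) \<le> 1 / vv t l * exp (- (t * HH N l)) \<and>
   1 / vv t l * exp (- (t * HH N l)) \<le> E * (1 / rho t) * exp (- (t / 2) * HH N l)"
   using lo up unfolding A_def by (simp add: mult.assoc)
 qed
qed

end

section \<open>Translation to the functions of the paper\<close>

definition on_pos :: "(real \<Rightarrow> real) \<Rightarrow> real \<Rightarrow> real" where
 "on_pos f s = indicator {0<..} s * f s"

lemma on_pos_eq: "0 < s \<Longrightarrow> on_pos f s = f s"
 by (simp add: on_pos_def)

lemma laplace_exponent_eq: "laplace_exponent \<nu> = lexp (on_pos \<nu>)"
 unfolding laplace_exponent_def lexp_def set_lebesgue_integral_def on_pos_def
 by (intro ext Bochner_Integration.integral_cong) auto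

lemma levy_tail_eq:
 assumes "0 < r"
 shows "levy_tail \<nu> r = ww (on_pos \<nu>) r" unfolding levy_tail_def ww_def lint_def set_lebesgue_integral_def on_pos_def
 by (intro Bochner_Integration.integral_cong) (use assms in \<open>auto simp: indicator_def\<close>)

lemma laplace_exponent_derivs:
 assumes N: "levy (on_pos \<nu>)" and l: "0 < l"
 shows "deriv (laplace_exponent \<nu>) l = mom (on_pos \<nu>) 1 l"
  and "deriv (deriv (laplace_exponent \<nu>)) l = - mom (on_pos \<nu>) 2 l"
  and "H_fun \<nu> l = HH (on_pos \<nu>) l"
proof -
 have 1: "deriv (laplace_exponent \<nu>) x = mom (on_pos \<nu>) 1 x" if "0 < x" for x
  unfolding laplace_exponent_eq by (rule DERIV_imp_deriv[OF lexp_deriv[OF N that]])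
 show "deriv (laplace_exponent \<nu>) l = mom (on_pos \<nu>) 1 l" by (rule 1[OF l])
 have "(mom (on_pos \<nu>) 1 has_real_derivative - mom (on_pos \<nu>) 2 l) (at l)" using mom_deriv[OF N l, of 1] by (simp add: numeral_2_eq_2)
 then have "(deriv (laplace_exponent \<nu>) has_real_derivative - mom (on_pos \<nu>) 2 l) (at l)"
  by (rule has_field_derivative_transform_within_open[where S="{0<..}"]) (use l 1 in auto)
 then show "deriv (deriv (laplace_exponent \<nu>)) l = - mom (on_pos \<nu>) 2 l" by (rule DERIV_imp_deriv)
 show "H_fun \<nu> l = HH (on_pos \<nu>) l" unfolding H_fun_def 1[OF l] HH_eq[OF N l] by (simp add: laplace_exponent_eq)
qed

lemma mom1_tendsto_0:
 assumes "levy N"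
 shows "(\<lambda>n. mom N 1 (real (Suc n))) \<longlonglongrightarrow> 0" unfolding mom_def lint_def
proof (rule levy_dominated_convergence[OF assms])
 fix n and s :: real assume s: "0 < s"
 have e: "exp (- real (Suc n) * s) = exp (- s) ^ Suc n" for n by (simp only: exp_of_nat_mult[symmetric] mult_minus_left mult_minus_right)
 have "s * exp (- s) \<le> exp s * exp (- s)" by (rule mult_right_mono) (use exp_ge_add_one_self[of s] in linarith, simp)
 then have 1: "s * exp (- s) \<le> 1" by (simp add: exp_minus_inverse)
 have "exp (- s) ^ Suc n \<le> exp (- s)" using s by (simp add: mult_le_cancel_left1 power_le_one)
 then have 2: "s * exp (- s) ^ Suc n \<le> s * exp (- s)" using s by (intro mult_left_mono) auto
 have "s * exp (- s) \<le> s * 1" using s by (intro mult_left_mono) auto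
 with 1 2 have "s * exp (- s) ^ Suc n \<le> min 1 s" by simp
 then show "\<bar>s ^ 1 * exp (- real (Suc n) * s)\<bar> \<le> min 1 s"
  using s unfolding e by (simp only: power_one_right abs_mult abs_of_pos zero_less_power exp_gt_zero)
 have "(\<lambda>n. exp (- s) ^ Suc n) \<longlonglongrightarrow> 0" using s by (intro LIMSEQ_Suc LIMSEQ_realpow_zero) auto
 from tendsto_mult[OF tendsto_const this, of s] show "(\<lambda>n. s ^ 1 * exp (- real (Suc n) * s)) \<longlonglongrightarrow> 0" unfolding e by simp
qed simp

context scaling begin

text \<open>phi' is continuous and tends to 0 at infinity, so the saddle parameter of x <= t b(t)
  exists and is at least 1 / rho t.\<close>

lemma mom1_surj:
 assumes "0 < x" "x \<le> mom N 1 l" "0 < l"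
 shows "\<exists>l'\<ge>l. mom N 1 l' = x"
proof -
 have "eventually (\<lambda>n. mom N 1 (real (Suc n)) < x) sequentially" by (rule order_tendstoD(2)[OF mom1_tendsto_0[OF N] assms(1)])
 moreover have "eventually (\<lambda>n. l \<le> real (Suc n)) sequentially" using eventually_ge_at_top[of "nat \<lceil>l\<rceil>"] by eventually_elim linarith
 ultimately have "eventually (\<lambda>n. mom N 1 (real (Suc n)) < x \<and> l \<le> real (Suc n)) sequentially" by (rule eventually_conj)
 then obtain n where n: "mom N 1 (real (Suc n)) < x" "l \<le> real (Suc n)" by (auto simp: eventually_sequentially)
 have "\<exists>l'. l \<le> l' \<and> l' \<le> real (Suc n) \<and> mom N 1 l' = x"
 proof (rule IVT2)
  show "\<forall>z. l \<le> z \<and> z \<le> real (Suc n) \<longrightarrow> isCont (mom N 1) z"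
   using mom_deriv[OF N, of _ 1] assms(3) by (auto intro: DERIV_isCont less_le_trans)
 qed (use n assms in auto)
 then show ?thesis by blast
qed

end

locale on_pos_density = subord_density "on_pos \<nu>" Y R0 C0 a L k p T for \<nu> Y R0 C0 a L k p T
begin

lemmas derivs = laplace_exponent_derivs[OF N]

lemma H_inv_eq:
 assumes "0 < t"
 shows "H_inv \<nu> (1 / t) = 1 / rho t"
proof -
 note r = rho_props[OF assms]
 have "inj_on (H_fun \<nu>) {0<..}" by (rule inj_onI) (use HH_inj derivs(3) in auto)
 moreover have "H_fun \<nu> (1 / rho t) = 1 / t" using r derivs(3) by simp
 ultimately show ?thesis unfolding H_inv_def using r by (intro inv_into_f_eq) auto
qed

lemma b_fun_eq: "0 < t \<Longrightarrow> b_fun \<nu> t = mom (on_pos \<nu>) 1 (1 / rho t)"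
 unfolding b_fun_def using H_inv_eq derivs(1)[of "1 / rho t"] rho_props(1) by simp

lemma levy_tail_inv_eq: "levy_tail_inv \<nu> (2 * exp 1 / t) = s0 t"
proof -
 have "{r. 0 < r \<and> levy_tail \<nu> r \<le> 2 * exp 1 / t} = {r. 0 < r \<and> ww (on_pos \<nu>) r \<le> 2 * exp 1 / t}" using levy_tail_eq[of _ \<nu>] by auto
 then show ?thesis unfolding levy_tail_inv_def s0_def by simp
qed

lemma scale_interval_eq: "0 < t \<Longrightarrow> scale_interval \<nu> t = {s0 t..rho t}"
 unfolding scale_interval_def by (simp add: levy_tail_inv_eq H_inv_eq)

lemma H_on_scale_interval: "0 < t \<Longrightarrow> s \<in> {s0 t..rho t} \<Longrightarrow> H_fun \<nu> (1 / s) = HH (on_pos \<nu>) (1 / s)"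
 using derivs(3)[of "1 / s"] s0_props(1)[of t] by simp

lemma sigma_fun_eq:
 assumes "0 < t" "0 < l"
 shows "sigma_fun \<nu> t (t * mom (on_pos \<nu>) 1 l) = l"
proof -
 have "inj_on (deriv (laplace_exponent \<nu>)) {0<..}" by (rule linorder_inj_onI') (use mom1_strict_antimono derivs(1) in force)
 then show ?thesis unfolding sigma_fun_def using assms derivs(1)[of l] by (intro inv_into_f_eq) auto
qed


lemma D_fun_eq:
 assumes "0 < t"
 shows "D_fun \<nu> t = DD t"
proof -
 have "(\<lambda>s. s * H_fun \<nu> (1 / s)) ` {s0 t..rho t} = (\<lambda>s. s * HH (on_pos \<nu>) (1 / s)) ` {s0 t..rho t}"
  by (intro image_cong refl) (simp only: H_on_scale_interval[OF assms])
 then show ?thesis unfolding D_fun_def DD_def scale_interval_eq[OF assms] by simp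
qed

lemma theta_fun_eq:
 assumes "0 < t"
 shows "theta_fun \<nu> t y = th t y"
proof -
 have "(\<lambda>s. s \<in> {s0 t..rho t} \<and> t * s * H_fun \<nu> (1 / s) = y)
   = (\<lambda>s. s \<in> {s0 t..rho t} \<and> t * s * HH (on_pos \<nu>) (1 / s) = y)"
  using H_on_scale_interval[OF assms] by (intro ext) (metis (no_types))
 then show ?thesis
  unfolding theta_fun_def th_def D_fun_eq[OF assms] H_inv_eq[OF assms] scale_interval_eq[OF assms] levy_tail_inv_eq
  by simp
qed

lemma right_profile_eq:
 assumes "0 < t" "0 < y"
 shows "right_profile \<nu> \<kappa> t y = ereal (prof \<kappa> t y)"
proof -
 have r: "0 < rho t" by (rule rho_props(1)[OF assms(1)])
 have y: "y \<noteq> 0" using assms by simp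
 have "right_profile \<nu> \<kappa> t y = ereal (1 / rho t) *
   min 1 (ereal (t * \<nu> y / (1 / rho t)) + ereal (exp (- (\<kappa> * y / th t (y / e8)))))"
  unfolding right_profile_def theta_fun_eq[OF assms(1)] H_inv_eq[OF assms(1)] levy_density_ext_def
  using r y by simp
 also have "\<dots> = ereal (prof \<kappa> t y)" unfolding prof_def by (simp add: on_pos_eq[OF assms(2)] one_ereal_def flip: ereal_min)
 finally show ?thesis .
qed

lemma right_profile_0:
 assumes "0 < t"
 shows "right_profile \<nu> \<kappa> t 0 = ereal (1 / rho t)"
proof -
 have r: "0 < rho t" by (rule rho_props(1)[OF assms(1)])
 have "ereal t * levy_density_ext \<nu> 0 / ereal (1 / rho t) = \<infinity>" unfolding levy_density_ext_def using r assms by (simp add: divide_ereal_def)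
 then show ?thesis unfolding right_profile_def H_inv_eq[OF assms] by simp
qed

lemma left_estimates:
 "\<exists>c1>1. \<exists>c2>1. \<forall>t x. 0 < t \<longrightarrow> t \<le> T \<longrightarrow> 0 < x \<longrightarrow> x \<le> t * b_fun \<nu> t \<longrightarrow>
  (let \<phi> = laplace_exponent \<nu>; H = H_fun \<nu>; \<sigma> = sigma_fun \<nu> t x in
   (1 / c1) / sqrt (t * (- deriv (deriv \<phi>) \<sigma>)) * exp (- t * H \<sigma>) \<le> p t x \<and>
   p t x \<le> c1 / sqrt (t * (- deriv (deriv \<phi>) \<sigma>)) * exp (- t * H \<sigma>) \<and>
   (1 / c2) * H_inv \<nu> (1 / t) * exp (- 2 * t * H \<sigma>) \<le> p t x \<and>
   p t x \<le> c2 * H_inv \<nu> (1 / t) * exp (- (t / 2) * H \<sigma>))"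
 (is "\<exists>c1>1. \<exists>c2>1. \<forall>t x. _ \<longrightarrow> _ \<longrightarrow> _ \<longrightarrow> _ \<longrightarrow> ?P c1 c2 t x")
proof -
 obtain c where c: "1 \<le> c" and sb: "\<And>t l. 0 < t \<Longrightarrow> t \<le> T \<Longrightarrow> 1 / rho t \<le> l \<Longrightarrow>
   1 / c / vv t l * exp (- (t * HH (on_pos \<nu>) l)) \<le> p t (t * mom (on_pos \<nu>) 1 l) \<and>
   p t (t * mom (on_pos \<nu>) 1 l) \<le> c / vv t l * exp (- (t * HH (on_pos \<nu>) l))"
  using saddle_bounds by blast
 obtain d where d: "1 \<le> d" and vc: "\<And>t l. 0 < t \<Longrightarrow> t \<le> T \<Longrightarrow> 1 / rho t \<le> l \<Longrightarrow>
   1 / d * (1 / rho t) * exp (- 2 * t * HH (on_pos \<nu>) l) \<le> 1 / vv t l * exp (- (t * HH (on_pos \<nu>) l)) \<and>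
   1 / vv t l * exp (- (t * HH (on_pos \<nu>) l)) \<le> d * (1 / rho t) * exp (- (t / 2) * HH (on_pos \<nu>) l)"
  using vv_compare by blast
 define c1 where "c1 = c + 1"
 define c2 where "c2 = c * d + 1"
 have cd: "0 < c * d" using c d by simp
 have c1: "1 < c1" "c \<le> c1" "1 / c1 \<le> 1 / c" unfolding c1_def using c by (auto intro!: divide_left_mono)
 have c2: "1 < c2" "c * d \<le> c2" "1 / c2 \<le> 1 / (c * d)" unfolding c2_def using cd by (auto intro!: divide_left_mono)
 show ?thesis
 proof (rule exI[of _ c1], rule conjI[OF c1(1)], rule exI[of _ c2], rule conjI[OF c2(1)], intro allI impI)
  fix t x assume t: "0 < t" "t \<le> T" and x: "0 < x" "x \<le> t * b_fun \<nu> t"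
  have r: "0 < rho t" by (rule rho_props(1)[OF t(1)])
  have r': "0 < 1 / rho t" using r by simp
  have x0: "0 < x / t" using t x by simp
  have "x / t \<le> mom (on_pos \<nu>) 1 (1 / rho t)" using x t b_fun_eq[OF t(1)] by (simp add: divide_le_eq mult.commute)
  then obtain l where l: "1 / rho t \<le> l" "mom (on_pos \<nu>) 1 l = x / t" using mom1_surj[OF x0 _ r'] by blast
  have l0: "0 < l" using l(1) r' by linarith
  have xl: "x = t * mom (on_pos \<nu>) 1 l" using l(2) t by simp
  have sg: "sigma_fun \<nu> t x = l" unfolding xl by (rule sigma_fun_eq[OF t(1) l0])
  have v: "sqrt (t * (- deriv (deriv (laplace_exponent \<nu>)) l)) = vv t l" unfolding vv_def derivs(2)[OF l0] by simp
  note H = derivs(3)[OF l0]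
  define E where "E = 1 / vv t l * exp (- (t * HH (on_pos \<nu>) l))"
  have E: "0 < E" unfolding E_def using vv_pos[OF t(1) l0] by simp
  have s: "1 / c * E \<le> p t x" "p t x \<le> c * E" using sb[OF t l(1)] unfolding E_def xl by simp_all
  define A where "A = (1 / rho t) * exp (- 2 * t * HH (on_pos \<nu>) l)"
  define B where "B = (1 / rho t) * exp (- (t / 2) * HH (on_pos \<nu>) l)"
  have AB: "1 / d * A \<le> E" "E \<le> d * B" "0 < A" "0 < B"
   using vc[OF t l(1)] r unfolding E_def A_def B_def by (simp_all only: mult.assoc) auto
  have 1: "1 / c1 * E \<le> p t x" using mult_right_mono[OF c1(3) less_imp_le[OF E]] s(1) by linarith
  have 2: "p t x \<le> c1 * E" using mult_right_mono[OF c1(2) less_imp_le[OF E]] s(2) by linarith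
  have "1 / c2 * A \<le> 1 / (c * d) * A" using AB by (intro mult_right_mono c2) auto
  also have "\<dots> = 1 / c * (1 / d * A)" by simp
  also have "\<dots> \<le> 1 / c * E" using AB c by (intro mult_left_mono) auto
  finally have 3: "1 / c2 * A \<le> p t x" using s(1) by linarith
  have "c * E \<le> c * (d * B)" using AB c by (intro mult_left_mono) auto
  also have "\<dots> \<le> c2 * B" using mult_right_mono[OF c2(2) less_imp_le[OF AB(4)]] by (simp only: mult.assoc)
  finally have 4: "p t x \<le> c2 * B" using s(2) by linarith
  show "?P c1 c2 t x" using 1 2 3 4 unfolding Let_def sg v H H_inv_eq[OF t(1)] E_def A_def B_def by simp
 qed
qed

lemma right_estimates:
 "\<exists>c3>1. \<exists>c4>0. \<forall>t y. 0 < t \<longrightarrow> t \<le> T \<longrightarrow> y = 0 \<or> y \<in> Y \<longrightarrow>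
   ereal (1 / c3) * right_profile \<nu> c4 t y \<le> ereal (p t (t * b_fun \<nu> t + y)) \<and>
   ereal (p t (t * b_fun \<nu> t + y)) \<le> ereal c3 * right_profile \<nu> (1 / 8) t y"
 (is "\<exists>c3>1. \<exists>c4>0. \<forall>t y. _ \<longrightarrow> _ \<longrightarrow> _ \<longrightarrow> ?P c3 c4 t y")
proof -
 obtain M where M: "saddle M" using saddle_exists by blast
 have M1: "1 < M" using M by (simp add: saddle_def)
 obtain e where e: "0 < e" and nd: "\<And>t x. 0 < t \<Longrightarrow> t \<le> T \<Longrightarrow> xM M t \<le> x \<Longrightarrow> x \<le> cc t + 0 * rho t \<Longrightarrow> e / rho t \<le> p t x"
  using near_diagonal[OF M order_refl] by blast
 obtain D where D: "1 \<le> D" and sup: "\<And>t x. 0 < t \<Longrightarrow> t \<le> T \<Longrightarrow> 0 < x \<Longrightarrow> p t x \<le> D / rho t" using p_sup by blast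
 obtain C where C: "0 < C" and up: "\<And>t y. 0 < t \<Longrightarrow> t \<le> T \<Longrightarrow> y \<in> Y \<Longrightarrow> p t (cc t + y) \<le> C * prof (1 / 8) t y" using upper_profile by blast
 obtain c \<kappa> where c: "0 < c" and \<kappa>: "0 < \<kappa>" and lp: "\<And>t y. 0 < t \<Longrightarrow> t \<le> T \<Longrightarrow> y \<in> Y \<Longrightarrow> c * prof \<kappa> t y \<le> p t (cc t + y)"
  using lower_profile by blast
 define c3 where "c3 = D + C + 1 / c + 1 / e"
 have c3: "1 < c3" "D \<le> c3" "C \<le> c3" "1 / c \<le> c3" "1 / e \<le> c3"
  unfolding c3_def using D C c e zero_less_divide_1_iff[of c] zero_less_divide_1_iff[of e] by linarith+
 have c3': "1 / c3 \<le> c" "1 / c3 \<le> e" using c3 c e by (auto simp: divide_le_eq mult.commute)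
 show ?thesis
 proof (rule exI[of _ c3], rule conjI[OF c3(1)], rule exI[of _ \<kappa>], rule conjI[OF \<kappa>], intro allI impI)
  fix t y assume t: "0 < t" "t \<le> T" and y: "y = 0 \<or> y \<in> Y"
  have r: "0 < rho t" by (rule rho_props(1)[OF t(1)])
  have tb: "t * b_fun \<nu> t = cc t" unfolding cc_def b_fun_eq[OF t(1)] ..
  show "?P c3 \<kappa> t y"
  proof (cases "y = 0")
   \<comment> \<open>At y = 0 the infinite value of the density makes the minimum 1, so the claim is
     that p t (cc t) is comparable to 1 / rho t.\<close>
   case True
   have cp: "0 < cc t" unfolding cc_def using t mom1_pos r by simp
   have "1 / c3 * (1 / rho t) \<le> e * (1 / rho t)" using c3' r by (intro mult_right_mono) auto
   also have "\<dots> \<le> p t (cc t)" using nd[OF t cc_xM(1)[OF t(1) M1]] by simp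
   finally have 1: "1 / c3 * (1 / rho t) \<le> p t (cc t)" .
   have "p t (cc t) \<le> D * (1 / rho t)" using sup[OF t cp] by simp
   also have "\<dots> \<le> c3 * (1 / rho t)" using c3 r by (intro mult_right_mono) auto
   finally have "p t (cc t) \<le> c3 * (1 / rho t)" .
   with 1 show ?thesis unfolding tb right_profile_0[OF t(1)] True by simp
  next
   case False
   then have yY: "y \<in> Y" using y by simp
   have pn: "0 \<le> prof k t y" for k unfolding prof_def using t r N_nonneg by (intro mult_nonneg_nonneg) auto
   have "1 / c3 * prof \<kappa> t y \<le> c * prof \<kappa> t y" by (rule mult_right_mono[OF c3'(1) pn])
   then have 1: "1 / c3 * prof \<kappa> t y \<le> p t (cc t + y)" using lp[OF t yY] by linarith
   have "C * prof (1 / 8) t y \<le> c3 * prof (1 / 8) t y" by (rule mult_right_mono[OF c3(3) pn])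
   then have 2: "p t (cc t + y) \<le> c3 * prof (1 / 8) t y" using up[OF t yY] by linarith
   show ?thesis unfolding tb right_profile_eq[OF t(1) Y_pos[OF yY]] times_ereal.simps ereal_less_eq
    using 1 2 by simp
  qed
 qed
qed

lemma jump_estimates:
 "\<exists>c5>1. \<forall>t y. 0 < t \<longrightarrow> t \<le> T \<longrightarrow> y \<in> Y \<longrightarrow> D_fun \<nu> t < y \<longrightarrow>
   (1 / c5) * t * \<nu> y \<le> p t (t * b_fun \<nu> t + y) \<and> p t (t * b_fun \<nu> t + y) \<le> c5 * t * \<nu> y"
proof -
 obtain C where C: "0 < C" and ju: "\<And>t y. 0 < t \<Longrightarrow> t \<le> T \<Longrightarrow> y \<in> Y \<Longrightarrow> DD t < y \<Longrightarrow> p t (cc t + y) \<le> C * (t * on_pos \<nu> y)"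
  using jump_upper by blast
 obtain c where c: "0 < c" and jl: "\<And>t y. 0 < t \<Longrightarrow> t \<le> T \<Longrightarrow> y \<in> Y \<Longrightarrow> rho t \<le> y \<Longrightarrow> c * (t * on_pos \<nu> y) \<le> p t (cc t + y)"
  using jump_lower by blast
 define c5 where "c5 = 1 + C + 1 / c"
 have c5: "1 < c5" "C \<le> c5" "1 / c \<le> c5" unfolding c5_def using C c zero_less_divide_1_iff[of c] by linarith+
 have c5': "1 / c5 \<le> c" using c5 c by (auto simp: divide_le_eq mult.commute)
 show ?thesis
 proof (rule exI[of _ c5], rule conjI[OF c5(1)], intro allI impI)
  fix t y assume t: "0 < t" "t \<le> T" and y: "y \<in> Y" "D_fun \<nu> t < y"
  have tb: "t * b_fun \<nu> t = cc t" unfolding cc_def b_fun_eq[OF t(1)] ..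
  have Dy: "DD t < y" using y(2) unfolding D_fun_eq[OF t(1)] .
  have ry: "rho t \<le> y" using Dy DD_props(3)[OF t(1)] by linarith
  have tn: "0 \<le> t * on_pos \<nu> y" using t N_nonneg by simp
  have nu: "\<nu> y = on_pos \<nu> y" using on_pos_eq[OF Y_pos[OF y(1)]] by simp
  have "1 / c5 * (t * on_pos \<nu> y) \<le> p t (cc t + y)" using mult_right_mono[OF c5' tn] jl[OF t y(1) ry] by linarith
  moreover have "p t (cc t + y) \<le> c5 * (t * on_pos \<nu> y)" using mult_right_mono[OF c5(2) tn] ju[OF t y(1) Dy] by linarith
  ultimately show "(1 / c5) * t * \<nu> y \<le> p t (t * b_fun \<nu> t + y) \<and> p t (t * b_fun \<nu> t + y) \<le> c5 * t * \<nu> y"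
   unfolding tb nu by (simp only: mult.assoc simp_thms)
 qed
qed

end

section \<open>From the subordinator to its one-dimensional laws\<close>

context driftless_subordinator begin

lemma levy_on_pos: "levy (on_pos \<nu>)"
proof -
 have "on_pos \<nu> \<in> borel_measurable borel" using levy_density_measurable unfolding set_borel_measurable_def on_pos_def by simp
 moreover have "integrable lborel (\<lambda>s. min 1 s * on_pos \<nu> s)"
  using levy_density_integrable unfolding set_integrable_def on_pos_def by (simp add: mult.left_commute)
 ultimately show ?thesis
  unfolding levy_def on_pos_def using levy_density_nonneg by (auto simp: indicator_def)
qed

text \<open>Only real Laplace arguments are given. Their values at the integers identify the
  distribution with the law constructed from the Levy density, which carries the transform on the
  whole half-plane.\<close>

lemma id_law_transition_density:
 assumes t: "0 < t" and p: "transition_density_at M S p t"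
 shows "id_law (\<lambda>s. t * on_pos \<nu> s) (pos_density (p t))"
proof -
 let ?f = "\<lambda>x. ennreal (indicator {0<..} x * p t x)"
 have d: "distributed M lborel (S t) ?f" using p by (simp add: transition_density_at_def)
 have St: "S t \<in> borel_measurable M" using measurable_S t by simp
 have dd: "distr M lborel (S t) = pos_density (p t)" unfolding pos_density_def by (rule distributed_distr_eq_density[OF d])
 have "prob_space (pos_density (p t))" unfolding dd[symmetric] using St by (intro prob_space_distr) simp
 moreover have "AE x in pos_density (p t). 0 \<le> x"
  unfolding pos_density_def using distributed_borel_measurable[OF d] by (subst AE_density) (auto simp: indicator_def)
 moreover have "sets (pos_density (p t)) = sets borel" "space (pos_density (p t)) = UNIV" by (simp_all add: pos_density_def)
 ultimately have nd: "nonneg_dist (pos_density (p t))" by (auto simp: nonneg_dist_def real_distribution_def real_distribution_axioms_def)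
 obtain \<mu> where \<mu>: "id_law (\<lambda>s. t * on_pos \<nu> s) \<mu>" using id_law_exists[OF levy_scale[OF levy_on_pos less_imp_le[OF t]]] by blast
 have "pos_density (p t) = \<mu>"
 proof (rule laplace_unique[OF nd])
  show "nonneg_dist \<mu>" using \<mu> by (simp add: id_law_def)
  fix n :: nat
  have "(\<integral>x. exp (- real n * x) \<partial>pos_density (p t)) = expectation (\<lambda>\<omega>. exp (- real n * S t \<omega>))"
   unfolding dd[symmetric] using St by (subst integral_distr) auto
  also have "\<dots> = exp (- t * laplace_exponent \<nu> (real n))" using laplace_transform[of t "real n"] t by simp
  also have "\<dots> = exp (- lexp (\<lambda>s. t * on_pos \<nu> s) (real n))" unfolding laplace_exponent_eq lexp_lint lint_scale by simp
  also have "\<dots> = (\<integral>x. exp (- real n * x) \<partial>\<mu>)" by (rule lap_id_law_real[OF \<mu>, symmetric]) simp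
  finally show "(\<integral>x. exp (- real n * x) \<partial>pos_density (p t)) = (\<integral>x. exp (- real n * x) \<partial>\<mu>)" .
 qed
 with \<mu> show ?thesis by simp
qed

text \<open>\<open>rho\<close> depends on the density alone. A first instance with ceiling
  \<open>R0\<close> makes \<open>rho T\<close> available, and the second instance raises the ceiling
  to it.\<close>

lemma on_pos_densityI:
 assumes "scaling (on_pos \<nu>) Y R0 C0 a R0 k" and T: "0 < T" and p: "\<And>t. 0 < t \<Longrightarrow> transition_density_at M S p t"
 obtains L where "on_pos_density \<nu> Y R0 C0 a L k p T"
proof -
 interpret s: scaling "on_pos \<nu>" Y R0 C0 a R0 k by fact
 define L where "L = max R0 (s.rho T)"
 have L: "R0 \<le> L" "s.rho T \<le> L" unfolding L_def by auto
 interpret s': scaling "on_pos \<nu>" Y R0 C0 a L k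
  by unfold_locales (fact s.N s.Y_pos s.R0 s.Y_down s.C0 s.a_pos L(1) s.N_pos s.AD s.VV s.LL)+
 have "subord_density (on_pos \<nu>) Y R0 C0 a L k p T"
  by unfold_locales (use T L(2) p id_law_transition_density in \<open>auto simp: transition_density_at_def\<close>)
 then show ?thesis by (intro that[of L]) (simp add: on_pos_density_def)
qed

end

section \<open>Power-law bounds\<close>

locale power_law =
 fixes \<nu> :: "real \<Rightarrow> real" and R\<^sub>1 :: ereal
  and a\<^sub>1 a\<^sub>2 a\<^sub>3 \<alpha>\<^sub>1 \<alpha>\<^sub>2 :: real
 assumes R1: "0 < R\<^sub>1" and a: "0 < a\<^sub>1" "0 < a\<^sub>2" "0 < a\<^sub>3" and al: "0 < \<alpha>\<^sub>1" "\<alpha>\<^sub>1 \<le> \<alpha>\<^sub>2"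
  and pos: "\<And>r. 0 < r \<Longrightarrow> ereal r < R\<^sub>1 \<Longrightarrow> 0 < \<nu> r"
  and pw: "\<And>r R. 0 < r \<Longrightarrow> r \<le> R \<Longrightarrow> ereal R < R\<^sub>1 \<Longrightarrow>
      a\<^sub>1 * (R / r) powr (1 + \<alpha>\<^sub>1) \<le> \<nu> r / \<nu> R \<and> \<nu> r / \<nu> R \<le> a\<^sub>2 * (R / r) powr (1 + \<alpha>\<^sub>2)"
  and bd: "\<And>r. R\<^sub>1 \<le> ereal r \<Longrightarrow> \<nu> r \<le> a\<^sub>3"
begin

lemma power_law_bounds:
 assumes r: "0 < r" "r \<le> R" "ereal R < R\<^sub>1"
 shows "(R / r) powr (1 + \<alpha>\<^sub>1) * \<nu> R \<le> 1 / a\<^sub>1 * \<nu> r" and "\<nu> R \<le> 1 / a\<^sub>1 * \<nu> r"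
  and "1 + \<alpha>\<^sub>2 \<le> real k \<Longrightarrow> \<nu> r \<le> a\<^sub>2 * (R / r) ^ k * \<nu> R"
proof -
 have R0: "0 < R" using r by linarith
 have nR: "0 < \<nu> R" by (rule pos[OF R0 r(3)])
 have q: "1 \<le> R / r" using r by simp
 have h: "a\<^sub>1 * (R / r) powr (1 + \<alpha>\<^sub>1) * \<nu> R \<le> \<nu> r" "\<nu> r \<le> a\<^sub>2 * (R / r) powr (1 + \<alpha>\<^sub>2) * \<nu> R"
  using pw[OF r] nR by (simp_all add: pos_le_divide_eq pos_divide_le_eq)
 show 1: "(R / r) powr (1 + \<alpha>\<^sub>1) * \<nu> R \<le> 1 / a\<^sub>1 * \<nu> r" using h(1) a by (simp add: field_simps)
 have "1 * \<nu> R \<le> (R / r) powr (1 + \<alpha>\<^sub>1) * \<nu> R" using q al nR by (intro mult_right_mono ge_one_powr_ge_zero) auto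
 then show "\<nu> R \<le> 1 / a\<^sub>1 * \<nu> r" using 1 by linarith
 show "\<nu> r \<le> a\<^sub>2 * (R / r) ^ k * \<nu> R" if k: "1 + \<alpha>\<^sub>2 \<le> real k"
 proof -
  have "(R / r) powr (1 + \<alpha>\<^sub>2) \<le> (R / r) powr (real k)" by (rule powr_mono[OF k q])
  also have "\<dots> = (R / r) ^ k" using q by (intro powr_realpow) linarith
  finally have "a\<^sub>2 * (R / r) powr (1 + \<alpha>\<^sub>2) * \<nu> R \<le> a\<^sub>2 * (R / r) ^ k * \<nu> R" using a nR by (intro mult_right_mono mult_left_mono) auto
  then show ?thesis using h(2) by linarith
 qed
qed

text \<open>For finite R_1 the points s beyond R_1 satisfy only the bound a_3. It is compared with
  the fixed positive number nu (R_1/2), below which nu (y) cannot fall by more than a factor a_1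
  when y < R_1/2.\<close>

lemma power_law_almost_decreasing:
 "\<exists>C\<ge>0. \<forall>y s. 0 < y \<longrightarrow> ereal y < R\<^sub>1 / 2 \<longrightarrow> y \<le> s \<longrightarrow> \<nu> s \<le> C * \<nu> y"
proof (cases R\<^sub>1)
 case PInf
 show ?thesis
 proof (rule exI[of _ "1 / a\<^sub>1"], intro conjI allI impI)
  fix y s :: real assume "0 < y" "y \<le> s"
  then show "\<nu> s \<le> 1 / a\<^sub>1 * \<nu> y" using PInf by (intro power_law_bounds(2)) auto
 qed (use a in simp)
next
 case (real R)
 have R: "0 < R" using R1 real by simp
 define h where "h = R / 2"
 have h: "0 < h" "ereal h < R\<^sub>1" using R real by (auto simp: h_def)
 have nh: "0 < \<nu> h" by (rule pos[OF h])
 have half: "R\<^sub>1 / 2 = ereal h" unfolding real h_def by simp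
 note le = power_law_bounds(2)
 define C where "C = 1 / a\<^sub>1 + a\<^sub>3 / (a\<^sub>1 * \<nu> h)"
 have Cp: "0 < a\<^sub>3 / (a\<^sub>1 * \<nu> h)" "0 < 1 / a\<^sub>1" using a nh by auto
 have C: "0 \<le> C" "1 / a\<^sub>1 \<le> C" "a\<^sub>3 / (a\<^sub>1 * \<nu> h) \<le> C" unfolding C_def using Cp by linarith+
 show ?thesis
 proof (rule exI[of _ C], intro conjI allI impI C(1))
  fix y s :: real assume y: "0 < y" "ereal y < R\<^sub>1 / 2" "y \<le> s"
  have yh: "y \<le> h" using y(2) unfolding half by simp
  have yR: "ereal y < R\<^sub>1" using yh h(2) by (meson ereal_less_eq(3) le_less_trans)
  have ny: "0 < \<nu> y" by (rule pos[OF y(1) yR])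
  show "\<nu> s \<le> C * \<nu> y"
  proof (cases "ereal s < R\<^sub>1")
   case True
   have "\<nu> s \<le> 1 / a\<^sub>1 * \<nu> y" by (rule le[OF y(1,3) True])
   also have "\<dots> \<le> C * \<nu> y" using C(2) ny by (intro mult_right_mono) auto
   finally show ?thesis .
  next
   case False
   then have "\<nu> s \<le> a\<^sub>3" using bd by simp
   also have "\<dots> = a\<^sub>3 / (a\<^sub>1 * \<nu> h) * (a\<^sub>1 * \<nu> h)" using a nh by simp
   also have "\<dots> \<le> a\<^sub>3 / (a\<^sub>1 * \<nu> h) * \<nu> y" using le[OF y(1) yh h(2)] a Cp by (intro mult_left_mono) (auto simp: field_simps)
   also have "\<dots> \<le> C * \<nu> y" using C(3) ny by (intro mult_right_mono) auto
   finally show ?thesis .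
  qed
 qed
qed (use R1 in simp)

lemma scaling_intro:
 assumes N: "levy (on_pos \<nu>)" and R0: "0 < R0" "R0 \<in> Y" "ereal R0 < R\<^sub>1" and C: "0 \<le> D" "0 \<le> E"
  and Y: "\<And>y. y \<in> Y \<Longrightarrow> 0 < y" "\<And>s y. 0 < s \<Longrightarrow> s \<le> y \<Longrightarrow> y \<in> Y \<Longrightarrow> s \<in> Y" "\<And>y. y \<in> Y \<Longrightarrow> 0 < \<nu> y"
  and AD: "\<And>y s. y \<in> Y \<Longrightarrow> y \<le> s \<Longrightarrow> \<nu> s \<le> D * \<nu> y"
  and VV: "\<And>y s. y \<in> Y \<Longrightarrow> 0 < s \<Longrightarrow> s \<le> y \<Longrightarrow> \<nu> s \<le> E * (y / s) ^ k * \<nu> y"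
 shows "\<exists>R0 C0 k. scaling (on_pos \<nu>) Y R0 C0 \<alpha>\<^sub>1 R0 k"
proof -
 define C0 where "C0 = 1 + D + E + 1 / a\<^sub>1"
 have C0: "1 \<le> C0" "D \<le> C0" "E \<le> C0" "1 / a\<^sub>1 \<le> C0" unfolding C0_def using C a zero_less_divide_1_iff[of a\<^sub>1] by linarith+
 have n: "0 \<le> on_pos \<nu> s" for s by (rule levy_nonneg[OF N])
 have "scaling (on_pos \<nu>) Y R0 C0 \<alpha>\<^sub>1 R0 k"
 proof
  fix y s :: real
  assume y: "y \<in> Y"
  note y0 = Y(1)[OF y]
  show "0 < on_pos \<nu> y" using Y(3)[OF y] y0 by (simp add: on_pos_eq)
  show "on_pos \<nu> s \<le> C0 * on_pos \<nu> y" if s: "y \<le> s" using AD[OF y s] mult_right_mono[OF C0(2) n, of y] y0 s by (simp add: on_pos_eq)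
  show "on_pos \<nu> s \<le> C0 * (y / s) ^ k * on_pos \<nu> y" if s: "0 < s" "s \<le> y"
  proof -
   have "on_pos \<nu> s \<le> E * (y / s) ^ k * on_pos \<nu> y" using VV[OF y s] y0 s by (simp add: on_pos_eq)
   also have "\<dots> \<le> C0 * (y / s) ^ k * on_pos \<nu> y" using C0(3) s by (intro mult_right_mono n) auto
   finally show ?thesis .
  qed
 next
  fix r R :: real assume r: "0 < r" "r \<le> R" "R \<le> R0"
  have "ereal R < R\<^sub>1" using r(3) R0(3) by (meson ereal_less_eq(3) le_less_trans)
  then have "(R / r) powr (1 + \<alpha>\<^sub>1) * on_pos \<nu> R \<le> 1 / a\<^sub>1 * on_pos \<nu> r" using power_law_bounds(1)[OF r(1,2)] r by (simp add: on_pos_eq)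
  also have "\<dots> \<le> C0 * on_pos \<nu> r" by (rule mult_right_mono[OF C0(4) n])
  finally show "(R / r) powr (1 + \<alpha>\<^sub>1) * on_pos \<nu> R \<le> C0 * on_pos \<nu> r" .
 qed (use N R0 C0(1) al Y in auto)
 then show ?thesis by blast
qed

lemma scaling_near_0:
 assumes N: "levy (on_pos \<nu>)"
 shows "\<exists>R0 C0 k. scaling (on_pos \<nu>) {y. 0 < y \<and> ereal y < R\<^sub>1 / 2} R0 C0 \<alpha>\<^sub>1 R0 k"
proof -
 obtain C where C: "0 \<le> C" and AD: "\<And>y s. 0 < y \<Longrightarrow> ereal y < R\<^sub>1 / 2 \<Longrightarrow> y \<le> s \<Longrightarrow> \<nu> s \<le> C * \<nu> y" using power_law_almost_decreasing by blast
 have half: "ereal y < R\<^sub>1" if "0 < y" "ereal y < R\<^sub>1 / 2" for y using that by (cases R\<^sub>1) auto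
 have "0 < R\<^sub>1 / 2" using R1 by (cases R\<^sub>1) auto
 then obtain R0 where R0: "0 < R0" "ereal R0 < R\<^sub>1 / 2" using ereal_dense2[of 0 "R\<^sub>1 / 2"] by (auto simp: zero_ereal_def)
 have k: "1 + \<alpha>\<^sub>2 \<le> real (nat \<lceil>1 + \<alpha>\<^sub>2\<rceil>)" using al by linarith
 show ?thesis
 proof (rule scaling_intro[OF N R0(1) _ half[OF R0] C])
  fix y s :: real assume y: "y \<in> {y. 0 < y \<and> ereal y < R\<^sub>1 / 2}" and s: "0 < s" "s \<le> y"
  show "\<nu> s \<le> a\<^sub>2 * (y / s) ^ nat \<lceil>1 + \<alpha>\<^sub>2\<rceil> * \<nu> y" by (rule power_law_bounds(3)[OF s _ k]) (use half y in simp)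
 qed (use R0 AD pos half a in \<open>auto intro: le_less_trans[rotated]\<close>)
qed

text \<open>Induction over the dyadic range R 2^m: the doubling condition carries positivity and the
  polynomial bound from y/2 to y. Almost monotonicity beyond R/2 is the hypothesis on the
  supremum.\<close>

lemma scaling_everywhere:
 fixes R :: real
 assumes N: "levy (on_pos \<nu>)" and R1_eq: "R\<^sub>1 = ereal R"
  and a45: "0 < a\<^sub>4" "0 < a\<^sub>5"
  and sup: "\<And>r u. R / 2 \<le> r \<Longrightarrow> r \<le> u \<Longrightarrow> a\<^sub>4 * \<nu> u \<le> \<nu> r"
  and dbl: "\<And>r. R / 2 \<le> r \<Longrightarrow> a\<^sub>5 * \<nu> r \<le> \<nu> (2 * r)"
 shows "\<exists>R0 C0 k. scaling (on_pos \<nu>) {0<..} R0 C0 \<alpha>\<^sub>1 R0 k"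
proof -
 have R: "0 < R" using R1 unfolding R1_eq by simp
 obtain C where C: "0 \<le> C" and AD0: "\<And>y s. 0 < y \<Longrightarrow> ereal y < R\<^sub>1 / 2 \<Longrightarrow> y \<le> s \<Longrightarrow> \<nu> s \<le> C * \<nu> y" using power_law_almost_decreasing by blast
 obtain j where j: "1 / a\<^sub>5 < 2 ^ j" using real_arch_pow[of 2 "1 / a\<^sub>5"] by auto
 \<comment> \<open>The exponent must dominate 1 + \<open>\<alpha>\<^sub>2\<close> below R and
   satisfy 2^k \<open>a\<^sub>5\<close> >= 1, so that one doubling is paid by the factor 2^k gained
   from y/s.\<close>
 define k where "k = max j (nat \<lceil>1 + \<alpha>\<^sub>2\<rceil>)"
 have k: "1 + \<alpha>\<^sub>2 \<le> real k" unfolding k_def using al by (simp add: max_def) linarith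
 have "(2::real) ^ j \<le> 2 ^ k" unfolding k_def by (rule power_increasing) auto
 then have "1 / a\<^sub>5 \<le> 2 ^ k" using j by linarith
 then have k5: "1 \<le> 2 ^ k * a\<^sub>5" using a45 by (simp add: field_simps)
 note b = power_law_bounds
 have grow: "\<exists>m. y < R * 2 ^ m" for y using real_arch_pow[of 2 "y / R"] R by (auto simp: divide_less_eq mult.commute)
 have pos': "0 < y \<longrightarrow> y < R * 2 ^ m \<longrightarrow> 0 < \<nu> y" for m y
 proof (induction m arbitrary: y)
  case (Suc m)
  show ?case
  proof (intro impI)
   assume y: "0 < y" "y < R * 2 ^ Suc m"
   show "0 < \<nu> y"
   proof (cases "y < R")
    case False
    have "0 < a\<^sub>5 * \<nu> (y / 2)" using Suc[of "y / 2"] y a45 by simp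
    also have "\<dots> \<le> \<nu> y" using dbl[of "y / 2"] False by simp
    finally show ?thesis .
   qed (use pos y in \<open>simp add: R1_eq\<close>)
  qed
 qed (use pos in \<open>simp add: R1_eq\<close>)
 then have pos': "0 < \<nu> y" if "0 < y" for y using grow[of y] that by blast
 define D where "D = C + 1 / a\<^sub>4"
 have D: "0 < D" "C \<le> D" "1 / a\<^sub>4 \<le> D" unfolding D_def using C a45 zero_less_divide_1_iff[of a\<^sub>4] by linarith+
 have AD: "\<nu> s \<le> D * \<nu> y" if y: "0 < y" "y \<le> s" for y s
 proof (cases "y < R / 2")
  case True
  then have "\<nu> s \<le> C * \<nu> y" using AD0[of y s] y by (simp add: R1_eq)
  also have "\<dots> \<le> D * \<nu> y" using D pos'[OF y(1)] by (intro mult_right_mono) auto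
  finally show ?thesis .
 next
  case False
  then have "\<nu> s \<le> 1 / a\<^sub>4 * \<nu> y" using sup[of y s] y a45 by (simp add: field_simps)
  also have "\<dots> \<le> D * \<nu> y" using D pos'[OF y(1)] by (intro mult_right_mono) auto
  finally show ?thesis .
 qed
 \<comment> \<open>The second summand covers s between y/2 and y, where almost monotonicity from y/2
   and one doubling are used.\<close>
 define E where "E = a\<^sub>2 + D / a\<^sub>5"
 have "0 < D / a\<^sub>5" using D a45 by simp
 then have E: "0 < E" "a\<^sub>2 \<le> E" "D / a\<^sub>5 \<le> E" unfolding E_def using a by linarith+
 have base: "\<nu> s \<le> E * (y / s) ^ k * \<nu> y" if s: "0 < s" "s \<le> y" "y < R" for y s
 proof -
  have "\<nu> s \<le> a\<^sub>2 * (y / s) ^ k * \<nu> y" using b(3)[OF s(1,2) _ k] s(3) by (simp add: R1_eq)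
  also have "\<dots> \<le> E * (y / s) ^ k * \<nu> y" using s E pos'[of y] by (intro mult_right_mono) auto
  finally show ?thesis .
 qed
 have VV': "0 < s \<longrightarrow> s \<le> y \<longrightarrow> y < R * 2 ^ m \<longrightarrow> \<nu> s \<le> E * (y / s) ^ k * \<nu> y" for m y s
 proof (induction m arbitrary: y)
  case 0
  then show ?case using base by simp
 next
  case (Suc m)
  show ?case
  proof (intro impI)
   assume s: "0 < s" "s \<le> y" "y < R * 2 ^ Suc m"
   have y0: "0 < y" using s by linarith
   have ny: "0 < \<nu> y" by (rule pos'[OF y0])
   show "\<nu> s \<le> E * (y / s) ^ k * \<nu> y"
   proof (cases "y < R")
    case True
    then show ?thesis using base s by simp
   next
    case False
    have d: "a\<^sub>5 * \<nu> (y / 2) \<le> \<nu> y" using dbl[of "y / 2"] False by simp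
    then have d': "\<nu> (y / 2) \<le> 1 / a\<^sub>5 * \<nu> y" using a45 by (simp add: field_simps)
    show ?thesis
    proof (cases "s \<le> y / 2")
     case True
     have "\<nu> s \<le> E * (y / 2 / s) ^ k * \<nu> (y / 2)" using Suc[of "y / 2"] s True by simp
     also have "\<dots> \<le> E * (y / 2 / s) ^ k * ((2 ^ k * a\<^sub>5) * \<nu> (y / 2))"
      using mult_right_mono[OF k5, of "\<nu> (y / 2)"] pos'[of "y / 2"] E s y0 by (intro mult_left_mono) auto
     also have "\<dots> = E * (y / s) ^ k * (a\<^sub>5 * \<nu> (y / 2))" by (simp add: power_divide)
     also have "\<dots> \<le> E * (y / s) ^ k * \<nu> y" using d E s y0 by (intro mult_left_mono) auto
     finally show ?thesis .
    next
     case False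
     have "\<nu> s \<le> D * \<nu> (y / 2)" using AD[of "y / 2" s] False y0 by simp
     also have "\<dots> \<le> D * (1 / a\<^sub>5 * \<nu> y)" using d' D by (intro mult_left_mono) auto
     also have "\<dots> \<le> E * \<nu> y" using E(3) mult_right_mono[OF E(3) less_imp_le[OF ny]] by simp
     also have "\<dots> \<le> E * (y / s) ^ k * \<nu> y" using E ny s one_le_power[of "y / s" k] by (intro mult_right_mono) auto
     finally show ?thesis .
    qed
   qed
  qed
 qed
 have VV: "\<nu> s \<le> E * (y / s) ^ k * \<nu> y" if "0 < s" "s \<le> y" for y s using VV' grow[of y] that by blast
 show ?thesis by (rule scaling_intro[OF N, of "R / 2" _ D E]) (use R D E pos' AD VV in \<open>auto simp: R1_eq\<close>)
qed

text \<open>Near 0 the lower scaling bounds x nu (x) below by a multiple of the power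
  \<open>\<alpha>\<^sub>1\<close> of R/x, which is unbounded, so the lower limit exceeds every
  finite value.\<close>

lemma T0_eq_0:
 assumes T0: "0 \<le> T\<^sub>0" and lim: "Liminf (at_right 0) (\<lambda>x. ereal (x * \<nu> x)) = 1 / ereal T\<^sub>0"
 shows "T\<^sub>0 = 0"
proof (rule ccontr)
 assume "T\<^sub>0 \<noteq> 0"
 then have T: "0 < T\<^sub>0" using T0 by simp
 obtain R where R: "0 < R" "ereal R < R\<^sub>1" using ereal_dense2[OF R1] by (auto simp: zero_ereal_def)
 define c where "c = a\<^sub>1 * R * \<nu> R"
 have c: "0 < c" unfolding c_def using a R pos by simp
 define B where "B = 1 / T\<^sub>0 + 1"
 define z where "z = (max 1 (B / c)) powr (1 / \<alpha>\<^sub>1)"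
 have z: "1 \<le> z" unfolding z_def using al by (intro ge_one_powr_ge_zero) auto
 have "B \<le> x * \<nu> x" if x: "0 < x" "x < R / z" for x
 proof -
  have zR: "z \<le> R / x" using x z by (simp add: field_simps)
  have xR: "x \<le> R" using order_trans[OF z zR] x by simp
  have "max 1 (B / c) = z powr \<alpha>\<^sub>1" unfolding z_def using al by (simp add: powr_powr)
  also have "\<dots> \<le> (R / x) powr \<alpha>\<^sub>1" using zR z al by (intro powr_mono2) auto
  finally have "B / c \<le> (R / x) powr \<alpha>\<^sub>1" by simp
  then have "B \<le> c * (R / x) powr \<alpha>\<^sub>1" using c by (simp add: field_simps)
  also have "\<dots> = x * (a\<^sub>1 * ((R / x) powr (1 + \<alpha>\<^sub>1) * \<nu> R))" unfolding c_def powr_add using x R by simp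
  also have "\<dots> \<le> x * \<nu> x" using power_law_bounds(1)[OF x(1) xR R(2)] x a by (intro mult_left_mono) (auto simp: field_simps)
  finally show ?thesis .
 qed
 moreover have "0 < R / z" using R z by simp
 ultimately have "eventually (\<lambda>x. ereal B \<le> ereal (x * \<nu> x)) (at_right 0)" by (auto simp: eventually_at_right_field)
 then have "ereal B \<le> 1 / ereal T\<^sub>0" unfolding lim[symmetric] by (rule Liminf_bounded)
 then show False unfolding B_def using T by (simp add: one_ereal_def)
qed

end

theorem theorem1p3:
  fixes M :: "'a measure" and S :: "real \<Rightarrow> 'a \<Rightarrow> real" and \<nu> :: "real \<Rightarrow> real"
    and T\<^sub>0 :: real and p :: "real \<Rightarrow> real \<Rightarrow> real"
    and R\<^sub>1 :: ereal and a\<^sub>1 a\<^sub>2 a\<^sub>3 \<alpha>\<^sub>1 \<alpha>\<^sub>2 T :: real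
  assumes "driftless_subordinator M S \<nu>"
    and "0 \<le> T\<^sub>0"
    and "Liminf (at_right 0) (\<lambda>x. ereal (x * \<nu> x)) = 1 / ereal T\<^sub>0"
    and "\<And>t. T\<^sub>0 < t \<Longrightarrow> transition_density_at M S p t"
    and "0 < R\<^sub>1" and "0 < a\<^sub>1" and "0 < a\<^sub>2" and "0 < a\<^sub>3"
    and "0 < \<alpha>\<^sub>1" and "\<alpha>\<^sub>1 \<le> \<alpha>\<^sub>2"
    and "\<And>r. 0 < r \<Longrightarrow> ereal r < R\<^sub>1 \<Longrightarrow> 0 < \<nu> r"
    and "\<And>r R. 0 < r \<Longrightarrow> r \<le> R \<Longrightarrow> ereal R < R\<^sub>1 \<Longrightarrow>
           a\<^sub>1 * (R / r) powr (1 + \<alpha>\<^sub>1) \<le> \<nu> r / \<nu> R \<and>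
           \<nu> r / \<nu> R \<le> a\<^sub>2 * (R / r) powr (1 + \<alpha>\<^sub>2)"
    and "(SUP r\<in>{r. R\<^sub>1 \<le> ereal r}. ereal (\<nu> r)) \<le> ereal a\<^sub>3"
    and "0 < T"
  shows "\<exists>c\<^sub>1>1. \<exists>c\<^sub>2>1. \<exists>c\<^sub>3>1. \<exists>c\<^sub>4>0. \<exists>c\<^sub>5>1. \<forall>t. 0 < t \<and> t \<le> T \<longrightarrow>
    (\<forall>x. 0 < x \<and> x \<le> t * b_fun \<nu> t \<longrightarrow>
      (let \<phi> = laplace_exponent \<nu>; H = H_fun \<nu>; \<sigma> = sigma_fun \<nu> t x in
        (1 / c\<^sub>1) / sqrt (t * (- deriv (deriv \<phi>) \<sigma>)) * exp (- t * H \<sigma>) \<le> p t x \<and>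
        p t x \<le> c\<^sub>1 / sqrt (t * (- deriv (deriv \<phi>) \<sigma>)) * exp (- t * H \<sigma>) \<and>
        (1 / c\<^sub>2) * H_inv \<nu> (1 / t) * exp (- 2 * t * H \<sigma>) \<le> p t x \<and>
        p t x \<le> c\<^sub>2 * H_inv \<nu> (1 / t) * exp (- (t / 2) * H \<sigma>))) \<and>
    (\<forall>y. 0 \<le> y \<and> ereal y < R\<^sub>1 / 2 \<longrightarrow>
      (ereal (1 / c\<^sub>3) * right_profile \<nu> c\<^sub>4 t y \<le> ereal (p t (t * b_fun \<nu> t + y)) \<and>
       ereal (p t (t * b_fun \<nu> t + y)) \<le> ereal c\<^sub>3 * right_profile \<nu> (1 / 8) t y)) \<and>
    (\<forall>y. D_fun \<nu> t < y \<and> ereal y < R\<^sub>1 / 2 \<longrightarrow>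
      (1 / c\<^sub>5) * t * \<nu> y \<le> p t (t * b_fun \<nu> t + y) \<and>
      p t (t * b_fun \<nu> t + y) \<le> c\<^sub>5 * t * \<nu> y) \<and>
    ((\<exists>a\<^sub>4>0. \<exists>a\<^sub>5>0. \<forall>r. R\<^sub>1 / 2 \<le> ereal r \<longrightarrow>
        ereal a\<^sub>4 * (SUP u\<in>{r..}. ereal (\<nu> u)) \<le> ereal (\<nu> r) \<and>
        a\<^sub>5 * \<nu> r \<le> \<nu> (2 * r)) \<longrightarrow>
      (\<forall>y\<ge>0.
        ereal (1 / c\<^sub>3) * right_profile \<nu> c\<^sub>4 t y \<le> ereal (p t (t * b_fun \<nu> t + y)) \<and>
        ereal (p t (t * b_fun \<nu> t + y)) \<le> ereal c\<^sub>3 * right_profile \<nu> (1 / 8) t y) \<and>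
      (\<forall>y>D_fun \<nu> t.
        (1 / c\<^sub>5) * t * \<nu> y \<le> p t (t * b_fun \<nu> t + y) \<and>
        p t (t * b_fun \<nu> t + y) \<le> c\<^sub>5 * t * \<nu> y))"
proof -
 interpret driftless_subordinator M S \<nu> by fact
 let ?Y = "{y. 0 < y \<and> ereal y < R\<^sub>1 / 2}"
 let ?X = "\<exists>a\<^sub>4>0. \<exists>a\<^sub>5>0. \<forall>r. R\<^sub>1 / 2 \<le> ereal r \<longrightarrow>
    ereal a\<^sub>4 * (SUP u\<in>{r..}. ereal (\<nu> u)) \<le> ereal (\<nu> r) \<and> a\<^sub>5 * \<nu> r \<le> \<nu> (2 * r)"
 have bd: "\<nu> r \<le> a\<^sub>3" if "R\<^sub>1 \<le> ereal r" for r using assms(13) that by (simp add: SUP_le_iff)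
 interpret power_law \<nu> R\<^sub>1 a\<^sub>1 a\<^sub>2 a\<^sub>3 \<alpha>\<^sub>1 \<alpha>\<^sub>2
  by unfold_locales (fact assms(5-12) bd)+
 have "T\<^sub>0 = 0" by (rule T0_eq_0[OF assms(2,3)])
 then have p: "\<And>t. 0 < t \<Longrightarrow> transition_density_at M S p t" using assms(4) by simp
 have near: "\<exists>R0 C0 k. scaling (on_pos \<nu>) ?Y R0 C0 \<alpha>\<^sub>1 R0 k" by (rule scaling_near_0[OF levy_on_pos])
 \<comment> \<open>The constants are quantified before the additional condition, so one set must
   serve both ranges. \<open>Y\<close> is therefore chosen by cases: the whole half-line if the
   condition holds, and the range below R_1/2 otherwise; for infinite R_1 the two coincide.\<close>
 have "\<exists>Y R0 C0 k. scaling (on_pos \<nu>) Y R0 C0 \<alpha>\<^sub>1 R0 k \<and> ?Y \<subseteq> Y \<and> (?X \<longrightarrow> Y = {0<..})"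
 proof (cases "?X \<and> R\<^sub>1 \<noteq> \<infinity>")
  case True
  then obtain a\<^sub>4 a\<^sub>5 where a45: "0 < a\<^sub>4" "0 < a\<^sub>5" and
   h: "\<And>r. R\<^sub>1 / 2 \<le> ereal r \<Longrightarrow> ereal a\<^sub>4 * (SUP u\<in>{r..}. ereal (\<nu> u)) \<le> ereal (\<nu> r) \<and> a\<^sub>5 * \<nu> r \<le> \<nu> (2 * r)" by blast
  obtain R where R: "R\<^sub>1 = ereal R" using True assms(5) by (cases R\<^sub>1) auto
  have "a\<^sub>4 * \<nu> u \<le> \<nu> r" if "R / 2 \<le> r" "r \<le> u" for r u
  proof -
   have "ereal (a\<^sub>4 * \<nu> u) = ereal a\<^sub>4 * ereal (\<nu> u)" by simp
   also have "\<dots> \<le> ereal a\<^sub>4 * (SUP u\<in>{r..}. ereal (\<nu> u))" using that a45 by (intro ereal_mult_left_mono SUP_upper) auto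
   also have "\<dots> \<le> ereal (\<nu> r)" using h[of r] that unfolding R by simp
   finally show ?thesis by simp
  qed
  moreover have "a\<^sub>5 * \<nu> r \<le> \<nu> (2 * r)" if "R / 2 \<le> r" for r using h[of r] that unfolding R by simp
  ultimately have "\<exists>R0 C0 k. scaling (on_pos \<nu>) {0<..} R0 C0 \<alpha>\<^sub>1 R0 k" using scaling_everywhere[OF levy_on_pos R a45] by blast
  then show ?thesis by (intro exI[of _ "{0<..}"]) auto
 next
  case False
  have "?X \<longrightarrow> ?Y = {0<..}" using False by auto
  then show ?thesis using near by blast
 qed
 then obtain Y R0 C0 k where sc: "scaling (on_pos \<nu>) Y R0 C0 \<alpha>\<^sub>1 R0 k" and Y: "?Y \<subseteq> Y" "?X \<Longrightarrow> Y = {0<..}" by blast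
 obtain L where "on_pos_density \<nu> Y R0 C0 \<alpha>\<^sub>1 L k p T" using on_pos_densityI[OF sc assms(14) p] by blast
 then interpret d: on_pos_density \<nu> Y R0 C0 \<alpha>\<^sub>1 L k p T .
 have Dpos: "0 < D_fun \<nu> t" if "0 < t" for t using d.D_fun_eq[OF that] d.DD_props(3)[OF that] d.rho_props(1)[OF that] by linarith
 from d.left_estimates obtain c1 c2 where c1: "1 < c1" and c2: "1 < c2" and le: "\<And>t x. 0 < t \<Longrightarrow> t \<le> T \<Longrightarrow> 0 < x \<Longrightarrow> x \<le> t * b_fun \<nu> t \<Longrightarrow>
  (let \<phi> = laplace_exponent \<nu>; H = H_fun \<nu>; \<sigma> = sigma_fun \<nu> t x in
   (1 / c1) / sqrt (t * (- deriv (deriv \<phi>) \<sigma>)) * exp (- t * H \<sigma>) \<le> p t x \<and>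
   p t x \<le> c1 / sqrt (t * (- deriv (deriv \<phi>) \<sigma>)) * exp (- t * H \<sigma>) \<and>
   (1 / c2) * H_inv \<nu> (1 / t) * exp (- 2 * t * H \<sigma>) \<le> p t x \<and>
   p t x \<le> c2 * H_inv \<nu> (1 / t) * exp (- (t / 2) * H \<sigma>))"
  by blast
 from d.right_estimates obtain c3 c4 where c3: "1 < c3" and c4: "0 < c4" and ri: "\<And>t y. 0 < t \<Longrightarrow> t \<le> T \<Longrightarrow> y = 0 \<or> y \<in> Y \<Longrightarrow>
   ereal (1 / c3) * right_profile \<nu> c4 t y \<le> ereal (p t (t * b_fun \<nu> t + y)) \<and>
   ereal (p t (t * b_fun \<nu> t + y)) \<le> ereal c3 * right_profile \<nu> (1 / 8) t y"
  by blast
 from d.jump_estimates obtain c5 where c5: "1 < c5" and ju: "\<And>t y. 0 < t \<Longrightarrow> t \<le> T \<Longrightarrow> y \<in> Y \<Longrightarrow> D_fun \<nu> t < y \<Longrightarrow>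
   (1 / c5) * t * \<nu> y \<le> p t (t * b_fun \<nu> t + y) \<and> p t (t * b_fun \<nu> t + y) \<le> c5 * t * \<nu> y"
  by blast
 show ?thesis
 proof (rule exI[of _ c1], rule conjI[OF c1], rule exI[of _ c2], rule conjI[OF c2], rule exI[of _ c3], rule conjI[OF c3],
   rule exI[of _ c4], rule conjI[OF c4], rule exI[of _ c5], rule conjI[OF c5], intro allI impI, elim conjE, intro conjI, goal_cases)
  case (1 t)
  then show ?case using le by blast
 next
  case (2 t)
  have "y = 0 \<or> y \<in> Y" if "0 \<le> y" "ereal y < R\<^sub>1 / 2" for y using Y(1) that by (cases "y = 0") auto
  then show ?case using ri[OF 2] by blast
 next
  case (3 t)
  then show ?case using ju Y(1) less_trans[OF Dpos[OF 3(1)]] by blast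
 next
  case (4 t)
  note t = 4
  show ?case
  proof (rule impI, goal_cases)
   case 1
   have "y = 0 \<or> y \<in> Y" if "0 \<le> y" for y using Y(2)[OF 1] that by auto
   moreover have "y \<in> Y" if "D_fun \<nu> t < y" for y using Y(2)[OF 1] less_trans[OF Dpos[OF t(1)] that] by simp
   ultimately show ?case using ri[OF t] ju[OF t] by blast
  qed
 qed
qed

end
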